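(* Assume $\phi$ is a Schwartz function on $\mathbb{R}^d$ with $\widehat{\phi}$ supported in $\mathcal{C}_0 b^{-1}$, and let $\nu$ be the cut-off function used in the definition of $h^1$. Then for each $j$, the analysis operator $T_j$ maps $H^1(\mathbb{R}^d)$ into $h^1$, $$T_j : H^1 \to h^1 \qquad \text{with norm } \| T_j \| \leq \| P|\phi| \|_\infty \, \| \check{\nu} \|_1 .$$
   Context: Fix $d\in\mathbb{N}$. The dilation matrices are isotropic and expanding: $a_j=\alpha_j I$ ($j=1,2,3,\ldots$), where $\alpha_j$ are nonzero real numbers with $|\alpha_j|\to\infty$ as $j\to\infty$. The translation matrix $b$ is an invertible $d\times d$ real matrix. Functions are complex-valued. Here (taking $p=1$, $q=\infty$) $\phi_{j,k}(x)=\phi(a_jx-bk)$ for $k\in\mathbb{Z}^d$, $\langle f,\phi_{j,k}\rangle=\int_{\mathbb{R}^d} f\,\overline{\phi_{j,k}}\,dx$, and the analysis operator at scale $j$ is $T_jf=\{|\det b|\langle f,\phi_{j,k}\rangle\}_{k\in\mathbb{Z}^d}$. The periodization is $Pf(x)=|\det b|\sum_{k\in\mathbb{Z}^d}f(x-bk)$. The Fourier transform is $\widehat f(\xi)=\int_{\mathbb{R}^d} f(x)e^{-2\pi i\xi x}\,dx$ for row vectors $\xi$, and $\check{\nu}(x)=\int_{\mathbb{R}^d}\nu(\xi)e^{2\pi i\xi x}\,d\xi$ is the inverse Fourier transform. $\mathcal{C}_0=(-1/2,1/2)^d$ (row vectors) and $\mathcal{C}_0b^{-1}=\{\xi b^{-1}:\xi\in\mathcal{C}_0\}$.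 Hardy space: let $C_d=\Gamma((d+1)/2)\pi^{-(d+1)/2}$, $Z(x)=C_d\,x/|x|^{d+1}$ for $x\ne0$ and $Z(0)=0$. The (vector-valued) Riesz transform of $f\in L^1(\mathbb{R}^d)$ is $Rf(x)=(f*Z)(x)=\text{p.v.}\int f(x-y)Z(y)\,dy$. $H^1=H^1(\mathbb{R}^d)=\{f\in L^1: Rf\in L^1\}$ with $\|f\|_{H^1}=\|f\|_1+\|Rf\|_1$. Discrete Hardy space: $\nu$ is a smooth, compactly supported cut-off function supported in $\mathcal{C}_0$ with $\nu\equiv1$ near the origin. The discrete Riesz kernel $z=\{z_k\}_{k\in\mathbb{Z}^d}\in\ell^2$, $z_k\in\mathbb{C}^d$, is defined by its Fourier series $$\zeta(\xi)=\sum_{k\in\mathbb{Z}^d} z_k e^{-2\pi i\xi k}:=-i\frac{\xi b^{-1}}{|\xi b^{-1}|}\nu(\xi),\qquad \xi\in\mathcal{C}_0,$$ with $\xi$ a row vector and $k$ a column vector. Then $h^1=\{s\in\ell^1(\mathbb{Z}^d): s*z\in\ell^1\}$ with norm $\|s\|_{h^1}=\|s\|_{\ell^1}+\|s*z\|_{\ell^1}$. *)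

theory Defs
  imports "HOL-Probability.Essential_Supremum"
begin

text \<open>
  Row and column vectors are both represented by \<open>real ^ 'n\<close>: the product of a row vector \<open>\<xi>\<close> and a
  column vector \<open>x\<close> is \<open>\<xi> \<bullet> x\<close>, and \<open>\<xi> b\<^sup>-\<^sup>1\<close> is \<open>\<xi> v* matrix_inv b\<close>.  Elements of \<open>L\<^sup>1\<close> are represented by
  functions that are integrable for the (complete) Lebesgue measure.
\<close>

subsection \<open>Smooth and Schwartz functions\<close>

fun iter_partial :: "'n list \<Rightarrow> (real ^ 'n \<Rightarrow> complex) \<Rightarrow> real ^ 'n::finite \<Rightarrow> complex" where
  "iter_partial [] f = f"
| "iter_partial (i # is) f = (\<lambda>x. frechet_derivative (iter_partial is f) (at x) (axis i 1))"

text \<open>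
  Differentiability of all iterated partial derivatives makes all of them continuous, so this is
  \<open>C\<^sup>\<infinity>\<close>.
\<close>

definition smooth :: "(real ^ 'n::finite \<Rightarrow> complex) \<Rightarrow> bool" where
  "smooth f \<longleftrightarrow> (\<forall>is x. iter_partial is f differentiable at x)"

definition schwartz :: "(real ^ 'n::finite \<Rightarrow> complex) \<Rightarrow> bool" where
  "schwartz f \<longleftrightarrow> smooth f \<and>
     (\<forall>is N. \<exists>C. \<forall>x. (1 + norm x) ^ N * norm (iter_partial is f x) \<le> C)"

definition supp :: "(real ^ 'n::finite \<Rightarrow> complex) \<Rightarrow> (real ^ 'n) set" where
  "supp f = closure (support_on UNIV f)"

definition open_cube :: "(real ^ 'n::finite) set" where
  "open_cube = {\<xi>. \<forall>i. - 1/2 < \<xi> $ i \<and> \<xi> $ i < 1/2}"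

definition cutoff :: "(real ^ 'n::finite \<Rightarrow> complex) \<Rightarrow> bool" where
  "cutoff \<nu> \<longleftrightarrow> smooth \<nu> \<and> compact (supp \<nu>) \<and> supp \<nu> \<subseteq> open_cube \<and> (\<forall>\<^sub>F \<xi> in nhds 0. \<nu> \<xi> = 1)"

subsection \<open>Fourier transform and Lebesgue norms\<close>

definition fourier :: "(real ^ 'n::finite \<Rightarrow> complex) \<Rightarrow> real ^ 'n \<Rightarrow> complex" where
  "fourier f \<xi> = (LINT x|lebesgue. f x * exp (- 2 * pi * \<i> * of_real (\<xi> \<bullet> x)))"

definition inv_fourier :: "(real ^ 'n::finite \<Rightarrow> complex) \<Rightarrow> real ^ 'n \<Rightarrow> complex" where
  "inv_fourier g x = (LINT \<xi>|lebesgue. g \<xi> * exp (2 * pi * \<i> * of_real (\<xi> \<bullet> x)))"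

definition L1_norm :: "(real ^ 'n::finite \<Rightarrow> 'b::real_normed_vector) \<Rightarrow> ennreal" where
  "L1_norm f = (\<integral>\<^sup>+x. ennreal (norm (f x)) \<partial>lebesgue)"

definition Linf_norm :: "(real ^ 'n::finite \<Rightarrow> 'b::real_normed_vector) \<Rightarrow> ennreal" where
  "Linf_norm f = esssup lebesgue (\<lambda>x. ennreal (norm (f x)))"

subsection \<open>The Hardy space\<close>

text \<open>The value at \<open>0\<close> is \<open>0\<close> because division by zero yields zero.\<close>

definition riesz_kernel :: "real ^ 'n::finite \<Rightarrow> complex ^ 'n" where
  "riesz_kernel x = (\<chi> i. of_real
     (Gamma ((real CARD('n) + 1) / 2) * pi powr (- ((real CARD('n) + 1) / 2))
        * x $ i / norm x ^ (CARD('n) + 1)))"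

definition riesz_trunc :: "(real ^ 'n::finite \<Rightarrow> complex) \<Rightarrow> real ^ 'n \<Rightarrow> real \<Rightarrow> complex ^ 'n" where
  "riesz_trunc f x \<epsilon> = (LINT y:{y. \<epsilon> < norm y}|lebesgue. f (x - y) *s riesz_kernel y)"

definition riesz :: "(real ^ 'n::finite \<Rightarrow> complex) \<Rightarrow> real ^ 'n \<Rightarrow> complex ^ 'n" where
  "riesz f x = Lim (at_right 0) (riesz_trunc f x)"

text \<open>
  For integrable \<open>f\<close> the principal value exists almost everywhere (Calderon--Zygmund), so the second
  clause only spells out that the third one speaks about genuine limits.
\<close>

definition H1 :: "(real ^ 'n::finite \<Rightarrow> complex) set" where
  "H1 = {f. integrable lebesgue f \<and>
            (AE x in lebesgue. \<exists>l. (riesz_trunc f x \<longlongrightarrow> l) (at_right 0)) \<and>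
            integrable lebesgue (riesz f)}"

definition H1_norm :: "(real ^ 'n::finite \<Rightarrow> complex) \<Rightarrow> ennreal" where
  "H1_norm f = L1_norm f + L1_norm (riesz f)"

subsection \<open>The discrete Hardy space\<close>

definition real_vec :: "int ^ 'n::finite \<Rightarrow> real ^ 'n" where
  "real_vec k = (\<chi> i. real_of_int (k $ i))"

definition discrete_riesz_symbol ::
    "real ^ 'n ^ 'n \<Rightarrow> (real ^ 'n \<Rightarrow> complex) \<Rightarrow> real ^ 'n::finite \<Rightarrow> complex ^ 'n" where
  "discrete_riesz_symbol b \<nu> \<xi> = (let \<eta> = \<xi> v* matrix_inv b in
     (\<chi> i. - \<i> * of_real (\<eta> $ i / norm \<eta>) * \<nu> \<xi>))"

text \<open>
  The sequence \<open>z\<close> with Fourier series \<open>\<Sum>\<^sub>k z\<^sub>k exp (- 2 \<pi> \<i> \<xi> k)\<close> equal to the symbol on the unit cube,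
  i.e. the sequence of Fourier coefficients of the symbol.
\<close>

definition discrete_riesz_kernel ::
    "real ^ 'n ^ 'n \<Rightarrow> (real ^ 'n \<Rightarrow> complex) \<Rightarrow> int ^ 'n::finite \<Rightarrow> complex ^ 'n" where
  "discrete_riesz_kernel b \<nu> k = (LINT \<xi>:open_cube|lebesgue.
     exp (2 * pi * \<i> * of_real (\<xi> \<bullet> real_vec k)) *s discrete_riesz_symbol b \<nu> \<xi>)"

definition discrete_conv ::
    "(int ^ 'n::finite \<Rightarrow> complex) \<Rightarrow> (int ^ 'n \<Rightarrow> complex ^ 'n) \<Rightarrow> int ^ 'n \<Rightarrow> complex ^ 'n" where
  "discrete_conv s z k = (\<Sum>\<^sub>\<infinity>m. s m *s z (k - m))"

definition ell1 :: "(int ^ 'n::finite \<Rightarrow> 'b::real_normed_vector) set" where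
  "ell1 = {s. (\<lambda>k. norm (s k)) summable_on UNIV}"

definition ell1_norm :: "(int ^ 'n::finite \<Rightarrow> 'b::real_normed_vector) \<Rightarrow> ennreal" where
  "ell1_norm s = (\<Sum>\<^sub>\<infinity>k. ennreal (norm (s k)))"

definition h1 ::
    "real ^ 'n ^ 'n \<Rightarrow> (real ^ 'n \<Rightarrow> complex) \<Rightarrow> (int ^ 'n::finite \<Rightarrow> complex) set" where
  "h1 b \<nu> = {s \<in> ell1. discrete_conv s (discrete_riesz_kernel b \<nu>) \<in> ell1}"

definition h1_norm ::
    "real ^ 'n ^ 'n \<Rightarrow> (real ^ 'n \<Rightarrow> complex) \<Rightarrow> (int ^ 'n::finite \<Rightarrow> complex) \<Rightarrow> ennreal" where
  "h1_norm b \<nu> s = ell1_norm s + ell1_norm (discrete_conv s (discrete_riesz_kernel b \<nu>))"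

subsection \<open>Analysis operator, periodization, operator norm\<close>

text \<open>Here \<open>a\<close> is a single dilation matrix, to be instantiated with \<open>a\<^sub>j\<close>.\<close>

definition analysis_op ::
    "real ^ 'n ^ 'n \<Rightarrow> real ^ 'n ^ 'n \<Rightarrow> (real ^ 'n \<Rightarrow> complex) \<Rightarrow>
     (real ^ 'n \<Rightarrow> complex) \<Rightarrow> int ^ 'n::finite \<Rightarrow> complex" where
  "analysis_op a b \<phi> f k =
     of_real \<bar>det b\<bar> * (LINT x|lebesgue. f x * cnj (\<phi> (a *v x - b *v real_vec k)))"

definition periodization ::
    "real ^ 'n ^ 'n \<Rightarrow> (real ^ 'n \<Rightarrow> 'b::real_normed_vector) \<Rightarrow> real ^ 'n::finite \<Rightarrow> 'b" where
  "periodization b f x = \<bar>det b\<bar> *\<^sub>R (\<Sum>\<^sub>\<infinity>k. f (x - b *v real_vec k))"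

text \<open>
  The analogue of \<^const>\<open>onorm\<close> for an operator on a normed space given by a carrier set \<open>X\<close> and norms
  \<open>nX\<close>, \<open>nY\<close>.  In \<^typ>\<open>ennreal\<close> a quotient \<open>c / 0\<close> is \<open>\<infinity>\<close> unless \<open>c = 0\<close>, when it is \<open>0\<close>; hence the value
  is at most a finite \<open>C\<close> iff \<open>nY (T f) \<le> C * nX f\<close> on \<open>X\<close>, provided \<open>nX\<close> is finite on \<open>X\<close>.
\<close>

definition operator_norm ::
    "'a set \<Rightarrow> ('a \<Rightarrow> ennreal) \<Rightarrow> ('b \<Rightarrow> ennreal) \<Rightarrow> ('a \<Rightarrow> 'b) \<Rightarrow> ennreal" where
  "operator_norm X nX nY T = (SUP f\<in>X. nY (T f) / nX f)"

end

theory Submission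
  imports Defs "HOL-Probability.Probability"
begin

text \<open>
  Put \<open>u x = \<bar>det b\<bar> * \<phi> (b x)\<close> and \<open>M = \<alpha> b\<^sup>-\<^sup>1\<close>, so that \<open>T f m = \<integral> f x * cnj (u (M x - m)) dx\<close> and the
  \<open>\<ell>\<^sup>1\<close> bound for \<open>T f\<close> is Fubini's theorem.  In the convolution of \<open>T f\<close> with \<open>z\<close>, Poisson summation for
  the band-limited function \<open>u\<close> turns the lattice sum into a Fourier integral over the cube.  There the
  symbol of \<open>z\<close> meets the Fourier transform of \<open>f\<close> and, dilations being isotropic, turns it up to sign
  into the cut-off \<open>\<nu>\<close> times the transform of \<open>R f\<close>.  Undoing the transforms gives
  \<open>\<plusminus> \<integral> R f x * (\<integral> cnj (u (M x - v - k)) * ft \<nu> v dv) dx\<close>, which Fubini's theorem bounds again; the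
  bound for \<open>T f\<close> itself is absorbed because \<open>1 = \<nu> 0 \<le> \<parallel>ft \<nu>\<parallel>\<^sub>1\<close>.

  The analytic core is that the transform of \<open>R f\<close>, an almost everywhere principal value that happens
  to be integrable, is the multiplier times that of \<open>f\<close>.  The Riesz kernel is a superposition of
  Gaussians; cutting it off gives kernels with uniformly bounded transforms and Hoermander constants
  whose convolutions with \<open>f\<close> converge almost everywhere.  Pair these with a Gaussian-damped character
  and split \<open>f\<close> by Calderon--Zygmund at height \<open>\<mu>\<close>: outside a set of measure \<open>o(1/\<mu>)\<close> the bad part
  contributes \<open>o(1)\<close> in \<open>L\<^sup>1\<close>, while the good part has \<open>L\<^sup>2\<close> norm squared \<open>O(\<mu>)\<close> and contributes \<open>o(1)\<close> on
  that set by Cauchy--Schwarz.  Let \<open>\<mu>\<close> tend to infinity.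
\<close>

text \<open>The truncations defining R f need not converge in \<open>L^1\<close>, so their
  transforms cannot simply be passed to the limit, and a weak type (1,1) bound controls the size of
  exceptional sets but not integrals over them. Two facts close the gap. First, the exceptional set
  at height \<open>\<mu>\<close> has measure at most a constant times \<open>tau / \<mu>\<close>,
  where \<open>tau\<close> is the mass of f on the stopped cubes rather than its whole norm;
  \<open>tau\<close> tends to 0 by absolute continuity, and this is the source of the little-o.
  Second, the limit is assumed integrable, so its own mass on these shrinking sets disappears as
  well.

  Gaussians serve twice. Their transforms are explicit, which gives multipliers bounded by exactly 1
  with an exact limit. Cut off in the scale variable, their superposition is also an average of
  sharply truncated Riesz kernels, so pointwise convergence carries over with the right constant.

  Calderon-Zygmund arguments usually sum over a disjoint family of cubes. Here each such sum is an
  integral over pairs of points in a common cube, and Tonelli's theorem takes over the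
  bookkeeping.\<close>

definition ec :: "real \<Rightarrow> complex" where
  "ec t = cis (2 * pi * t)"

lemma ec_0 [simp]: "ec 0 = 1"
  by (simp add: ec_def)

lemma ec_add: "ec (s + t) = ec s * ec t"
  by (simp add: ec_def cis_mult ring_distribs)

lemma ec_minus: "ec (- t) = cnj (ec t)"
  by (simp add: ec_def cis_cnj)

lemma ec_diff: "ec (s - t) = ec s * ec (- t)"
  using ec_add[of s "- t"] by simp

lemma norm_ec [simp]: "norm (ec t) = 1"
  by (simp add: ec_def)

lemma continuous_on_ec [continuous_intros]:
  "continuous_on A f \<Longrightarrow> continuous_on A (\<lambda>x. ec (f x))"
  unfolding ec_def by (intro continuous_intros)

lemma tendsto_ec [tendsto_intros]: "(f \<longlongrightarrow> l) F \<Longrightarrow> ((\<lambda>x. ec (f x)) \<longlongrightarrow> ec l) F"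
  unfolding ec_def by (intro tendsto_intros)

lemma measurable_ec [measurable]: "ec \<in> borel_measurable borel"
  by (intro borel_measurable_continuous_onI continuous_intros)

lemma ec_exp: "ec t = exp (2 * pi * \<i> * of_real t)"
  by (simp add: ec_def cis_conv_exp mult_ac)

text \<open>Taken over \<open>lborel\<close> instead of \<open>lebesgue\<close>, so that joint Borel
  measurability and Fubini's theorem apply directly. For Borel functions
  \<open>fourier_eq_ft\<close> and \<open>inv_fourier_eq_ft\<close> lead back to the transforms of
  the statement.\<close>

definition ft :: "(real ^ 'n::finite \<Rightarrow> complex) \<Rightarrow> real ^ 'n \<Rightarrow> complex" where
  "ft f \<xi> = (LINT x|lborel. f x * ec (- (\<xi> \<bullet> x)))"

subsection \<open>Integrals over \<open>real ^ 'n\<close>\<close>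

text \<open>The measure \<open>lborel\<close> is the image of a product of one-dimensional measures
  indexed by \<open>Basis\<close>; the bijection between \<open>'n\<close> and \<open>Basis\<close>
  given by \<open>axis\<close> moves the product formulas to coordinates.\<close>

lemma
  fixes f :: "'n::finite \<Rightarrow> real \<Rightarrow> 'b::{real_normed_field,banach,second_countable_topology}"
  assumes f: "\<And>i. integrable lborel (f i)"
  shows integrable_prod_vec: "integrable (lborel :: (real ^ 'n) measure) (\<lambda>x. \<Prod>i\<in>UNIV. f i (x $ i))"
    and integral_prod_vec: "(LINT x|(lborel :: (real ^ 'n) measure). (\<Prod>i\<in>UNIV. f i (x $ i))) = (\<Prod>i\<in>UNIV. LINT t|lborel. f i t)"
proof -
  let ?a = "\<lambda>i::'n. axis i (1::real)"
  have inj: "inj ?a" by (auto simp: inj_on_def axis_eq_axis)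
  have B: "(Basis :: (real ^ 'n) set) = range ?a" by (auto simp: Basis_vec_def)
  define F where "F b = f (inv ?a b)" for b
  interpret product_sigma_finite "\<lambda>_::real ^ 'n. lborel :: real measure" ..
  have [measurable]: "f i \<in> borel_measurable borel" for i
    using borel_measurable_integrable[OF f[of i]] by simp
  have F: "integrable lborel (F b)" for b unfolding F_def by (rule f)
  have eq: "(\<Prod>i\<in>UNIV. f i (x $ i)) = (\<Prod>b\<in>Basis. F b (x \<bullet> b))" for x :: "real ^ 'n"
    unfolding B by (subst prod.reindex[OF inj]) (simp add: F_def inv_f_f[OF inj] inner_axis)
  have eq2: "(\<Prod>b\<in>Basis. F b ((\<Sum>b'\<in>Basis. g b' *\<^sub>R b') \<bullet> b)) = (\<Prod>b\<in>Basis. F b (g b))"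
    for g :: "real ^ 'n \<Rightarrow> real"
    by (intro prod.cong) (simp_all)
  have m: "(\<lambda>x::real ^ 'n. \<Prod>b\<in>Basis. F b (x \<bullet> b)) \<in> borel_measurable borel"
    unfolding F_def by measurable
  have m2: "(\<lambda>g::(real ^ 'n \<Rightarrow> real). \<Sum>b\<in>Basis. g b *\<^sub>R b) \<in> (\<Pi>\<^sub>M b\<in>Basis. lborel) \<rightarrow>\<^sub>M (borel :: (real ^ 'n) measure)"
    by measurable
  show "integrable (lborel :: (real ^ 'n) measure) (\<lambda>x. \<Prod>i\<in>UNIV. f i (x $ i))"
    unfolding eq by (subst lborel_eq, subst integrable_distr_eq[OF m2 m])
      (unfold eq2, rule product_integrable_prod, simp_all add: F)
  have "(LINT x|(lborel :: (real ^ 'n) measure). (\<Prod>i\<in>UNIV. f i (x $ i))) = (\<Prod>b\<in>Basis. LINT t|lborel. F b t)"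
    unfolding eq by (subst lborel_eq, subst integral_distr[OF m2 m])
      (unfold eq2, rule product_integral_prod, simp_all add: F)
  also have "\<dots> = (\<Prod>i\<in>UNIV. LINT t|lborel. f i t)"
    unfolding B by (subst prod.reindex[OF inj]) (simp add: F_def inv_f_f[OF inj])
  finally show "(LINT x|(lborel :: (real ^ 'n) measure). (\<Prod>i\<in>UNIV. f i (x $ i))) = (\<Prod>i\<in>UNIV. LINT t|lborel. f i t)" .
qed

lemma nn_integral_lborel_affine:
  fixes f :: "'a::euclidean_space \<Rightarrow> ennreal"
  assumes [measurable]: "f \<in> borel_measurable borel" and "c \<noteq> 0"
  shows "(\<integral>\<^sup>+x. f (t + c *\<^sub>R x) \<partial>lborel) = ennreal (1 / \<bar>c\<bar> ^ DIM('a)) * (\<integral>\<^sup>+x. f x \<partial>lborel)"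
proof -
  have "(\<integral>\<^sup>+x. f x \<partial>lborel) = ennreal (\<bar>c\<bar> ^ DIM('a)) * (\<integral>\<^sup>+x. f (t + c *\<^sub>R x) \<partial>lborel)"
    using assms(2) by (subst lborel_affine[of c t])
      (simp_all add: nn_integral_density nn_integral_distr nn_integral_cmult)
  then show ?thesis
    using assms(2) by (simp add: mult.assoc[symmetric] flip: ennreal_mult)
qed

lemma integrable_lborel_affine:
  fixes f :: "'a::euclidean_space \<Rightarrow> 'b::{banach, second_countable_topology}"
  assumes f: "integrable lborel f" and c: "c \<noteq> 0"
  shows "integrable lborel (\<lambda>x. f (t + c *\<^sub>R x))"
  using f borel_measurable_integrable[OF f] nn_integral_lborel_affine[of "\<lambda>x. ennreal (norm (f x))" c t] c
  unfolding integrable_iff_bounded by (auto simp: ennreal_mult_less_top)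

lemma integral_lborel_affine:
  fixes f :: "'a::euclidean_space \<Rightarrow> 'b::{banach, second_countable_topology}"
  assumes f: "f \<in> borel_measurable borel" and c: "c \<noteq> 0"
  shows "(LINT x|lborel. f (t + c *\<^sub>R x)) = (1 / \<bar>c\<bar> ^ DIM('a)) *\<^sub>R (LINT x|lborel. f x)"
proof -
  have "(LINT x|lborel. f x) = (\<bar>c\<bar> ^ DIM('a)) *\<^sub>R (LINT x|lborel. f (t + c *\<^sub>R x))"
    using c f by (subst lborel_affine[of c t]) (simp_all add: integral_density integral_distr)
  then show ?thesis using c by simp
qed

lemma integrable_lborel_translate:
  fixes f :: "'a::euclidean_space \<Rightarrow> 'b::{banach, second_countable_topology}"
  assumes "integrable lborel f"
  shows "integrable lborel (\<lambda>x. f (t + x))" "integrable lborel (\<lambda>x. f (x + t))"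
    "integrable lborel (\<lambda>x. f (x - t))" "integrable lborel (\<lambda>x. f (t - x))" "integrable lborel (\<lambda>x. f (- x))"
  using integrable_lborel_affine[OF assms, of 1 t] integrable_lborel_affine[OF assms, of 1 "-t"]
   integrable_lborel_affine[OF assms, of "-1" t] integrable_lborel_affine[OF assms, of "-1" 0]
  by (simp_all add: add.commute)

lemma integral_lborel_translate:
  fixes f :: "'a::euclidean_space \<Rightarrow> 'b::{banach, second_countable_topology}"
  assumes "f \<in> borel_measurable borel"
  shows "(LINT x|lborel. f (t + x)) = (LINT x|lborel. f x)" "(LINT x|lborel. f (x + t)) = (LINT x|lborel. f x)"
    "(LINT x|lborel. f (x - t)) = (LINT x|lborel. f x)" "(LINT x|lborel. f (t - x)) = (LINT x|lborel. f x)"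
    "(LINT x|lborel. f (- x)) = (LINT x|lborel. f x)"
  using integral_lborel_affine[OF assms, of 1 t] integral_lborel_affine[OF assms, of 1 "-t"]
   integral_lborel_affine[OF assms, of "-1" t] integral_lborel_affine[OF assms, of "-1" 0]
  by (simp_all add: add.commute)

lemma nn_integral_lborel_translate:
  fixes f :: "'a::euclidean_space \<Rightarrow> ennreal"
  assumes "f \<in> borel_measurable borel"
  shows "(\<integral>\<^sup>+x. f (t + x) \<partial>lborel) = (\<integral>\<^sup>+x. f x \<partial>lborel)" "(\<integral>\<^sup>+x. f (x + t) \<partial>lborel) = (\<integral>\<^sup>+x. f x \<partial>lborel)"
    "(\<integral>\<^sup>+x. f (x - t) \<partial>lborel) = (\<integral>\<^sup>+x. f x \<partial>lborel)" "(\<integral>\<^sup>+x. f (t - x) \<partial>lborel) = (\<integral>\<^sup>+x. f x \<partial>lborel)"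
    "(\<integral>\<^sup>+x. f (- x) \<partial>lborel) = (\<integral>\<^sup>+x. f x \<partial>lborel)"
  using nn_integral_lborel_affine[OF assms, of 1 t] nn_integral_lborel_affine[OF assms, of 1 "-t"]
   nn_integral_lborel_affine[OF assms, of "-1" t] nn_integral_lborel_affine[OF assms, of "-1" 0]
  by (simp_all add: add.commute)

lemma integrable_mult_bounded:
  fixes f g :: "'a \<Rightarrow> complex"
  assumes "integrable M f" "g \<in> borel_measurable M" "\<And>x. norm (g x) \<le> B"
  shows "integrable M (\<lambda>x. f x * g x)" "integrable M (\<lambda>x. g x * f x)"
proof -
  have i1: "integrable M (\<lambda>x. B * norm (f x))" using assms(1) by simp
  have n1: "norm (f x * g x) \<le> norm (B * norm (f x))" for x
  proof -
    have "norm (f x) * norm (g x) \<le> norm (f x) * B"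
      by (intro mult_left_mono assms) auto
    also have "\<dots> \<le> \<bar>B * norm (f x)\<bar>" by (simp add: mult.commute)
    finally show ?thesis by (simp add: norm_mult)
  qed
  show "integrable M (\<lambda>x. f x * g x)"
    by (rule Bochner_Integration.integrable_bound[OF i1 borel_measurable_times[OF borel_measurable_integrable[OF assms(1)] assms(2)]])
      (rule AE_I2[OF n1])
  then show "integrable M (\<lambda>x. g x * f x)" by (simp add: mult.commute)
qed

lemma integrable_mult_ec:
  assumes "integrable lborel (f :: real ^ 'n::finite \<Rightarrow> complex)"
  shows "integrable lborel (\<lambda>x. f x * ec (c + \<xi> \<bullet> x))" "integrable lborel (\<lambda>x. f x * ec (\<xi> \<bullet> x))" "integrable lborel (\<lambda>x. f x * ec (- (\<xi> \<bullet> x)))"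
  by (intro integrable_mult_bounded(1)[OF assms, where B = 1]; simp)+

lemma norm_ft_le: "norm (ft f \<xi>) \<le> (LINT x|lborel. norm (f x))"
proof -
  have "norm (ft f \<xi>) \<le> (LINT x|lborel. norm (f x * ec (- (\<xi> \<bullet> x))))"
    unfolding ft_def by (rule integral_norm_bound)
  then show ?thesis by (simp add: norm_mult)
qed

lemma continuous_ft:
  assumes f: "integrable lborel (f :: real ^ 'n::finite \<Rightarrow> complex)"
  shows "continuous_on UNIV (ft f)"
proof -
  have [measurable]: "f \<in> borel_measurable borel" using borel_measurable_integrable[OF f] by simp
  have "(\<lambda>n. ft f (u n)) \<longlonglongrightarrow> ft f \<xi>" if "u \<longlonglongrightarrow> \<xi>" for u \<xi>
    unfolding ft_def
  proof (rule integral_dominated_convergence[where w = "\<lambda>x. norm (f x)"])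
    show "AE x in lborel. (\<lambda>n. f x * ec (- (u n \<bullet> x))) \<longlonglongrightarrow> f x * ec (- (\<xi> \<bullet> x))"
      using that by (intro always_eventually allI tendsto_intros)
  qed (use f in \<open>auto simp: norm_mult\<close>)
  then show ?thesis by (auto simp: continuous_on_sequentially o_def)
qed

lemma
  fixes f :: "'a::euclidean_space \<Rightarrow> 'b::euclidean_space \<Rightarrow> 'c::{banach, second_countable_topology}"
  assumes m: "case_prod f \<in> borel_measurable (lborel \<Otimes>\<^sub>M lborel)"
    and fin: "(\<integral>\<^sup>+x. \<integral>\<^sup>+y. ennreal (norm (f x y)) \<partial>lborel \<partial>lborel) < \<infinity>"
  shows fubini_swap: "(LINT x|lborel. LINT y|lborel. f x y) = (LINT y|lborel. LINT x|lborel. f x y)"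
    and fubini_integrable_fst: "integrable lborel (\<lambda>x. LINT y|lborel. f x y)"
    and fubini_integrable_snd: "integrable lborel (\<lambda>y. LINT x|lborel. f x y)"
proof -
  have "(\<integral>\<^sup>+z. ennreal (norm (case_prod f z)) \<partial>(lborel \<Otimes>\<^sub>M lborel)) = (\<integral>\<^sup>+x. \<integral>\<^sup>+y. ennreal (norm (f x y)) \<partial>lborel \<partial>lborel)"
    using m by (subst lborel.nn_integral_fst[symmetric]) (auto simp: split_beta')
  then have i: "integrable (lborel \<Otimes>\<^sub>M lborel) (case_prod f)"
    using m fin by (auto simp: integrable_iff_bounded)
  show "(LINT x|lborel. LINT y|lborel. f x y) = (LINT y|lborel. LINT x|lborel. f x y)"
    using lborel_pair.Fubini_integral[OF i] by simp
  show "integrable lborel (\<lambda>x. LINT y|lborel. f x y)"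
    using lborel_pair.integrable_fst[OF i] by simp
  show "integrable lborel (\<lambda>y. LINT x|lborel. f x y)"
    using lborel_pair.integrable_snd[OF i] by simp
qed

lemma integrable_nn_finite:
  fixes f :: "'a \<Rightarrow> 'b::{banach, second_countable_topology}"
  shows "integrable M f \<Longrightarrow> (\<integral>\<^sup>+x. ennreal (norm (f x)) \<partial>M) < \<infinity>"
  by (simp add: integrable_iff_bounded)

lemma nn_mult_finite:
  assumes "integrable lborel (f :: _ \<Rightarrow> 'a::{banach, second_countable_topology})" "integrable lborel (g :: _ \<Rightarrow> 'b::{banach, second_countable_topology})"
  shows "(\<integral>\<^sup>+x. \<integral>\<^sup>+y. ennreal (norm (f x)) * ennreal (norm (g y)) \<partial>lborel \<partial>lborel) < \<infinity>"
proof -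
  have [measurable]: "f \<in> borel_measurable lborel" "g \<in> borel_measurable lborel"
    using assms by auto
  show ?thesis
    using integrable_nn_finite[OF assms(1)] integrable_nn_finite[OF assms(2)]
    by (simp add: nn_integral_cmult nn_integral_multc ennreal_mult_less_top)
qed

subsection \<open>Gaussians\<close>

definition gauss :: "real ^ 'n::finite \<Rightarrow> real" where
  "gauss x = exp (- pi * (norm x)\<^sup>2)"

lemma gauss_nonneg [simp]: "gauss x \<ge> 0"
  and gauss_le_1: "gauss x \<le> 1"
  and gauss_minus [simp]: "gauss (- x) = gauss x"
  and gauss_0 [simp]: "gauss 0 = 1"
  by (simp_all add: gauss_def)

lemma norm_vec_power2: "(norm (x :: real ^ 'n::finite))\<^sup>2 = (\<Sum>i\<in>UNIV. (x $ i)\<^sup>2)"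
  by (simp add: norm_vec_def L2_set_def sum_nonneg)

lemma continuous_gauss: "continuous_on UNIV gauss"
  unfolding gauss_def by (intro continuous_intros)

lemma measurable_gauss [measurable]: "gauss \<in> borel_measurable borel"
  by (intro borel_measurable_continuous_onI continuous_gauss)

text \<open>This is the characteristic function of the standard normal law after rescaling by
  \<open>sqrt (2 * pi)\<close>, a factor that turns the exponent into \<open>- pi * x^2\<close> and
  cancels the normalising constant of the density.\<close>

lemma has_bochner_integral_gauss_ec_1:
  "has_bochner_integral lborel (\<lambda>x::real. complex_of_real (exp (- pi * x\<^sup>2)) * ec (- (s * x))) (exp (- pi * s\<^sup>2))"
proof -
  define r where "r = sqrt (2 * pi)"
  have r: "r > 0" "r\<^sup>2 = 2 * pi" by (simp_all add: r_def)
  define t where "t = - r * s"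
  have m: "(\<lambda>x. iexp (t * x)) \<in> borel_measurable lborel" by measurable
  have "(LINT x|std_normal_distribution. iexp (t * x)) = complex_of_real (exp (- t\<^sup>2 / 2))"
    using fun_cong[OF char_std_normal_distribution, of t] unfolding char_def by (simp add: cis_conv_exp)
  then have 1: "(LINT x|lborel. std_normal_density x *\<^sub>R iexp (t * x)) = complex_of_real (exp (- t\<^sup>2 / 2))"
    by (subst (asm) integral_density) (auto simp: normal_density_nonneg)
  have 2: "integrable lborel (\<lambda>x. std_normal_density x *\<^sub>R iexp (t * x))"
    by (rule Bochner_Integration.integrable_bound[of _ "\<lambda>x. std_normal_density x"])
       (auto intro!: always_eventually simp: normal_density_nonneg norm_exp_i_times)
  have eq: "r *\<^sub>R (std_normal_density (0 + r * x) *\<^sub>R iexp (t * (0 + r * x))) =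
    complex_of_real (exp (- pi * x\<^sup>2)) * ec (- (s * x))" for x
  proof -
    have "r * std_normal_density (r * x) = exp (- pi * x\<^sup>2)"
      using r by (simp add: std_normal_density_def power_mult_distrib r_def[symmetric])
    moreover have "t * (r * x) = 2 * pi * (- (s * x))"
      using r by (simp add: t_def power2_eq_square)
    then have "iexp (t * (r * x)) = ec (- (s * x))"
      unfolding ec_def cis_conv_exp by (simp only:)
    ultimately show ?thesis
      by (simp add: scaleR_conv_of_real mult.assoc[symmetric] flip: of_real_mult)
  qed
  have i: "integrable lborel (\<lambda>x. r *\<^sub>R (std_normal_density (0 + r * x) *\<^sub>R iexp (t * (0 + r * x))))"
    by (intro integrable_scaleR_right lborel_integrable_real_affine[OF 2]) (use r in simp)
  have "(LINT x|lborel. r *\<^sub>R (std_normal_density (0 + r * x) *\<^sub>R iexp (t * (0 + r * x)))) = complex_of_real (exp (- t\<^sup>2 / 2))"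
    using lborel_integral_real_affine[of r "\<lambda>x. std_normal_density x *\<^sub>R iexp (t * x)" 0] r 1 by (simp del: scaleR_scaleR)
  moreover have "exp (- t\<^sup>2 / 2) = exp (- pi * s\<^sup>2)"
    using r by (simp add: t_def power_mult_distrib)
  ultimately show ?thesis using i unfolding eq by (simp add: has_bochner_integral_iff)
qed

lemma
  shows integrable_gauss_ec: "integrable lborel (\<lambda>x. complex_of_real (gauss x) * ec (- (\<xi> \<bullet> x)))"
    and integral_gauss_ec: "(LINT x|lborel. complex_of_real (gauss x) * ec (- (\<xi> \<bullet> x))) = of_real (gauss (\<xi> :: real ^ 'n::finite))"
proof -
  have ecs: "ec (\<Sum>i\<in>A. g i) = (\<Prod>i\<in>A. ec (g i))" for g :: "'n \<Rightarrow> real" and A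
    by (induction A rule: infinite_finite_induct) (auto simp: ec_add)
  have g: "gauss x = (\<Prod>i\<in>UNIV. exp (- pi * (x $ i)\<^sup>2))" for x :: "real ^ 'n"
    unfolding gauss_def norm_vec_power2 by (simp add: sum_distrib_left exp_sum sum_negf[symmetric])
  have eq: "complex_of_real (gauss x) * ec (- (\<xi> \<bullet> x)) =
      (\<Prod>i\<in>UNIV. complex_of_real (exp (- pi * (x $ i)\<^sup>2)) * ec (- (\<xi> $ i * x $ i)))" for x
    unfolding g of_real_prod prod.distrib by (simp add: inner_vec_def sum_negf[symmetric] ecs)
  note h = has_bochner_integral_gauss_ec_1[unfolded has_bochner_integral_iff]
  show "integrable lborel (\<lambda>x. complex_of_real (gauss x) * ec (- (\<xi> \<bullet> x)))"
    unfolding eq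
    using h by (intro integrable_prod_vec[of "\<lambda>i x. complex_of_real (exp (- pi * x\<^sup>2)) * ec (- (\<xi> $ i * x))"]) auto
  show "(LINT x|lborel. complex_of_real (gauss x) * ec (- (\<xi> \<bullet> x))) = of_real (gauss \<xi>)"
    unfolding eq
    using h by (subst integral_prod_vec[of "\<lambda>i x. complex_of_real (exp (- pi * x\<^sup>2)) * ec (- (\<xi> $ i * x))"]) (auto simp: g)
qed

lemma integrable_gauss: "integrable lborel (gauss :: real ^ 'n::finite \<Rightarrow> real)"
  using integrable_norm[OF integrable_gauss_ec[of "0::real ^ 'n"]] by simp

lemma integral_gauss: "(LINT x|lborel. gauss (x :: real ^ 'n::finite)) = 1"
proof -
  have "complex_of_real (LINT x|lborel. gauss (x :: real ^ 'n)) = 1"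
    using integral_gauss_ec[of "0::real ^ 'n"] by (simp flip: integral_complex_of_real)
  then show ?thesis by simp
qed

lemma nn_integral_gauss: "(\<integral>\<^sup>+x. ennreal (gauss (x :: real ^ 'n::finite)) \<partial>lborel) = 1"
  by (subst nn_integral_eq_integral[OF integrable_gauss]) (auto simp: integral_gauss)

lemma
  fixes \<xi> :: "real ^ 'n::finite"
  assumes t: "t > 0"
  shows integrable_gauss_scaled: "integrable lborel (\<lambda>x::real ^ 'n. gauss (t *\<^sub>R x))"
    and integral_gauss_scaled_ec: "(LINT x|lborel. complex_of_real (gauss (t *\<^sub>R x)) * ec (\<xi> \<bullet> x)) =
      of_real (gauss ((1 / t) *\<^sub>R \<xi>) / t ^ CARD('n))"
proof -
  show "integrable lborel (\<lambda>x::real ^ 'n. gauss (t *\<^sub>R x))"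
    using integrable_lborel_affine[OF integrable_gauss, of t 0] t by simp
  have m: "(\<lambda>x. complex_of_real (gauss x) * ec (- ((- ((1 / t) *\<^sub>R \<xi>)) \<bullet> x))) \<in> borel_measurable borel"
    by measurable
  have "(\<lambda>x. complex_of_real (gauss (0 + t *\<^sub>R x)) * ec (- ((- ((1 / t) *\<^sub>R \<xi>)) \<bullet> (0 + t *\<^sub>R x)))) =
     (\<lambda>x. complex_of_real (gauss (t *\<^sub>R x)) * ec (\<xi> \<bullet> x))"
    using t by simp
  then show "(LINT x|lborel. complex_of_real (gauss (t *\<^sub>R x)) * ec (\<xi> \<bullet> x)) = of_real (gauss ((1 / t) *\<^sub>R \<xi>) / t ^ CARD('n))"
    using integral_lborel_affine[OF m, of t 0] integral_gauss_ec[of "- ((1 / t) *\<^sub>R \<xi>)"] t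
    by (simp add: scaleR_conv_of_real)
qed

text \<open>The scale sits in the argument of f and not in the kernel, so the majorant
  \<open>gauss u * B\<close> serves for all n. Continuity at the single point x is enough, which
  matters later for a multiplier that jumps at the origin.\<close>

lemma gauss_approx_identity:
  fixes f :: "real ^ 'n::finite \<Rightarrow> complex"
  assumes f: "f \<in> borel_measurable borel" "\<And>x. norm (f x) \<le> B" "isCont f x" and t: "t \<longlonglongrightarrow> 0"
  shows "(\<lambda>n. LINT u|lborel. of_real (gauss u) * f (x + t n *\<^sub>R u)) \<longlonglongrightarrow> f x"
proof -
  note f(1)[measurable]
  have "(\<lambda>n. LINT u|lborel. of_real (gauss u) * f (x + t n *\<^sub>R u)) \<longlonglongrightarrow> (LINT u::real ^ 'n|lborel. of_real (gauss u) * f x)"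
  proof (rule integral_dominated_convergence[where w = "\<lambda>u. gauss u * B"])
    show "integrable lborel (\<lambda>u::real ^ 'n. gauss u * B)" by (intro integrable_mult_left integrable_gauss)
    show "AE u in lborel. (\<lambda>n. of_real (gauss u) * f (x + t n *\<^sub>R u)) \<longlonglongrightarrow> of_real (gauss u) * f x"
    proof (intro always_eventually allI tendsto_mult tendsto_const)
      fix u
      have "(\<lambda>n. x + t n *\<^sub>R u) \<longlonglongrightarrow> x + 0 *\<^sub>R u" by (intro tendsto_intros t)
      then show "(\<lambda>n. f (x + t n *\<^sub>R u)) \<longlonglongrightarrow> f x"
        using f(3) by (auto intro: isCont_tendsto_compose)
    qed
    show "AE u in lborel. norm (of_real (gauss u) * f (x + t n *\<^sub>R u)) \<le> gauss u * B" for n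
      using f(2) by (auto intro!: always_eventually mult_left_mono simp: norm_mult)
  qed measurable
  moreover have "(LINT u|lborel. of_real (gauss (u :: real ^ 'n)) * f x) = f x"
    using integral_complex_of_real[of lborel "gauss :: real ^ 'n \<Rightarrow> real"]
    by (simp add: integral_gauss)
  ultimately show ?thesis by (simp add: integral_gauss)
qed

text \<open>Damp the inversion integral by \<open>gauss (t *\<^sub>R \<xi>)\<close>. Fubini's
  theorem then turns it into a Gaussian average of f around x at scale t, and both sides converge as
  t tends to 0.\<close>

lemma fourier_inversion:
  fixes f :: "real ^ 'n::finite \<Rightarrow> complex"
  assumes f: "integrable lborel f" "\<And>x. norm (f x) \<le> B" "isCont f x" and ff: "integrable lborel (ft f)"
  shows "(LINT \<xi>|lborel. ft f \<xi> * ec (\<xi> \<bullet> x)) = f x"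
proof -
  have [measurable]: "f \<in> borel_measurable borel" using f(1) by auto
  have [measurable]: "ft f \<in> borel_measurable borel" using ff by auto
  define t :: "nat \<Rightarrow> real" where "t n = 1 / real (Suc n)" for n
  have t: "t \<longlonglongrightarrow> 0" "t n > 0" for n
    unfolding t_def using LIMSEQ_inverse_real_of_nat by (auto simp: inverse_eq_divide)
  have "(\<lambda>n. LINT \<xi>|lborel. ft f \<xi> * ec (\<xi> \<bullet> x) * of_real (gauss (t n *\<^sub>R \<xi>))) \<longlonglongrightarrow> (LINT \<xi>|lborel. ft f \<xi> * ec (\<xi> \<bullet> x) * 1)"
  proof (rule integral_dominated_convergence[where w = "\<lambda>\<xi>. norm (ft f \<xi>)"])
    show "AE \<xi> in lborel. (\<lambda>n. ft f \<xi> * ec (\<xi> \<bullet> x) * of_real (gauss (t n *\<^sub>R \<xi>))) \<longlonglongrightarrow> ft f \<xi> * ec (\<xi> \<bullet> x) * 1"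
    proof (intro always_eventually allI tendsto_mult tendsto_const)
      fix \<xi> :: "real ^ 'n"
      have "(\<lambda>n. gauss (t n *\<^sub>R \<xi>)) \<longlonglongrightarrow> gauss (0 *\<^sub>R \<xi>)"
        unfolding gauss_def by (intro tendsto_intros t)
      then show "(\<lambda>n. complex_of_real (gauss (t n *\<^sub>R \<xi>))) \<longlonglongrightarrow> 1"
        using tendsto_of_real by fastforce
    qed
    show "AE \<xi> in lborel. norm (ft f \<xi> * ec (\<xi> \<bullet> x) * of_real (gauss (t n *\<^sub>R \<xi>))) \<le> norm (ft f \<xi>)" for n
      by (auto intro!: always_eventually mult_left_le simp: norm_mult gauss_le_1)
  qed (use ff in \<open>auto\<close>)
  moreover have "(LINT \<xi>|lborel. ft f \<xi> * ec (\<xi> \<bullet> x) * of_real (gauss (t n *\<^sub>R \<xi>))) =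
      (LINT u|lborel. of_real (gauss u) * f (x + t n *\<^sub>R u))" for n
  proof -
    let ?F = "\<lambda>\<xi> y. f y * ec (- (\<xi> \<bullet> y)) * (ec (\<xi> \<bullet> x) * of_real (gauss (t n *\<^sub>R \<xi>)))"
    have "(\<integral>\<^sup>+\<xi>. \<integral>\<^sup>+y. ennreal (norm (?F \<xi> y)) \<partial>lborel \<partial>lborel) < \<infinity>"
      using nn_mult_finite[OF integrable_gauss_scaled[OF t(2)[of n]] f(1)]
      by (simp add: norm_mult ennreal_mult mult.commute)
    from fubini_swap[OF _ this]
    have "(LINT \<xi>|lborel. LINT y|lborel. ?F \<xi> y) = (LINT y|lborel. LINT \<xi>|lborel. ?F \<xi> y)" by simp
    moreover have "(LINT y|lborel. ?F \<xi> y) = ft f \<xi> * ec (\<xi> \<bullet> x) * of_real (gauss (t n *\<^sub>R \<xi>))" for \<xi>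
      unfolding ft_def integral_mult_left_zero by (simp add: mult.assoc)
    moreover have "(LINT \<xi>|lborel. ?F \<xi> y) = f y * of_real (gauss ((1 / t n) *\<^sub>R (x - y)) / t n ^ CARD('n))" for y
    proof -
      have "?F \<xi> y = f y * (of_real (gauss (t n *\<^sub>R \<xi>)) * ec ((x - y) \<bullet> \<xi>))" for \<xi>
        using ec_diff[of "\<xi> \<bullet> x" "\<xi> \<bullet> y"] by (simp add: inner_commute[of _ \<xi>] inner_diff_right mult_ac)
      then show ?thesis
        unfolding integral_gauss_scaled_ec[OF t(2), symmetric] integral_mult_right_zero[symmetric] by (simp only:)
    qed
    ultimately have 1: "(LINT \<xi>|lborel. ft f \<xi> * ec (\<xi> \<bullet> x) * of_real (gauss (t n *\<^sub>R \<xi>))) =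
       (LINT y|lborel. f y * of_real (gauss ((1 / t n) *\<^sub>R (x - y)) / t n ^ CARD('n)))" by (simp only:)
    have m: "(\<lambda>y. f y * of_real (gauss ((1 / t n) *\<^sub>R (x - y)) / t n ^ CARD('n))) \<in> borel_measurable borel"
      by measurable
    have "(LINT u|lborel. f (x + t n *\<^sub>R u) * of_real (gauss ((1 / t n) *\<^sub>R (x - (x + t n *\<^sub>R u))) / t n ^ CARD('n))) =
       (1 / t n ^ CARD('n)) *\<^sub>R (LINT y|lborel. f y * of_real (gauss ((1 / t n) *\<^sub>R (x - y)) / t n ^ CARD('n)))"
      using integral_lborel_affine[OF m, of "t n" x] t(2)[of n] by simp
    moreover have "f (x + t n *\<^sub>R u) * of_real (gauss ((1 / t n) *\<^sub>R (x - (x + t n *\<^sub>R u))) / t n ^ CARD('n)) =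
       (1 / t n ^ CARD('n)) *\<^sub>R (of_real (gauss u) * f (x + t n *\<^sub>R u))" for u
    proof -
      have "(1 / t n) *\<^sub>R (x - (x + t n *\<^sub>R u)) = - u" using t(2)[of n] by simp
      then show ?thesis by (simp add: scaleR_conv_of_real[where 'a = complex] del: scaleR_right_diff_distrib)
    qed
    ultimately have "(1 / t n ^ CARD('n)) *\<^sub>R (LINT u|lborel. of_real (gauss u) * f (x + t n *\<^sub>R u)) =
       (1 / t n ^ CARD('n)) *\<^sub>R (LINT y|lborel. f y * of_real (gauss ((1 / t n) *\<^sub>R (x - y)) / t n ^ CARD('n)))"
      by (simp only: integral_scaleR_right)
    then show ?thesis unfolding 1 using t(2)[of n] by (simp only: scaleR_cancel_left) simp
  qed
  moreover have "(\<lambda>n. LINT u|lborel. of_real (gauss u) * f (x + t n *\<^sub>R u)) \<longlonglongrightarrow> f x"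
    by (rule gauss_approx_identity[OF _ f(2,3) t(1)]) measurable
  ultimately show ?thesis by (auto dest: LIMSEQ_unique)
qed

text \<open>Integrating the fundamental theorem of calculus over all translates of a unit segment
  avoids boundary terms.\<close>

lemma integral_partial_derivative_eq_0:
  fixes F :: "real ^ 'n::finite \<Rightarrow> complex"
  assumes F: "integrable lborel F" and F': "integrable lborel F'" and cont: "continuous_on UNIV F'"
    and deriv: "\<And>x. ((\<lambda>s. F (x + s *\<^sub>R v)) has_vector_derivative F' x) (at 0)"
  shows "(LINT x|lborel. F' x) = 0"
proof -
  have [measurable]: "F \<in> borel_measurable borel" "F' \<in> borel_measurable borel" using F F' by auto
  let ?G = "\<lambda>x s. indicator {0..1::real} s *\<^sub>R F' (x + s *\<^sub>R v)"
  have der: "((\<lambda>s. F (x + s *\<^sub>R v)) has_vector_derivative F' (x + s *\<^sub>R v)) (at s)" for x s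
  proof -
    have "((\<lambda>r. F ((x + s *\<^sub>R v) + r *\<^sub>R v)) has_vector_derivative F' (x + s *\<^sub>R v)) (at (0))" by (rule deriv)
    then have "((\<lambda>r. F ((x + s *\<^sub>R v) + r *\<^sub>R v)) has_vector_derivative F' (x + s *\<^sub>R v)) (at (s - s))" by simp
    moreover have "((\<lambda>r. r - s) has_vector_derivative 1) (at s)"
      by (auto intro!: derivative_eq_intros)
    ultimately have "((\<lambda>r. F ((x + s *\<^sub>R v) + r *\<^sub>R v)) \<circ> (\<lambda>r. r - s) has_vector_derivative 1 *\<^sub>R F' (x + s *\<^sub>R v)) (at s)"
      by (intro vector_diff_chain_at) auto
    then show ?thesis by (simp add: o_def scaleR_diff_left)
  qed
  have 1: "(LINT s|lborel. ?G x s) = F (x + v) - F x" for x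
  proof -
    have "continuous_on {0..1} (\<lambda>s. F' (x + s *\<^sub>R v))"
      by (intro continuous_on_compose2[OF cont] continuous_intros) auto
    then have "(LINT s|lborel. ?G x s) = F (x + 1 *\<^sub>R v) - F (x + 0 *\<^sub>R v)"
      by (intro integral_FTC_Icc has_vector_derivative_at_within[OF der]) auto
    then show ?thesis by simp
  qed
  have "(\<integral>\<^sup>+s. \<integral>\<^sup>+x. ennreal (norm (?G x s)) \<partial>lborel \<partial>lborel) = (\<integral>\<^sup>+s. indicator {0..1::real} s * (\<integral>\<^sup>+x. ennreal (norm (F' x)) \<partial>lborel) \<partial>lborel)"
  proof (intro nn_integral_cong)
    fix s :: real
    have "(\<integral>\<^sup>+x. ennreal (norm (?G x s)) \<partial>lborel) = (\<integral>\<^sup>+x. indicator {0..1} s * ennreal (norm (F' (x + s *\<^sub>R v))) \<partial>lborel)"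
      by (intro nn_integral_cong) (auto simp: indicator_def)
    also have "\<dots> = indicator {0..1::real} s * (\<integral>\<^sup>+x. ennreal (norm (F' (x + s *\<^sub>R v))) \<partial>lborel)"
      by (subst nn_integral_cmult) auto
    also have "(\<integral>\<^sup>+x. ennreal (norm (F' (x + s *\<^sub>R v))) \<partial>lborel) = (\<integral>\<^sup>+x. ennreal (norm (F' x)) \<partial>lborel)"
      by (rule nn_integral_lborel_translate) measurable
    finally show "(\<integral>\<^sup>+x. ennreal (norm (?G x s)) \<partial>lborel) = indicator {0..1::real} s * (\<integral>\<^sup>+x. ennreal (norm (F' x)) \<partial>lborel)" .
  qed
  also have "\<dots> = (\<integral>\<^sup>+x. ennreal (norm (F' x)) \<partial>lborel)"
    by (subst nn_integral_multc) auto
  also have "\<dots> < \<infinity>" by (rule integrable_nn_finite[OF F'])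
  finally have fin: "(\<integral>\<^sup>+s. \<integral>\<^sup>+x. ennreal (norm (?G x s)) \<partial>lborel \<partial>lborel) < \<infinity>" .
  have "(LINT s|lborel. LINT x|lborel. ?G x s) = (LINT x|lborel. LINT s|lborel. ?G x s)"
    by (rule fubini_swap[OF _ fin]) measurable
  also have "\<dots> = (LINT x|lborel. F (x + v) - F x)" unfolding 1 ..
  also have "\<dots> = 0"
    using integrable_lborel_translate(2)[OF F, of v] F integral_lborel_translate(2)[of F v] by simp
  also have "(LINT s|lborel. LINT x|lborel. ?G x s) = (LINT s|lborel. indicator {0..1::real} s *\<^sub>R (LINT x|lborel. F' x))"
    by (simp add: integral_lborel_translate(2))
  also have "\<dots> = (LINT x|lborel. F' x)" by simp
  finally show ?thesis .
qed

subsection \<open>The Riesz kernel as a superposition of Gaussians\<close>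

text \<open>One integrable majorant for the Gaussian times any factor up to quadratic growth; it
  dominates \<open>kap\<close> as well as its directional derivatives.\<close>

definition wgauss :: "real ^ 'n::finite \<Rightarrow> real" where
  "wgauss x = (1 + (norm x)\<^sup>2) * gauss x"

lemma wgauss_nonneg [simp]: "0 \<le> wgauss x"
  by (simp add: wgauss_def)

lemma measurable_wgauss [measurable]: "wgauss \<in> borel_measurable borel"
  unfolding wgauss_def by measurable

lemma integrable_wgauss: "integrable lborel (wgauss :: real ^ 'n::finite \<Rightarrow> real)"
proof (rule Bochner_Integration.integrable_bound)
  show "integrable lborel (\<lambda>x::real ^ 'n. gauss ((1 / sqrt 2) *\<^sub>R x))"
    by (rule integrable_gauss_scaled) simp
  show "AE x in lborel. norm (wgauss (x :: real ^ 'n)) \<le> norm (gauss ((1 / sqrt 2) *\<^sub>R x))"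
  proof (intro always_eventually allI)
    fix x :: "real ^ 'n"
    \<comment> \<open>Since pi is at least 2, half of the Gaussian exponent absorbs the polynomial
      factor; the other half remains as the dilated Gaussian.\<close>
    have "1 + (norm x)\<^sup>2 \<le> exp ((norm x)\<^sup>2)" by (rule exp_ge_add_one_self)
    also have "(norm x)\<^sup>2 * 2 \<le> pi * (norm x)\<^sup>2"
      using pi_ge_two by (subst mult.commute) (intro mult_right_mono, auto)
    then have "exp ((norm x)\<^sup>2) \<le> exp (pi * (norm x)\<^sup>2 / 2)" by simp
    finally have "wgauss x \<le> exp (pi * (norm x)\<^sup>2 / 2) * gauss x"
      unfolding wgauss_def by (intro mult_right_mono) auto
    also have "\<dots> = gauss ((1 / sqrt 2) *\<^sub>R x)"
      by (simp add: gauss_def power_mult_distrib power_divide field_simps flip: exp_add)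
    finally show "norm (wgauss x) \<le> norm (gauss ((1 / sqrt 2) *\<^sub>R x))" by simp
  qed
qed simp

lemma norm_gauss_le_wgauss: "norm x * gauss x \<le> wgauss x"
  and norm2_gauss_le_wgauss: "(norm x)\<^sup>2 * gauss x \<le> wgauss x"
proof -
  have "2 * norm x \<le> 1 + (norm x)\<^sup>2"
    using zero_le_power2[of "norm x - 1"] by (simp add: power2_diff)
  then have 1: "norm x \<le> 1 + (norm x)\<^sup>2" using norm_ge_zero[of x] by linarith
  show "norm x * gauss x \<le> wgauss x"
    unfolding wgauss_def by (intro mult_right_mono 1) auto
  show "(norm x)\<^sup>2 * gauss x \<le> wgauss x"
    by (simp add: wgauss_def algebra_simps)
qed

lemma norm_gauss_le_1: "norm x * gauss x \<le> 1"
proof -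
  have "(norm x)\<^sup>2 \<le> pi * (norm x)\<^sup>2"
    using pi_ge_two by (intro mult_right_mono[of 1 pi, simplified]) auto
  have "norm x * gauss x \<le> wgauss x" by (rule norm_gauss_le_wgauss)
  also have "\<dots> \<le> exp ((norm x)\<^sup>2) * gauss x"
    unfolding wgauss_def by (intro mult_right_mono exp_ge_add_one_self) auto
  also have "\<dots> \<le> 1"
    using \<open>(norm x)\<^sup>2 \<le> pi * (norm x)\<^sup>2\<close> by (simp add: gauss_def flip: exp_add)
  finally show ?thesis .
qed

text \<open>An eigenfunction of the Fourier transform, with eigenvalue \<open>-\<i>\<close>.\<close>

definition kap :: "'n \<Rightarrow> real ^ 'n::finite \<Rightarrow> real" where
  "kap i x = x $ i * gauss x"

lemma measurable_kap [measurable]: "kap i \<in> borel_measurable borel"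
  unfolding kap_def by measurable

lemma abs_kap_le: "\<bar>kap i x\<bar> \<le> norm x * gauss x"
  unfolding kap_def by (simp add: abs_mult mult_right_mono component_le_norm_cart)

lemma integrable_kap: "integrable lborel (kap i)"
  by (rule Bochner_Integration.integrable_bound[OF integrable_wgauss])
    (auto intro!: always_eventually order_trans[OF abs_kap_le norm_gauss_le_wgauss])

lemma has_derivative_gauss_line:
  "((\<lambda>s. gauss (x + s *\<^sub>R v)) has_real_derivative (- 2 * pi * (x \<bullet> v) * gauss x)) (at 0)"
  unfolding gauss_def power2_norm_eq_inner
  by (auto intro!: derivative_eq_intros simp: inner_commute inner_add_left algebra_simps)

text \<open>The i-th partial derivative of the Gaussian times the character has integral 0. Its two
  terms are multiples of the integrand on the left and of the known transform of the
  Gaussian.\<close>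

lemma integral_kap_ec:
  "(LINT x|lborel. of_real (kap i x) * ec (- (\<xi> \<bullet> x))) = - \<i> * of_real (\<xi> $ i * gauss \<xi>)"
proof -
  let ?F = "\<lambda>x. complex_of_real (gauss x) * ec (- (\<xi> \<bullet> x))"
  let ?F' = "\<lambda>x. (- 2 * pi) * (complex_of_real (kap i x) * ec (- (\<xi> \<bullet> x))) + (- 2 * pi * \<i> * \<xi> $ i) * ?F x"
  have k: "integrable lborel (\<lambda>x. complex_of_real (kap i x) * ec (- (\<xi> \<bullet> x)))"
    by (intro integrable_mult_ec(3) integrable_of_real integrable_kap)
  have "(LINT x|lborel. ?F' x) = 0"
  proof (rule integral_partial_derivative_eq_0)
    show "integrable lborel ?F" by (rule integrable_gauss_ec)
    show "integrable lborel ?F'" using k integrable_gauss_ec[of \<xi>] by auto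
    show "continuous_on UNIV ?F'"
      unfolding kap_def gauss_def by (intro continuous_intros)
    show "((\<lambda>s. ?F (x + s *\<^sub>R axis i 1)) has_vector_derivative ?F' x) (at 0)" for x
    proof -
      have e: "((\<lambda>s. ec (- (\<xi> \<bullet> (x + s *\<^sub>R axis i 1)))) has_vector_derivative - 2 * pi * \<i> * \<xi> $ i * ec (- (\<xi> \<bullet> x))) (at 0)"
      proof -
        have "((\<lambda>s. complex_of_real (2 * pi) * \<i> * of_real (- (\<xi> \<bullet> x + s * \<xi> $ i))) has_vector_derivative
            complex_of_real (2 * pi) * \<i> * of_real (- \<xi> $ i)) (at 0)"
          by (intro has_vector_derivative_mult_right has_vector_derivative_of_real)
            (auto intro!: derivative_eq_intros)
        from field_vector_diff_chain_at[OF this DERIV_exp] show ?thesis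
          by (simp add: ec_exp o_def inner_add_right inner_axis mult_ac)
      qed
      have g: "((\<lambda>s. complex_of_real (gauss (x + s *\<^sub>R axis i 1))) has_vector_derivative of_real (- 2 * pi * (x \<bullet> axis i 1) * gauss x)) (at 0)"
        using has_derivative_gauss_line[of x "axis i 1"]
        by (intro has_vector_derivative_of_real) (simp add: has_real_derivative_iff_has_vector_derivative[symmetric])
      show ?thesis
        by (rule has_vector_derivative_eq_rhs[OF has_vector_derivative_mult[OF g e]])
          (simp add: kap_def inner_axis algebra_simps)
    qed
  qed
  moreover have "(LINT x|lborel. ?F' x) = (- 2 * pi) * (LINT x|lborel. of_real (kap i x) * ec (- (\<xi> \<bullet> x))) + (- 2 * pi * \<i> * \<xi> $ i) * gauss \<xi>"
    using k integrable_gauss_ec[of \<xi>] by (subst Bochner_Integration.integral_add) (auto simp: integral_gauss_ec)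
  ultimately have "(2 * pi) * (LINT x|lborel. of_real (kap i x) * ec (- (\<xi> \<bullet> x))) = (2 * pi) * (- \<i> * of_real (\<xi> $ i * gauss \<xi>))"
    by (simp add: algebra_simps add_eq_0_iff)
  then show ?thesis by (subst (asm) mult_cancel_left) simp
qed

text \<open>A modulus of continuity in \<open>L^1\<close>, linear in v: write the difference as the
  integral of the derivative along the segment from x to x + v and integrate over x first. It
  controls the small scales in \<open>rk_hormander\<close>.\<close>

lemma integral_kap_translate:
  fixes v :: "real ^ 'n::finite"
  shows "(\<integral>\<^sup>+x. ennreal \<bar>kap i (x + v) - kap i x\<bar> \<partial>lborel) \<le> ennreal (2 * pi * norm v * (LINT x|lborel. wgauss (x :: real ^ 'n)))"
proof -
  \<comment> \<open>The derivative of \<open>kap i\<close> in direction v.\<close>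
  define kd where "kd = (\<lambda>x. v $ i * gauss x + x $ i * (- 2 * pi * (x \<bullet> v) * gauss x))"
  have bd: "\<bar>kd x\<bar> \<le> 2 * pi * norm v * wgauss x" for x
  proof -
    have "\<bar>v $ i * gauss x\<bar> \<le> norm v * gauss x"
      by (simp add: abs_mult component_le_norm_cart mult_right_mono)
    moreover have "\<bar>x $ i * (- 2 * pi * (x \<bullet> v) * gauss x)\<bar> \<le> norm x * (2 * pi * (norm x * norm v) * gauss x)"
      unfolding abs_mult by (intro mult_mono component_le_norm_cart Cauchy_Schwarz_ineq2) (auto simp: abs_mult)
    moreover have "norm v * gauss x \<le> 2 * pi * (norm v * gauss x)"
      using pi_ge_two by (intro mult_right_mono[of 1 "2 * pi", simplified]) auto
    ultimately show ?thesis
      by (simp add: kd_def wgauss_def algebra_simps power2_eq_square)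
  qed
  have der: "((\<lambda>s. kap i (x + s *\<^sub>R v)) has_real_derivative kd (x + s *\<^sub>R v)) (at s)" for x s
  proof -
    have "((\<lambda>r. kap i ((x + s *\<^sub>R v) + r *\<^sub>R v)) has_real_derivative kd (x + s *\<^sub>R v)) (at (s - s))"
      unfolding kap_def kd_def by (auto intro!: derivative_eq_intros has_derivative_gauss_line)
    moreover have "((\<lambda>r. r - s) has_real_derivative 1) (at s)"
      by (auto intro!: derivative_eq_intros)
    ultimately have "((\<lambda>r. kap i ((x + s *\<^sub>R v) + r *\<^sub>R v)) \<circ> (\<lambda>r. r - s) has_real_derivative kd (x + s *\<^sub>R v) * 1) (at s)"
      by (intro DERIV_chain) auto
    then show ?thesis by (simp add: o_def scaleR_diff_left)
  qed
  have 1: "ennreal \<bar>kap i (x + v) - kap i x\<bar> \<le> (\<integral>\<^sup>+s. indicator {0..1::real} s * ennreal (2 * pi * norm v * wgauss (x + s *\<^sub>R v)) \<partial>lborel)" for x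
  proof -
    have c: "continuous_on {0..1} (\<lambda>s. kd (x + s *\<^sub>R v))"
      unfolding kd_def gauss_def by (intro continuous_intros)
    have "(LINT s|lborel. indicator {0..1} s *\<^sub>R kd (x + s *\<^sub>R v)) = kap i (x + 1 *\<^sub>R v) - kap i (x + 0 *\<^sub>R v)"
      by (intro integral_FTC_Icc c) (use der[of x] in \<open>auto intro: has_vector_derivative_at_within simp: has_real_derivative_iff_has_vector_derivative\<close>)
    then have "ennreal \<bar>kap i (x + v) - kap i x\<bar> = ennreal (norm (LINT s|lborel. indicator {0..1} s *\<^sub>R kd (x + s *\<^sub>R v)))"
      by simp
    also have "\<dots> \<le> (\<integral>\<^sup>+s. ennreal (norm (indicator {0..1} s *\<^sub>R kd (x + s *\<^sub>R v))) \<partial>lborel)"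
      by (rule integral_norm_bound_ennreal) (use borel_integrable_compact[OF compact_Icc c] in \<open>simp add: mult.commute\<close>)
    also have "\<dots> \<le> (\<integral>\<^sup>+s. indicator {0..1::real} s * ennreal (2 * pi * norm v * wgauss (x + s *\<^sub>R v)) \<partial>lborel)"
      by (intro nn_integral_mono) (auto simp: indicator_def intro!: ennreal_leI bd)
    finally show ?thesis .
  qed
  have "(\<integral>\<^sup>+x. ennreal \<bar>kap i (x + v) - kap i x\<bar> \<partial>lborel) \<le> (\<integral>\<^sup>+x. \<integral>\<^sup>+s. indicator {0..1::real} s * ennreal (2 * pi * norm v * wgauss (x + s *\<^sub>R v)) \<partial>lborel \<partial>lborel)"
    by (intro nn_integral_mono 1)
  also have "\<dots> = (\<integral>\<^sup>+s. \<integral>\<^sup>+x. indicator {0..1::real} s * ennreal (2 * pi * norm v * wgauss (x + s *\<^sub>R v)) \<partial>lborel \<partial>lborel)"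
    by (rule lborel_pair.Fubini'[symmetric]) measurable
  also have "\<dots> = (\<integral>\<^sup>+s. indicator {0..1::real} s * (\<integral>\<^sup>+x. ennreal (2 * pi * norm v * wgauss (x :: real ^ 'n)) \<partial>lborel) \<partial>lborel)"
    using nn_integral_lborel_translate(2)[of "\<lambda>x::real ^ 'n. ennreal (2 * pi * norm v * wgauss x)"]
    by (simp add: nn_integral_cmult)
  also have "\<dots> = (\<integral>\<^sup>+x. ennreal (2 * pi * norm v * wgauss (x :: real ^ 'n)) \<partial>lborel)"
    by (subst nn_integral_multc) auto
  also have "\<dots> = ennreal (2 * pi * norm v * (LINT x|lborel. wgauss (x :: real ^ 'n)))"
    by (subst nn_integral_eq_integral) (auto intro!: integrable_mult_right integrable_wgauss)
  finally show ?thesis .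
qed

lemma measurable_vec_nth [measurable (raw)]:
  "f \<in> borel_measurable M \<Longrightarrow> (\<lambda>x. f x $ i) \<in> borel_measurable M" for f :: "_ \<Rightarrow> real ^ 'n::finite"
  by (erule measurable_compose) (intro borel_measurable_continuous_onI continuous_intros)

lemma integrable_indicator_Icc: "integrable lborel (indicator {a..b::real} :: real \<Rightarrow> real)"
  by (rule integrable_real_indicator) (auto simp: emeasure_lborel_Icc_eq)

text \<open>Since \<open>\<integral>\<^sub>0\<^sup>\<infinity> 2 s\<^sup>d exp (- \<pi> s\<^sup>2 r\<^sup>2) ds\<close> is a constant times \<open>r powr - (d + 1)\<close>, this is a
  multiple of the Riesz kernel in the limit \<open>a = 0\<close>, \<open>T = \<infinity>\<close>.\<close>

definition rk :: "'n \<Rightarrow> real \<Rightarrow> real \<Rightarrow> real ^ 'n::finite \<Rightarrow> real" where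
  "rk i a T y = (LINT s|lborel. indicator {a..T} s * (2 * s ^ CARD('n) * (y $ i * gauss (s *\<^sub>R y))))"

lemma measurable_rk [measurable]: "rk i a T \<in> borel_measurable borel"
  unfolding rk_def by measurable

lemma rk_integrand_bound:
  fixes y :: "real ^ 'n::finite"
  assumes "0 \<le> s" "s \<le> T"
  shows "\<bar>2 * s ^ CARD('n) * (y $ i * gauss (s *\<^sub>R y))\<bar> \<le> 2 * T ^ (CARD('n) - 1)"
proof -
  obtain m where m: "CARD('n) = Suc m" using zero_less_card_finite[where 'a = 'n] gr0_implies_Suc by blast
  \<comment> \<open>One power of s is spent on turning the remaining factor into a value of
    \<open>kap\<close>, which is at most 1; with d the dimension, d - 1 powers remain.\<close>
  have "\<bar>2 * s ^ CARD('n) * (y $ i * gauss (s *\<^sub>R y))\<bar> = 2 * s ^ m * \<bar>kap i (s *\<^sub>R y)\<bar>"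
    using assms by (simp add: m kap_def abs_mult)
  also have "\<dots> \<le> 2 * T ^ m * 1"
    by (intro mult_mono power_mono order_trans[OF abs_kap_le norm_gauss_le_1]) (use assms in auto)
  finally show ?thesis by (simp add: m)
qed

lemma rk_integrand_integrable:
  "integrable lborel (\<lambda>s. indicator {a..T} s * (2 * s ^ CARD('n) * (y $ i * gauss (s *\<^sub>R (y :: real ^ 'n::finite)))))"
proof -
  have "continuous_on {a..T} (\<lambda>s. 2 * s ^ CARD('n) * (y $ i * gauss (s *\<^sub>R y)))"
    unfolding gauss_def by (intro continuous_intros)
  from borel_integrable_compact[OF compact_Icc this] show ?thesis by (simp add: mult.commute)
qed

lemma abs_rk_le:
  fixes y :: "real ^ 'n::finite"
  assumes "0 \<le> a" "a \<le> T"
  shows "\<bar>rk i a T y\<bar> \<le> 2 * T ^ CARD('n)"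
proof -
  obtain m where m: "CARD('n) = Suc m" using zero_less_card_finite[where 'a = 'n] gr0_implies_Suc by blast
  have "\<bar>rk i a T y\<bar> \<le> (LINT s|lborel. \<bar>indicator {a..T} s * (2 * s ^ CARD('n) * (y $ i * gauss (s *\<^sub>R y)))\<bar>)"
    unfolding rk_def by (rule integral_abs_bound)
  also have "\<dots> \<le> (LINT s|lborel. indicator {a..T} s * (2 * T ^ (CARD('n) - 1)))"
  proof (rule integral_mono)
    show "integrable lborel (\<lambda>s. \<bar>indicator {a..T} s * (2 * s ^ CARD('n) * (y $ i * gauss (s *\<^sub>R y)))\<bar>)"
      by (intro integrable_abs rk_integrand_integrable)
    show "\<bar>indicator {a..T} s * (2 * s ^ CARD('n) * (y $ i * gauss (s *\<^sub>R y)))\<bar> \<le> indicator {a..T} s * (2 * T ^ (CARD('n) - 1))" for s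
      using rk_integrand_bound[of s T y i] assms by (cases "s \<in> {a..T}") auto
  qed (intro integrable_mult_left integrable_indicator_Icc)
  also have "\<dots> = (T - a) * (2 * T ^ m)" using assms by (simp add: m)
  also have "\<dots> \<le> T * (2 * T ^ m)" using assms by (intro mult_right_mono) auto
  finally show ?thesis by (simp add: m)
qed

lemma continuous_rk:
  assumes "0 \<le> a"
  shows "continuous_on UNIV (rk i a T :: real ^ 'n::finite \<Rightarrow> real)"
proof -
  have "(\<lambda>n. rk i a T (u n)) \<longlonglongrightarrow> rk i a T y" if "u \<longlonglongrightarrow> y" for u and y :: "real ^ 'n"
    unfolding rk_def
  proof (rule integral_dominated_convergence[where w = "\<lambda>s. indicator {a..T} s * (2 * T ^ (CARD('n) - 1))"])
    show "AE s in lborel. (\<lambda>n. indicator {a..T} s * (2 * s ^ CARD('n) * (u n $ i * gauss (s *\<^sub>R u n))))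
       \<longlonglongrightarrow> indicator {a..T} s * (2 * s ^ CARD('n) * (y $ i * gauss (s *\<^sub>R y)))"
      unfolding gauss_def by (intro always_eventually allI tendsto_intros that)
    show "AE s in lborel. norm (indicator {a..T} s * (2 * s ^ CARD('n) * (u n $ i * gauss (s *\<^sub>R u n)))) \<le> indicator {a..T} s * (2 * T ^ (CARD('n) - 1))" for n
    proof (intro always_eventually allI)
      show "norm (indicator {a..T} s * (2 * s ^ CARD('n) * (u n $ i * gauss (s *\<^sub>R u n)))) \<le> indicator {a..T} s * (2 * T ^ (CARD('n) - 1))" for s
        using rk_integrand_bound[of s T "u n" i] assms by (cases "s \<in> {a..T}") auto
    qed
    show "integrable lborel (\<lambda>s. indicator {a..T} s * (2 * T ^ (CARD('n) - 1)))" by (intro integrable_mult_left integrable_indicator_Icc)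
  qed measurable
  then show ?thesis by (auto simp: continuous_on_sequentially o_def)
qed

lemma kap_scaled: "s > 0 \<Longrightarrow> x $ i * gauss (s *\<^sub>R x) = kap i (s *\<^sub>R x) / s"
  by (simp add: kap_def)

lemma nn_integral_kap_scaled:
  assumes "s > 0"
  shows "(\<integral>\<^sup>+y. ennreal \<bar>y $ i * gauss (s *\<^sub>R y)\<bar> \<partial>lborel) =
    ennreal (1 / s ^ (CARD('n) + 1) * (LINT y|lborel. \<bar>kap i (y :: real ^ 'n::finite)\<bar>))"
proof -
  have "(\<integral>\<^sup>+y. ennreal \<bar>y $ i * gauss (s *\<^sub>R y)\<bar> \<partial>lborel) = (\<integral>\<^sup>+y. ennreal (\<bar>kap i (0 + s *\<^sub>R y)\<bar> / s) \<partial>lborel)"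
    using assms by (simp add: kap_scaled)
  also have "\<dots> = ennreal (1 / \<bar>s\<bar> ^ CARD('n)) * (\<integral>\<^sup>+y. ennreal (\<bar>kap i (y :: real ^ 'n)\<bar> / s) \<partial>lborel)"
    using assms by (subst nn_integral_lborel_affine[of "\<lambda>y. ennreal (\<bar>kap i y\<bar> / s)"]) auto
  also have "(\<integral>\<^sup>+y. ennreal (\<bar>kap i (y :: real ^ 'n)\<bar> / s) \<partial>lborel) = ennreal (LINT y|lborel. \<bar>kap i (y :: real ^ 'n)\<bar> / s)"
    using assms integrable_kap[of i] by (intro nn_integral_eq_integral) auto
  finally show ?thesis using assms by (simp add: field_simps flip: ennreal_mult)
qed

text \<open>The integral over space at scale s is a multiple of 1/s, so the positive lower limit a
  is what makes the double integral finite.\<close>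

lemma rk_fubini_finite:
  assumes "0 < a"
  shows "(\<integral>\<^sup>+s. \<integral>\<^sup>+y. ennreal \<bar>indicator {a..T} s * (2 * s ^ CARD('n) * (y $ i * gauss (s *\<^sub>R (y :: real ^ 'n::finite))))\<bar> \<partial>lborel \<partial>lborel) < \<infinity>"
proof -
  define K where "K = (LINT y|lborel. \<bar>kap i (y :: real ^ 'n)\<bar>)"
  have K: "K \<ge> 0" unfolding K_def by simp
  have "(\<integral>\<^sup>+y. ennreal \<bar>indicator {a..T} s * (2 * s ^ CARD('n) * (y $ i * gauss (s *\<^sub>R (y :: real ^ 'n))))\<bar> \<partial>lborel) \<le> ennreal (2 / a * K) * indicator {a..T} s" for s
  proof (cases "s \<in> {a..T}")
    case True
    then have s: "s > 0" using assms by auto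
    have "(\<integral>\<^sup>+y. ennreal \<bar>indicator {a..T} s * (2 * s ^ CARD('n) * (y $ i * gauss (s *\<^sub>R (y :: real ^ 'n))))\<bar> \<partial>lborel) =
      (\<integral>\<^sup>+y. ennreal (2 * s ^ CARD('n)) * ennreal \<bar>y $ i * gauss (s *\<^sub>R (y :: real ^ 'n))\<bar> \<partial>lborel)"
      using True s by (intro nn_integral_cong) (simp add: abs_mult flip: ennreal_mult)
    also have "\<dots> = ennreal (2 * s ^ CARD('n)) * ennreal (1 / s ^ (CARD('n) + 1) * K)"
      by (subst nn_integral_cmult) (auto simp: nn_integral_kap_scaled[OF s] K_def)
    also have "\<dots> = ennreal (2 / s * K)"
      using s K by (simp add: field_simps flip: ennreal_mult)
    also have "\<dots> \<le> ennreal (2 / a * K)"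
      using True assms K by (intro ennreal_leI mult_right_mono divide_left_mono) auto
    finally show ?thesis using True by simp
  qed auto
  then have "(\<integral>\<^sup>+s. \<integral>\<^sup>+y. ennreal \<bar>indicator {a..T} s * (2 * s ^ CARD('n) * (y $ i * gauss (s *\<^sub>R (y :: real ^ 'n))))\<bar> \<partial>lborel \<partial>lborel) \<le>
     (\<integral>\<^sup>+s. ennreal (2 / a * K) * indicator {a..T} s \<partial>lborel)"
    by (rule nn_integral_mono)
  also have "\<dots> < \<infinity>"
    by (subst nn_integral_cmult) (auto simp: ennreal_mult_less_top emeasure_lborel_Icc_eq)
  finally show ?thesis .
qed

lemma integrable_rk:
  assumes "0 < a"
  shows "integrable lborel (rk i a T :: real ^ 'n::finite \<Rightarrow> real)"
  using fubini_integrable_snd[of "\<lambda>s y. indicator {a..T} s * (2 * s ^ CARD('n) * (y $ i * gauss (s *\<^sub>R y)))"]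
    rk_fubini_finite[OF assms, of T i] unfolding rk_def by simp

text \<open>Each scale contributes \<open>kap i (s *\<^sub>R x)\<close>, whose transform is known
  since \<open>kap i\<close> is an eigenfunction. With d the dimension, the prefactor gives 2
  s^(d-1), the dilation s^(-d), and the component of the rescaled frequency 1/s, in total
  2/s^2.\<close>

lemma ft_rk:
  fixes \<xi> :: "real ^ 'n::finite"
  assumes a: "0 < a"
  shows "ft (\<lambda>x. of_real (rk i a T x)) \<xi> =
    - \<i> * of_real (\<xi> $ i * (LINT s|lborel. indicator {a..T} s * (2 / s\<^sup>2 * gauss ((1 / s) *\<^sub>R \<xi>))))"
proof -
  let ?f = "\<lambda>s y. complex_of_real (indicator {a..T} s * (2 * s ^ CARD('n) * (y $ i * gauss (s *\<^sub>R y)))) * ec (- (\<xi> \<bullet> y))"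
  have "(\<integral>\<^sup>+s. \<integral>\<^sup>+y. ennreal (norm (?f s y)) \<partial>lborel \<partial>lborel) < \<infinity>"
    using rk_fubini_finite[OF a, of T i] by (simp only: norm_mult norm_of_real norm_ec mult_1_right)
  from fubini_swap[OF _ this] have "(LINT s|lborel. LINT y|lborel. ?f s y) = (LINT y|lborel. LINT s|lborel. ?f s y)"
    by simp
  also have "\<dots> = ft (\<lambda>x. of_real (rk i a T x)) \<xi>"
    unfolding ft_def rk_def by (simp only: integral_mult_left_zero integral_complex_of_real)
  finally have 1: "ft (\<lambda>x. of_real (rk i a T x)) \<xi> = (LINT s|lborel. LINT y|lborel. ?f s y)" by simp
  have 2: "(LINT y|lborel. ?f s y) = - \<i> * of_real (\<xi> $ i * (indicator {a..T} s * (2 / s\<^sup>2 * gauss ((1 / s) *\<^sub>R \<xi>))))" for s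
  proof (cases "s \<in> {a..T}")
    case True
    then have s: "s > 0" using a by auto
    have m: "(\<lambda>y. complex_of_real (kap i y) * ec (- (((1 / s) *\<^sub>R \<xi>) \<bullet> y))) \<in> borel_measurable borel" by measurable
    have "(LINT y|lborel. ?f s y) = (LINT y|lborel. of_real (2 * s ^ CARD('n) / s) * (complex_of_real (kap i (0 + s *\<^sub>R y)) * ec (- (((1 / s) *\<^sub>R \<xi>) \<bullet> (0 + s *\<^sub>R y)))))"
      by (rule Bochner_Integration.integral_cong) (use True s in \<open>simp_all add: kap_scaled\<close>)
    also have "\<dots> = of_real (2 * s ^ CARD('n) / s) * (1 / s ^ CARD('n)) *\<^sub>R (- \<i> * of_real (((1 / s) *\<^sub>R \<xi>) $ i * gauss ((1 / s) *\<^sub>R \<xi>)))"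
      unfolding integral_mult_right_zero using integral_lborel_affine[OF m, of s 0] s integral_kap_ec[of i "(1 / s) *\<^sub>R \<xi>"] by simp
    also have "\<dots> = - \<i> * of_real (\<xi> $ i * (indicator {a..T} s * (2 / s\<^sup>2 * gauss ((1 / s) *\<^sub>R \<xi>))))"
      using True s by (simp add: scaleR_conv_of_real[where 'a = complex] power2_eq_square field_simps)
    finally show ?thesis .
  qed auto
  show ?thesis unfolding 1 2 by (simp only: integral_mult_right_zero integral_complex_of_real)
qed

text \<open>The substitution u = r/s brings the scale integral in \<open>ft_rk\<close> into this
  form. Its limit 1/2 at infinity cancels the factor 2 in front, so the multipliers are bounded by 1
  and converge to the exact symbol.\<close>

definition gauss_cdf :: "real \<Rightarrow> real" where
  "gauss_cdf x = (LINT u|lborel. indicator {0..x} u * exp (- pi * u\<^sup>2))"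

lemma has_integral_gauss_half:
  "has_bochner_integral lborel (\<lambda>u. indicator {0..} u * exp (- pi * u\<^sup>2)) (1 / 2 :: real)"
proof -
  have "has_bochner_integral lborel (\<lambda>x. indicator {0..} (0 + sqrt pi * x) *\<^sub>R exp (- (0 + sqrt pi * x)\<^sup>2)) ((sqrt pi / 2) /\<^sub>R \<bar>sqrt pi\<bar>)"
    using gaussian_moment_0 by (subst lborel_has_bochner_integral_real_affine_iff[symmetric]) auto
  moreover have "indicator {0..} (0 + sqrt pi * x) *\<^sub>R exp (- (0 + sqrt pi * x)\<^sup>2) = indicator {0..} x * exp (- pi * x\<^sup>2)" for x
    by (simp add: power_mult_distrib indicator_def zero_le_mult_iff pi_gt_zero[unfolded not_le[symmetric]])
  ultimately show ?thesis by (simp add: field_simps)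
qed

lemmas integral_gauss_half = has_bochner_integral_integral_eq[OF has_integral_gauss_half]

lemma integrable_gauss_cdf: "integrable lborel (\<lambda>u. indicator {0..x} u * exp (- pi * u\<^sup>2))" for x :: real
  by (rule Bochner_Integration.integrable_bound[OF integrable.intros[OF has_integral_gauss_half]])
    (auto simp: indicator_def)

lemma gauss_cdf_nonneg: "0 \<le> gauss_cdf x"
  unfolding gauss_cdf_def by simp

lemma gauss_cdf_le_half: "gauss_cdf x \<le> 1 / 2"
proof -
  have "gauss_cdf x \<le> (LINT u|lborel. indicator {0..} u * exp (- pi * u\<^sup>2))"
    unfolding gauss_cdf_def
    using has_integral_gauss_half integrable_gauss_cdf
    by (intro integral_mono) (auto simp: indicator_def has_bochner_integral_iff)
  then show ?thesis unfolding integral_gauss_half .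
qed

lemma gauss_cdf_le: "0 \<le> x \<Longrightarrow> gauss_cdf x \<le> x"
proof -
  assume x: "0 \<le> x"
  have "gauss_cdf x \<le> (LINT u|lborel. indicator {0..x} u)"
    unfolding gauss_cdf_def
    by (intro integral_mono integrable_gauss_cdf integrable_indicator_Icc) (auto simp: indicator_def)
  then show ?thesis using x by simp
qed

lemma gauss_cdf_at_top:
  assumes "filterlim u at_top sequentially"
  shows "(\<lambda>n. gauss_cdf (u n)) \<longlonglongrightarrow> 1 / 2"
proof -
  have "(\<lambda>n. gauss_cdf (u n)) \<longlonglongrightarrow> (LINT u|lborel. indicator {0..} u * exp (- pi * u\<^sup>2))"
    unfolding gauss_cdf_def
  proof (rule integral_dominated_convergence[where w = "\<lambda>u. indicator {0..} u * exp (- pi * u\<^sup>2)"])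
    show "AE x in lborel. (\<lambda>n. indicator {0..u n} x * exp (- pi * x\<^sup>2)) \<longlonglongrightarrow> indicator {0..} x * exp (- pi * x\<^sup>2)"
    proof (intro always_eventually allI tendsto_mult tendsto_const)
      fix x :: real
      have "eventually (\<lambda>n. x \<le> u n) sequentially" using assms by (simp add: filterlim_at_top)
      then have "eventually (\<lambda>n. indicator {0..u n} x = (indicator {0..} x :: real)) sequentially"
        by eventually_elim (auto simp: indicator_def)
      then show "(\<lambda>n. indicator {0..u n} x) \<longlonglongrightarrow> (indicator {0..} x :: real)"
        by (rule tendsto_eventually)
    qed
  qed (use has_integral_gauss_half in \<open>auto simp: indicator_def has_bochner_integral_iff\<close>)
  then show ?thesis unfolding integral_gauss_half .
qed

lemma has_derivative_gauss_cdf: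
  assumes "0 < x"
  shows "(gauss_cdf has_real_derivative exp (- pi * x\<^sup>2)) (at x)"
proof -
  have "((\<lambda>y. integral {0..y} (\<lambda>u. exp (- pi * u\<^sup>2))) has_real_derivative exp (- pi * x\<^sup>2)) (at x within {0..x + 1})"
    using assms by (intro integral_has_real_derivative continuous_intros) auto
  then have "((\<lambda>y. integral {0..y} (\<lambda>u. exp (- pi * u\<^sup>2))) has_real_derivative exp (- pi * x\<^sup>2)) (at x)"
    using assms by (simp add: at_within_Icc_at)
  moreover have "gauss_cdf = (\<lambda>y. integral {0..y} (\<lambda>u. exp (- pi * u\<^sup>2)))"
  proof
    show "gauss_cdf y = integral {0..y} (\<lambda>u. exp (- pi * u\<^sup>2))" for y
      unfolding gauss_cdf_def
      using set_borel_integral_eq_integral(2)[of "{0..y}" "\<lambda>u. exp (- pi * u\<^sup>2)"] integrable_gauss_cdf[of y]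
      by (simp add: set_lebesgue_integral_def set_integrable_def)
  qed
  ultimately show ?thesis by (simp only:)
qed

text \<open>An antiderivative in s is \<open>- 2 / r * gauss_cdf (r / s)\<close>, by the chain
  rule.\<close>

lemma riesz_multiplier_integral:
  assumes a: "0 < a" "a \<le> T" and r: "r > 0"
  shows "(LINT s|lborel. indicator {a..T} s * (2 / s\<^sup>2 * exp (- pi * (r / s)\<^sup>2))) = 2 / r * (gauss_cdf (r / a) - gauss_cdf (r / T))"
proof -
  have "(LINT s|lborel. indicator {a..T} s *\<^sub>R (2 / s\<^sup>2 * exp (- pi * (r / s)\<^sup>2))) =
    - 2 / r * gauss_cdf (r / T) - - 2 / r * gauss_cdf (r / a)"
  proof (rule integral_FTC_Icc)
    show "((\<lambda>s. - 2 / r * gauss_cdf (r / s)) has_vector_derivative 2 / s\<^sup>2 * exp (- pi * (r / s)\<^sup>2)) (at s within {a..T})"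
      if "a \<le> s" "s \<le> T" for s
    proof -
      have s: "s > 0" using a that by auto
      have "((\<lambda>s. r / s) has_real_derivative (- r / s\<^sup>2)) (at s)"
        using s by (auto intro!: derivative_eq_intros simp: power2_eq_square)
      then have "((\<lambda>s. gauss_cdf (r / s)) has_real_derivative (exp (- pi * (r / s)\<^sup>2) * (- r / s\<^sup>2))) (at s)"
        using s r by (intro DERIV_chain'[where g = gauss_cdf] has_derivative_gauss_cdf) auto
      then have "((\<lambda>s. - 2 / r * gauss_cdf (r / s)) has_real_derivative - 2 / r * (exp (- pi * (r / s)\<^sup>2) * (- r / s\<^sup>2))) (at s)"
        by (rule DERIV_cmult)
      moreover have "- 2 / r * (exp (- pi * (r / s)\<^sup>2) * (- r / s\<^sup>2)) = 2 / s\<^sup>2 * exp (- pi * (r / s)\<^sup>2)"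
        using r s by (simp add: field_simps)
      ultimately show ?thesis
        unfolding has_real_derivative_iff_has_vector_derivative by (metis has_vector_derivative_at_within)
    qed
    show "continuous_on {a..T} (\<lambda>s. 2 / s\<^sup>2 * exp (- pi * (r / s)\<^sup>2))"
      using a by (intro continuous_intros) auto
  qed (use a in auto)
  then show ?thesis using r by (simp add: field_simps)
qed

lemma gauss_inverse_scaled: "gauss ((1 / s) *\<^sub>R \<xi>) = exp (- pi * (norm \<xi> / s)\<^sup>2)"
  by (simp add: gauss_def power_divide)

text \<open>Both values of \<open>gauss_cdf\<close> lie between 0 and 1/2, so their difference
  cancels the 2, and the remaining quotient is a component divided by the norm.\<close>

lemma norm_ft_rk_le_1:
  assumes a: "0 < a" "a \<le> T"
  shows "norm (ft (\<lambda>x. of_real (rk i a T x)) (\<xi> :: real ^ 'n::finite)) \<le> 1"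
proof (cases "\<xi> = 0")
  case False
  then have r: "norm \<xi> > 0" by simp
  have "norm (ft (\<lambda>x. of_real (rk i a T x)) \<xi>) = \<bar>\<xi> $ i\<bar> * \<bar>2 / norm \<xi> * (gauss_cdf (norm \<xi> / a) - gauss_cdf (norm \<xi> / T))\<bar>"
    unfolding ft_rk[OF a(1)] gauss_inverse_scaled riesz_multiplier_integral[OF a r] norm_mult norm_of_real abs_mult by simp
  also have "\<dots> \<le> norm \<xi> * (2 / norm \<xi> * (1 / 2))"
    unfolding abs_mult using gauss_cdf_le_half[of "norm \<xi> / a"] gauss_cdf_le_half[of "norm \<xi> / T"]
      gauss_cdf_nonneg[of "norm \<xi> / a"] gauss_cdf_nonneg[of "norm \<xi> / T"]
    by (intro mult_mono component_le_norm_cart) (auto simp: abs_if)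
  finally show ?thesis using r by simp
qed (simp add: ft_rk[OF a(1)])

abbreviation rkn :: "'n \<Rightarrow> nat \<Rightarrow> real ^ 'n::finite \<Rightarrow> real" where
  "rkn i n \<equiv> rk i (1 / real (Suc n)) (real (Suc n))"

lemma ft_rkn_tendsto:
  "(\<lambda>n. ft (\<lambda>x. of_real (rkn i n x)) \<xi>) \<longlonglongrightarrow> - \<i> * of_real (\<xi> $ i / norm (\<xi> :: real ^ 'n::finite))"
proof (cases "\<xi> = 0")
  case False
  then have r: "norm \<xi> > 0" by simp
  have a: "0 < 1 / real (Suc n)" "1 / real (Suc n) \<le> real (Suc n)" for n
    by (auto simp: field_simps)
  have 1: "(\<lambda>n. gauss_cdf (norm \<xi> / (1 / real (Suc n)))) \<longlonglongrightarrow> 1 / 2"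
    using r by (intro gauss_cdf_at_top) real_asymp
  have 0: "(\<lambda>n. norm \<xi> / real (Suc n)) \<longlonglongrightarrow> 0" by real_asymp
  have 2: "(\<lambda>n. gauss_cdf (norm \<xi> / real (Suc n))) \<longlonglongrightarrow> 0"
    by (rule tendsto_sandwich[OF _ _ tendsto_const 0])
      (auto intro!: always_eventually gauss_cdf_nonneg gauss_cdf_le)
  have "(\<lambda>n. - \<i> * of_real (\<xi> $ i * (2 / norm \<xi> * (gauss_cdf (norm \<xi> / (1 / real (Suc n))) - gauss_cdf (norm \<xi> / real (Suc n))))))
     \<longlonglongrightarrow> - \<i> * of_real (\<xi> $ i * (2 / norm \<xi> * (1 / 2 - 0)))"
    by (intro tendsto_intros 1 2)
  moreover have "ft (\<lambda>x. of_real (rkn i n x)) \<xi> = - \<i> * of_real (\<xi> $ i * (2 / norm \<xi> * (gauss_cdf (norm \<xi> / (1 / real (Suc n))) - gauss_cdf (norm \<xi> / real (Suc n)))))" for n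
    unfolding ft_rk[OF a(1)] gauss_inverse_scaled riesz_multiplier_integral[OF a r] ..
  ultimately show ?thesis by simp
\<comment> \<open>At the zero frequency both sides vanish, the right one because division by zero
  yields zero.\<close>
qed (simp add: ft_rk)

subsection \<open>The Hoermander condition\<close>

lemma integrable_inverse_1_plus_square_UNIV: "integrable lborel (\<lambda>u::real. 1 / (1 + u\<^sup>2))"
  using integrable_inverse_1_plus_square by (simp add: set_integrable_def inverse_eq_divide)

text \<open>The difference at one scale s is estimated in two ways: by smoothness when r s is at
  most 1, by decay when r s exceeds 1. Both give a multiple of r / (1 + (r s)^2), whose integral
  over s does not depend on r, so the constant is uniform in r, a and T.\<close>

lemma rk_hormander:
  fixes i :: "'n::finite"
  defines "C \<equiv> 8 * pi * (LINT x|lborel. wgauss (x :: real ^ 'n)) * (LINT u|lborel. 1 / (1 + u\<^sup>2))"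
  assumes a: "0 < a" and v: "norm v \<le> r" and r: "0 < r"
  shows "(\<integral>\<^sup>+x. indicator {x. 2 * r < norm x} x * ennreal \<bar>rk i a T (x + v) - rk i a T x\<bar> \<partial>lborel) \<le> ennreal C"
proof -
  define W where "W = (LINT x|lborel. wgauss (x :: real ^ 'n))"
  have W: "W \<ge> 0" unfolding W_def by simp
  define D where "D s x = (x + v) $ i * gauss (s *\<^sub>R (x + v)) - x $ i * gauss (s *\<^sub>R x)" for s x
  have D_m [measurable]: "(\<lambda>(s, x). D s x) \<in> borel_measurable (borel \<Otimes>\<^sub>M borel)"
    unfolding D_def by measurable
  let ?A = "{x :: real ^ 'n. 2 * r < norm x}"
  \<comment> \<open>Smoothness: the \<open>L^1\<close> modulus of continuity of \<open>kap\<close>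
    at the translation s v.\<close>
  have J1: "(\<integral>\<^sup>+x. ennreal \<bar>D s x\<bar> \<partial>lborel) \<le> ennreal (2 * pi * r * W / s ^ CARD('n))" if s: "s > 0" for s
  proof -
    have "(\<integral>\<^sup>+x. ennreal \<bar>D s x\<bar> \<partial>lborel) = (\<integral>\<^sup>+x. ennreal (1 / s) * ennreal \<bar>kap i ((0 + s *\<^sub>R x) + s *\<^sub>R v) - kap i (0 + s *\<^sub>R x)\<bar> \<partial>lborel)"
      unfolding D_def using s
      by (intro nn_integral_cong) (simp add: kap_scaled scaleR_add_right[symmetric] diff_divide_distrib[symmetric] flip: ennreal_mult' del: vector_add_component scaleR_add_right)
    also have "\<dots> = ennreal (1 / s) * (ennreal (1 / \<bar>s\<bar> ^ CARD('n)) * (\<integral>\<^sup>+x. ennreal \<bar>kap i (x + s *\<^sub>R v) - kap i x\<bar> \<partial>lborel))"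
      using s by (subst nn_integral_cmult) (auto simp: nn_integral_lborel_affine[of "\<lambda>x. ennreal \<bar>kap i (x + s *\<^sub>R v) - kap i x\<bar>" s 0, simplified])
    also have "\<dots> \<le> ennreal (1 / s) * (ennreal (1 / \<bar>s\<bar> ^ CARD('n)) * ennreal (2 * pi * (s * r) * W))"
    proof (intro mult_left_mono order_trans[OF integral_kap_translate] ennreal_leI)
      show "2 * pi * norm (s *\<^sub>R v) * (LINT x|lborel. wgauss (x :: real ^ 'n)) \<le> 2 * pi * (s * r) * W"
        unfolding W_def[symmetric] using s v W by (intro mult_right_mono mult_left_mono) auto
    qed auto
    also have "\<dots> = ennreal (2 * pi * r * W / s ^ CARD('n))"
      using s W r by (simp add: field_simps flip: ennreal_mult)
    finally show ?thesis .
  qed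
  have sc: "(\<integral>\<^sup>+x. ennreal (wgauss (s *\<^sub>R (x :: real ^ 'n))) \<partial>lborel) = ennreal (W / s ^ CARD('n))" if "s > 0" for s
    using that W nn_integral_lborel_affine[of "\<lambda>x::real ^ 'n. ennreal (wgauss x)" s 0]
      nn_integral_eq_integral[OF integrable_wgauss[where 'n = 'n]]
    by (simp add: W_def flip: ennreal_mult)
  \<comment> \<open>Decay: outside the ball of radius 2r both x and x + v have norm at least r, so a
    factor r s can be traded for the norm of the argument of \<open>kap\<close> and the quadratic
    weight in \<open>wgauss\<close> pays for it.\<close>
  have J2: "(\<integral>\<^sup>+x. indicator ?A x * ennreal \<bar>D s x\<bar> \<partial>lborel) \<le> ennreal (2 * W / (s\<^sup>2 * r) / s ^ CARD('n))" if s: "s > 0" for s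
  proof -
    have g: "\<bar>x $ i * gauss (s *\<^sub>R x)\<bar> \<le> 1 / (s\<^sup>2 * r) * wgauss (s *\<^sub>R x)" if "r \<le> norm x" for x :: "real ^ 'n"
    proof -
      have "r * s * \<bar>kap i (s *\<^sub>R x)\<bar> \<le> norm (s *\<^sub>R x) * \<bar>kap i (s *\<^sub>R x)\<bar>"
        using that s by (intro mult_right_mono) auto
      also have "\<dots> \<le> norm (s *\<^sub>R x) * (norm (s *\<^sub>R x) * gauss (s *\<^sub>R x))"
        by (intro mult_left_mono abs_kap_le) auto
      also have "\<dots> \<le> wgauss (s *\<^sub>R x)"
        using norm2_gauss_le_wgauss[of "s *\<^sub>R x"] by (simp add: power2_eq_square mult_ac)
      finally show ?thesis using s r by (simp add: kap_scaled abs_div field_simps power2_eq_square)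
    qed
    have "indicator ?A x * ennreal \<bar>D s x\<bar> \<le> ennreal (1 / (s\<^sup>2 * r)) * (ennreal (wgauss (s *\<^sub>R (x + v))) + ennreal (wgauss (s *\<^sub>R x)))" for x
    proof (cases "x \<in> ?A")
      case True
      then have "r \<le> norm x" "r \<le> norm (x + v)"
        using v r norm_triangle_ineq4[of "x + v" v] by auto
      then have "\<bar>D s x\<bar> \<le> 1 / (s\<^sup>2 * r) * wgauss (s *\<^sub>R (x + v)) + 1 / (s\<^sup>2 * r) * wgauss (s *\<^sub>R x)"
        unfolding D_def using g[of x] g[of "x + v"] by linarith
      then have "\<bar>D s x\<bar> \<le> 1 / (s\<^sup>2 * r) * (wgauss (s *\<^sub>R (x + v)) + wgauss (s *\<^sub>R x))"
        by (simp add: distrib_left)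
      then show ?thesis using True s r
        by (simp add: ennreal_leI flip: ennreal_plus ennreal_mult)
    qed auto
    then have "(\<integral>\<^sup>+x. indicator ?A x * ennreal \<bar>D s x\<bar> \<partial>lborel) \<le>
      (\<integral>\<^sup>+x. ennreal (1 / (s\<^sup>2 * r)) * (ennreal (wgauss (s *\<^sub>R (x + v))) + ennreal (wgauss (s *\<^sub>R x))) \<partial>lborel)"
      by (rule nn_integral_mono)
    also have "\<dots> = ennreal (1 / (s\<^sup>2 * r)) * (ennreal (W / s ^ CARD('n)) + ennreal (W / s ^ CARD('n)))"
      using nn_integral_lborel_translate(2)[of "\<lambda>x::real ^ 'n. ennreal (wgauss (s *\<^sub>R x))" v]
      by (subst nn_integral_cmult, simp, subst nn_integral_add) (simp_all add: sc[OF s])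
    also have "\<dots> = ennreal (2 * W / (s\<^sup>2 * r) / s ^ CARD('n))"
      using s r W by (simp add: field_simps flip: ennreal_mult ennreal_plus)
    finally show ?thesis .
  qed
  \<comment> \<open>After multiplication by 2 s^d, with d the dimension, the two bounds are 4 pi W r
    and 4 W r / (r s)^2. Comparing each with the common form costs a factor 2, and the factor pi is
    carried through the second bound; hence 8 pi. The summand 0 prepares the affine substitution
    below.\<close>
  have J: "(\<integral>\<^sup>+x. indicator ?A x * (indicator {a..T} s * ennreal (2 * s ^ CARD('n) * \<bar>D s x\<bar>)) \<partial>lborel) \<le> ennreal (8 * pi * W * (r / (1 + (0 + r * s)\<^sup>2)))" for s
  proof (cases "s \<in> {a..T}")
    case True
    then have s: "s > 0" using a by auto
    have eq: "(\<integral>\<^sup>+x. indicator ?A x * (indicator {a..T} s * ennreal (2 * s ^ CARD('n) * \<bar>D s x\<bar>)) \<partial>lborel) =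
      ennreal (2 * s ^ CARD('n)) * (\<integral>\<^sup>+x. indicator ?A x * ennreal \<bar>D s x\<bar> \<partial>lborel)"
      using True s by (subst nn_integral_cmult[symmetric]) (auto simp: ennreal_mult mult_ac)
    show ?thesis
    proof (cases "r * s \<le> 1")
      case True
      have "(\<integral>\<^sup>+x. indicator ?A x * ennreal \<bar>D s x\<bar> \<partial>lborel) \<le> (\<integral>\<^sup>+x. ennreal \<bar>D s x\<bar> \<partial>lborel)"
        by (intro nn_integral_mono) (auto simp: indicator_def)
      also note J1[OF s]
      finally have "ennreal (2 * s ^ CARD('n)) * (\<integral>\<^sup>+x. indicator ?A x * ennreal \<bar>D s x\<bar> \<partial>lborel) \<le>
        ennreal (2 * s ^ CARD('n)) * ennreal (2 * pi * r * W / s ^ CARD('n))"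
        by (intro mult_left_mono) auto
      also have "\<dots> = ennreal (4 * pi * W * r)"
        using s r W by (simp add: field_simps flip: ennreal_mult)
      also have "\<dots> \<le> ennreal (8 * pi * W * (r / (1 + (0 + r * s)\<^sup>2)))"
      proof (rule ennreal_leI)
        have "(r * s)\<^sup>2 \<le> 1" using True s r by (simp add: power_le_one)
        then have "1 / 2 \<le> 1 / (1 + (r * s)\<^sup>2)" by (intro divide_left_mono) (auto intro: add_pos_nonneg)
        then have "8 * pi * W * r * (1 / 2) \<le> 8 * pi * W * r * (1 / (1 + (r * s)\<^sup>2))"
          using W r by (intro mult_left_mono) auto
        then show "4 * pi * W * r \<le> 8 * pi * W * (r / (1 + (0 + r * s)\<^sup>2))" by simp
      qed
      finally show ?thesis unfolding eq .
    next
      case False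
      have "ennreal (2 * s ^ CARD('n)) * (\<integral>\<^sup>+x. indicator ?A x * ennreal \<bar>D s x\<bar> \<partial>lborel) \<le>
        ennreal (2 * s ^ CARD('n)) * ennreal (2 * W / (s\<^sup>2 * r) / s ^ CARD('n))"
        by (intro mult_left_mono J2[OF s]) auto
      also have "\<dots> = ennreal (4 * W * r * (1 / (r * s)\<^sup>2))"
        using s r W by (simp add: field_simps power2_eq_square flip: ennreal_mult)
      also have "\<dots> \<le> ennreal (8 * pi * W * (r / (1 + (0 + r * s)\<^sup>2)))"
      proof (rule ennreal_leI)
        have "1 \<le> (r * s)\<^sup>2" using False by (simp add: one_le_power)
        then have "1 / (2 * (r * s)\<^sup>2) \<le> 1 / (1 + (r * s)\<^sup>2)" using s r
          by (intro divide_left_mono) (auto intro!: mult_pos_pos add_pos_nonneg)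
        then have "8 * W * r * (1 / (2 * (r * s)\<^sup>2)) \<le> 8 * W * r * (1 / (1 + (r * s)\<^sup>2))"
          using W r by (intro mult_left_mono) auto
        also have "\<dots> \<le> pi * (8 * W * r * (1 / (1 + (r * s)\<^sup>2)))"
          using pi_ge_two W r by (intro mult_right_mono[of 1 pi, simplified]) auto
        finally show "4 * W * r * (1 / (r * s)\<^sup>2) \<le> 8 * pi * W * (r / (1 + (0 + r * s)\<^sup>2))" by (simp add: mult_ac)
      qed
      finally show ?thesis unfolding eq .
    qed
  qed auto
  have pw: "ennreal \<bar>rk i a T (x + v) - rk i a T x\<bar> \<le> (\<integral>\<^sup>+s. indicator {a..T} s * ennreal (2 * s ^ CARD('n) * \<bar>D s x\<bar>) \<partial>lborel)" for x
  proof -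
    have "rk i a T (x + v) - rk i a T x = (LINT s|lborel. indicator {a..T} s * (2 * s ^ CARD('n) * D s x))"
      unfolding rk_def D_def by (subst Bochner_Integration.integral_diff[symmetric]) (intro rk_integrand_integrable | simp add: algebra_simps)+
    then have "ennreal \<bar>rk i a T (x + v) - rk i a T x\<bar> = ennreal (norm (LINT s|lborel. indicator {a..T} s * (2 * s ^ CARD('n) * D s x)))"
      by simp
    also have "\<dots> \<le> (\<integral>\<^sup>+s. ennreal (norm (indicator {a..T} s * (2 * s ^ CARD('n) * D s x))) \<partial>lborel)"
    proof (rule integral_norm_bound_ennreal)
      have "integrable lborel (\<lambda>s. indicator {a..T} s * (2 * s ^ CARD('n) * ((x + v) $ i * gauss (s *\<^sub>R (x + v)))) - indicator {a..T} s * (2 * s ^ CARD('n) * (x $ i * gauss (s *\<^sub>R x))))"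
        by (intro Bochner_Integration.integrable_diff rk_integrand_integrable)
      then show "integrable lborel (\<lambda>s. indicator {a..T} s * (2 * s ^ CARD('n) * D s x))"
        unfolding D_def by (simp only: right_diff_distrib)
    qed
    also have "\<dots> = (\<integral>\<^sup>+s. indicator {a..T} s * ennreal (2 * s ^ CARD('n) * \<bar>D s x\<bar>) \<partial>lborel)"
      using a by (intro nn_integral_cong) (auto simp: indicator_def abs_mult)
    finally show ?thesis .
  qed
  have "(\<integral>\<^sup>+x. indicator ?A x * ennreal \<bar>rk i a T (x + v) - rk i a T x\<bar> \<partial>lborel) \<le>
    (\<integral>\<^sup>+x. \<integral>\<^sup>+s. indicator ?A x * (indicator {a..T} s * ennreal (2 * s ^ CARD('n) * \<bar>D s x\<bar>)) \<partial>lborel \<partial>lborel)"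
    by (intro nn_integral_mono, subst nn_integral_cmult) (auto intro!: mult_left_mono pw)
  also have "\<dots> = (\<integral>\<^sup>+s. \<integral>\<^sup>+x. indicator ?A x * (indicator {a..T} s * ennreal (2 * s ^ CARD('n) * \<bar>D s x\<bar>)) \<partial>lborel \<partial>lborel)"
    by (rule lborel_pair.Fubini'[symmetric]) measurable
  also have "\<dots> \<le> (\<integral>\<^sup>+s. ennreal (8 * pi * W * (r / (1 + (0 + r * s)\<^sup>2))) \<partial>lborel)"
    by (intro nn_integral_mono J)
  \<comment> \<open>Replacing r s by s removes r, the Jacobian cancelling the factor r in the
    numerator.\<close>
  also have "\<dots> = (\<integral>\<^sup>+s. ennreal (8 * pi * W * (1 / (1 + s\<^sup>2))) \<partial>lborel)"
    using r W by (subst nn_integral_real_affine[of "\<lambda>s. ennreal (8 * pi * W * (1 / (1 + s\<^sup>2)))" r 0])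
      (auto simp: nn_integral_cmult[symmetric] mult_ac intro!: nn_integral_cong simp flip: ennreal_mult)
  also have "\<dots> = ennreal C"
    unfolding C_def W_def[symmetric] integral_mult_right_zero[symmetric] using W
    by (intro nn_integral_eq_integral integrable_mult_right integrable_inverse_1_plus_square_UNIV) auto
  finally show ?thesis .
qed

section \<open>Gaussian superpositions as averages of sharply truncated Riesz kernels\<close>

definition rad :: "nat \<Rightarrow> real \<Rightarrow> real" where
  "rad m s = indicator {0<..} s * (2 * s ^ m * exp (- pi * s\<^sup>2))"

lemma measurable_rad [measurable]: "rad m \<in> borel_measurable borel"
  unfolding rad_def by measurable

lemma rad_nonneg [simp]: "0 \<le> rad m s"
  by (auto simp: rad_def indicator_def)

lemma integrable_rad: "integrable lborel (rad m)"
proof -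
  define \<sigma> where "\<sigma> = 1 / sqrt (2 * pi)"
  have "normal_density 0 \<sigma> x = exp (- pi * x\<^sup>2)" for x
    by (simp add: normal_density_def \<sigma>_def power_divide)
  moreover have "integrable lborel (\<lambda>x. normal_density 0 \<sigma> x * (x - 0) ^ m)"
    by (rule integrable_normal_moment) (simp add: \<sigma>_def)
  ultimately have 1: "integrable lborel (\<lambda>x. exp (- pi * x\<^sup>2) * x ^ m)" by simp
  have "integrable lborel (\<lambda>x. 2 * (exp (- pi * x\<^sup>2) * x ^ m))"
    by (rule integrable_mult_right[OF 1])
  then show ?thesis
    by (rule Bochner_Integration.integrable_bound) (auto simp: rad_def indicator_def abs_mult)
qed

text \<open>The substitution t = pi s^2 turns Euler's integral for Gamma into the mass of
  \<open>rad\<close>. For m equal to the dimension the value is the normalising constant of the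
  Riesz kernel, which is how that constant enters.\<close>

lemma integral_rad: "(LINT s|lborel. rad m s) = Gamma ((real m + 1) / 2) * pi powr (- ((real m + 1) / 2))"
proof -
  define c where "c = (real m + 1) / 2"
  have c: "c > 0" by (simp add: c_def)
  let ?f = "\<lambda>t::real. t powr (c - 1) / exp t"
  have eq: "?f (pi * s\<^sup>2) * (2 * pi * s) = pi powr c * (2 * s ^ m * exp (- pi * s\<^sup>2))" if s: "s > 0" for s
  proof -
    have "(pi * s\<^sup>2) powr (c - 1) = pi powr c / pi * (s\<^sup>2) powr (c - 1)"
      using s by (simp add: powr_mult powr_diff)
    also have "s\<^sup>2 = s powr 2" using s by simp
    also have "(s powr 2) powr (c - 1) = s powr (real m - 1)"
    proof -
      have "2 * (c - 1) = real m - 1" by (simp add: c_def field_simps)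
      then show ?thesis unfolding powr_powr by (simp only:)
    qed
    also have "s powr (real m - 1) = s ^ m / s" using s by (simp add: powr_diff powr_realpow)
    finally show ?thesis using s by (simp add: exp_minus field_simps power2_eq_square)
  qed
  have int: "set_integrable lborel (einterval 0 \<infinity>) (\<lambda>s. ?f (pi * s\<^sup>2) * (2 * pi * s))"
  proof -
    have "integrable lborel (\<lambda>s. pi powr c * rad m s)" by (intro integrable_mult_right integrable_rad)
    moreover have "pi powr c * rad m s = indicator (einterval 0 \<infinity>) s *\<^sub>R (?f (pi * s\<^sup>2) * (2 * pi * s))" for s
      using eq[of s] by (auto simp: rad_def indicator_def einterval_def)
    ultimately show ?thesis by (simp add: set_integrable_def)
  qed
  have lim: "((ereal \<circ> (\<lambda>s. pi * s\<^sup>2) \<circ> real_of_ereal) \<longlongrightarrow> 0) (at_right 0)"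
  proof -
    have "((\<lambda>s. pi * s\<^sup>2) \<longlongrightarrow> pi * 0\<^sup>2) (at_right 0)" by (intro tendsto_intros)
    then show ?thesis by (simp add: zero_ereal_def ereal_tendsto_simps)
  qed
  have lim2: "((ereal \<circ> (\<lambda>s. pi * s\<^sup>2) \<circ> real_of_ereal) \<longlongrightarrow> \<infinity>) (at_left \<infinity>)"
  proof -
    have "filterlim (\<lambda>s. pi * s\<^sup>2) at_top at_top" by real_asymp
    then show ?thesis by (simp add: ereal_tendsto_simps)
  qed
  note S = interval_integral_substitution_nonneg[of 0 \<infinity> "\<lambda>s. pi * s\<^sup>2" "\<lambda>s. 2 * pi * s" ?f 0 \<infinity>, OF _ _ _ _ _ _ lim lim2 int]
  have cont: "isCont ?f t" if "t > 0" for t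
    using that by (intro continuous_intros) auto
  have S1: "set_integrable lborel (einterval 0 \<infinity>) ?f"
    by (rule S(1)) (auto intro!: derivative_eq_intros cont mult_pos_pos)
  have S2: "(LBINT t=0..\<infinity>. ?f t) = (LBINT s=0..\<infinity>. ?f (pi * s\<^sup>2) * (2 * pi * s))"
    by (rule S(2)) (auto intro!: derivative_eq_intros cont mult_pos_pos)
  have e0: "einterval 0 \<infinity> = {0<..}" by (auto simp: einterval_def)
  have "(LBINT t=0..\<infinity>. ?f t) = integral {0<..} ?f"
    using set_borel_integral_eq_integral(2)[OF S1] by (simp add: interval_lebesgue_integral_def e0)
  also have "(?f has_integral Gamma c) {0<..}"
    using Gamma_integral_real[OF c]
    by (subst has_integral_spike_set_eq[of "{0<..}" "{0..}"]) (auto intro: negligible_subset[of "{0}"])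
  then have "integral {0<..} ?f = Gamma c" by (rule integral_unique)
  finally have "Gamma c = (LBINT s=0..\<infinity>. ?f (pi * s\<^sup>2) * (2 * pi * s))" using S2 by simp
  also have "\<dots> = (LINT s|lborel. pi powr c * rad m s)"
  proof -
    have "indicator {0<..} s *\<^sub>R (?f (pi * s\<^sup>2) * (2 * pi * s)) = pi powr c * rad m s" for s
      using eq[of s] by (cases "s > 0") (simp_all add: rad_def)
    then show ?thesis
      unfolding interval_lebesgue_integral_def set_lebesgue_integral_def e0 by simp
  qed
  finally have "Gamma c = pi powr c * (LINT s|lborel. rad m s)" by simp
  then show ?thesis unfolding c_def[symmetric] by (simp add: powr_minus field_simps)
qed

text \<open>A component of the Riesz kernel without its normalising constant; the constant reappears
  as the mass of \<open>rad\<close>.\<close>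

definition zk :: "'n \<Rightarrow> real ^ 'n::finite \<Rightarrow> real" where
  "zk i y = y $ i / norm y ^ (CARD('n) + 1)"

lemma measurable_zk [measurable]: "zk i \<in> borel_measurable borel"
  unfolding zk_def by measurable

lemma abs_zk_le: "\<bar>zk i y\<bar> \<le> 1 / norm (y :: real ^ 'n::finite) ^ CARD('n)"
proof (cases "y = 0")
  case False
  have "\<bar>zk i y\<bar> \<le> norm y / norm y ^ (CARD('n) + 1)"
    unfolding zk_def abs_divide abs_of_nonneg[OF zero_le_power[OF norm_ge_zero]]
    by (intro divide_right_mono component_le_norm_cart) auto
  then show ?thesis using False by simp
qed (simp add: zk_def)

text \<open>Substituting s / |y| for s separates the radial profile \<open>rad\<close> from the
  homogeneous kernel \<open>zk\<close>. The upper limit T becomes the condition s < T |y|, which for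
  fixed s is a truncation in y.\<close>

lemma rk_0_eq:
  fixes y :: "real ^ 'n::finite"
  assumes T: "T > 0"
  shows "rk i 0 T y = (LINT s|lborel. indicator {..<T * norm y} s * rad CARD('n) s * zk i y)"
proof (cases "y = 0")
  case False
  then have r: "norm y > 0" by simp
  have "rk i 0 T y = (1 / norm y) * (LINT s|lborel. indicator {0..T} (0 + 1 / norm y * s) * (2 * (0 + 1 / norm y * s) ^ CARD('n) * (y $ i * gauss ((0 + 1 / norm y * s) *\<^sub>R y))))"
    unfolding rk_def using r by (subst lborel_integral_real_affine[of "1 / norm y" _ 0]) auto
  also have "\<dots> = (LINT s|lborel. (1 / norm y) * (indicator {0..T} (0 + 1 / norm y * s) * (2 * (0 + 1 / norm y * s) ^ CARD('n) * (y $ i * gauss ((0 + 1 / norm y * s) *\<^sub>R y)))))"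
    by simp
  also have "\<dots> = (LINT s|lborel. indicator {..<T * norm y} s * rad CARD('n) s * zk i y)"
  \<comment> \<open>The closed interval of scales and the open conditions on the right differ only
    at the two end points, which form a null set.\<close>
  proof (rule integral_cong_AE)
    have "AE s in lborel. s \<noteq> 0" "AE s in lborel. s \<noteq> T * norm y"
      by (auto intro: AE_lborel_singleton)
    then show "AE s in lborel. (1 / norm y) * (indicator {0..T} (0 + 1 / norm y * s) * (2 * (0 + 1 / norm y * s) ^ CARD('n) * (y $ i * gauss ((0 + 1 / norm y * s) *\<^sub>R y)))) =
       indicator {..<T * norm y} s * rad CARD('n) s * zk i y"
    proof eventually_elim
      case (elim s)
      have i: "indicator {0..T} (0 + 1 / norm y * s) = (indicator {..<T * norm y} s * indicator {0<..} s :: real)"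
        using r elim by (auto simp: indicator_def field_simps)
      have "norm ((0 + 1 / norm y * s) *\<^sub>R y) = \<bar>s\<bar>" using r by simp
      then have g: "gauss ((0 + 1 / norm y * s) *\<^sub>R y) = exp (- pi * s\<^sup>2)"
        unfolding gauss_def by simp
      show ?case unfolding i g rad_def zk_def using r by (simp add: power_divide)
    qed
  qed measurable
  finally show ?thesis .
qed (simp add: rk_def zk_def)

lemma rk_diff: 
  assumes "0 < a" "a \<le> T"
  shows "rk i a T y = rk i 0 T y - rk i 0 a (y :: real ^ 'n::finite)"
proof -
  have "rk i 0 T y - rk i 0 a y = (LINT s|lborel. indicator {0..T} s * (2 * s ^ CARD('n) * (y $ i * gauss (s *\<^sub>R y))) - indicator {0..a} s * (2 * s ^ CARD('n) * (y $ i * gauss (s *\<^sub>R y))))"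
    unfolding rk_def by (intro Bochner_Integration.integral_diff[symmetric] rk_integrand_integrable)
  also have "\<dots> = rk i a T y"
    unfolding rk_def
  proof (rule integral_cong_AE)
    have "AE s in lborel. s \<noteq> a" by (auto intro: AE_lborel_singleton)
    then show "AE s in lborel. indicator {0..T} s * (2 * s ^ CARD('n) * (y $ i * gauss (s *\<^sub>R y))) - indicator {0..a} s * (2 * s ^ CARD('n) * (y $ i * gauss (s *\<^sub>R y))) =
      indicator {a..T} s * (2 * s ^ CARD('n) * (y $ i * gauss (s *\<^sub>R y)))"
      by eventually_elim (use assms in \<open>auto simp: indicator_def\<close>)
  qed measurable
  finally show ?thesis by simp
qed

definition ztrunc :: "'n \<Rightarrow> (real ^ 'n::finite \<Rightarrow> complex) \<Rightarrow> real ^ 'n \<Rightarrow> real \<Rightarrow> complex" where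
  "ztrunc i f x \<epsilon> = (LINT y|lborel. indicator {y. \<epsilon> < norm y} y *\<^sub>R (f (x - y) * of_real (zk i y)))"

text \<open>Off the ball of radius \<open>\<epsilon>\<close> the kernel is bounded by the reciprocal
  of \<open>\<epsilon> ^ CARD('n)\<close>. This dominates all truncations at radii bounded away from
  0 and makes them vanish as the radius grows.\<close>

lemma ztrunc_le:
  fixes f :: "real ^ 'n::finite \<Rightarrow> complex"
  assumes f: "integrable lborel f" and e: "\<epsilon> > 0"
  shows "norm (ztrunc i f x \<epsilon>) \<le> (LINT y|lborel. norm (f y)) / \<epsilon> ^ CARD('n)"
proof -
  have [measurable]: "f \<in> borel_measurable borel" using f by auto
  have i: "integrable lborel (\<lambda>y. norm (f (x - y)))" using integrable_lborel_translate(4)[OF f] by auto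
  have bd: "norm (indicator {y. \<epsilon> < norm y} y *\<^sub>R (f (x - y) * of_real (zk i y))) \<le> norm (f (x - y)) * (1 / \<epsilon> ^ CARD('n))" for y
  proof (cases "\<epsilon> < norm y")
    case True
    have "norm y > 0" using True e by linarith
    have "norm (f (x - y)) * \<bar>zk i y\<bar> \<le> norm (f (x - y)) * (1 / \<epsilon> ^ CARD('n))"
      using True e \<open>norm y > 0\<close>
      by (intro mult_left_mono order_trans[OF abs_zk_le] divide_left_mono power_mono mult_pos_pos zero_less_power) auto
    then show ?thesis using True by (simp add: norm_mult)
  qed (use e in auto)
  have "norm (ztrunc i f x \<epsilon>) \<le> (LINT y|lborel. norm (indicator {y. \<epsilon> < norm y} y *\<^sub>R (f (x - y) * of_real (zk i y))))"
    unfolding ztrunc_def by (rule integral_norm_bound)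
  also have "\<dots> \<le> (LINT y|lborel. norm (f (x - y)) * (1 / \<epsilon> ^ CARD('n)))"
    using e by (intro integral_mono' integrable_mult_left i bd) auto
  also have "\<dots> = (LINT y|lborel. norm (f y)) / \<epsilon> ^ CARD('n)"
    using integral_lborel_translate(4)[of "\<lambda>y. norm (f y)" x] by simp
  finally show ?thesis .
qed

lemma measurable_ztrunc [measurable]:
  assumes [measurable]: "f \<in> borel_measurable borel"
  shows "ztrunc i f x \<in> borel_measurable borel"
  unfolding ztrunc_def by measurable

text \<open>The condition s < T |y| from \<open>rk_0_eq\<close> reads s / T < |y|, so after Fubini's
  theorem the profile value \<open>rad s\<close> multiplies the truncated integral at radius s /
  T.\<close>

lemma conv_rk_0_eq:
  fixes f :: "real ^ 'n::finite \<Rightarrow> complex"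
  assumes f: "integrable lborel f" and T: "T > 0"
  shows "integrable lborel (\<lambda>y. f (x - y) * of_real (rk i 0 T y))"
    and "(LINT y|lborel. f (x - y) * of_real (rk i 0 T y)) = (LINT s|lborel. of_real (rad CARD('n) s) * ztrunc i f x (s / T))"
proof -
  have m[measurable]: "f \<in> borel_measurable borel" using f by auto
  have fx: "integrable lborel (\<lambda>y. f (x - y))" by (rule integrable_lborel_translate(4)[OF f])
  show 1: "integrable lborel (\<lambda>y. f (x - y) * of_real (rk i 0 T y))"
    by (rule integrable_mult_bounded(1)[OF fx, where B = "2 * T ^ CARD('n)"]) (use T abs_rk_le[of 0 T i] in auto)
  let ?F = "\<lambda>y s. f (x - y) * of_real (indicator {..<T * norm y} s * rad CARD('n) s * zk i y)"
  have "(\<integral>\<^sup>+s. ennreal (norm (?F y s)) \<partial>lborel) = ennreal (norm (f (x - y) * of_real (rk i 0 T y)))" for y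
  proof -
    have int: "integrable lborel (\<lambda>s. indicator {..<T * norm y} s * rad CARD('n) s * zk i y)"
      by (intro integrable_mult_left Bochner_Integration.integrable_bound[OF integrable_rad[of "CARD('n)"]]) (auto simp: indicator_def)
    have "norm (?F y s) = norm (f (x - y)) * \<bar>indicator {..<T * norm y} s * rad CARD('n) s * zk i y\<bar>" for s
      by (simp only: norm_mult norm_of_real)
    then have "(\<integral>\<^sup>+s. ennreal (norm (?F y s)) \<partial>lborel) = (\<integral>\<^sup>+s. ennreal (norm (f (x - y)) * \<bar>indicator {..<T * norm y} s * rad CARD('n) s * zk i y\<bar>) \<partial>lborel)"
      by simp
    also have "\<dots> = ennreal (LINT s|lborel. norm (f (x - y)) * \<bar>indicator {..<T * norm y} s * rad CARD('n) s * zk i y\<bar>)"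
      by (intro nn_integral_eq_integral integrable_mult_right integrable_abs int) auto
    also have "(LINT s|lborel. norm (f (x - y)) * \<bar>indicator {..<T * norm y} s * rad CARD('n) s * zk i y\<bar>) =
        norm (f (x - y)) * \<bar>rk i 0 T y\<bar>"
      unfolding rk_0_eq[OF T] by (simp add: abs_mult)
    finally show ?thesis by (simp add: norm_mult)
  qed
  then have "(\<integral>\<^sup>+y. \<integral>\<^sup>+s. ennreal (norm (?F y s)) \<partial>lborel \<partial>lborel) < \<infinity>"
    using integrable_nn_finite[OF 1] by simp
  note fin = this
  have "case_prod ?F = (\<lambda>(y, s). f (x - y) * of_real ((if s < T * norm y then 1 else 0) * rad CARD('n) s * zk i y))"
    by (auto simp: fun_eq_iff indicator_def)
  then have "case_prod ?F \<in> borel_measurable (lborel \<Otimes>\<^sub>M lborel)" by (simp only:) measurable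
  then have "(LINT y|lborel. LINT s|lborel. ?F y s) = (LINT s|lborel. LINT y|lborel. ?F y s)"
    using fin by (rule fubini_swap)
  moreover have "(LINT s|lborel. ?F y s) = f (x - y) * of_real (rk i 0 T y)" for y
    unfolding rk_0_eq[OF T] by (simp only: integral_mult_right_zero integral_complex_of_real)
  moreover have "(LINT y|lborel. ?F y s) = of_real (rad CARD('n) s) * ztrunc i f x (s / T)" for s
  proof -
    have "?F y s = of_real (rad CARD('n) s) * (indicator {y. s / T < norm y} y *\<^sub>R (f (x - y) * of_real (zk i y)))" for y
      using T by (auto simp: indicator_def field_simps)
    then show ?thesis unfolding ztrunc_def by (simp only: integral_mult_right_zero)
  qed
  ultimately show "(LINT y|lborel. f (x - y) * of_real (rk i 0 T y)) = (LINT s|lborel. of_real (rad CARD('n) s) * ztrunc i f x (s / T))"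
    by (simp only:)
qed

text \<open>Since \<^term>\<open>rk i 0 T\<close> is an average of the truncated kernels, convergence of the truncated
  integrals at a point is inherited without any appeal to Lebesgue points.\<close>

lemma conv_rkn_tendsto:
  fixes f :: "real ^ 'n::finite \<Rightarrow> complex"
  assumes f: "integrable lborel f" and l: "(ztrunc i f x \<longlongrightarrow> l) (at_right 0)"
  shows "(\<lambda>n. LINT y|lborel. f (x - y) * of_real (rkn i n y)) \<longlonglongrightarrow> of_real (LINT s|lborel. rad CARD('n) s) * l"
proof -
  have m[measurable]: "f \<in> borel_measurable borel" using f by auto
  let ?N = "LINT y|lborel. norm (f y)"
  have "eventually (\<lambda>\<epsilon>. norm (ztrunc i f x \<epsilon>) < norm l + 1) (at_right 0)"
    using tendsto_norm[OF l] by (rule order_tendstoD) simp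
  then obtain \<delta> where \<delta>: "\<delta> > 0" "\<And>\<epsilon>. 0 < \<epsilon> \<Longrightarrow> \<epsilon> < \<delta> \<Longrightarrow> norm (ztrunc i f x \<epsilon>) < norm l + 1"
    unfolding eventually_at_right_field by auto
  \<comment> \<open>A bound for all radii at once: below \<open>\<delta>\<close> the truncations
    stay within 1 of the norm of their limit, above it \<open>ztrunc_le\<close> applies.\<close>
  define B where "B = norm l + 1 + ?N / \<delta> ^ CARD('n)"
  have N: "?N \<ge> 0" by simp
  have B: "norm (ztrunc i f x \<epsilon>) \<le> B" if "\<epsilon> > 0" for \<epsilon>
  proof (cases "\<epsilon> < \<delta>")
    case True
    have "0 \<le> ?N / \<delta> ^ CARD('n)" using \<delta>(1) N by (intro divide_nonneg_nonneg) auto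
    then show ?thesis using \<delta>(2)[OF that True] unfolding B_def by linarith
  next
    case False
    have "norm (ztrunc i f x \<epsilon>) \<le> ?N / \<epsilon> ^ CARD('n)" by (rule ztrunc_le[OF f that])
    also have "\<dots> \<le> ?N / \<delta> ^ CARD('n)"
      using False \<delta>(1) by (intro divide_left_mono power_mono N) auto
    finally show ?thesis using norm_ge_zero[of l] unfolding B_def by linarith
  qed
  let ?I = "\<lambda>T. LINT s|lborel. of_real (rad CARD('n) s) * ztrunc i f x (s / T)"
  have dom: "norm (complex_of_real (rad CARD('n) s) * ztrunc i f x (s / T)) \<le> rad CARD('n) s * B" if "T > 0" for s T
  proof (cases "s > 0")
    case True
    then show ?thesis using B[of "s / T"] that
      unfolding norm_mult norm_of_real abs_of_nonneg[OF rad_nonneg] by (intro mult_left_mono) auto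
  qed (simp add: rad_def)
  have iB: "integrable lborel (\<lambda>s. rad CARD('n) s * B)" by (intro integrable_mult_left integrable_rad)
  have 1: "(\<lambda>n. ?I (real (Suc n))) \<longlonglongrightarrow> (LINT s|lborel. of_real (rad CARD('n) s) * l)"
  proof (rule integral_dominated_convergence[where w = "\<lambda>s. rad CARD('n) s * B"])
    show "AE s in lborel. (\<lambda>n. of_real (rad CARD('n) s) * ztrunc i f x (s / real (Suc n))) \<longlonglongrightarrow> of_real (rad CARD('n) s) * l"
    proof (intro always_eventually allI)
      fix s :: real
      show "(\<lambda>n. of_real (rad CARD('n) s) * ztrunc i f x (s / real (Suc n))) \<longlonglongrightarrow> of_real (rad CARD('n) s) * l"
      proof (cases "s > 0")
        case True
        have "(\<lambda>n. s / real (Suc n)) \<longlonglongrightarrow> 0" by real_asymp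
        then have "filterlim (\<lambda>n. s / real (Suc n)) (at_right 0) sequentially"
          using True by (auto simp: filterlim_at intro!: always_eventually)
        then show ?thesis by (intro tendsto_intros filterlim_compose[OF l])
      qed (simp add: rad_def)
    qed
    show "AE s in lborel. norm (complex_of_real (rad CARD('n) s) * ztrunc i f x (s / real (Suc n))) \<le> rad CARD('n) s * B" for n
      by (intro always_eventually allI dom) auto
  qed (use iB in measurable)
  \<comment> \<open>The lower cut-off corresponds to truncation radii that grow with n, and these
    truncations tend to 0.\<close>
  have 2: "(\<lambda>n. ?I (1 / real (Suc n))) \<longlonglongrightarrow> (LINT s|lborel. of_real (rad CARD('n) s) * 0)"
  proof (rule integral_dominated_convergence[where w = "\<lambda>s. rad CARD('n) s * B"])
    show "AE s in lborel. (\<lambda>n. of_real (rad CARD('n) s) * ztrunc i f x (s / (1 / real (Suc n)))) \<longlonglongrightarrow> of_real (rad CARD('n) s) * 0"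
    proof (intro always_eventually allI)
      fix s :: real
      show "(\<lambda>n. of_real (rad CARD('n) s) * ztrunc i f x (s / (1 / real (Suc n)))) \<longlonglongrightarrow> of_real (rad CARD('n) s) * 0"
      proof (cases "s > 0")
        case True
        obtain m where m: "CARD('n) = Suc m" using zero_less_card_finite[where 'a = 'n] gr0_implies_Suc by blast
        have "filterlim (\<lambda>n. s / (1 / real (Suc n))) at_top sequentially" using True by real_asymp
        then have "filterlim (\<lambda>n. (s / (1 / real (Suc n))) ^ CARD('n)) at_top sequentially"
          by (rule filterlim_pow_at_top[rotated]) simp
        then have "(\<lambda>n. ?N / (s / (1 / real (Suc n))) ^ CARD('n)) \<longlonglongrightarrow> 0"
          by (intro tendsto_divide_0[OF tendsto_const] filterlim_at_top_imp_at_infinity)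
        then have "(\<lambda>n. ztrunc i f x (s / (1 / real (Suc n)))) \<longlonglongrightarrow> 0"
          by (rule Lim_null_comparison[rotated]) (use True in \<open>auto intro!: always_eventually ztrunc_le[OF f] simp del: divide_divide_eq_right\<close>)
        then show ?thesis by (intro tendsto_intros)
      qed (simp add: rad_def)
    qed
    show "AE s in lborel. norm (complex_of_real (rad CARD('n) s) * ztrunc i f x (s / (1 / real (Suc n)))) \<le> rad CARD('n) s * B" for n
      by (intro always_eventually allI dom) auto
  qed (use iB in measurable)
  have "(LINT y|lborel. f (x - y) * of_real (rkn i n y)) = ?I (real (Suc n)) - ?I (1 / real (Suc n))" for n
  proof -
    have a: "0 < 1 / real (Suc n)" "0 < real (Suc n)" "1 / real (Suc n) \<le> real (Suc n)" by (auto simp: field_simps)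
    have "(LINT y|lborel. f (x - y) * of_real (rkn i n y)) = (LINT y|lborel. f (x - y) * of_real (rk i 0 (real (Suc n)) y) - f (x - y) * of_real (rk i 0 (1 / real (Suc n)) y))"
      unfolding rk_diff[OF a(1,3)] by (simp only: of_real_diff right_diff_distrib)
    then show ?thesis
      using conv_rk_0_eq[OF f a(1), of x i] conv_rk_0_eq[OF f a(2), of x i]
      by (simp only: Bochner_Integration.integral_diff)
  qed
  with tendsto_diff[OF 1 2] show ?thesis
    by (simp only: integral_mult_left_zero integral_complex_of_real mult_zero_right integral_zero diff_zero)
qed

subsection \<open>Calderon--Zygmund decomposition\<close>

text \<open>If f is not integrable, its Bochner integral is 0 by convention and the bound is
  trivial, so chains of estimates need no side conditions.\<close>

lemma norm_integral_le_nn_integral: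
  fixes f :: "'a \<Rightarrow> 'b::{banach, second_countable_topology}"
  shows "ennreal (norm (integral\<^sup>L M f)) \<le> (\<integral>\<^sup>+x. ennreal (norm (f x)) \<partial>M)"
  by (cases "integrable M f") (auto intro: integral_norm_bound_ennreal simp: not_integrable_integral_eq)

text \<open>The index of the half-open dyadic cube of side 2^(-n) containing x. Lying in the same
  cube becomes equality of indices, so cubes never have to be handled as sets.\<close>

definition dyadic :: "nat \<Rightarrow> real ^ 'n::finite \<Rightarrow> int ^ 'n" where
  "dyadic n x = (\<chi> i. \<lfloor>2 ^ n * x $ i\<rfloor>)"

lemma dyadic_eq_iff: "dyadic n x = dyadic n y \<longleftrightarrow> (\<forall>i. \<lfloor>2 ^ n * x $ i\<rfloor> = \<lfloor>2 ^ n * y $ i\<rfloor>)"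
  by (simp add: dyadic_def vec_eq_iff)

lemma dyadic_eq_mono:
  assumes "dyadic n x = dyadic n y" "m \<le> n"
  shows "dyadic m x = dyadic m y"
proof -
  have "\<lfloor>2 ^ m * t\<rfloor> = \<lfloor>2 ^ n * t\<rfloor> div 2 ^ (n - m)" for t :: real
  proof -
    have "2 ^ m * t = (2 ^ n * t) / real_of_int (2 ^ (n - m))"
      using assms(2) power_add[of "2 :: real" m "n - m"] by simp
    then show ?thesis by (simp only: floor_divide_real_eq_div zero_le_power zero_le_numeral)
  qed
  then show ?thesis using assms(1) by (simp add: dyadic_eq_iff)
qed

text \<open>The norm is bounded by the sum of the components, so the dimension itself appears
  instead of its square root; the factor recurs in \<open>rad_at\<close> and in the bound for
  \<open>big\<close>.\<close>

lemma dyadic_eq_norm_le: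
  fixes x :: "real ^ 'n::finite"
  assumes "dyadic n x = dyadic n y"
  shows "norm (x - y) \<le> real CARD('n) / 2 ^ n"
proof -
  have "\<bar>(x - y) $ i\<bar> \<le> 1 / 2 ^ n" for i
  proof -
    have "\<lfloor>2 ^ n * x $ i\<rfloor> = \<lfloor>2 ^ n * y $ i\<rfloor>" using assms by (simp add: dyadic_eq_iff)
    then have "\<bar>2 ^ n * x $ i - 2 ^ n * y $ i\<bar> \<le> 1" by linarith
    then have "2 ^ n * \<bar>(x - y) $ i\<bar> \<le> 1" by (simp add: abs_mult flip: right_diff_distrib)
    then show ?thesis by (simp add: field_simps)
  qed
  then have "norm (x - y) \<le> (\<Sum>i\<in>(UNIV :: 'n set). 1 / 2 ^ n)"
    by (intro order_trans[OF norm_le_l1_cart] sum_mono)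
  then show ?thesis by simp
qed

lemma measurable_dyadic [measurable]: "dyadic n \<in> borel \<rightarrow>\<^sub>M count_space (UNIV :: (int ^ 'n::finite) set)"
proof (rule measurable_count_space_eq_countable[THEN iffD2])
  show "countable (UNIV :: (int ^ 'n) set)" by simp
  have "dyadic n -` {k} = {x :: real ^ 'n. \<forall>i. \<lfloor>2 ^ n * x $ i\<rfloor> = k $ i}" for k
    by (auto simp: dyadic_def vec_eq_iff)
  moreover have "{x :: real ^ 'n. \<forall>i. \<lfloor>2 ^ n * x $ i\<rfloor> = k $ i} \<in> sets borel" for k
    by measurable
  ultimately show "dyadic n \<in> space borel \<rightarrow> UNIV \<and> (\<forall>k\<in>UNIV. dyadic n -` {k} \<inter> space (borel :: (real ^ 'n) measure) \<in> sets borel)"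
    by simp
qed

lemma emeasure_dyadic:
  fixes x :: "real ^ 'n::finite"
  shows "emeasure lborel {y. dyadic n y = dyadic n x} = ennreal (1 / 2 ^ (n * CARD('n)))"
proof -
  define l u :: "real ^ 'n" where "l = (\<chi> i. \<lfloor>2 ^ n * x $ i\<rfloor> / 2 ^ n)" and "u = l + (\<chi> i. 1 / 2 ^ n)"
  have le: "\<forall>b\<in>Basis. l \<bullet> b \<le> u \<bullet> b"
    by (auto simp: u_def inner_add_left Basis_vec_def inner_axis)
  have "(\<Prod>b\<in>Basis. (u - l) \<bullet> b) = (\<Prod>b\<in>(Basis :: (real ^ 'n) set). 1 / 2 ^ n)"
    by (intro prod.cong) (auto simp: u_def Basis_vec_def inner_axis)
  then have v: "(\<Prod>b\<in>Basis. (u - l) \<bullet> b) = 1 / 2 ^ (n * CARD('n))"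
    by (simp add: power_mult power_one_over)
  have iff: "\<lfloor>2 ^ n * t\<rfloor> = \<lfloor>2 ^ n * x $ i\<rfloor> \<longleftrightarrow> l $ i \<le> t \<and> t < u $ i" for t i
    unfolding floor_eq_iff by (auto simp: l_def u_def field_simps)
  have S: "{y. dyadic n y = dyadic n x} = {y. \<forall>i. l $ i \<le> y $ i \<and> y $ i < u $ i}"
    by (simp add: dyadic_eq_iff iff)
  have m: "{y. dyadic n y = dyadic n x} \<in> sets lborel" by simp
  show ?thesis
  proof (rule antisym)
    have "emeasure lborel {y. dyadic n y = dyadic n x} \<le> emeasure lborel (cbox l u)"
      by (rule emeasure_mono) (auto simp: S mem_box_cart less_imp_le)
    then show "emeasure lborel {y. dyadic n y = dyadic n x} \<le> ennreal (1 / 2 ^ (n * CARD('n)))"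
      using le by (simp add: emeasure_lborel_cbox_eq v)
    have "emeasure lborel (box l u) \<le> emeasure lborel {y. dyadic n y = dyadic n x}"
      by (rule emeasure_mono[OF _ m]) (auto simp: S mem_box_cart less_imp_le)
    then show "ennreal (1 / 2 ^ (n * CARD('n))) \<le> emeasure lborel {y. dyadic n y = dyadic n x}"
      using le by (simp add: emeasure_lborel_box_eq v)
  qed
qed

text \<open>The bound of the \<open>L^1\<close> norm by \<open>\<mu>\<close> ensures that no unit
  cube has mean above \<open>\<mu>\<close>. Hence the stopping time starts at generation 0 and every
  selected cube has a parent that was not selected.\<close>

locale calderon_zygmund_level =
  fixes f :: "real ^ 'n::finite \<Rightarrow> complex" and \<mu> :: real
  assumes f: "integrable lborel f" and \<mu>: "(LINT x|lborel. norm (f x)) \<le> \<mu>" "\<mu> > 0"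
begin

lemma f_measurable [measurable]: "f \<in> borel_measurable borel"
  using f by auto

definition avg :: "nat \<Rightarrow> real ^ 'n \<Rightarrow> ennreal" where
  "avg n x = (\<integral>\<^sup>+y. indicator {y. dyadic n y = dyadic n x} y * ennreal (2 ^ (n * CARD('n)) * norm (f y)) \<partial>lborel)"

lemma measurable_avg [measurable]: "avg n \<in> borel_measurable borel"
proof -
  have "avg n = (\<lambda>x. \<integral>\<^sup>+y. (if dyadic n y = dyadic n x then 1 else 0) * ennreal (2 ^ (n * CARD('n)) * norm (f y)) \<partial>lborel)"
    unfolding avg_def by (auto simp: indicator_def fun_eq_iff intro!: nn_integral_cong)
  then show ?thesis by (simp only:) measurable
qed

lemma avg_cong: "dyadic n x = dyadic n y \<Longrightarrow> m \<le> n \<Longrightarrow> avg m x = avg m y"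
  using dyadic_eq_mono[of n x y m] by (simp add: avg_def)

lemma avg_0: "avg 0 x \<le> ennreal \<mu>"
proof -
  have "avg 0 x \<le> (\<integral>\<^sup>+y. ennreal (norm (f y)) \<partial>lborel)"
    unfolding avg_def by (intro nn_integral_mono) (auto simp: indicator_def)
  also have "\<dots> = ennreal (LINT x|lborel. norm (f x))"
    using f by (intro nn_integral_eq_integral) auto
  finally show ?thesis using ennreal_leI[OF \<mu>(1)] by simp
qed

lemma avg_Suc: "avg (Suc n) x \<le> ennreal (2 ^ CARD('n)) * avg n x"
proof -
  have "avg (Suc n) x \<le> (\<integral>\<^sup>+y. ennreal (2 ^ CARD('n)) * (indicator {y. dyadic n y = dyadic n x} y * ennreal (2 ^ (n * CARD('n)) * norm (f y))) \<partial>lborel)"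
    unfolding avg_def
  proof (rule nn_integral_mono)
    fix y
    show "indicator {y. dyadic (Suc n) y = dyadic (Suc n) x} y * ennreal (2 ^ (Suc n * CARD('n)) * norm (f y)) \<le> ennreal (2 ^ CARD('n)) * (indicator {y. dyadic n y = dyadic n x} y * ennreal (2 ^ (n * CARD('n)) * norm (f y)))"
      using dyadic_eq_mono[of "Suc n" y x n]
      by (auto simp: indicator_def power_add mult_ac simp flip: ennreal_mult)
  qed
  also have "\<dots> = ennreal (2 ^ CARD('n)) * avg n x"
    unfolding avg_def by (rule nn_integral_cmult) measurable
  finally show ?thesis .
qed

definition bad :: "(real ^ 'n) set" where
  "bad = {x. \<exists>n. ennreal \<mu> < avg n x}"

text \<open>The first generation whose cube around x has mean above \<open>\<mu>\<close>. Outside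
  \<open>bad\<close> there is no such generation and the value is unspecified, so \<open>lev\<close>
  is used there only behind a test for \<open>bad\<close>.\<close>

definition lev :: "real ^ 'n \<Rightarrow> nat" where
  "lev x = (LEAST n. ennreal \<mu> < avg n x)"

lemma bad_measurable [measurable]: "bad \<in> sets borel"
  unfolding bad_def by measurable

lemma lev_measurable [measurable]: "lev \<in> borel \<rightarrow>\<^sub>M count_space UNIV"
  unfolding lev_def by measurable

lemma avg_lev: "x \<in> bad \<Longrightarrow> ennreal \<mu> < avg (lev x) x"
  unfolding bad_def lev_def mem_Collect_eq by (rule LeastI_ex)

text \<open>The parent cube was not selected, so its mean is at most \<open>\<mu>\<close>, and
  passing to a child multiplies the mean by at most the ratio of the volumes.\<close>

lemma avg_lev_le:
  assumes "x \<in> bad"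
  shows "avg (lev x) x \<le> ennreal (2 ^ CARD('n) * \<mu>)"
proof -
  have "lev x \<noteq> 0" using avg_lev[OF assms] avg_0[of x] by (metis leD)
  then obtain n where n: "lev x = Suc n" using not0_implies_Suc by blast
  have "\<not> ennreal \<mu> < avg n x"
    by (rule not_less_Least) (simp add: n flip: lev_def)
  then have le: "avg n x \<le> ennreal \<mu>" by (simp only: not_less)
  have "avg (lev x) x \<le> ennreal (2 ^ CARD('n)) * avg n x" unfolding n by (rule avg_Suc)
  also have "\<dots> \<le> ennreal (2 ^ CARD('n)) * ennreal \<mu>" by (intro mult_left_mono le) auto
  also have "\<dots> = ennreal (2 ^ CARD('n) * \<mu>)" by (rule ennreal_mult'[symmetric]) auto
  finally show ?thesis .
qed

text \<open>Two points in a common cube of generation \<open>lev x\<close> share all coarser cubes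
  as well, hence all the means that decide where to stop.\<close>

lemma bad_cong:
  assumes "x \<in> bad" "dyadic (lev x) y = dyadic (lev x) x"
  shows "y \<in> bad" "lev y = lev x"
proof -
  have c: "avg m y = avg m x" if "m \<le> lev x" for m using avg_cong[OF assms(2) that] .
  have "ennreal \<mu> < avg (lev x) y" using avg_lev[OF assms(1)] c[of "lev x"] by simp
  then show b: "y \<in> bad" unfolding bad_def by blast
  show "lev y = lev x"
  proof (rule antisym)
    show "lev y \<le> lev x"
      using avg_lev[OF assms(1)] c[of "lev x"] unfolding lev_def[of y] by (intro Least_le) simp
    then show "lev x \<le> lev y"
      using avg_lev[OF b] c[of "lev y"] unfolding lev_def[of x] by (intro Least_le) simp
  qed
qed

text \<open>The Markov kernel that averages over the stopped cube of a point of \<^term>\<open>bad\<close>.  Its symmetry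
  replaces the usual sums over the disjoint stopped cubes by Fubini's theorem.\<close>

definition ker :: "real ^ 'n \<Rightarrow> real ^ 'n \<Rightarrow> real" where
  "ker x y = (if x \<in> bad \<and> dyadic (lev x) y = dyadic (lev x) x then 2 ^ (lev x * CARD('n)) else 0)"

lemma ker_nonneg [simp]: "0 \<le> ker x y"
  by (simp add: ker_def)

lemma ker_commute: "ker x y = ker y x"
proof -
  have "ker y x = ker x y" if "x \<in> bad" "dyadic (lev x) y = dyadic (lev x) x" for x y
    using bad_cong[OF that] that by (simp add: ker_def)
  then show ?thesis unfolding ker_def by (smt (verit, best))
qed

lemma ker_measurable [measurable]: "(\<lambda>(x, y). ker x y) \<in> borel_measurable (borel \<Otimes>\<^sub>M borel)"
  unfolding ker_def by measurable

lemma nn_integral_ker: "(\<integral>\<^sup>+y. ennreal (ker x y) \<partial>lborel) = indicator bad x"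
proof (cases "x \<in> bad")
  case True
  have "(\<integral>\<^sup>+y. ennreal (ker x y) \<partial>lborel) = (\<integral>\<^sup>+y. ennreal (2 ^ (lev x * CARD('n))) * indicator {y. dyadic (lev x) y = dyadic (lev x) x} y \<partial>lborel)"
    using True by (intro nn_integral_cong) (auto simp: ker_def indicator_def)
  also have "\<dots> = ennreal (2 ^ (lev x * CARD('n))) * ennreal (1 / 2 ^ (lev x * CARD('n)))"
    by (subst nn_integral_cmult_indicator) (auto simp: emeasure_dyadic)
  finally show ?thesis using True by (simp flip: ennreal_mult)
qed (simp add: ker_def)

lemma nn_integral_ker_f: "x \<in> bad \<Longrightarrow> (\<integral>\<^sup>+y. ennreal (ker x y * norm (f y)) \<partial>lborel) = avg (lev x) x"
  unfolding avg_def by (intro nn_integral_cong) (auto simp: ker_def indicator_def)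

definition tau :: real where
  "tau = (LINT x|lborel. indicator bad x * norm (f x))"

lemma tau_nonneg [simp]: "0 \<le> tau"
  unfolding tau_def by simp

lemma integrable_bad_f: "integrable lborel (\<lambda>x. indicator bad x * norm (f x))"
  by (rule Bochner_Integration.integrable_bound[OF integrable_norm[OF f]]) (auto simp: indicator_def)

lemma nn_integral_bad_f: "(\<integral>\<^sup>+x. indicator bad x * ennreal (norm (f x)) \<partial>lborel) = ennreal tau"
proof -
  have "(\<integral>\<^sup>+x. indicator bad x * ennreal (norm (f x)) \<partial>lborel) = (\<integral>\<^sup>+x. ennreal (indicator bad x * norm (f x)) \<partial>lborel)"
    by (intro nn_integral_cong) (auto simp: indicator_def)
  then show ?thesis
    unfolding tau_def by (subst nn_integral_eq_integral[OF integrable_bad_f, symmetric]) auto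
qed

lemma tau_le: "tau \<le> (LINT x|lborel. norm (f x))"
  unfolding tau_def by (intro integral_mono integrable_bad_f integrable_norm f) (auto simp: indicator_def)

text \<open>After Tonelli's theorem and the symmetry of \<open>ker\<close>, the inner integral is
  the mass of a Markov kernel, so averaging preserves the mass of f on \<open>bad\<close>.\<close>

lemma nn_integral_ker_ker: "(\<integral>\<^sup>+x. \<integral>\<^sup>+y. ennreal (ker x y * norm (f y)) \<partial>lborel \<partial>lborel) = ennreal tau"
proof -
  have "(\<integral>\<^sup>+x. \<integral>\<^sup>+y. ennreal (ker x y * norm (f y)) \<partial>lborel \<partial>lborel) = (\<integral>\<^sup>+y. \<integral>\<^sup>+x. ennreal (ker x y * norm (f y)) \<partial>lborel \<partial>lborel)"
    by (rule lborel_pair.Fubini'[symmetric]) measurable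
  also have "\<dots> = (\<integral>\<^sup>+y. \<integral>\<^sup>+x. ennreal (ker y x) * ennreal (norm (f y)) \<partial>lborel \<partial>lborel)"
    by (intro nn_integral_cong) (simp add: ker_commute ennreal_mult)
  also have "\<dots> = (\<integral>\<^sup>+y. indicator bad y * ennreal (norm (f y)) \<partial>lborel)"
    by (intro nn_integral_cong, subst nn_integral_multc) (auto simp: nn_integral_ker)
  finally show ?thesis by (simp add: nn_integral_bad_f)
qed

text \<open>Chebyshev's inequality for the stopped means. With \<open>tau\<close> instead of the
  full norm of f in the numerator, the measure is of smaller order than
  \<open>1 / \<mu>\<close>.\<close>

lemma emeasure_bad: "emeasure lborel bad \<le> ennreal (tau / \<mu>)"
proof -
  have "ennreal \<mu> * emeasure lborel bad = (\<integral>\<^sup>+x. ennreal \<mu> * indicator bad x \<partial>lborel)"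
    by (subst nn_integral_cmult_indicator) auto
  also have "\<dots> \<le> (\<integral>\<^sup>+x. \<integral>\<^sup>+y. ennreal (ker x y * norm (f y)) \<partial>lborel \<partial>lborel)"
    using less_imp_le[OF avg_lev] by (intro nn_integral_mono) (auto simp: indicator_def nn_integral_ker_f)
  finally have "ennreal \<mu> * emeasure lborel bad \<le> ennreal tau" by (simp add: nn_integral_ker_ker)
  then have "ennreal (1 / \<mu>) * (ennreal \<mu> * emeasure lborel bad) \<le> ennreal (1 / \<mu>) * ennreal tau"
    by (intro mult_left_mono) auto
  then show ?thesis using \<mu>(2)
    by (simp add: mult.assoc[symmetric] flip: ennreal_mult)
qed

definition good :: "real ^ 'n \<Rightarrow> complex" where
  "good x = (if x \<in> bad then (LINT y|lborel. of_real (ker x y) * f y) else f x)"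

lemma good_measurable [measurable]: "good \<in> borel_measurable borel"
  unfolding good_def by measurable

lemma integrable_ker_f: "integrable lborel (\<lambda>y. of_real (ker x y) * f y)"
  by (rule integrable_mult_bounded(2)[OF f, where B = "2 ^ (lev x * CARD('n))"]) (auto simp: ker_def)

lemma good_le_avg: "x \<in> bad \<Longrightarrow> ennreal (norm (good x)) \<le> avg (lev x) x"
  using integral_norm_bound_ennreal[OF integrable_ker_f[of x]] nn_integral_ker_f[of x]
  by (simp add: good_def norm_mult)

lemma norm_good_le:
  assumes "x \<in> bad"
  shows "norm (good x) \<le> 2 ^ CARD('n) * \<mu>"
  using order_trans[OF good_le_avg[OF assms] avg_lev_le[OF assms]] \<mu>(2) by (subst (asm) ennreal_le_iff) auto

lemma nn_integral_bad_good: "(\<integral>\<^sup>+x. indicator bad x * ennreal (norm (good x)) \<partial>lborel) \<le> ennreal tau"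
proof -
  have "(\<integral>\<^sup>+x. indicator bad x * ennreal (norm (good x)) \<partial>lborel) \<le> (\<integral>\<^sup>+x. \<integral>\<^sup>+y. ennreal (ker x y * norm (f y)) \<partial>lborel \<partial>lborel)"
    using good_le_avg by (intro nn_integral_mono) (auto simp: indicator_def nn_integral_ker_f)
  then show ?thesis by (simp add: nn_integral_ker_ker)
qed

lemma nn_integral_f_good: "(\<integral>\<^sup>+x. ennreal (norm (f x - good x)) \<partial>lborel) \<le> ennreal (2 * tau)"
proof -
  have "(\<integral>\<^sup>+x. ennreal (norm (f x - good x)) \<partial>lborel) \<le> (\<integral>\<^sup>+x. indicator bad x * ennreal (norm (f x)) + indicator bad x * ennreal (norm (good x)) \<partial>lborel)"
  proof (rule nn_integral_mono)
    fix x
    show "ennreal (norm (f x - good x)) \<le> indicator bad x * ennreal (norm (f x)) + indicator bad x * ennreal (norm (good x))"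
      by (cases "x \<in> bad") (auto simp: norm_triangle_ineq4 good_def[of x] simp flip: ennreal_plus intro!: ennreal_leI)
  qed
  also have "\<dots> \<le> ennreal tau + ennreal tau"
    by (subst nn_integral_add) (auto simp: nn_integral_bad_f intro!: add_left_mono nn_integral_bad_good)
  finally show ?thesis by (simp flip: ennreal_plus)
qed

lemma integrable_f_good: "integrable lborel (\<lambda>x. f x - good x)"
  using nn_integral_f_good by (auto simp: integrable_iff_bounded intro: order.strict_trans1)

lemma integrable_good: "integrable lborel good"
  using Bochner_Integration.integrable_diff[OF f integrable_f_good] by simp

text \<open>A set outside \<^term>\<open>bad\<close> on which \<open>\<bar>f\<bar> \<ge> \<mu> + \<delta>\<close> is covered by dyadic cubes inside a
  slightly larger open set, and on each of these cubes the mean of \<open>\<bar>f\<bar>\<close> is at most \<open>\<mu>\<close>.\<close>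

lemma nn_integral_saturated_le:
  assumes "B \<inter> bad = {}" "B' = {y. \<exists>x\<in>B. dyadic n y = dyadic n x}"
  shows "(\<integral>\<^sup>+x. indicator B' x * ennreal (norm (f x)) \<partial>lborel) \<le> ennreal \<mu> * emeasure lborel B'"
proof -
  have "B' = dyadic n -` (dyadic n ` B) \<inter> space borel" using assms(2) by auto
  then have [measurable]: "B' \<in> sets borel"
    using measurable_sets[OF measurable_dyadic, of "dyadic n ` B" n] by (simp only: UNIV_I sets_count_space Pow_UNIV)
  have c: "avg n x \<le> ennreal \<mu>" if "x \<in> B'" for x
  proof -
    obtain z where "z \<in> B" "dyadic n x = dyadic n z" using \<open>x \<in> B'\<close> assms(2) by auto
    then have "z \<notin> bad" "avg n x = avg n z" using assms(1) avg_cong[of n x z n] by auto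
    then show ?thesis by (auto simp: bad_def not_less)
  qed
  have "(\<integral>\<^sup>+x. indicator B' x * ennreal (norm (f x)) \<partial>lborel) =
     (\<integral>\<^sup>+y. \<integral>\<^sup>+x. indicator B' x * ((if dyadic n x = dyadic n y then 1 else 0) * ennreal (2 ^ (n * CARD('n)) * norm (f y))) \<partial>lborel \<partial>lborel)"
  proof (rule nn_integral_cong)
    fix y
    have "(\<integral>\<^sup>+x. indicator B' x * ((if dyadic n x = dyadic n y then 1 else 0) * ennreal (2 ^ (n * CARD('n)) * norm (f y))) \<partial>lborel) =
       (\<integral>\<^sup>+x. (indicator B' y * ennreal (2 ^ (n * CARD('n)) * norm (f y))) * indicator {x. dyadic n x = dyadic n y} x \<partial>lborel)"
      using assms(2) by (intro nn_integral_cong) (auto simp: indicator_def)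
    also have "\<dots> = (indicator B' y * ennreal (2 ^ (n * CARD('n)) * norm (f y))) * ennreal (1 / 2 ^ (n * CARD('n)))"
      by (subst nn_integral_cmult_indicator) (auto simp: emeasure_dyadic)
    also have "\<dots> = indicator B' y * ennreal (norm (f y))"
      by (auto simp: indicator_def simp flip: ennreal_mult)
    finally show "indicator B' y * ennreal (norm (f y)) = (\<integral>\<^sup>+x. indicator B' x * ((if dyadic n x = dyadic n y then 1 else 0) * ennreal (2 ^ (n * CARD('n)) * norm (f y))) \<partial>lborel)"
      by simp
  qed
  also have "\<dots> = (\<integral>\<^sup>+x. \<integral>\<^sup>+y. indicator B' x * ((if dyadic n x = dyadic n y then 1 else 0) * ennreal (2 ^ (n * CARD('n)) * norm (f y))) \<partial>lborel \<partial>lborel)"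
    by (rule lborel_pair.Fubini') measurable
  also have "\<dots> = (\<integral>\<^sup>+x. indicator B' x * avg n x \<partial>lborel)"
  proof (rule nn_integral_cong)
    fix x
    have "(\<integral>\<^sup>+y. indicator B' x * ((if dyadic n x = dyadic n y then 1 else 0) * ennreal (2 ^ (n * CARD('n)) * norm (f y))) \<partial>lborel) =
      indicator B' x * (\<integral>\<^sup>+y. (if dyadic n x = dyadic n y then 1 else 0) * ennreal (2 ^ (n * CARD('n)) * norm (f y)) \<partial>lborel)"
      by (rule nn_integral_cmult) measurable
    also have "(\<integral>\<^sup>+y. (if dyadic n x = dyadic n y then 1 else 0) * ennreal (2 ^ (n * CARD('n)) * norm (f y)) \<partial>lborel) = avg n x"
      unfolding avg_def by (intro nn_integral_cong) (auto simp: indicator_def)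
    finally show "(\<integral>\<^sup>+y. indicator B' x * ((if dyadic n x = dyadic n y then 1 else 0) * ennreal (2 ^ (n * CARD('n)) * norm (f y))) \<partial>lborel) =
      indicator B' x * avg n x" .
  qed
  also have "\<dots> \<le> (\<integral>\<^sup>+x. ennreal \<mu> * indicator B' x \<partial>lborel)"
    using c by (intro nn_integral_mono) (auto simp: indicator_def)
  also have "\<dots> = ennreal \<mu> * emeasure lborel B'" by (rule nn_integral_cmult_indicator) simp
  finally show ?thesis .
qed

text \<open>This takes the place of Lebesgue's differentiation theorem. Enclose B in an open set U
  of nearly the same measure and exhaust it by the points whose cube of generation n lies inside U.
  The saturation of such a part stays in U and has means at most \<open>\<mu>\<close>, while f is at
  least \<open>\<mu> + \<delta>\<close> on the part itself.\<close>

lemma emeasure_large_outside_bad: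
  assumes B: "B \<in> sets borel" "emeasure lborel B < \<infinity>" and \<delta>: "\<delta> > 0"
    and fB: "\<And>x. x \<in> B \<Longrightarrow> x \<notin> bad \<and> \<mu> + \<delta> \<le> norm (f x)"
  shows "emeasure lborel B = 0"
proof (rule ccontr)
  assume ne: "emeasure lborel B \<noteq> 0"
  define m where "m = measure lborel B"
  have m: "emeasure lborel B = ennreal m" using B(2) unfolding m_def by (intro emeasure_eq_ennreal_measure) auto
  have mp: "m > 0" using ne m by (metis ennreal_eq_0_iff not_le)
  \<comment> \<open>The excess is chosen so that \<open>\<mu> * e\<close> is half of
    \<open>\<delta> * m\<close>; then (\<open>\<mu>\<close> + \<open>\<delta>\<close>) m cannot be
    at most \<open>\<mu>\<close> (m + e).\<close>
  define e where "e = \<delta> * m / (2 * \<mu>)"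
  have e: "e > 0" using \<delta> mp \<mu>(2) by (simp add: e_def)
  obtain U where U: "open U" "B \<subseteq> U" "emeasure lborel (U - B) < e"
    using outer_regular_lborel[OF B(1) e] .
  have [measurable]: "U \<in> sets borel" "B \<in> sets borel" using U(1) B(1) by auto
  have "emeasure lborel U = emeasure lborel B + emeasure lborel (U - B)"
    using U(2) by (subst plus_emeasure) (auto simp: Un_absorb1)
  also have "\<dots> \<le> ennreal m + ennreal e" using U(3) m by (intro add_mono) auto
  finally have Um: "emeasure lborel U \<le> ennreal (m + e)" using mp e by simp
  define Bn where "Bn n = {x\<in>B. \<forall>y. dyadic n y = dyadic n x \<longrightarrow> y \<in> U}" for n
  have "Bn n = B \<inter> (dyadic n -` {k. \<forall>y. dyadic n y = k \<longrightarrow> y \<in> U} \<inter> space borel)" for n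
    by (auto simp: Bn_def)
  then have [measurable]: "Bn n \<in> sets borel" for n by simp
  have inc: "incseq Bn"
    by (rule incseq_SucI) (auto simp: Bn_def dest: dyadic_eq_mono[of "Suc _" _ _ "_", OF _ le_SucI[OF order_refl]])
  have un: "(\<Union>n. Bn n) = B"
  proof
    show "B \<subseteq> (\<Union>n. Bn n)"
    proof
      fix x assume x: "x \<in> B"
      then obtain r where r: "r > 0" "ball x r \<subseteq> U" using U open_contains_ball by blast
      have "(\<lambda>n. real CARD('n) / 2 ^ n) \<longlonglongrightarrow> 0" by real_asymp
      then have "eventually (\<lambda>n. real CARD('n) / 2 ^ n < r) sequentially" using r(1) by (rule order_tendstoD)
      then obtain n where n: "real CARD('n) / 2 ^ n < r" by (auto simp: eventually_sequentially)
      have "x \<in> Bn n"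
        unfolding Bn_def using x r(2) dyadic_eq_norm_le[of n _ x] n
        by (fastforce simp: dist_norm norm_minus_commute)
      then show "x \<in> (\<Union>n. Bn n)" by auto
    qed
  qed (auto simp: Bn_def)
  have "ennreal (\<mu> + \<delta>) * emeasure lborel (Bn n) \<le> ennreal (\<mu> * (m + e))" for n
  proof -
    define B' where "B' = {y. \<exists>x\<in>Bn n. dyadic n y = dyadic n x}"
    have "B' = dyadic n -` (dyadic n ` Bn n) \<inter> space borel" unfolding B'_def by auto
    then have [measurable]: "B' \<in> sets borel"
      using measurable_sets[OF measurable_dyadic, of "dyadic n ` Bn n" n] by (simp only: UNIV_I sets_count_space Pow_UNIV)
    have "ennreal (\<mu> + \<delta>) * emeasure lborel (Bn n) = (\<integral>\<^sup>+x. ennreal (\<mu> + \<delta>) * indicator (Bn n) x \<partial>lborel)"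
      by (subst nn_integral_cmult_indicator) auto
    also have "\<dots> \<le> (\<integral>\<^sup>+x. indicator B' x * ennreal (norm (f x)) \<partial>lborel)"
      using fB by (intro nn_integral_mono) (auto simp: indicator_def B'_def Bn_def intro!: ennreal_leI)
    also have "\<dots> \<le> ennreal \<mu> * emeasure lborel B'"
      by (rule nn_integral_saturated_le[where B = "Bn n", OF _ B'_def]) (use fB in \<open>auto simp: Bn_def\<close>)
    also have "\<dots> \<le> ennreal \<mu> * emeasure lborel U"
      by (intro mult_left_mono emeasure_mono) (auto simp: B'_def Bn_def)
    also have "\<dots> \<le> ennreal \<mu> * ennreal (m + e)" by (intro mult_left_mono Um) auto
    finally show ?thesis using \<mu>(2) mp e by (simp add: ennreal_mult)
  qed
  moreover have "(\<lambda>n. ennreal (\<mu> + \<delta>) * emeasure lborel (Bn n)) \<longlonglongrightarrow> ennreal (\<mu> + \<delta>) * emeasure lborel B"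
  proof (intro ennreal_tendsto_cmult)
    have "range Bn \<subseteq> sets lborel" by auto
    from Lim_emeasure_incseq[OF this inc] show "(\<lambda>n. emeasure lborel (Bn n)) \<longlonglongrightarrow> emeasure lborel B"
      unfolding un .
  qed auto
  ultimately have "ennreal (\<mu> + \<delta>) * emeasure lborel B \<le> ennreal (\<mu> * (m + e))"
    by (intro LIMSEQ_le_const2) auto
  moreover have "ennreal (\<mu> + \<delta>) * emeasure lborel B = ennreal ((\<mu> + \<delta>) * m)"
    unfolding m using mp \<mu>(2) \<delta> by (intro ennreal_mult[symmetric]) auto
  ultimately have "(\<mu> + \<delta>) * m \<le> \<mu> * (m + e)"
    using mp \<mu>(2) e ennreal_le_iff[of "\<mu> * (m + e)" "(\<mu> + \<delta>) * m"] by simp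
  then show False using mp \<mu>(2) \<delta> by (simp add: e_def field_simps)
qed

lemma AE_norm_f_le: "AE x in lborel. x \<notin> bad \<longrightarrow> norm (f x) \<le> \<mu>"
proof -
  \<comment> \<open>Countably many sets of finite measure exhaust the points to be excluded;
    intersecting with balls provides the finiteness.\<close>
  define B where "B j = {x. x \<notin> bad \<and> \<mu> + 1 / real (Suc j) \<le> norm (f x) \<and> norm x \<le> real j}" for j
  have [measurable]: "B j \<in> sets borel" for j unfolding B_def by measurable
  have "emeasure lborel (B j) = 0" for j
  proof (rule emeasure_large_outside_bad)
    have "emeasure lborel (B j) \<le> emeasure lborel (cball (0 :: real ^ 'n) (real j))"
      by (rule emeasure_mono) (auto simp: B_def)
    then show "emeasure lborel (B j) < \<infinity>"
      using emeasure_lborel_cball_finite[of "0 :: real ^ 'n" "real j"] by (simp add: order.strict_trans1 less_top)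
  qed (auto simp: B_def)
  then have "AE x in lborel. \<forall>j. x \<notin> B j"
    by (subst AE_all_countable) (auto intro!: AE_not_in simp: null_sets_def)
  then show ?thesis
  proof eventually_elim
    case (elim x)
    show ?case
    proof (rule ccontr)
      assume "\<not> ?case"
      then have x: "x \<notin> bad" "norm (f x) - \<mu> > 0" by auto
      obtain j where j: "1 / real (Suc j) < norm (f x) - \<mu>"
        using nat_approx_posE[OF x(2)] by blast
      obtain k where k: "norm x \<le> real k" using real_arch_simple by blast
      have "1 / real (Suc (max j k)) \<le> 1 / real (Suc j)" by (intro divide_left_mono) auto
      then have "x \<in> B (max j k)" using x j k by (auto simp: B_def)
      then show False using elim by blast
    qed
  qed
qed

text \<open>On \<open>bad\<close> the good part is at most \<open>2 ^ CARD('n) * \<mu>\<close>,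
  elsewhere almost everywhere at most \<open>\<mu>\<close>. One factor of the square is bounded this
  way and the other is integrated, so the result is linear in \<open>\<mu>\<close>.\<close>

lemma nn_integral_good_square: "(\<integral>\<^sup>+x. ennreal ((norm (good x))\<^sup>2) \<partial>lborel) \<le> ennreal ((2 ^ CARD('n) + 1) * \<mu> * (LINT x|lborel. norm (f x)))"
proof -
  let ?F = "LINT x|lborel. norm (f x)"
  have "AE x in lborel. ennreal ((norm (good x))\<^sup>2) \<le> ennreal (2 ^ CARD('n) * \<mu>) * (indicator bad x * ennreal (norm (good x))) + ennreal \<mu> * ennreal (norm (f x))"
    using AE_norm_f_le
  proof eventually_elim
    case (elim x)
    show ?case
    proof (cases "x \<in> bad")
      case True
      have "(norm (good x))\<^sup>2 \<le> 2 ^ CARD('n) * \<mu> * norm (good x)"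
        unfolding power2_eq_square by (intro mult_right_mono norm_good_le[OF True]) auto
      then have "ennreal ((norm (good x))\<^sup>2) \<le> ennreal (2 ^ CARD('n) * \<mu>) * ennreal (norm (good x))"
        using \<mu>(2) by (simp add: ennreal_leI flip: ennreal_mult)
      then show ?thesis using True by (simp add: add_increasing2)
    next
      case False
      have "(norm (good x))\<^sup>2 \<le> \<mu> * norm (f x)"
        using False elim unfolding good_def power2_eq_square by (simp add: mult_right_mono)
      then show ?thesis using False \<mu>(2) by (simp add: ennreal_leI flip: ennreal_mult)
    qed
  qed
  then have "(\<integral>\<^sup>+x. ennreal ((norm (good x))\<^sup>2) \<partial>lborel) \<le> (\<integral>\<^sup>+x. ennreal (2 ^ CARD('n) * \<mu>) * (indicator bad x * ennreal (norm (good x))) + ennreal \<mu> * ennreal (norm (f x)) \<partial>lborel)"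
    by (rule nn_integral_mono_AE)
  also have "\<dots> = ennreal (2 ^ CARD('n) * \<mu>) * (\<integral>\<^sup>+x. indicator bad x * ennreal (norm (good x)) \<partial>lborel) + ennreal \<mu> * (\<integral>\<^sup>+x. ennreal (norm (f x)) \<partial>lborel)"
    by (subst nn_integral_add) (auto simp: nn_integral_cmult)
  also have "(\<integral>\<^sup>+x. ennreal (norm (f x)) \<partial>lborel) = ennreal ?F"
    using f by (intro nn_integral_eq_integral) auto
  also have "ennreal (2 ^ CARD('n) * \<mu>) * (\<integral>\<^sup>+x. indicator bad x * ennreal (norm (good x)) \<partial>lborel) + ennreal \<mu> * ennreal ?F \<le>
      ennreal (2 ^ CARD('n) * \<mu>) * ennreal ?F + ennreal \<mu> * ennreal ?F"
    by (intro add_mono mult_left_mono order_trans[OF nn_integral_bad_good] ennreal_leI tau_le) auto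
  also have "\<dots> = ennreal ((2 ^ CARD('n) + 1) * \<mu> * ?F)"
    using \<mu>(2) by (simp add: algebra_simps flip: ennreal_mult ennreal_plus)
  finally show ?thesis .
qed

text \<open>A bound for the diameter of the stopped cube of y, as supplied by
  \<open>dyadic_eq_norm_le\<close>.\<close>

definition rad_at :: "real ^ 'n \<Rightarrow> real" where
  "rad_at y = real CARD('n) / 2 ^ lev y"

lemma rad_at_pos: "rad_at y > 0"
  by (simp add: rad_at_def)

lemma rad_at_measurable [measurable]: "rad_at \<in> borel_measurable borel"
  unfolding rad_at_def by measurable

lemma ker_nonzero:
  assumes "ker y y' \<noteq> 0"
  shows "y \<in> bad" "y' \<in> bad" "rad_at y' = rad_at y" "norm (y - y') \<le> rad_at y"
proof -
  have *: "y \<in> bad" "dyadic (lev y) y' = dyadic (lev y) y" using assms by (auto simp: ker_def split: if_splits)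
  then show "y \<in> bad" "y' \<in> bad" "rad_at y' = rad_at y" using bad_cong[OF *] by (auto simp: rad_at_def)
  show "norm (y - y') \<le> rad_at y" using dyadic_eq_norm_le[OF *(2)[symmetric]] by (simp add: rad_at_def)
qed

text \<open>The exceptional set. A union of open balls over all points of \<open>bad\<close> is
  open, hence measurable, without selecting countably many cubes. The factor 3 leaves a margin over
  the factor 2 in the Hoermander condition.\<close>

definition big :: "(real ^ 'n) set" where
  "big = (\<Union>y\<in>bad. ball y (3 * rad_at y))"

lemma big_measurable [measurable]: "big \<in> sets borel"
  unfolding big_def by (intro borel_open open_UN) auto

text \<open>If x lies within 3 radii of y0, the whole stopped cube of y0 lies within 4 radii of x,
  and \<open>ker y0\<close> has mass 1 on it. So the indicator of \<open>big\<close> is at most an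
  integral over y, which Tonelli's theorem evaluates ball by ball; no covering argument is
  involved.\<close>

lemma emeasure_big: "emeasure lborel big \<le> ennreal (unit_ball_vol (real CARD('n)) * (4 * real CARD('n)) ^ CARD('n) * (tau / \<mu>))"
proof -
  let ?K = "unit_ball_vol (real CARD('n)) * (4 * real CARD('n)) ^ CARD('n)"
  let ?g = "\<lambda>x y. (if norm (x - y) \<le> 4 * rad_at y then 1 else 0) * (indicator bad y * ennreal (2 ^ (lev y * CARD('n))))"
  have 1: "indicator big x \<le> (\<integral>\<^sup>+y. ?g x y \<partial>lborel)" for x
  proof (cases "x \<in> big")
    case True
    then obtain y0 where y0: "y0 \<in> bad" "norm (x - y0) < 3 * rad_at y0"
      unfolding big_def by (auto simp: dist_norm norm_minus_commute)
    have "ennreal (ker y0 y) \<le> ?g x y" for y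
    proof (cases "ker y0 y = 0")
      case False
      note k = ker_nonzero[OF False]
      have "norm (x - y) \<le> 4 * rad_at y"
        using norm_triangle_ineq[of "x - y0" "y0 - y"] k(3,4) y0(2) by simp
      moreover have "lev y = lev y0" using False bad_cong(2)[of y0 y] by (auto simp: ker_def split: if_splits)
      ultimately show ?thesis using k(2) by (simp add: ker_def)
    qed simp
    then have "(\<integral>\<^sup>+y. ennreal (ker y0 y) \<partial>lborel) \<le> (\<integral>\<^sup>+y. ?g x y \<partial>lborel)" by (rule nn_integral_mono)
    then show ?thesis using True y0(1) by (simp add: nn_integral_ker)
  qed simp
  have 2: "(\<integral>\<^sup>+x. ?g x y \<partial>lborel) = ennreal ?K * indicator bad y" for y
  proof -
    have "(\<integral>\<^sup>+x. ?g x y \<partial>lborel) = (\<integral>\<^sup>+x. (indicator bad y * ennreal (2 ^ (lev y * CARD('n)))) * indicator (cball y (4 * rad_at y)) x \<partial>lborel)"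
      by (intro nn_integral_cong) (auto simp: indicator_def dist_norm norm_minus_commute)
    also have "\<dots> = (indicator bad y * ennreal (2 ^ (lev y * CARD('n)))) * ennreal (unit_ball_vol (real CARD('n)) * (4 * rad_at y) ^ CARD('n))"
      using rad_at_pos[of y] by (subst nn_integral_cmult_indicator) (auto simp: emeasure_cball)
    also have "\<dots> = ennreal ?K * indicator bad y"
    proof -
      have "2 ^ (lev y * CARD('n)) * (4 * rad_at y) ^ CARD('n) = (4 * real CARD('n)) ^ CARD('n)"
        by (simp add: rad_at_def power_mult power_mult_distrib power_divide)
      then have eq: "2 ^ (lev y * CARD('n)) * (unit_ball_vol (real CARD('n)) * (4 * rad_at y) ^ CARD('n)) = ?K"
        by (simp only: mult_ac)
      then have "ennreal (2 ^ (lev y * CARD('n))) * ennreal (unit_ball_vol (real CARD('n)) * (4 * rad_at y) ^ CARD('n)) = ennreal ?K"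
        by (subst ennreal_mult'[symmetric], simp, simp only: eq)
      then show ?thesis by (simp add: indicator_def)
    qed
    finally show ?thesis .
  qed
  have "emeasure lborel big = (\<integral>\<^sup>+x. indicator big x \<partial>lborel)" by simp
  also have "\<dots> \<le> (\<integral>\<^sup>+x. \<integral>\<^sup>+y. ?g x y \<partial>lborel \<partial>lborel)" by (intro nn_integral_mono 1)
  also have "\<dots> = (\<integral>\<^sup>+y. \<integral>\<^sup>+x. ?g x y \<partial>lborel \<partial>lborel)"
    by (rule lborel_pair.Fubini'[symmetric]) measurable
  also have "\<dots> = ennreal ?K * emeasure lborel bad"
    unfolding 2 by (rule nn_integral_cmult_indicator) simp
  also have "\<dots> \<le> ennreal ?K * ennreal (tau / \<mu>)" by (intro mult_left_mono emeasure_bad) auto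
  also have "\<dots> = ennreal (?K * (tau / \<mu>))"
    using \<mu>(2) unit_ball_vol_nonneg[of "real CARD('n)"] by (subst ennreal_mult) auto
  finally show ?thesis .
qed

text \<open>The mean zero property on each stopped cube is encoded by \<open>ker\<close>: the bad
  part is f minus its average, so the convolution becomes a double integral of differences of k at
  two points of a common cube. Off \<open>big\<close> each difference is covered by the Hoermander
  condition.\<close>

lemma nn_integral_conv_bad_part:
  fixes k :: "real ^ 'n \<Rightarrow> real"
  assumes k[measurable]: "k \<in> borel_measurable borel" and kb: "\<And>x. \<bar>k x\<bar> \<le> B" and C: "C \<ge> 0"
    and H: "\<And>v r. 0 < r \<Longrightarrow> norm v \<le> r \<Longrightarrow>
      (\<integral>\<^sup>+x. indicator {x. 2 * r < norm x} x * ennreal \<bar>k (x + v) - k x\<bar> \<partial>lborel) \<le> ennreal C"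
  shows "(\<integral>\<^sup>+x. indicator (- big) x * ennreal (norm (LINT y|lborel. of_real (k (x - y)) * (f y - good y))) \<partial>lborel) \<le> ennreal (C * tau)"
proof -
  have B: "B \<ge> 0" using kb[of 0] by linarith
  have fin: "(\<integral>\<^sup>+y. \<integral>\<^sup>+y'. ennreal (norm (of_real (g y y' * ker y y') * f y)) \<partial>lborel \<partial>lborel) < \<infinity>"
    if g: "\<And>y y'. \<bar>g y y'\<bar> \<le> M" for g M
  proof -
    have M: "M \<ge> 0" using g[of undefined undefined] by linarith
    have "(\<integral>\<^sup>+y. \<integral>\<^sup>+y'. ennreal (norm (of_real (g y y' * ker y y') * f y)) \<partial>lborel \<partial>lborel) \<le>
      (\<integral>\<^sup>+y. \<integral>\<^sup>+y'. ennreal (M * norm (f y)) * ennreal (ker y y') \<partial>lborel \<partial>lborel)"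
    proof (intro nn_integral_mono)
      fix y y'
      have "norm (of_real (g y y' * ker y y') * f y) = \<bar>g y y'\<bar> * (ker y y' * norm (f y))"
        by (simp add: norm_mult abs_mult)
      also have "\<dots> \<le> M * (ker y y' * norm (f y))" by (intro mult_right_mono g) auto
      finally show "ennreal (norm (of_real (g y y' * ker y y') * f y)) \<le> ennreal (M * norm (f y)) * ennreal (ker y y')"
        using M by (simp add: ennreal_leI mult_ac flip: ennreal_mult)
    qed
    also have "\<dots> \<le> (\<integral>\<^sup>+y. ennreal (M * norm (f y)) \<partial>lborel)"
      by (intro nn_integral_mono, subst nn_integral_cmult) (auto simp: nn_integral_ker indicator_def)
    also have "\<dots> < \<infinity>" using integrable_nn_finite[OF integrable_mult_right[OF integrable_norm[OF f], of M]] M by simp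
    finally show ?thesis .
  qed
  \<comment> \<open>Integrating out the second variable in the first term gives f on
    \<open>bad\<close>, and integrating out the first variable in the second term gives
    \<open>good\<close> on \<open>bad\<close>.\<close>
  have rep: "(LINT y|lborel. of_real (k (x - y)) * (f y - good y)) =
     (LINT y|lborel. LINT y'|lborel. of_real ((k (x - y) - k (x - y')) * ker y y') * f y)" for x
  proof -
    let ?F1 = "\<lambda>y y'. complex_of_real (k (x - y) * ker y y') * f y"
    let ?F2 = "\<lambda>y y'. complex_of_real (k (x - y') * ker y y') * f y"
    have fin1: "(\<integral>\<^sup>+y. \<integral>\<^sup>+y'. ennreal (norm (?F1 y y')) \<partial>lborel \<partial>lborel) < \<infinity>"
      by (rule fin[where M = B]) (rule kb)
    have fin2: "(\<integral>\<^sup>+y. \<integral>\<^sup>+y'. ennreal (norm (?F2 y y')) \<partial>lborel \<partial>lborel) < \<infinity>"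
      by (rule fin[where M = B]) (rule kb)
    have m1: "case_prod ?F1 \<in> borel_measurable (lborel \<Otimes>\<^sub>M lborel)" by measurable
    have m2: "case_prod ?F2 \<in> borel_measurable (lborel \<Otimes>\<^sub>M lborel)" by measurable
    have ik: "integrable lborel (ker y)" for y
      by (rule integrableI_nn_integral_finite[where x = "indicator bad y"])
        (auto simp: nn_integral_ker indicator_def)
    have lk: "(LINT y'|lborel. ker y y') = indicator bad y" for y
      using nn_integral_eq_integral[OF ik[of y]] nn_integral_ker[of y]
      by (auto simp: indicator_def split: if_splits)
    have i1: "(LINT y'|lborel. ?F1 y y') = of_real (k (x - y)) * (indicator bad y * f y)" for y
    proof -
      have "?F1 y y' = of_real (ker y y') * (of_real (k (x - y)) * f y)" for y' by simp
      then have "(LINT y'|lborel. ?F1 y y') = of_real (LINT y'|lborel. ker y y') * (of_real (k (x - y)) * f y)"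
        by (simp only: integral_mult_left_zero integral_complex_of_real)
      then show ?thesis by (simp add: lk indicator_def)
    qed
    \<comment> \<open>Symmetry of \<open>ker\<close> turns the integral over the first variable into
      the defining average of \<open>good\<close>.\<close>
    have i2: "(LINT y|lborel. ?F2 y y') = of_real (k (x - y')) * (indicator bad y' * good y')" for y'
    proof -
      have "?F2 y y' = of_real (k (x - y')) * (of_real (ker y' y) * f y)" for y
        by (simp add: ker_commute)
      then have "(LINT y|lborel. ?F2 y y') = of_real (k (x - y')) * (LINT y|lborel. of_real (ker y' y) * f y)"
        by (simp only: integral_mult_right_zero)
      also have "(LINT y|lborel. of_real (ker y' y) * f y) = indicator bad y' * good y'"
        by (cases "y' \<in> bad") (auto simp: good_def ker_def)
      finally show ?thesis .
    qed
    have kk: "integrable lborel (\<lambda>y'. of_real (k (x - y')) * (indicator bad y' * good y'))"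
      using fubini_integrable_snd[OF m2 fin2] by (simp only: i2)
    have kk1: "integrable lborel (\<lambda>y. of_real (k (x - y)) * (indicator bad y * f y))"
      using fubini_integrable_fst[OF m1 fin1] by (simp only: i1)
    have s: "(LINT y|lborel. LINT y'|lborel. ?F2 y y') = (LINT y'|lborel. of_real (k (x - y')) * (indicator bad y' * good y'))"
      using fubini_swap[OF m2 fin2] by (simp only: i2)
    have inn: "integrable lborel (\<lambda>y'. ?F1 y y')" "integrable lborel (\<lambda>y'. ?F2 y y')" for y
    proof -
      have "integrable lborel (\<lambda>y'. complex_of_real (ker y y'))" using ik[of y] by simp
      then show "integrable lborel (\<lambda>y'. ?F1 y y')" by simp
      have "integrable lborel (\<lambda>y'. complex_of_real (ker y y') * (of_real (k (x - y')) * f y))"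
        using kb B by (intro integrable_mult_bounded(1)[OF \<open>integrable lborel (\<lambda>y'. complex_of_real (ker y y'))\<close>, where B = "B * norm (f y)"])
          (auto simp: norm_mult intro!: mult_right_mono)
      then show "integrable lborel (\<lambda>y'. ?F2 y y')" by (simp add: mult_ac)
    qed
    have "(LINT y|lborel. LINT y'|lborel. of_real ((k (x - y) - k (x - y')) * ker y y') * f y) = (LINT y|lborel. (LINT y'|lborel. ?F1 y y') - (LINT y'|lborel. ?F2 y y'))"
      by (simp only: Bochner_Integration.integral_diff[OF inn, symmetric] left_diff_distrib of_real_diff)
    also have "\<dots> = (LINT y|lborel. LINT y'|lborel. ?F1 y y') - (LINT y|lborel. LINT y'|lborel. ?F2 y y')"
      by (intro Bochner_Integration.integral_diff fubini_integrable_fst m1 m2 fin1 fin2)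
    also have "\<dots> = (LINT y|lborel. of_real (k (x - y)) * (indicator bad y * f y) - of_real (k (x - y)) * (indicator bad y * good y))"
      unfolding s i1 by (rule Bochner_Integration.integral_diff[symmetric, OF kk1 kk])
    also have "\<dots> = (LINT y|lborel. of_real (k (x - y)) * (f y - good y))"
      by (intro Bochner_Integration.integral_cong) (auto simp: indicator_def good_def algebra_simps)
    finally show ?thesis by simp
  qed
  have "ennreal (norm (LINT y|lborel. of_real (k (x - y)) * (f y - good y))) \<le>
    (\<integral>\<^sup>+y. \<integral>\<^sup>+y'. ennreal (\<bar>k (x - y) - k (x - y')\<bar> * ker y y' * norm (f y)) \<partial>lborel \<partial>lborel)" for x
  proof -
    let ?F = "\<lambda>y y'. complex_of_real ((k (x - y) - k (x - y')) * ker y y') * f y"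
    have m: "case_prod ?F \<in> borel_measurable (lborel \<Otimes>\<^sub>M lborel)" by measurable
    have "\<bar>k (x - y) - k (x - y')\<bar> \<le> 2 * B" for y y' using kb[of "x - y"] kb[of "x - y'"] by linarith
    then have fi: "(\<integral>\<^sup>+y. \<integral>\<^sup>+y'. ennreal (norm (?F y y')) \<partial>lborel \<partial>lborel) < \<infinity>" by (rule fin)
    have "ennreal (norm (LINT y|lborel. LINT y'|lborel. ?F y y')) \<le> (\<integral>\<^sup>+y. ennreal (norm (LINT y'|lborel. ?F y y')) \<partial>lborel)"
      by (intro integral_norm_bound_ennreal fubini_integrable_fst m fi)
    also have "\<dots> \<le> (\<integral>\<^sup>+y. \<integral>\<^sup>+y'. ennreal (norm (?F y y')) \<partial>lborel \<partial>lborel)"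
      by (intro nn_integral_mono norm_integral_le_nn_integral)
    finally show ?thesis
      unfolding rep by (simp only: norm_mult norm_of_real abs_mult abs_of_nonneg[OF ker_nonneg])
  qed
  then have "(\<integral>\<^sup>+x. indicator (- big) x * ennreal (norm (LINT y|lborel. of_real (k (x - y)) * (f y - good y))) \<partial>lborel) \<le>
    (\<integral>\<^sup>+x. indicator (- big) x * (\<integral>\<^sup>+y. \<integral>\<^sup>+y'. ennreal (\<bar>k (x - y) - k (x - y')\<bar> * ker y y' * norm (f y)) \<partial>lborel \<partial>lborel) \<partial>lborel)"
    by (intro nn_integral_mono mult_left_mono) auto
  also have "\<dots> = (\<integral>\<^sup>+x. \<integral>\<^sup>+y. \<integral>\<^sup>+y'. indicator (- big) x * ennreal (\<bar>k (x - y) - k (x - y')\<bar> * ker y y' * norm (f y)) \<partial>lborel \<partial>lborel \<partial>lborel)"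
    by (simp add: nn_integral_cmult)
  also have "\<dots> = (\<integral>\<^sup>+y. \<integral>\<^sup>+x. \<integral>\<^sup>+y'. indicator (- big) x * ennreal (\<bar>k (x - y) - k (x - y')\<bar> * ker y y' * norm (f y)) \<partial>lborel \<partial>lborel \<partial>lborel)"
    by (rule lborel_pair.Fubini'[symmetric]) measurable
  also have "\<dots> = (\<integral>\<^sup>+y. \<integral>\<^sup>+y'. \<integral>\<^sup>+x. indicator (- big) x * ennreal (\<bar>k (x - y) - k (x - y')\<bar> * ker y y' * norm (f y)) \<partial>lborel \<partial>lborel \<partial>lborel)"
    by (intro nn_integral_cong lborel_pair.Fubini'[symmetric]) measurable
  also have "\<dots> \<le> (\<integral>\<^sup>+y. \<integral>\<^sup>+y'. ennreal C * ennreal (ker y y' * norm (f y)) \<partial>lborel \<partial>lborel)"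
  proof (intro nn_integral_mono)
    fix y y'
    show "(\<integral>\<^sup>+x. indicator (- big) x * ennreal (\<bar>k (x - y) - k (x - y')\<bar> * ker y y' * norm (f y)) \<partial>lborel) \<le> ennreal C * ennreal (ker y y' * norm (f y))"
    proof (cases "ker y y' = 0")
      case False
      note k' = ker_nonzero[OF False]
      have "(\<integral>\<^sup>+x. indicator (- big) x * ennreal (\<bar>k (x - y) - k (x - y')\<bar> * ker y y' * norm (f y)) \<partial>lborel) =
        (\<integral>\<^sup>+x. (indicator (- big) x * ennreal \<bar>k (x - y) - k (x - y')\<bar>) * ennreal (ker y y' * norm (f y)) \<partial>lborel)"
        by (intro nn_integral_cong) (simp add: ennreal_mult mult.assoc)
      also have "\<dots> = (\<integral>\<^sup>+x. indicator (- big) x * ennreal \<bar>k (x - y) - k (x - y')\<bar> \<partial>lborel) * ennreal (ker y y' * norm (f y))"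
        by (rule nn_integral_multc) measurable
      also have "(\<integral>\<^sup>+x. indicator (- big) x * ennreal \<bar>k (x - y) - k (x - y')\<bar> \<partial>lborel) \<le>
        (\<integral>\<^sup>+x. indicator {u. 2 * rad_at y < norm u} (x - y) * ennreal \<bar>k ((x - y) + (y - y')) - k (x - y)\<bar> \<partial>lborel)"
      proof (rule nn_integral_mono)
        fix x
        show "indicator (- big) x * ennreal \<bar>k (x - y) - k (x - y')\<bar> \<le> indicator {u. 2 * rad_at y < norm u} (x - y) * ennreal \<bar>k ((x - y) + (y - y')) - k (x - y)\<bar>"
        proof (cases "x \<in> big")
          case False
          \<comment> \<open>Points off \<open>big\<close> are at least 3 radii from y, while y and
            y' are at most one radius apart, so the hypothesis H applies with radius
            \<open>rad_at y\<close> and shift y - y'.\<close>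
          then have "3 * rad_at y \<le> norm (x - y)"
            using k'(1) unfolding big_def by (force simp: dist_norm norm_minus_commute)
          then have "2 * rad_at y < norm (x - y)" using rad_at_pos[of y] by linarith
          then show ?thesis using False by (simp add: abs_minus_commute)
        qed simp
      qed
      also have "\<dots> = (\<integral>\<^sup>+u. indicator {u. 2 * rad_at y < norm u} u * ennreal \<bar>k (u + (y - y')) - k u\<bar> \<partial>lborel)"
        by (rule nn_integral_lborel_translate(3)[of "\<lambda>u. indicator {u. 2 * rad_at y < norm u} u * ennreal \<bar>k (u + (y - y')) - k u\<bar>"]) measurable
      also have "\<dots> \<le> ennreal C" by (rule H[OF rad_at_pos k'(4)])
      finally show ?thesis by (simp add: mult_right_mono)
    qed simp
  qed
  also have "\<dots> = ennreal C * (\<integral>\<^sup>+y. \<integral>\<^sup>+y'. ennreal (ker y y' * norm (f y)) \<partial>lborel \<partial>lborel)"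
    by (simp add: nn_integral_cmult)
  also have "(\<integral>\<^sup>+y. \<integral>\<^sup>+y'. ennreal (ker y y' * norm (f y)) \<partial>lborel \<partial>lborel) = (\<integral>\<^sup>+y. indicator bad y * ennreal (norm (f y)) \<partial>lborel)"
    by (intro nn_integral_cong) (simp add: ennreal_mult nn_integral_multc nn_integral_ker)
  finally show ?thesis using C by (simp add: nn_integral_bad_f ennreal_mult)
qed

end

subsection \<open>The multiplier of a singular integral\<close>

definition conv :: "(real ^ 'n::finite \<Rightarrow> complex) \<Rightarrow> (real ^ 'n \<Rightarrow> complex) \<Rightarrow> real ^ 'n \<Rightarrow> complex" where
  "conv K h x = (LINT y|lborel. K (x - y) * h y)"

lemma measurable_conv [measurable]:
  assumes [measurable]: "K \<in> borel_measurable borel" "h \<in> borel_measurable borel"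
  shows "conv K h \<in> borel_measurable borel"
  unfolding conv_def by measurable

lemma measurable_cnj [measurable (raw)]:
  "f \<in> borel_measurable M \<Longrightarrow> (\<lambda>x. cnj (f x)) \<in> borel_measurable M"
  by (erule measurable_compose) (intro borel_measurable_continuous_onI continuous_intros)

lemma conv_fubini_finite:
  fixes K h :: "real ^ 'n::finite \<Rightarrow> complex"
  assumes K: "integrable lborel K" and h: "integrable lborel h"
  shows "(\<integral>\<^sup>+x. \<integral>\<^sup>+y. ennreal (norm (K (x - y) * h y)) \<partial>lborel \<partial>lborel) < \<infinity>"
proof -
  have [measurable]: "K \<in> borel_measurable borel" "h \<in> borel_measurable borel" using K h by auto
  have "(\<integral>\<^sup>+x. \<integral>\<^sup>+y. ennreal (norm (K (x - y) * h y)) \<partial>lborel \<partial>lborel) = (\<integral>\<^sup>+y. \<integral>\<^sup>+x. ennreal (norm (K (x - y) * h y)) \<partial>lborel \<partial>lborel)"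
    by (rule lborel_pair.Fubini'[symmetric]) measurable
  also have "\<dots> = (\<integral>\<^sup>+y. \<integral>\<^sup>+x. ennreal (norm (h y)) * ennreal (norm (K x)) \<partial>lborel \<partial>lborel)"
  proof (rule nn_integral_cong)
    fix y
    have "(\<integral>\<^sup>+x. ennreal (norm (K (x - y) * h y)) \<partial>lborel) = (\<integral>\<^sup>+x. ennreal (norm (h y)) * ennreal (norm (K (x - y))) \<partial>lborel)"
      by (simp add: norm_mult ennreal_mult mult.commute)
    also have "\<dots> = (\<integral>\<^sup>+x. ennreal (norm (h y)) * ennreal (norm (K x)) \<partial>lborel)"
      by (rule nn_integral_lborel_translate(3)[of "\<lambda>x. ennreal (norm (h y)) * ennreal (norm (K x))"]) measurable
    finally show "(\<integral>\<^sup>+x. ennreal (norm (K (x - y) * h y)) \<partial>lborel) = (\<integral>\<^sup>+x. ennreal (norm (h y)) * ennreal (norm (K x)) \<partial>lborel)" .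
  qed
  also have "\<dots> < \<infinity>" by (rule nn_mult_finite[OF h K])
  finally show ?thesis .
qed

lemma integrable_conv:
  assumes K: "integrable lborel K" and h: "integrable lborel h"
  shows "integrable lborel (conv K h)"
proof -
  have [measurable]: "K \<in> borel_measurable borel" "h \<in> borel_measurable borel" using K h by auto
  show ?thesis
    unfolding conv_def[abs_def] by (rule fubini_integrable_fst[OF _ conv_fubini_finite[OF K h]]) measurable
qed

lemma ft_conv:
  assumes K: "integrable lborel K" and h: "integrable lborel h"
  shows "ft (conv K h) \<xi> = ft K \<xi> * ft h \<xi>"
proof -
  have [measurable]: "K \<in> borel_measurable borel" "h \<in> borel_measurable borel" using K h by auto
  let ?F = "\<lambda>x y. K (x - y) * h y * ec (- (\<xi> \<bullet> x))"
  have fin: "(\<integral>\<^sup>+x. \<integral>\<^sup>+y. ennreal (norm (?F x y)) \<partial>lborel \<partial>lborel) < \<infinity>"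
    using conv_fubini_finite[OF K h] by (simp only: norm_mult norm_ec mult_1_right)
  have "ft (conv K h) \<xi> = (LINT x|lborel. LINT y|lborel. ?F x y)"
    unfolding ft_def conv_def integral_mult_left_zero ..
  also have "\<dots> = (LINT y|lborel. LINT x|lborel. ?F x y)"
    by (rule fubini_swap[OF _ fin]) measurable
  also have "\<dots> = (LINT y|lborel. ft K \<xi> * (h y * ec (- (\<xi> \<bullet> y))))"
  proof (rule Bochner_Integration.integral_cong[OF refl])
    fix y
    have "(LINT x|lborel. ?F x y) = (LINT x|lborel. ?F (x + y) y)"
      by (rule integral_lborel_translate(2)[symmetric]) measurable
    also have "\<dots> = (LINT x|lborel. (K x * ec (- (\<xi> \<bullet> x))) * (h y * ec (- (\<xi> \<bullet> y))))"
      by (rule Bochner_Integration.integral_cong)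
        (simp_all add: inner_add_right ec_diff[of "- (\<xi> \<bullet> _)", simplified] mult_ac)
    also have "\<dots> = ft K \<xi> * (h y * ec (- (\<xi> \<bullet> y)))"
      unfolding ft_def integral_mult_left_zero ..
    finally show "(LINT x|lborel. ?F x y) = ft K \<xi> * (h y * ec (- (\<xi> \<bullet> y)))" .
  qed
  also have "\<dots> = ft K \<xi> * ft h \<xi>" unfolding ft_def integral_mult_right_zero ..
  finally show ?thesis .
qed

lemma conv_integrand_integrable:
  fixes K h :: "real ^ 'n::finite \<Rightarrow> complex"
  assumes "K \<in> borel_measurable borel" "\<And>x. norm (K x) \<le> B" and h: "integrable lborel h"
  shows "integrable lborel (\<lambda>y. K (x - y) * h y)"
  by (rule integrable_mult_bounded(2)[OF h]) (use assms in auto)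

lemma conv_commute:
  assumes [measurable]: "K \<in> borel_measurable borel" "h \<in> borel_measurable borel"
  shows "conv K h x = (LINT y|lborel. h (x - y) * K y)"
proof -
  have "(LINT y|lborel. K (x - y) * h y) = (LINT y|lborel. K (x - (x - y)) * h (x - y))"
    by (rule integral_lborel_translate(4)[symmetric]) measurable
  then show ?thesis by (simp add: conv_def mult.commute)
qed

lemma norm_conv_le:
  assumes K: "K \<in> borel_measurable borel" "\<And>x. norm (K x) \<le> B" and h: "integrable lborel h"
  shows "norm (conv K h x) \<le> B * (LINT y|lborel. norm (h y))"
proof -
  have "norm (conv K h x) \<le> (LINT y|lborel. norm (K (x - y) * h y))"
    unfolding conv_def by (rule integral_norm_bound)
  also have "\<dots> \<le> (LINT y|lborel. B * norm (h y))"
    using K(2)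
    by (intro integral_mono integrable_norm conv_integrand_integrable[OF K h] integrable_mult_right h)
      (auto simp: norm_mult mult_right_mono)
  finally show ?thesis by simp
qed

lemma continuous_conv:
  assumes K: "continuous_on UNIV K" "\<And>x. norm (K x) \<le> B" and h: "integrable lborel h"
  shows "continuous_on UNIV (conv K h)"
proof -
  have [measurable]: "h \<in> borel_measurable borel" "K \<in> borel_measurable borel"
    using h borel_measurable_continuous_onI[OF K(1)] by auto
  have "(\<lambda>n. conv K h (u n)) \<longlonglongrightarrow> conv K h x" if "u \<longlonglongrightarrow> x" for u x
    unfolding conv_def
  proof (rule integral_dominated_convergence[where w = "\<lambda>y. B * norm (h y)"])
    show "AE y in lborel. (\<lambda>n. K (u n - y) * h y) \<longlonglongrightarrow> K (x - y) * h y"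
      using K(1) that by (intro always_eventually allI tendsto_intros continuous_on_tendsto_compose[of UNIV K]) auto
  qed (use K(2) h in \<open>auto simp: norm_mult mult_right_mono\<close>)
  then show ?thesis by (auto simp: continuous_on_sequentially o_def)
qed

text \<open>A Gaussian-regularised Plancherel identity; it yields the \<open>L\<^sup>2\<close> bound below without the
  \<open>L\<^sup>2\<close> theory of the Fourier transform.\<close>

lemma plancherel_regularised:
  fixes u :: "real ^ 'n::finite \<Rightarrow> complex"
  assumes u: "integrable lborel u" and t: "t > 0"
  shows "of_real (LINT \<xi>|lborel. (norm (ft u \<xi>))\<^sup>2 * gauss (t *\<^sub>R \<xi>)) =
    (LINT x|lborel. u x * (LINT w|lborel. of_real (gauss w) * cnj (u (x + t *\<^sub>R w))))"
proof -
  have [measurable]: "u \<in> borel_measurable borel" using u by auto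
  have [measurable]: "ft u \<in> borel_measurable borel"
    by (intro borel_measurable_continuous_onI continuous_ft u)
  have cu: "integrable lborel (\<lambda>x. cnj (u x))" using u by simp
  have cft: "cnj (ft u \<xi>) = (LINT y|lborel. cnj (u y) * ec (\<xi> \<bullet> y))" for \<xi>
    unfolding ft_def by (subst Bochner_Integration.integral_cnj[symmetric]) (simp add: ec_minus[symmetric])
  have P: "(LINT \<xi>|lborel. cnj (ft u \<xi>) * (ec (- (\<xi> \<bullet> x)) * of_real (gauss (t *\<^sub>R \<xi>)))) = (LINT w|lborel. of_real (gauss w) * cnj (u (x + t *\<^sub>R w)))" for x
  proof -
    let ?F = "\<lambda>\<xi> y. cnj (u y) * ec (\<xi> \<bullet> y) * (ec (- (\<xi> \<bullet> x)) * of_real (gauss (t *\<^sub>R \<xi>)))"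
    have fin: "(\<integral>\<^sup>+\<xi>. \<integral>\<^sup>+y. ennreal (norm (?F \<xi> y)) \<partial>lborel \<partial>lborel) < \<infinity>"
      using nn_mult_finite[OF integrable_gauss_scaled[OF t] cu]
      by (simp add: norm_mult ennreal_mult mult.commute)
    have 1: "(LINT \<xi>|lborel. cnj (ft u \<xi>) * (ec (- (\<xi> \<bullet> x)) * of_real (gauss (t *\<^sub>R \<xi>)))) = (LINT \<xi>|lborel. LINT y|lborel. ?F \<xi> y)"
      unfolding cft integral_mult_left_zero ..
    have 2: "(LINT \<xi>|lborel. LINT y|lborel. ?F \<xi> y) = (LINT y|lborel. LINT \<xi>|lborel. ?F \<xi> y)"
      by (rule fubini_swap[OF _ fin]) measurable
    have 3: "(LINT \<xi>|lborel. ?F \<xi> y) = cnj (u y) * of_real (gauss ((1 / t) *\<^sub>R (y - x)) / t ^ CARD('n))" for y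
    proof -
      have "?F \<xi> y = cnj (u y) * (of_real (gauss (t *\<^sub>R \<xi>)) * ec ((y - x) \<bullet> \<xi>))" for \<xi>
        using ec_diff[of "\<xi> \<bullet> y" "\<xi> \<bullet> x"] by (simp add: inner_commute[of _ \<xi>] inner_diff_right mult_ac)
      then show ?thesis
        unfolding integral_gauss_scaled_ec[OF t, symmetric] integral_mult_right_zero[symmetric] by (simp only:)
    qed
    have m: "(\<lambda>y. cnj (u y) * of_real (gauss ((1 / t) *\<^sub>R (y - x)) / t ^ CARD('n))) \<in> borel_measurable borel"
      by measurable
    have "(LINT w|lborel. cnj (u (x + t *\<^sub>R w)) * of_real (gauss ((1 / t) *\<^sub>R ((x + t *\<^sub>R w) - x)) / t ^ CARD('n))) =
       (1 / t ^ CARD('n)) *\<^sub>R (LINT y|lborel. cnj (u y) * of_real (gauss ((1 / t) *\<^sub>R (y - x)) / t ^ CARD('n)))"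
      using integral_lborel_affine[OF m, of "t" x] t by simp
    moreover have "cnj (u (x + t *\<^sub>R w)) * of_real (gauss ((1 / t) *\<^sub>R ((x + t *\<^sub>R w) - x)) / t ^ CARD('n)) =
       (1 / t ^ CARD('n)) *\<^sub>R (of_real (gauss w) * cnj (u (x + t *\<^sub>R w)))" for w
    proof -
      have "(1 / t) *\<^sub>R ((x + t *\<^sub>R w) - x) = w" using t by simp
      then show ?thesis by (simp add: scaleR_conv_of_real[where 'a = complex] del: scaleR_right_diff_distrib)
    qed
    ultimately have "(1 / t ^ CARD('n)) *\<^sub>R (LINT w|lborel. of_real (gauss w) * cnj (u (x + t *\<^sub>R w))) =
       (1 / t ^ CARD('n)) *\<^sub>R (LINT y|lborel. cnj (u y) * of_real (gauss ((1 / t) *\<^sub>R (y - x)) / t ^ CARD('n)))"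
      by (simp only: integral_scaleR_right)
    then show ?thesis unfolding 1 2 3 using t by (simp only: scaleR_cancel_left) simp
  qed
  let ?F = "\<lambda>\<xi> x. u x * ec (- (\<xi> \<bullet> x)) * (cnj (ft u \<xi>) * of_real (gauss (t *\<^sub>R \<xi>)))"
  have gf: "integrable lborel (\<lambda>\<xi>. of_real (gauss (t *\<^sub>R \<xi>)) * cnj (ft u \<xi>))"
    by (rule integrable_mult_bounded(1)[where B = "LINT x|lborel. norm (u x)"])
      (use integrable_gauss_scaled[OF t] norm_ft_le[of u] in auto)
  have fin: "(\<integral>\<^sup>+\<xi>. \<integral>\<^sup>+x. ennreal (norm (?F \<xi> x)) \<partial>lborel \<partial>lborel) < \<infinity>"
    using nn_mult_finite[OF gf u] by (simp add: norm_mult ennreal_mult mult_ac)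
  have "of_real (LINT \<xi>|lborel. (norm (ft u \<xi>))\<^sup>2 * gauss (t *\<^sub>R \<xi>)) = (LINT \<xi>|lborel. ft u \<xi> * (cnj (ft u \<xi>) * of_real (gauss (t *\<^sub>R \<xi>))))"
    by (subst integral_complex_of_real[symmetric]) (simp add: complex_norm_square mult_ac del: of_real_power)
  also have "\<dots> = (LINT \<xi>|lborel. LINT x|lborel. ?F \<xi> x)"
    unfolding ft_def[of u] integral_mult_left_zero ..
  also have "\<dots> = (LINT x|lborel. LINT \<xi>|lborel. ?F \<xi> x)"
    by (rule fubini_swap[OF _ fin]) measurable
  also have "\<dots> = (LINT x|lborel. u x * (LINT \<xi>|lborel. cnj (ft u \<xi>) * (ec (- (\<xi> \<bullet> x)) * of_real (gauss (t *\<^sub>R \<xi>)))))"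
    unfolding integral_mult_right_zero[symmetric] by (simp only: mult_ac)
  finally show ?thesis unfolding P .
qed

text \<open>Compare the regularised energies of H and h on the frequency side, where the multiplier
  is at most 1. For H, which is bounded and continuous, they converge to the square norm; for h,
  translation invariance bounds them uniformly in n.\<close>

lemma conv_L2_bound:
  fixes K h :: "real ^ 'n::finite \<Rightarrow> complex"
  assumes K: "integrable lborel K" "continuous_on UNIV K" "\<And>x. norm (K x) \<le> B"
    and K1: "\<And>\<xi>. norm (ft K \<xi>) \<le> 1" and h: "integrable lborel h"
  shows "(\<integral>\<^sup>+x. ennreal ((norm (conv K h x))\<^sup>2) \<partial>lborel) \<le> (\<integral>\<^sup>+x. ennreal ((norm (h x))\<^sup>2) \<partial>lborel)"
proof -
  have [measurable]: "K \<in> borel_measurable borel" "h \<in> borel_measurable borel" using K h by auto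
  define H where "H = conv K h"
  have H: "integrable lborel H" unfolding H_def by (rule integrable_conv[OF K(1) h])
  have [measurable]: "H \<in> borel_measurable borel" using H by auto
  have [measurable]: "ft H \<in> borel_measurable borel" "ft h \<in> borel_measurable borel"
    by (intro borel_measurable_continuous_onI continuous_ft H h)+
  define M where "M = B * (LINT y|lborel. norm (h y))"
  have M: "norm (H x) \<le> M" for x unfolding H_def M_def by (rule norm_conv_le) (use K in auto, rule h)
  have cH: "isCont H x" for x
    using continuous_conv[OF K(2,3) h] unfolding H_def by (simp add: continuous_on_eq_continuous_at)
  define t :: "nat \<Rightarrow> real" where "t n = 1 / real (Suc n)" for n
  have t: "t \<longlonglongrightarrow> 0" "t n > 0" for n
    unfolding t_def using LIMSEQ_inverse_real_of_nat by (auto simp: inverse_eq_divide)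
  define Q where "Q u n = (LINT \<xi>|lborel. (norm (ft u \<xi>))\<^sup>2 * gauss (t n *\<^sub>R \<xi>))" for u :: "real ^ 'n \<Rightarrow> complex" and n
  have HM: "M \<ge> 0" using M[of 0] norm_ge_zero[of "H 0"] by linarith
  have iH: "integrable lborel (\<lambda>x. (norm (H x))\<^sup>2)"
    by (rule Bochner_Integration.integrable_bound[OF integrable_mult_right[OF integrable_norm[OF H], of M]])
      (use M HM in \<open>auto simp: power2_eq_square mult_right_mono abs_mult\<close>)
  \<comment> \<open>H is continuous, so its Gaussian averages converge to it at every point.\<close>
  have lim: "(\<lambda>n. complex_of_real (Q H n)) \<longlonglongrightarrow> (LINT x|lborel. H x * cnj (H x))"
    unfolding Q_def plancherel_regularised[OF H t(2)]
  proof (rule integral_dominated_convergence[where w = "\<lambda>x. norm (H x) * M"])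
    show "AE x in lborel. (\<lambda>n. H x * (LINT w|lborel. of_real (gauss w) * cnj (H (x + t n *\<^sub>R w)))) \<longlonglongrightarrow> H x * cnj (H x)"
    proof (intro always_eventually allI tendsto_mult tendsto_const)
      fix x
      show "(\<lambda>n. LINT w|lborel. of_real (gauss w) * cnj (H (x + t n *\<^sub>R w))) \<longlonglongrightarrow> cnj (H x)"
        by (rule gauss_approx_identity[of "\<lambda>x. cnj (H x)" M, OF _ _ _ t(1)]) (use M cH in \<open>auto intro!: continuous_intros isCont_cnj\<close>)
    qed
    show "AE x in lborel. norm (H x * (LINT w|lborel. of_real (gauss w) * cnj (H (x + t n *\<^sub>R w)))) \<le> norm (H x) * M" for n
    proof (intro always_eventually allI)
      fix x
      have "norm (LINT w|lborel. of_real (gauss w) * cnj (H (x + t n *\<^sub>R w))) \<le> (LINT w|lborel. norm (of_real (gauss w) * cnj (H (x + t n *\<^sub>R w))))"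
        by (rule integral_norm_bound)
      also have "\<dots> \<le> (LINT w|lborel. gauss (w :: real ^ 'n) * M)"
        by (rule integral_mono') (use M HM integrable_gauss in \<open>auto simp: norm_mult mult_left_mono\<close>)
      also have "\<dots> = M" by (simp add: integral_gauss)
      finally show "norm (H x * (LINT w|lborel. of_real (gauss w) * cnj (H (x + t n *\<^sub>R w)))) \<le> norm (H x) * M"
        unfolding norm_mult by (rule mult_left_mono) simp
    qed
    show "integrable lborel (\<lambda>x. norm (H x) * M)" using H by simp
  qed measurable
  have "(LINT x|lborel. H x * cnj (H x)) = of_real (LINT x|lborel. (norm (H x))\<^sup>2)"
    by (subst integral_complex_of_real[symmetric]) (simp add: complex_norm_square del: of_real_power)
  with lim have lim': "(\<lambda>n. Q H n) \<longlonglongrightarrow> (LINT x|lborel. (norm (H x))\<^sup>2)"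
    by (simp only: tendsto_of_real_iff)
  \<comment> \<open>The product of two values of h is at most half the sum of their squares, and
    both squares integrate to the same value by translation invariance.\<close>
  have bound: "ennreal (Q H n) \<le> (\<integral>\<^sup>+x. ennreal ((norm (h x))\<^sup>2) \<partial>lborel)" for n
  proof -
    have ig: "integrable lborel (\<lambda>\<xi>. (norm (ft u \<xi>))\<^sup>2 * gauss (t n *\<^sub>R \<xi>))" if u: "integrable lborel u" for u :: "real ^ 'n \<Rightarrow> complex"
    proof (rule Bochner_Integration.integrable_bound[OF integrable_mult_right[OF integrable_gauss_scaled[OF t(2)[of n]], of "(LINT x|lborel. norm (u x))\<^sup>2"]])
      have "ft u \<in> borel_measurable borel" by (intro borel_measurable_continuous_onI continuous_ft u)
      then show "(\<lambda>\<xi>. (norm (ft u \<xi>))\<^sup>2 * gauss (t n *\<^sub>R \<xi>)) \<in> borel_measurable lborel" by simp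
    qed (auto intro!: mult_right_mono power_mono norm_ft_le)
    have "Q H n \<le> Q h n"
      unfolding Q_def
    proof (intro integral_mono ig H h mult_right_mono power_mono)
      fix \<xi>
      show "norm (ft H \<xi>) \<le> norm (ft h \<xi>)"
        unfolding H_def ft_conv[OF K(1) h] norm_mult using K1[of \<xi>] by (intro mult_left_le_one_le) auto
    qed auto
    then have "ennreal (Q H n) \<le> ennreal (norm (complex_of_real (Q h n)))"
      by (intro ennreal_leI) simp
    also have "\<dots> \<le> (\<integral>\<^sup>+x. ennreal (norm (h x * (LINT w|lborel. of_real (gauss w) * cnj (h (x + t n *\<^sub>R w))))) \<partial>lborel)"
      unfolding Q_def plancherel_regularised[OF h t(2)] by (rule norm_integral_le_nn_integral)
    also have "\<dots> \<le> (\<integral>\<^sup>+x. \<integral>\<^sup>+w. ennreal (gauss w) * (ennreal ((norm (h x))\<^sup>2 / 2) + ennreal ((norm (h (x + t n *\<^sub>R w)))\<^sup>2 / 2)) \<partial>lborel \<partial>lborel)"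
    proof (rule nn_integral_mono)
      fix x
      have "ennreal (norm (h x * (LINT w|lborel. of_real (gauss w) * cnj (h (x + t n *\<^sub>R w))))) =
        ennreal (norm (LINT w|lborel. h x * (of_real (gauss w) * cnj (h (x + t n *\<^sub>R w)))))" by simp
      also have "\<dots> \<le> (\<integral>\<^sup>+w. ennreal (norm (h x * (of_real (gauss w) * cnj (h (x + t n *\<^sub>R w))))) \<partial>lborel)"
        by (rule norm_integral_le_nn_integral)
      also have "\<dots> \<le> (\<integral>\<^sup>+w. ennreal (gauss w) * (ennreal ((norm (h x))\<^sup>2 / 2) + ennreal ((norm (h (x + t n *\<^sub>R w)))\<^sup>2 / 2)) \<partial>lborel)"
      proof (rule nn_integral_mono)
        fix w
        have "norm (h x) * norm (h (x + t n *\<^sub>R w)) \<le> (norm (h x))\<^sup>2 / 2 + (norm (h (x + t n *\<^sub>R w)))\<^sup>2 / 2"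
          using sum_squares_bound[of "norm (h x)" "norm (h (x + t n *\<^sub>R w))"] by simp
        then have "gauss w * (norm (h x) * norm (h (x + t n *\<^sub>R w))) \<le> gauss w * ((norm (h x))\<^sup>2 / 2 + (norm (h (x + t n *\<^sub>R w)))\<^sup>2 / 2)"
          by (rule mult_left_mono) simp
        then show "ennreal (norm (h x * (of_real (gauss w) * cnj (h (x + t n *\<^sub>R w))))) \<le> ennreal (gauss w) * (ennreal ((norm (h x))\<^sup>2 / 2) + ennreal ((norm (h (x + t n *\<^sub>R w)))\<^sup>2 / 2))"
          by (simp add: norm_mult ennreal_leI mult_ac flip: ennreal_plus ennreal_mult)
      qed
      finally show "ennreal (norm (h x * (LINT w|lborel. of_real (gauss w) * cnj (h (x + t n *\<^sub>R w))))) \<le>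
         (\<integral>\<^sup>+w. ennreal (gauss w) * (ennreal ((norm (h x))\<^sup>2 / 2) + ennreal ((norm (h (x + t n *\<^sub>R w)))\<^sup>2 / 2)) \<partial>lborel)" .
    qed
    also have "\<dots> = (\<integral>\<^sup>+w. \<integral>\<^sup>+x. ennreal (gauss w) * (ennreal ((norm (h x))\<^sup>2 / 2) + ennreal ((norm (h (x + t n *\<^sub>R w)))\<^sup>2 / 2)) \<partial>lborel \<partial>lborel)"
      by (rule lborel_pair.Fubini'[symmetric]) measurable
    also have "\<dots> = (\<integral>\<^sup>+w. ennreal (gauss (w :: real ^ 'n)) * (\<integral>\<^sup>+x. ennreal ((norm (h x))\<^sup>2) \<partial>lborel) \<partial>lborel)"
    proof (rule nn_integral_cong)
      fix w :: "real ^ 'n"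
      have "(\<integral>\<^sup>+x. ennreal ((norm (h (x + t n *\<^sub>R w)))\<^sup>2 / 2) \<partial>lborel) = (\<integral>\<^sup>+x. ennreal ((norm (h x))\<^sup>2 / 2) \<partial>lborel)"
        by (rule nn_integral_lborel_translate(2)[of "\<lambda>x. ennreal ((norm (h x))\<^sup>2 / 2)"]) measurable
      then have "(\<integral>\<^sup>+x. ennreal (gauss w) * (ennreal ((norm (h x))\<^sup>2 / 2) + ennreal ((norm (h (x + t n *\<^sub>R w)))\<^sup>2 / 2)) \<partial>lborel) =
        ennreal (gauss w) * ((\<integral>\<^sup>+x. ennreal ((norm (h x))\<^sup>2 / 2) \<partial>lborel) + (\<integral>\<^sup>+x. ennreal ((norm (h x))\<^sup>2 / 2) \<partial>lborel))"
        by (subst nn_integral_cmult, measurable, subst nn_integral_add) auto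
      also have "(\<integral>\<^sup>+x. ennreal ((norm (h x))\<^sup>2 / 2) \<partial>lborel) + (\<integral>\<^sup>+x. ennreal ((norm (h x))\<^sup>2 / 2) \<partial>lborel) = (\<integral>\<^sup>+x. ennreal ((norm (h x))\<^sup>2) \<partial>lborel)"
        by (subst nn_integral_add[symmetric]) (auto simp flip: ennreal_plus)
      finally show "(\<integral>\<^sup>+x. ennreal (gauss w) * (ennreal ((norm (h x))\<^sup>2 / 2) + ennreal ((norm (h (x + t n *\<^sub>R w)))\<^sup>2 / 2)) \<partial>lborel) =
        ennreal (gauss w) * (\<integral>\<^sup>+x. ennreal ((norm (h x))\<^sup>2) \<partial>lborel)" .
    qed
    also have "\<dots> = (\<integral>\<^sup>+x. ennreal ((norm (h x))\<^sup>2) \<partial>lborel)"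
      by (subst nn_integral_multc) (auto simp: nn_integral_gauss)
    finally show ?thesis .
  qed
  have "(\<integral>\<^sup>+x. ennreal ((norm (H x))\<^sup>2) \<partial>lborel) = ennreal (LINT x|lborel. (norm (H x))\<^sup>2)"
    by (rule nn_integral_eq_integral[OF iH]) auto
  also have "\<dots> \<le> (\<integral>\<^sup>+x. ennreal ((norm (h x))\<^sup>2) \<partial>lborel)"
    using tendsto_ennrealI[OF lim'] bound by (intro LIMSEQ_le_const2) auto
  finally show ?thesis unfolding H_def .
qed

text \<open>Absolute continuity of the integral: the part of g above height N is small uniformly in
  j, and the part below contributes at most N times the measure of \<open>A j\<close>.\<close>

lemma integral_small_sets_tendsto_0:
  fixes g :: "'a \<Rightarrow> 'b::{banach, second_countable_topology}"
  assumes g: "integrable M g" and A: "\<And>j. A j \<in> sets M" "\<And>j. emeasure M (A j) \<le> ennreal (W j)" and W: "W \<longlonglongrightarrow> 0" "\<And>j. W j \<ge> 0"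
  shows "(\<lambda>j. LINT x|M. indicator (A j) x * norm (g x)) \<longlonglongrightarrow> 0"
proof (rule LIMSEQ_I)
  fix r :: real assume r: "r > 0"
  note A(1)[measurable] borel_measurable_integrable[OF g, measurable]
  let ?S = "\<lambda>N::nat. {x \<in> space M. real N < norm (g x)}"
  have "(\<lambda>N. LINT x|M. indicator (?S N) x * norm (g x)) \<longlonglongrightarrow> (LINT x|M. 0)"
  proof (rule integral_dominated_convergence[where w = "\<lambda>x. norm (g x)"])
    show "AE x in M. (\<lambda>N. indicator (?S N) x * norm (g x)) \<longlonglongrightarrow> 0"
    proof (intro AE_I2 tendsto_eventually)
      fix x
      obtain N0 where "norm (g x) \<le> real N0" using real_arch_simple by blast
      then show "\<forall>\<^sub>F N in sequentially. indicator (?S N) x * norm (g x) = 0"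
        by (intro eventually_mono[OF eventually_ge_at_top[of N0]]) (auto simp: indicator_def)
    qed
  qed (use g in \<open>auto simp: indicator_def\<close>)
  then have "\<forall>\<^sub>F N in sequentially. (LINT x|M. indicator (?S N) x * norm (g x)) < r / 2"
    using r by (intro order_tendstoD(2)) auto
  then obtain N where N: "(LINT x|M. indicator (?S N) x * norm (g x)) < r / 2"
    by (auto simp: eventually_sequentially)
  have "(\<lambda>j. real N * W j) \<longlonglongrightarrow> real N * 0" by (intro tendsto_intros W(1))
  then have "\<forall>\<^sub>F j in sequentially. real N * W j < r / 2" using r by (intro order_tendstoD(2)) auto
  then obtain j0 where j0: "\<And>j. j \<ge> j0 \<Longrightarrow> real N * W j < r / 2" by (auto simp: eventually_sequentially)
  have iS: "integrable M (\<lambda>x. indicator B x * norm (g x))" if [measurable]: "B \<in> sets M" for B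
    by (rule Bochner_Integration.integrable_bound[OF integrable_norm[OF g]]) (auto simp: indicator_def)
  show "\<exists>no. \<forall>n\<ge>no. norm ((LINT x|M. indicator (A n) x * norm (g x)) - 0) < r"
  proof (intro exI[of _ j0] allI impI)
    fix j assume j: "j \<ge> j0"
    have fin: "emeasure M (A j) < \<infinity>" using A(2)[of j] by (rule order.strict_trans1) simp
    have iA: "integrable M (\<lambda>x. real N * indicator (A j) x)"
      using fin by (intro integrable_mult_right integrable_real_indicator A)
    have "(LINT x|M. indicator (A j) x * norm (g x)) \<le> (LINT x|M. indicator (?S N) x * norm (g x) + real N * indicator (A j) x)"
      by (intro integral_mono iS Bochner_Integration.integrable_add iA) (auto simp: indicator_def)
    also have "\<dots> = (LINT x|M. indicator (?S N) x * norm (g x)) + real N * measure M (A j)"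
      using A(1)[of j] by (subst Bochner_Integration.integral_add[OF iS iA]) auto
    also have "measure M (A j) \<le> W j"
      using A(2)[of j] W(2)[of j] by (auto simp: measure_def intro!: enn2real_leI)
    then have "real N * measure M (A j) \<le> real N * W j"
      by (simp add: mult_left_mono)
    finally have "(LINT x|M. indicator (A j) x * norm (g x)) < r"
      using N j0[OF j] by linarith
    then show "norm ((LINT x|M. indicator (A j) x * norm (g x)) - 0) < r" by simp
  qed
qed

text \<open>The multiplier bound 1 and the Hoermander constant C are uniform in n, while the
  pointwise bound in \<open>k_bounded\<close> may grow with n: it only secures integrability and
  continuity and never enters an estimate.\<close>

locale singular_kernel =
  fixes k :: "nat \<Rightarrow> real ^ 'n::finite \<Rightarrow> real" and m :: "real ^ 'n \<Rightarrow> complex" and C :: real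
  assumes k_integrable: "\<And>n. integrable lborel (k n)"
    and k_continuous: "\<And>n. continuous_on UNIV (k n)"
    and k_bounded: "\<And>n. \<exists>B. \<forall>x. \<bar>k n x\<bar> \<le> B"
    and k_ft: "\<And>n \<xi>. norm (ft (\<lambda>x. of_real (k n x)) \<xi>) \<le> 1"
    and k_limit: "\<And>\<xi>. (\<lambda>n. ft (\<lambda>x. of_real (k n x)) \<xi>) \<longlonglongrightarrow> m \<xi>"
    and C: "C \<ge> 0"
    and k_hormander: "\<And>n v r. 0 < r \<Longrightarrow> norm v \<le> r \<Longrightarrow>
      (\<integral>\<^sup>+x. indicator {x. 2 * r < norm x} x * ennreal \<bar>k n (x + v) - k n x\<bar> \<partial>lborel) \<le> ennreal C"
begin

abbreviation kc :: "nat \<Rightarrow> real ^ 'n \<Rightarrow> complex" where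
  "kc n \<equiv> (\<lambda>x. of_real (k n x))"

lemma k_measurable [measurable]: "k n \<in> borel_measurable borel"
  using k_integrable[of n] by auto

lemma kc_integrable: "integrable lborel (kc n)"
  using k_integrable by simp

lemma ft_kc_measurable [measurable]: "ft (kc n) \<in> borel_measurable borel"
  by (intro borel_measurable_continuous_onI continuous_ft kc_integrable)

lemma m_measurable [measurable]: "m \<in> borel_measurable borel"
  by (rule borel_measurable_LIMSEQ_metric[where f = "\<lambda>n. ft (kc n)"]) (auto intro: k_limit)

lemma norm_m_le: "norm (m \<xi>) \<le> 1"
  using tendsto_norm[OF k_limit[of \<xi>]] k_ft by (intro LIMSEQ_le_const2) auto

definition test :: "real \<Rightarrow> real ^ 'n \<Rightarrow> real ^ 'n \<Rightarrow> complex" where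
  "test t \<xi> x = of_real (gauss (t *\<^sub>R x)) * ec (- (\<xi> \<bullet> x))"

lemma test_measurable [measurable]: "test t \<xi> \<in> borel_measurable borel"
  unfolding test_def by measurable

lemma norm_test: "norm (test t \<xi> x) = gauss (t *\<^sub>R x)"
  by (simp add: test_def norm_mult)

lemma norm_test_le: "norm (test t \<xi> x) \<le> 1"
  by (simp add: norm_test gauss_le_1)

lemma integrable_test: "t > 0 \<Longrightarrow> integrable lborel (test t \<xi>)"
  unfolding test_def by (intro integrable_mult_ec(3) integrable_of_real integrable_gauss_scaled)

text \<open>The Fourier integral of \<open>M\<close> against a Gaussian of width \<open>t\<close> around \<open>\<xi>\<close>; this is what the adjoint
  of the multiplier operator \<open>M\<close> makes of \<^const>\<open>test\<close>.\<close>

definition dual :: "(real ^ 'n \<Rightarrow> complex) \<Rightarrow> real \<Rightarrow> real ^ 'n \<Rightarrow> real ^ 'n \<Rightarrow> complex" where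
  "dual M t \<xi> y = (LINT \<eta>|lborel. of_real (gauss \<eta>) * (ec (- ((\<xi> + t *\<^sub>R \<eta>) \<bullet> y)) * M (\<xi> + t *\<^sub>R \<eta>)))"

lemma dual_measurable [measurable]:
  assumes [measurable]: "M \<in> borel_measurable borel"
  shows "dual M t \<xi> \<in> borel_measurable borel"
  unfolding dual_def by measurable

lemma norm_dual_le:
  assumes "\<And>\<eta>. norm (M \<eta>) \<le> 1"
  shows "norm (dual M t \<xi> y) \<le> 1"
proof -
  have "norm (dual M t \<xi> y) \<le> (LINT \<eta>|lborel. norm (of_real (gauss \<eta>) * (ec (- ((\<xi> + t *\<^sub>R \<eta>) \<bullet> y)) * M (\<xi> + t *\<^sub>R \<eta>))))"
    unfolding dual_def by (rule integral_norm_bound)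
  also have "\<dots> \<le> (LINT \<eta>|lborel. gauss (\<eta> :: real ^ 'n))"
    using assms by (intro integral_mono' integrable_gauss) (auto simp: norm_mult mult_left_le)
  finally show ?thesis by (simp add: integral_gauss)
qed

lemma dual_kc_tendsto: "(\<lambda>n. dual (ft (kc n)) t \<xi> y) \<longlonglongrightarrow> dual m t \<xi> y"
  unfolding dual_def
proof (rule integral_dominated_convergence[where w = gauss])
  show "AE \<eta> in lborel. (\<lambda>n. of_real (gauss \<eta>) * (ec (- ((\<xi> + t *\<^sub>R \<eta>) \<bullet> y)) * ft (kc n) (\<xi> + t *\<^sub>R \<eta>)))
      \<longlonglongrightarrow> of_real (gauss \<eta>) * (ec (- ((\<xi> + t *\<^sub>R \<eta>) \<bullet> y)) * m (\<xi> + t *\<^sub>R \<eta>))"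
    by (intro always_eventually allI tendsto_intros k_limit)
qed (use k_ft integrable_gauss in \<open>auto simp: norm_mult mult_left_le\<close>)

text \<open>Writing the damping Gaussian as the transform of a Gaussian in \<open>\<eta>\<close>
  presents the test function as a superposition of characters of frequency
  \<open>\<xi> + t *\<^sub>R \<eta>\<close>, and on each of them the kernel acts as a
  scalar.\<close>

lemma conv_kc_test:
  assumes t: "t > 0"
  shows "(LINT x|lborel. kc n (x - y) * test t \<xi> x) = dual (ft (kc n)) t \<xi> y"
proof -
  let ?F = "\<lambda>x \<eta>. kc n (x - y) * ec (- (\<xi> \<bullet> x)) * (of_real (gauss \<eta>) * ec (- ((t *\<^sub>R x) \<bullet> \<eta>)))"
  have "(\<integral>\<^sup>+x. \<integral>\<^sup>+\<eta>. ennreal (norm (?F x \<eta>)) \<partial>lborel \<partial>lborel) < \<infinity>"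
    using nn_mult_finite[OF integrable_lborel_translate(3)[OF k_integrable[of n], of y] integrable_gauss[where 'n = 'n]]
    by (simp add: norm_mult ennreal_mult)
  then have "(LINT x|lborel. LINT \<eta>|lborel. ?F x \<eta>) = (LINT \<eta>|lborel. LINT x|lborel. ?F x \<eta>)"
    by (intro fubini_swap) measurable
  moreover have "(LINT \<eta>|lborel. ?F x \<eta>) = kc n (x - y) * test t \<xi> x" for x
    unfolding integral_mult_right_zero integral_gauss_ec test_def by (simp add: mult_ac)
  moreover have "(LINT x|lborel. ?F x \<eta>) = of_real (gauss \<eta>) * (ec (- ((\<xi> + t *\<^sub>R \<eta>) \<bullet> y)) * ft (kc n) (\<xi> + t *\<^sub>R \<eta>))" for \<eta>
  proof -
    have "(LINT x|lborel. ?F x \<eta>) = (LINT x|lborel. ?F (x + y) \<eta>)"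
      by (rule integral_lborel_translate(2)[symmetric]) measurable
    also have "\<dots> = (LINT x|lborel. (of_real (gauss \<eta>) * ec (- ((\<xi> + t *\<^sub>R \<eta>) \<bullet> y))) * (kc n x * ec (- ((\<xi> + t *\<^sub>R \<eta>) \<bullet> x))))"
    proof (rule Bochner_Integration.integral_cong[OF refl])
      fix x
      have "ec (- (\<xi> \<bullet> (x + y))) * ec (- ((t *\<^sub>R (x + y)) \<bullet> \<eta>)) = ec (- ((\<xi> + t *\<^sub>R \<eta>) \<bullet> y)) * ec (- ((\<xi> + t *\<^sub>R \<eta>) \<bullet> x))"
        unfolding ec_add[symmetric] by (rule arg_cong[where f = ec]) (simp add: inner_add_left inner_add_right inner_commute[of _ \<eta>] algebra_simps)
      then show "?F (x + y) \<eta> = (of_real (gauss \<eta>) * ec (- ((\<xi> + t *\<^sub>R \<eta>) \<bullet> y))) * (kc n x * ec (- ((\<xi> + t *\<^sub>R \<eta>) \<bullet> x)))"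
        by (simp add: mult_ac)
    qed
    finally show ?thesis unfolding integral_mult_right_zero ft_def by (simp add: mult_ac)
  qed
  ultimately show ?thesis unfolding dual_def by (simp only:)
qed

lemma conv_test_pairing:
  assumes t: "t > 0" and h: "integrable lborel h"
  shows "integrable lborel (\<lambda>x. conv (kc n) h x * test t \<xi> x)"
    and "(LINT x|lborel. conv (kc n) h x * test t \<xi> x) = (LINT y|lborel. h y * dual (ft (kc n)) t \<xi> y)"
proof -
  have [measurable]: "h \<in> borel_measurable borel" using h by auto
  show "integrable lborel (\<lambda>x. conv (kc n) h x * test t \<xi> x)"
    by (rule integrable_mult_bounded(1)[OF integrable_conv[OF kc_integrable h]]) (auto intro: norm_test_le)
  let ?F = "\<lambda>x y. kc n (x - y) * h y * test t \<xi> x"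
  have "(\<integral>\<^sup>+x. \<integral>\<^sup>+y. ennreal (norm (?F x y)) \<partial>lborel \<partial>lborel) \<le> (\<integral>\<^sup>+x. \<integral>\<^sup>+y. ennreal (norm (kc n (x - y) * h y)) \<partial>lborel \<partial>lborel)"
    by (intro nn_integral_mono ennreal_leI) (simp only: norm_mult mult_left_le norm_test_le norm_ge_zero mult_nonneg_nonneg)
  also have "\<dots> < \<infinity>" by (rule conv_fubini_finite[OF kc_integrable h])
  finally have "(LINT x|lborel. LINT y|lborel. ?F x y) = (LINT y|lborel. LINT x|lborel. ?F x y)"
    by (intro fubini_swap) measurable
  moreover have "(LINT y|lborel. ?F x y) = conv (kc n) h x * test t \<xi> x" for x
    unfolding conv_def integral_mult_left_zero ..
  moreover have "(LINT x|lborel. ?F x y) = h y * dual (ft (kc n)) t \<xi> y" for y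
  proof -
    have "?F x y = h y * (kc n (x - y) * test t \<xi> x)" for x by (simp only: mult_ac)
    then show ?thesis unfolding conv_kc_test[OF t, symmetric] by (simp only: integral_mult_right_zero)
  qed
  ultimately show "(LINT x|lborel. conv (kc n) h x * test t \<xi> x) = (LINT y|lborel. h y * dual (ft (kc n)) t \<xi> y)"
    by (simp only:)
qed

context
  fixes f g :: "real ^ 'n \<Rightarrow> complex"
  assumes f: "integrable lborel f" and g: "integrable lborel g"
    and lim: "AE x in lborel. (\<lambda>n. conv (kc n) f x) \<longlonglongrightarrow> g x"
begin

lemma fg_measurable [measurable]: "f \<in> borel_measurable borel" "g \<in> borel_measurable borel"
  using f g by auto

text \<open>Sublevel sets of the maximal function of the convolutions. Almost everywhere convergence
  makes them exhaust almost all of space, and on each of them dominated convergence is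
  available.\<close>

definition sup_le :: "nat \<Rightarrow> (real ^ 'n) set" where
  "sup_le M = {x. \<forall>n. norm (conv (kc n) f x) \<le> real M}"

lemma sup_le_measurable [measurable]: "sup_le M \<in> sets borel"
  unfolding sup_le_def by measurable

lemma AE_sup_le: "AE x in lborel. \<forall>\<^sub>F M in sequentially. x \<in> sup_le M"
  using lim
proof eventually_elim
  case (elim x)
  then obtain B where B: "\<And>n. norm (conv (kc n) f x) \<le> B"
    using convergent_imp_Bseq[of "\<lambda>n. conv (kc n) f x"] by (auto simp: convergent_def Bseq_def)
  obtain M0 where M0: "B \<le> real M0" using real_arch_simple by blast
  show ?case
  proof (rule eventually_mono[OF eventually_ge_at_top[of M0]])
    fix M assume "M0 \<le> M"
    then have "B \<le> real M" using M0 by linarith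
    then show "x \<in> sup_le M" unfolding sup_le_def using B order_trans by blast
  qed
qed

text \<open>On \<open>- X \<inter> sup_le M\<close> the convolution of \<open>f\<close> is compared with that of \<open>h\<close> in \<open>L\<^sup>1\<close>; off that set the
  convolution of \<open>h\<close> is small by its \<open>L\<^sup>2\<close> bound.  The bound on \<open>sup_le M\<close> allows passing to the
  limit in \<open>n\<close> although the convolutions of \<open>f\<close> need not converge in \<open>L\<^sup>1\<close>.\<close>

lemma truncated_pairing_bound:
  assumes t: "t > 0" and c: "c > 0" and h: "integrable lborel h"
    and P: "(\<integral>\<^sup>+x. ennreal ((norm (h x))\<^sup>2) \<partial>lborel) \<le> ennreal P" "P \<ge> 0"
    and X: "X \<in> sets borel" "emeasure lborel X \<le> ennreal W" "W \<ge> 0"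
    and D: "D \<ge> 0" "\<And>n. (\<integral>\<^sup>+x. indicator (- X) x * ennreal (norm (conv (kc n) (\<lambda>y. f y - h y) x)) \<partial>lborel) \<le> ennreal D"
  shows "norm ((LINT x|lborel. indicator (- X \<inter> sup_le M) x *\<^sub>R (g x * test t \<xi> x)) - (LINT y|lborel. h y * dual m t \<xi> y)) \<le>
    D + (c / 2 * P + 1 / (2 * c) * (W + (LINT x|lborel. indicator (- sup_le M) x * norm (test t \<xi> x))))"
    (is "_ \<le> ?R")
proof -
  note X(1)[measurable]
  have [measurable]: "h \<in> borel_measurable borel" using h by auto
  let ?A = "- X \<inter> sup_le M"
  let ?\<psi> = "test t \<xi>"
  define e where "e = (LINT x|lborel. indicator (- sup_le M) x * norm (?\<psi> x))"
  have ie: "integrable lborel (\<lambda>x. indicator (- sup_le M) x * norm (?\<psi> x))"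
    by (rule Bochner_Integration.integrable_bound[OF integrable_norm[OF integrable_test[OF t]]]) (auto simp: indicator_def)
  have e: "e \<ge> 0" unfolding e_def by simp
  have R0: "0 \<le> c / 2 * P + 1 / (2 * c) * (W + e)" using c P(2) X(3) e by simp
  have ih: "integrable lborel (conv (kc n) h)" "integrable lborel (conv (kc n) f)" for n
    by (intro integrable_conv kc_integrable h f)+
  have step: "norm ((LINT x|lborel. indicator ?A x *\<^sub>R (conv (kc n) f x * ?\<psi> x)) - (LINT y|lborel. h y * dual (ft (kc n)) t \<xi> y)) \<le> ?R" for n
  proof -
    let ?u = "conv (kc n) f" and ?H = "conv (kc n) h"
    obtain B where B: "\<And>x. norm (kc n x) \<le> B" using k_bounded[of n] by auto
    have kcm: "kc n \<in> borel_measurable borel" by measurable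
    have dif: "conv (kc n) (\<lambda>y. f y - h y) x = ?u x - ?H x" for x
      unfolding conv_def right_diff_distrib
      by (rule Bochner_Integration.integral_diff) (intro conv_integrand_integrable[OF kcm B] f h)+
    have bm: "integrable lborel (\<lambda>x. v x * ?\<psi> x)" if "integrable lborel v" for v
      by (rule integrable_mult_bounded(1)[OF that]) (auto intro: norm_test_le)
    have bi: "integrable lborel (\<lambda>x. indicator S x *\<^sub>R v x)" if "integrable lborel v" "S \<in> sets borel" for v :: "real ^ 'n \<Rightarrow> complex" and S
      using that by (intro integrable_mult_indicator) auto
    have "(LINT x|lborel. indicator ?A x *\<^sub>R (?u x * ?\<psi> x)) - (LINT y|lborel. h y * dual (ft (kc n)) t \<xi> y)
      = (LINT x|lborel. indicator ?A x *\<^sub>R (?u x * ?\<psi> x)) - (LINT x|lborel. ?H x * ?\<psi> x)"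
      by (simp only: conv_test_pairing(2)[OF t h])
    also have "\<dots> = (LINT x|lborel. indicator ?A x *\<^sub>R (?u x * ?\<psi> x) - ?H x * ?\<psi> x)"
      by (intro Bochner_Integration.integral_diff[symmetric] bi bm ih) measurable
    finally have eq: "(LINT x|lborel. indicator ?A x *\<^sub>R (?u x * ?\<psi> x)) - (LINT y|lborel. h y * dual (ft (kc n)) t \<xi> y) =
      (LINT x|lborel. indicator ?A x *\<^sub>R (?u x * ?\<psi> x) - ?H x * ?\<psi> x)" .
    have "ennreal (norm ((LINT x|lborel. indicator ?A x *\<^sub>R (?u x * ?\<psi> x)) - (LINT y|lborel. h y * dual (ft (kc n)) t \<xi> y))) \<le>
       (\<integral>\<^sup>+x. ennreal (norm (indicator ?A x *\<^sub>R (?u x * ?\<psi> x) - ?H x * ?\<psi> x)) \<partial>lborel)"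
      unfolding eq by (rule norm_integral_le_nn_integral)
    also have "\<dots> \<le> (\<integral>\<^sup>+x. indicator (- X) x * ennreal (norm (?u x - ?H x)) + (ennreal (c / 2) * ennreal ((norm (?H x))\<^sup>2) +
        ennreal (1 / (2 * c)) * (indicator X x + ennreal (indicator (- sup_le M) x * norm (?\<psi> x)))) \<partial>lborel)"
    proof (rule nn_integral_mono)
      fix x
      show "ennreal (norm (indicator ?A x *\<^sub>R (?u x * ?\<psi> x) - ?H x * ?\<psi> x)) \<le> indicator (- X) x * ennreal (norm (?u x - ?H x)) + (ennreal (c / 2) * ennreal ((norm (?H x))\<^sup>2) +
        ennreal (1 / (2 * c)) * (indicator X x + ennreal (indicator (- sup_le M) x * norm (?\<psi> x))))"
      proof (cases "x \<in> ?A")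
        case True
        have "norm (indicator ?A x *\<^sub>R (?u x * ?\<psi> x) - ?H x * ?\<psi> x) = norm (?u x - ?H x) * norm (?\<psi> x)"
          using True by (simp add: norm_mult flip: left_diff_distrib)
        also have "\<dots> \<le> norm (?u x - ?H x)" by (rule mult_left_le[OF norm_test_le]) simp
        finally show ?thesis using True by (simp add: add_increasing2 ennreal_leI)
      next
        case False
        \<comment> \<open>Cauchy-Schwarz in its weighted pointwise form; the free weight c is chosen
          in \<open>pairing_eq\<close>.\<close>
        have "0 \<le> (c * norm (?H x) - norm (?\<psi> x))\<^sup>2" by simp
        then have "2 * c * (norm (?H x) * norm (?\<psi> x)) \<le> c\<^sup>2 * (norm (?H x))\<^sup>2 + (norm (?\<psi> x))\<^sup>2"
          by (simp add: power2_diff power_mult_distrib mult_ac)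
        then have le1: "norm (?H x) * norm (?\<psi> x) \<le> c / 2 * (norm (?H x))\<^sup>2 + 1 / (2 * c) * (norm (?\<psi> x))\<^sup>2"
          using c by (simp add: field_simps power2_eq_square)
        \<comment> \<open>A point outside the comparison set lies either in X, where the test
          function is at most 1, or outside \<open>sup_le M\<close>, where its square is at most its
          norm.\<close>
        have le2: "(norm (?\<psi> x))\<^sup>2 \<le> indicator X x + indicator (- sup_le M) x * norm (?\<psi> x)"
        proof (cases "x \<in> X")
          case True
          then show ?thesis using norm_test_le[of t \<xi> x] by (simp add: power_le_one add_increasing2)
        next
          case False
          then have "x \<notin> sup_le M" using \<open>x \<notin> ?A\<close> by auto
          then show ?thesis using False norm_test_le[of t \<xi> x] by (simp add: power2_eq_square mult_left_le)
        qed
        have "1 / (2 * c) * (norm (?\<psi> x))\<^sup>2 \<le> 1 / (2 * c) * (indicator X x + indicator (- sup_le M) x * norm (?\<psi> x))"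
          using c by (intro mult_left_mono le2) auto
        with le1 have "norm (?H x * ?\<psi> x) \<le> c / 2 * (norm (?H x))\<^sup>2 + 1 / (2 * c) * (indicator X x + indicator (- sup_le M) x * norm (?\<psi> x))"
          unfolding norm_mult by linarith
        then have "ennreal (norm (?H x * ?\<psi> x)) \<le> ennreal (c / 2 * (norm (?H x))\<^sup>2 + 1 / (2 * c) * (indicator X x + indicator (- sup_le M) x * norm (?\<psi> x)))"
          by (rule ennreal_leI)
        also have "\<dots> = ennreal (c / 2) * ennreal ((norm (?H x))\<^sup>2) + ennreal (1 / (2 * c)) * (ennreal (indicator X x) + ennreal (indicator (- sup_le M) x * norm (?\<psi> x)))"
          using c by (simp add: ennreal_mult'[symmetric] flip: ennreal_plus)
        finally have le: "ennreal (norm (?H x * ?\<psi> x)) \<le> ennreal (c / 2) * ennreal ((norm (?H x))\<^sup>2) + ennreal (1 / (2 * c)) * (indicator X x + ennreal (indicator (- sup_le M) x * norm (?\<psi> x)))"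
          by (simp add: ennreal_indicator)
        have "norm (indicator ?A x *\<^sub>R (?u x * ?\<psi> x) - ?H x * ?\<psi> x) = norm (?H x * ?\<psi> x)"
          using False by simp
        then show ?thesis using add_increasing[OF zero_le le] by (simp only:)
      qed
    qed
    also have "\<dots> = (\<integral>\<^sup>+x. indicator (- X) x * ennreal (norm (?u x - ?H x)) \<partial>lborel) + (ennreal (c / 2) * (\<integral>\<^sup>+x. ennreal ((norm (?H x))\<^sup>2) \<partial>lborel) +
        ennreal (1 / (2 * c)) * (emeasure lborel X + (\<integral>\<^sup>+x. ennreal (indicator (- sup_le M) x * norm (?\<psi> x)) \<partial>lborel)))"
      by (simp add: nn_integral_add nn_integral_cmult)
    also have "(\<integral>\<^sup>+x. ennreal (indicator (- sup_le M) x * norm (?\<psi> x)) \<partial>lborel) = ennreal e"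
      unfolding e_def by (rule nn_integral_eq_integral[OF ie]) auto
    also have "(\<integral>\<^sup>+x. indicator (- X) x * ennreal (norm (?u x - ?H x)) \<partial>lborel) + (ennreal (c / 2) * (\<integral>\<^sup>+x. ennreal ((norm (?H x))\<^sup>2) \<partial>lborel) +
        ennreal (1 / (2 * c)) * (emeasure lborel X + ennreal e)) \<le> ennreal D + (ennreal (c / 2) * ennreal P + ennreal (1 / (2 * c)) * (ennreal W + ennreal e))"
    proof (intro add_mono mult_left_mono order_refl X(2))
      show "(\<integral>\<^sup>+x. indicator (- X) x * ennreal (norm (?u x - ?H x)) \<partial>lborel) \<le> ennreal D"
        using D(2)[of n] unfolding dif .
      have "continuous_on UNIV (kc n)" by (intro continuous_intros k_continuous)
      from order_trans[OF conv_L2_bound[OF kc_integrable this B k_ft h] P(1)]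
      show "(\<integral>\<^sup>+x. ennreal ((norm (?H x))\<^sup>2) \<partial>lborel) \<le> ennreal P" .
    qed auto
    also have "\<dots> = ennreal ?R"
      unfolding e_def[symmetric] using c D(1) P(2) X(3) e R0
      by (simp add: ennreal_mult'[symmetric] flip: ennreal_plus)
    finally show ?thesis
      using R0 D(1) unfolding e_def by (subst (asm) ennreal_le_iff) (simp_all only: add_nonneg_nonneg)
  qed
  have l1: "(\<lambda>n. LINT x|lborel. indicator ?A x *\<^sub>R (conv (kc n) f x * ?\<psi> x)) \<longlonglongrightarrow> (LINT x|lborel. indicator ?A x *\<^sub>R (g x * ?\<psi> x))"
  proof (rule integral_dominated_convergence[where w = "\<lambda>x. real M * norm (?\<psi> x)"])
    show "integrable lborel (\<lambda>x. real M * norm (?\<psi> x))"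
      by (intro integrable_mult_right integrable_norm integrable_test t)
    show "AE x in lborel. (\<lambda>n. indicator ?A x *\<^sub>R (conv (kc n) f x * ?\<psi> x)) \<longlonglongrightarrow> indicator ?A x *\<^sub>R (g x * ?\<psi> x)"
      using lim by eventually_elim (intro tendsto_intros)
    show "AE x in lborel. norm (indicator ?A x *\<^sub>R (conv (kc n) f x * ?\<psi> x)) \<le> real M * norm (?\<psi> x)" for n
      by (intro always_eventually allI) (auto simp: indicator_def norm_mult sup_le_def mult_right_mono)
  qed measurable
  have l2: "(\<lambda>n. LINT y|lborel. h y * dual (ft (kc n)) t \<xi> y) \<longlonglongrightarrow> (LINT y|lborel. h y * dual m t \<xi> y)"
  proof (rule integral_dominated_convergence[where w = "\<lambda>x. norm (h x)"])
    show "AE y in lborel. (\<lambda>n. h y * dual (ft (kc n)) t \<xi> y) \<longlonglongrightarrow> h y * dual m t \<xi> y"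
      by (intro always_eventually allI tendsto_intros dual_kc_tendsto)
    show "AE y in lborel. norm (h y * dual (ft (kc n)) t \<xi> y) \<le> norm (h y)" for n
      by (intro always_eventually allI) (simp add: norm_mult mult_left_le norm_dual_le k_ft)
  qed (use h in auto)
  show ?thesis
    using tendsto_norm[OF tendsto_diff[OF l1 l2]] step by (intro LIMSEQ_le_const2) auto
qed

text \<open>Let M tend to infinity in \<open>truncated_pairing_bound\<close>, which removes the tail
  of the test function. The last two terms pay for restoring g on X and for replacing h by
  f.\<close>

lemma pairing_bound:
  assumes t: "t > 0" and c: "c > 0" and h: "integrable lborel h"
    and P: "(\<integral>\<^sup>+x. ennreal ((norm (h x))\<^sup>2) \<partial>lborel) \<le> ennreal P" "P \<ge> 0"
    and X: "X \<in> sets borel" "emeasure lborel X \<le> ennreal W" "W \<ge> 0"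
    and D: "D \<ge> 0" "\<And>n. (\<integral>\<^sup>+x. indicator (- X) x * ennreal (norm (conv (kc n) (\<lambda>y. f y - h y) x)) \<partial>lborel) \<le> ennreal D"
  shows "norm ((LINT x|lborel. g x * test t \<xi> x) - (LINT y|lborel. f y * dual m t \<xi> y)) \<le>
    D + (c / 2 * P + 1 / (2 * c) * W) + (LINT x|lborel. indicator X x * norm (g x)) + (LINT x|lborel. norm (f x - h x))"
proof -
  note X(1)[measurable]
  have [measurable]: "h \<in> borel_measurable borel" using h by auto
  let ?\<psi> = "test t \<xi>"
  have bm: "integrable lborel (\<lambda>x. g x * ?\<psi> x)"
    by (rule integrable_mult_bounded(1)[OF g]) (auto intro: norm_test_le)
  have l1: "(\<lambda>M. LINT x|lborel. indicator (- X \<inter> sup_le M) x *\<^sub>R (g x * ?\<psi> x)) \<longlonglongrightarrow> (LINT x|lborel. indicator (- X) x *\<^sub>R (g x * ?\<psi> x))"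
  proof (rule integral_dominated_convergence[where w = "\<lambda>x. norm (g x * ?\<psi> x)"])
    show "AE x in lborel. (\<lambda>M. indicator (- X \<inter> sup_le M) x *\<^sub>R (g x * ?\<psi> x)) \<longlonglongrightarrow> indicator (- X) x *\<^sub>R (g x * ?\<psi> x)"
      using AE_sup_le
    proof eventually_elim
      case (elim x)
      show ?case by (rule tendsto_eventually, rule eventually_mono[OF elim]) (auto simp: indicator_def)
    qed
    show "integrable lborel (\<lambda>x. norm (g x * ?\<psi> x))" by (rule integrable_norm[OF bm])
  qed (auto simp: indicator_def)
  have l2: "(\<lambda>M. LINT x|lborel. indicator (- sup_le M) x * norm (?\<psi> x)) \<longlonglongrightarrow> (LINT x|(lborel :: (real ^ 'n) measure). (0::real))"
  proof (rule integral_dominated_convergence[where w = "\<lambda>x. norm (?\<psi> x)"])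
    show "AE x in lborel. (\<lambda>M. indicator (- sup_le M) x * norm (?\<psi> x)) \<longlonglongrightarrow> 0"
      using AE_sup_le
    proof eventually_elim
      case (elim x)
      show ?case by (rule tendsto_eventually, rule eventually_mono[OF elim]) (auto simp: indicator_def)
    qed
    show "integrable lborel (\<lambda>x. norm (?\<psi> x))" by (rule integrable_norm[OF integrable_test[OF t]])
  qed (auto simp: indicator_def)
  have "norm ((LINT x|lborel. indicator (- X) x *\<^sub>R (g x * ?\<psi> x)) - (LINT y|lborel. h y * dual m t \<xi> y)) \<le>
     D + (c / 2 * P + 1 / (2 * c) * (W + (LINT x|(lborel :: (real ^ 'n) measure). (0::real))))"
    by (rule LIMSEQ_le[OF tendsto_norm[OF tendsto_diff[OF l1 tendsto_const]] tendsto_add[OF tendsto_const tendsto_add[OF tendsto_const tendsto_mult[OF tendsto_const tendsto_add[OF tendsto_const l2]]]]])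
      (use truncated_pairing_bound[OF t c h P X D] in blast)
  then have 1: "norm ((LINT x|lborel. indicator (- X) x *\<^sub>R (g x * ?\<psi> x)) - (LINT y|lborel. h y * dual m t \<xi> y)) \<le>
     D + (c / 2 * P + 1 / (2 * c) * W)" by simp
  have "norm ((LINT x|lborel. g x * ?\<psi> x) - (LINT x|lborel. indicator (- X) x *\<^sub>R (g x * ?\<psi> x))) =
    norm (LINT x|lborel. g x * ?\<psi> x - indicator (- X) x *\<^sub>R (g x * ?\<psi> x))"
    by (subst Bochner_Integration.integral_diff[OF bm]) (auto intro!: integrable_mult_indicator bm)
  also have "\<dots> \<le> (LINT x|lborel. norm (g x * ?\<psi> x - indicator (- X) x *\<^sub>R (g x * ?\<psi> x)))"
    by (rule integral_norm_bound)
  also have "\<dots> \<le> (LINT x|lborel. indicator X x * norm (g x))"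
  proof (rule integral_mono')
    show "integrable lborel (\<lambda>x. indicator X x * norm (g x))"
      using integrable_mult_indicator[of X lborel "\<lambda>x. norm (g x)"] g by simp
    show "norm (g x * ?\<psi> x - indicator (- X) x *\<^sub>R (g x * ?\<psi> x)) \<le> indicator X x * norm (g x)" for x
      using norm_test_le[of t \<xi> x] by (cases "x \<in> X") (auto simp: norm_mult mult_left_le)
  qed auto
  finally have 2: "norm ((LINT x|lborel. g x * ?\<psi> x) - (LINT x|lborel. indicator (- X) x *\<^sub>R (g x * ?\<psi> x))) \<le> (LINT x|lborel. indicator X x * norm (g x))" .
  have db: "norm (dual m t \<xi> y) \<le> 1" for y by (rule norm_dual_le[OF norm_m_le])
  have "norm ((LINT y|lborel. h y * dual m t \<xi> y) - (LINT y|lborel. f y * dual m t \<xi> y)) =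
    norm (LINT y|lborel. h y * dual m t \<xi> y - f y * dual m t \<xi> y)"
    by (subst Bochner_Integration.integral_diff) (auto intro!: integrable_mult_bounded(1)[OF f] integrable_mult_bounded(1)[OF h] db)
  also have "\<dots> \<le> (LINT y|lborel. norm (h y * dual m t \<xi> y - f y * dual m t \<xi> y))"
    by (rule integral_norm_bound)
  also have "\<dots> \<le> (LINT x|lborel. norm (f x - h x))"
    using db f h by (intro integral_mono') (auto simp: norm_mult norm_minus_commute mult_left_le simp flip: left_diff_distrib)
  finally have 3: "norm ((LINT y|lborel. h y * dual m t \<xi> y) - (LINT y|lborel. f y * dual m t \<xi> y)) \<le> (LINT x|lborel. norm (f x - h x))" .
  let ?a = "LINT x|lborel. g x * ?\<psi> x" and ?b = "LINT x|lborel. indicator (- X) x *\<^sub>R (g x * ?\<psi> x)"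
    and ?c = "LINT y|lborel. h y * dual m t \<xi> y" and ?d = "LINT y|lborel. f y * dual m t \<xi> y"
  have "norm (?a - ?d) \<le> norm (?a - ?b) + norm (?b - ?c) + norm (?c - ?d)"
    using norm_triangle_ineq[of "?a - ?b" "?b - ?d"] norm_triangle_ineq[of "?b - ?c" "?c - ?d"] by simp
  with 1 2 3 show ?thesis by linarith
qed

lemma pairing_eq:
  assumes t: "t > 0"
  shows "(LINT x|lborel. g x * test t \<xi> x) = (LINT y|lborel. f y * dual m t \<xi> y)"
proof -
  define F where "F = (LINT x|lborel. norm (f x))"
  have F: "F \<ge> 0" unfolding F_def by simp
  \<comment> \<open>Any heights would do that are positive, at least F as the decomposition demands,
    and tend to infinity.\<close>
  define \<mu> where "\<mu> j = F + real (Suc j)" for j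
  have \<mu>: "\<mu> j > 0" "F \<le> \<mu> j" for j using F by (auto simp: \<mu>_def)
  have "calderon_zygmund_level f (\<mu> j)" for j
    using f \<mu>[of j] unfolding F_def by unfold_locales auto
  note cz = this
  define \<tau> where "\<tau> j = calderon_zygmund_level.tau f (\<mu> j)" for j
  define h where "h j = calderon_zygmund_level.good f (\<mu> j)" for j
  define X where "X j = calderon_zygmund_level.big f (\<mu> j)" for j
  have \<tau>0: "\<tau> j \<ge> 0" for j unfolding \<tau>_def by (rule calderon_zygmund_level.tau_nonneg[OF cz])
  have \<tau>F: "\<tau> j \<le> F" for j unfolding \<tau>_def F_def by (rule calderon_zygmund_level.tau_le[OF cz])
  have Flim: "(\<lambda>j. F / \<mu> j) \<longlonglongrightarrow> 0" unfolding \<mu>_def by real_asymp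
  \<comment> \<open>The stopped cubes have measure at most \<open>F / \<mu> j\<close>, which tends
    to 0, so the mass of the fixed function f on them tends to 0.\<close>
  have \<tau>lim: "\<tau> \<longlonglongrightarrow> 0"
  proof -
    have "(\<lambda>j. LINT x|lborel. indicator (calderon_zygmund_level.bad f (\<mu> j)) x * norm (f x)) \<longlonglongrightarrow> 0"
    proof (rule integral_small_sets_tendsto_0[OF f _ _ Flim])
      show "calderon_zygmund_level.bad f (\<mu> j) \<in> sets lborel" for j
        using calderon_zygmund_level.bad_measurable[OF cz] by simp
      show "emeasure lborel (calderon_zygmund_level.bad f (\<mu> j)) \<le> ennreal (F / \<mu> j)" for j
        by (rule order_trans[OF calderon_zygmund_level.emeasure_bad[OF cz]])
          (use \<tau>F[of j] \<mu>(1)[of j] in \<open>auto simp: \<tau>_def intro!: ennreal_leI divide_right_mono\<close>)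
    qed (use F \<mu> in \<open>auto intro!: divide_nonneg_pos\<close>)
    then show ?thesis by (simp add: \<tau>_def[abs_def] calderon_zygmund_level.tau_def[OF cz])
  qed
  define K where "K = unit_ball_vol (real CARD('n)) * (4 * real CARD('n)) ^ CARD('n)"
  have K: "K \<ge> 0" unfolding K_def by simp
  define Q where "Q = (2 ^ CARD('n) + 1) * F"
  have Q: "Q \<ge> 0" unfolding Q_def using F by simp
  define W where "W j = K * (\<tau> j / \<mu> j)" for j
  have W: "W j \<ge> 0" for j unfolding W_def using K \<tau>0 \<mu>(1) by (intro mult_nonneg_nonneg divide_nonneg_pos) auto
  \<comment> \<open>With weight \<open>s j / \<mu> j\<close> the two Cauchy-Schwarz terms become s Q
    / 2 and K \<open>\<tau>\<close> / (2 s). Both tend to 0 once s tends to 0 with s^2 at least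
    \<open>\<tau>\<close>; the summand 1/(j+1) keeps s positive.\<close>
  define s where "s j = sqrt (\<tau> j + 1 / real (Suc j))" for j
  have s: "s j > 0" "\<tau> j \<le> s j * s j" for j
    using \<tau>0[of j] by (auto simp: s_def add_nonneg_pos)
  have slim: "s \<longlonglongrightarrow> 0"
  proof -
    have "(\<lambda>j. 1 / real (Suc j)) \<longlonglongrightarrow> 0" by real_asymp
    then have "(\<lambda>j. sqrt (\<tau> j + 1 / real (Suc j))) \<longlonglongrightarrow> sqrt (0 + 0)" by (intro tendsto_intros \<tau>lim)
    then show ?thesis by (simp add: s_def[abs_def])
  qed
  have Om: "X j \<in> sets borel" "emeasure lborel (X j) \<le> ennreal (W j)" for j
    unfolding X_def W_def K_def \<tau>_def
    by (rule calderon_zygmund_level.big_measurable[OF cz]) (rule calderon_zygmund_level.emeasure_big[OF cz])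
  have bound: "norm ((LINT x|lborel. g x * test t \<xi> x) - (LINT y|lborel. f y * dual m t \<xi> y)) \<le>
      C * \<tau> j + (s j * (Q / 2) + s j * (K / 2)) + (LINT x|lborel. indicator (X j) x * norm (g x)) + 2 * \<tau> j" for j
  proof -
    have hj: "integrable lborel (h j)" unfolding h_def by (rule calderon_zygmund_level.integrable_good[OF cz])
    have P: "(\<integral>\<^sup>+x. ennreal ((norm (h j x))\<^sup>2) \<partial>lborel) \<le> ennreal (Q * \<mu> j)"
      using calderon_zygmund_level.nn_integral_good_square[OF cz, of j] unfolding h_def Q_def F_def by (simp add: mult_ac)
    have Dn: "(\<integral>\<^sup>+x. indicator (- X j) x * ennreal (norm (conv (kc n) (\<lambda>y. f y - h j y) x)) \<partial>lborel) \<le> ennreal (C * \<tau> j)" for n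
    proof -
      obtain B where B: "\<And>x. \<bar>k n x\<bar> \<le> B" using k_bounded[of n] by auto
      show ?thesis
        unfolding X_def h_def conv_def \<tau>_def
        by (rule calderon_zygmund_level.nn_integral_conv_bad_part[OF cz k_measurable B C k_hormander])
    qed
    have c: "s j / \<mu> j > 0" using s \<mu> by simp
    have "norm ((LINT x|lborel. g x * test t \<xi> x) - (LINT y|lborel. f y * dual m t \<xi> y)) \<le>
      C * \<tau> j + (s j / \<mu> j / 2 * (Q * \<mu> j) + 1 / (2 * (s j / \<mu> j)) * W j) + (LINT x|lborel. indicator (X j) x * norm (g x)) + (LINT x|lborel. norm (f x - h j x))"
      by (rule pairing_bound[OF t c hj P _ Om W _ Dn]) (use Q \<mu>(1)[of j] C \<tau>0 in auto)
    moreover have "s j / \<mu> j / 2 * (Q * \<mu> j) = s j * (Q / 2)" using \<mu>(1)[of j] by simp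
    moreover have "1 / (2 * (s j / \<mu> j)) * W j \<le> s j * (K / 2)"
    proof -
      have "1 / (2 * (s j / \<mu> j)) * W j = (K / 2) * (\<tau> j / s j)" using \<mu>(1)[of j] s(1)[of j] by (simp add: W_def)
      also have "\<dots> \<le> (K / 2) * s j" using s[of j] K by (intro mult_left_mono) (auto simp: field_simps)
      finally show ?thesis by (simp add: mult.commute)
    qed
    moreover have "(LINT x|lborel. norm (f x - h j x)) \<le> 2 * \<tau> j"
    proof -
      have "ennreal (LINT x|lborel. norm (f x - h j x)) = (\<integral>\<^sup>+x. ennreal (norm (f x - h j x)) \<partial>lborel)"
        using f hj by (intro nn_integral_eq_integral[symmetric]) auto
      also have "\<dots> \<le> ennreal (2 * \<tau> j)"
        unfolding h_def \<tau>_def by (rule calderon_zygmund_level.nn_integral_f_good[OF cz])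
      finally show ?thesis using \<tau>0[of j] by (subst (asm) ennreal_le_iff) auto
    qed
    ultimately show ?thesis by linarith
  qed
  have Wlim: "W \<longlonglongrightarrow> 0"
  proof -
    have "(\<lambda>j. K * (F / \<mu> j)) \<longlonglongrightarrow> K * 0" by (intro tendsto_intros Flim)
    then have lim0: "(\<lambda>j. K * (F / \<mu> j)) \<longlonglongrightarrow> 0" by simp
    show ?thesis
      by (rule tendsto_sandwich[OF _ _ tendsto_const lim0])
        (use W \<tau>F \<mu>(1) K in \<open>auto intro!: always_eventually mult_left_mono divide_right_mono simp: W_def less_imp_le\<close>)
  qed
  have "(\<lambda>j. LINT x|lborel. indicator (X j) x * norm (g x)) \<longlonglongrightarrow> 0"
    by (rule integral_small_sets_tendsto_0[OF g _ Om(2) Wlim W]) (use Om in simp)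
  then have "(\<lambda>j. C * \<tau> j + (s j * (Q / 2) + s j * (K / 2)) + (LINT x|lborel. indicator (X j) x * norm (g x)) + 2 * \<tau> j) \<longlonglongrightarrow>
     C * 0 + (0 * (Q / 2) + 0 * (K / 2)) + 0 + 2 * 0"
    by (intro tendsto_intros \<tau>lim slim)
  then have "norm ((LINT x|lborel. g x * test t \<xi> x) - (LINT y|lborel. f y * dual m t \<xi> y)) \<le> 0"
    using bound by (intro LIMSEQ_le_const) auto
  then show ?thesis by simp
qed

text \<open>Remove the damping. As t tends to 0, \<open>dual m t \<xi> y\<close> concentrates at the
  frequency \<open>\<xi>\<close>, for which continuity of m at that one frequency suffices.\<close>

theorem ft_singular_integral:
  assumes m: "isCont m \<xi>"
  shows "ft g \<xi> = m \<xi> * ft f \<xi>"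
proof -
  define t :: "nat \<Rightarrow> real" where "t n = 1 / real (Suc n)" for n
  have t: "t \<longlonglongrightarrow> 0" "t n > 0" for n
    unfolding t_def using LIMSEQ_inverse_real_of_nat by (auto simp: inverse_eq_divide)
  have 1: "(\<lambda>n. LINT x|lborel. g x * test (t n) \<xi> x) \<longlonglongrightarrow> ft g \<xi>"
    unfolding ft_def
  proof (rule integral_dominated_convergence[where w = "\<lambda>x. norm (g x)"])
    show "AE x in lborel. (\<lambda>n. g x * test (t n) \<xi> x) \<longlonglongrightarrow> g x * ec (- (\<xi> \<bullet> x))"
    proof (intro always_eventually allI)
      fix x
      have "(\<lambda>n. g x * test (t n) \<xi> x) \<longlonglongrightarrow> g x * (of_real (gauss (0 *\<^sub>R x)) * ec (- (\<xi> \<bullet> x)))"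
        unfolding test_def gauss_def by (intro tendsto_intros t)
      then show "(\<lambda>n. g x * test (t n) \<xi> x) \<longlonglongrightarrow> g x * ec (- (\<xi> \<bullet> x))" by simp
    qed
    show "AE x in lborel. norm (g x * test (t n) \<xi> x) \<le> norm (g x)" for n
      by (intro always_eventually allI) (simp add: norm_mult mult_left_le norm_test_le)
  qed (use g in auto)
  have 2: "(\<lambda>n. LINT y|lborel. f y * dual m (t n) \<xi> y) \<longlonglongrightarrow> (LINT y|lborel. f y * (ec (- (\<xi> \<bullet> y)) * m \<xi>))"
  proof (rule integral_dominated_convergence[where w = "\<lambda>x. norm (f x)"])
    show "AE y in lborel. (\<lambda>n. f y * dual m (t n) \<xi> y) \<longlonglongrightarrow> f y * (ec (- (\<xi> \<bullet> y)) * m \<xi>)"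
    proof (intro always_eventually allI tendsto_mult tendsto_const)
      fix y
      show "(\<lambda>n. dual m (t n) \<xi> y) \<longlonglongrightarrow> ec (- (\<xi> \<bullet> y)) * m \<xi>"
        unfolding dual_def
      proof (rule gauss_approx_identity[where B = 1, OF _ _ _ t(1)])
        show "(\<lambda>\<eta>. ec (- (\<eta> \<bullet> y)) * m \<eta>) \<in> borel_measurable borel" by measurable
        show "norm (ec (- (\<eta> \<bullet> y)) * m \<eta>) \<le> 1" for \<eta> using norm_m_le by (simp add: norm_mult)
        have "continuous_on UNIV (\<lambda>\<eta>. ec (- (\<eta> \<bullet> y)))" by (intro continuous_intros)
        then have "isCont (\<lambda>\<eta>. ec (- (\<eta> \<bullet> y))) \<xi>" by (simp add: continuous_on_eq_continuous_at)
        then show "isCont (\<lambda>\<eta>. ec (- (\<eta> \<bullet> y)) * m \<eta>) \<xi>" by (intro continuous_intros m)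
      qed
    qed
    show "AE y in lborel. norm (f y * dual m (t n) \<xi> y) \<le> norm (f y)" for n
      by (intro always_eventually allI) (simp add: norm_mult mult_left_le norm_dual_le norm_m_le)
  qed (use f in auto)
  have "(LINT y|lborel. f y * (ec (- (\<xi> \<bullet> y)) * m \<xi>)) = m \<xi> * ft f \<xi>"
    unfolding ft_def by (simp add: mult.assoc[symmetric])
  with 1 2 show ?thesis unfolding pairing_eq[OF t(2)] by (auto dest: LIMSEQ_unique)
qed

end

end

text \<open>Here g is the principal value for the unnormalised kernel \<open>zk\<close>, while the
  Gaussian superpositions converge to the mass of \<open>rad\<close> times g; this accounts for the
  factor on the left. Excluding the zero frequency makes the symbol continuous at
  \<open>\<xi>\<close>.\<close>

theorem riesz_transform_multiplier:
  fixes f g :: "real ^ 'n::finite \<Rightarrow> complex"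
  assumes f: "integrable lborel f" and g: "integrable lborel g"
    and lim: "AE x in lborel. (ztrunc i f x \<longlongrightarrow> g x) (at_right 0)" and \<xi>: "\<xi> \<noteq> 0"
  shows "of_real (LINT s|lborel. rad CARD('n) s) * ft g \<xi> = - \<i> * of_real (\<xi> $ i / norm \<xi>) * ft f \<xi>"
proof -
  let ?Cd = "LINT s|lborel. rad CARD('n) s"
  have [measurable]: "f \<in> borel_measurable borel" using f by auto
  have a: "0 < 1 / real (Suc n)" "1 / real (Suc n) \<le> real (Suc n)" for n
    by (auto simp: field_simps)
  define C where "C = 8 * pi * (LINT x|lborel. wgauss (x :: real ^ 'n)) * (LINT u|lborel. 1 / (1 + u\<^sup>2))"
  interpret singular_kernel "rkn i" "\<lambda>\<xi>. - \<i> * of_real (\<xi> $ i / norm \<xi>)" C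
  proof
    show "integrable lborel (rkn i n)" for n by (rule integrable_rk[OF a(1)])
    show "continuous_on UNIV (rkn i n)" for n by (rule continuous_rk) simp
    show "\<exists>B. \<forall>x. \<bar>rkn i n x\<bar> \<le> B" for n using abs_rk_le[OF less_imp_le[OF a(1)] a(2), of i] by blast
    show "norm (ft (\<lambda>x. of_real (rkn i n x)) \<xi>) \<le> 1" for n \<xi> by (rule norm_ft_rk_le_1[OF a])
    show "C \<ge> 0" unfolding C_def by (intro mult_nonneg_nonneg Bochner_Integration.integral_nonneg) auto
    show "(\<integral>\<^sup>+x. indicator {x. 2 * r < norm x} x * ennreal \<bar>rkn i n (x + v) - rkn i n x\<bar> \<partial>lborel) \<le> ennreal C"
      if "0 < r" "norm v \<le> r" for n v r
      unfolding C_def by (rule rk_hormander[OF a(1) that(2,1)])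
  qed (rule ft_rkn_tendsto)
  have "ft (\<lambda>x. of_real ?Cd * g x) \<xi> = (- \<i> * of_real (\<xi> $ i / norm \<xi>)) * ft f \<xi>"
  proof (rule ft_singular_integral[OF f])
    show "integrable lborel (\<lambda>x. of_real ?Cd * g x)" using g by simp
    show "AE x in lborel. (\<lambda>n. conv (\<lambda>x. of_real (rkn i n x)) f x) \<longlonglongrightarrow> of_real ?Cd * g x"
      using lim
    proof eventually_elim
      case (elim x)
      from conv_rkn_tendsto[OF f elim] show ?case by (simp add: conv_commute)
    qed
    show "isCont (\<lambda>\<xi>. - \<i> * of_real (\<xi> $ i / norm \<xi>)) \<xi>" using \<xi> by (intro continuous_intros) auto
  qed
  then show ?thesis unfolding ft_def by (simp add: mult.assoc)
qed

section \<open>Integration of characters over the unit cube\<close>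

lemma open_cube_eq_box: "open_cube = box (\<chi> i. - 1 / 2) (\<chi> i. 1 / 2)"
  by (auto simp: open_cube_def mem_box_cart)

lemma open_cube_measurable [measurable]: "open_cube \<in> sets borel"
  unfolding open_cube_eq_box by simp

lemma indicator_open_cube:
  "(indicator open_cube \<xi> :: real) = (\<Prod>i\<in>UNIV. indicator {- 1 / 2<..<1 / 2} (\<xi> $ i))"
  by (auto simp: indicator_def open_cube_def prod_zero_iff intro!: prod.neutral[symmetric] split: if_splits)

lemma cube_integrable:
  fixes u :: "real ^ 'n::finite \<Rightarrow> 'b::{banach, second_countable_topology}"
  assumes "continuous_on UNIV u"
  shows "integrable lborel (\<lambda>\<xi>. indicator open_cube \<xi> *\<^sub>R u \<xi>)"
proof -
  let ?Q = "cbox (\<chi> i. - 1 / 2) (\<chi> i. 1 / 2) :: (real ^ 'n) set"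
  have "integrable lborel (\<lambda>\<xi>. indicator ?Q \<xi> *\<^sub>R u \<xi>)"
    by (intro borel_integrable_compact compact_cbox continuous_on_subset[OF assms]) auto
  then have "integrable lborel (\<lambda>\<xi>. indicator open_cube \<xi> *\<^sub>R (indicator ?Q \<xi> *\<^sub>R u \<xi>))"
    by (rule integrable_mult_indicator[rotated]) simp
  moreover have "indicator open_cube \<xi> *\<^sub>R (indicator ?Q \<xi> *\<^sub>R u \<xi>) = indicator open_cube \<xi> *\<^sub>R u \<xi>" for \<xi>
    using box_subset_cbox[of "(\<chi> i. - 1 / 2)" "(\<chi> i. 1 / 2) :: real ^ 'n"] unfolding open_cube_eq_box
    by (auto simp: indicator_def)
  ultimately show ?thesis by (simp only:)
qed

lemma inner_real_vec_add: "\<xi> \<bullet> real_vec (k + l) = \<xi> \<bullet> real_vec k + \<xi> \<bullet> real_vec l"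
  and inner_real_vec_diff: "\<xi> \<bullet> real_vec (k - l) = \<xi> \<bullet> real_vec k - \<xi> \<bullet> real_vec l"
  by (simp_all add: real_vec_def inner_vec_def algebra_simps sum.distrib sum_subtractf)

lemma inner_real_vec_axis: "\<xi> \<bullet> real_vec (axis i 1) = \<xi> $ i"
proof -
  have "real_vec (axis i 1) = axis i 1" by (simp add: real_vec_def axis_def vec_eq_iff)
  then show ?thesis by (simp add: inner_axis)
qed

lemma ec_of_int [simp]: "ec (of_int m) = 1"
  unfolding ec_def by (rule cis_multiple_2pi) simp

lemma integral_ec_unit_interval:
  fixes m :: int
  shows "(LINT t|lborel. of_real (indicator {- 1 / 2<..<1 / 2} t) * ec (t * of_int m)) = of_bool (m = 0)"
proof -
  have "(LINT t|lborel. of_real (indicator {- 1 / 2<..<1 / 2} t) * ec (t * of_int m)) = (LINT t|lborel. indicator {- 1 / 2..1 / 2} t *\<^sub>R ec (t * of_int m))"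
  proof (rule integral_cong_AE)
    have "AE t in lborel. t \<noteq> (- 1 / 2 :: real)" "AE t in lborel. t \<noteq> (1 / 2 :: real)"
      by (rule AE_lborel_singleton)+
    then show "AE t in lborel. of_real (indicator {- 1 / 2<..<1 / 2} t) * ec (t * of_int m) = indicator {- 1 / 2..1 / 2} t *\<^sub>R ec (t * of_int m)"
      by eventually_elim (auto simp: indicator_def)
  qed measurable
  also have "\<dots> = of_bool (m = 0)"
  proof (cases "m = 0")
    case False
    define c where "c = 2 * pi * \<i> * of_int m"
    have c: "c \<noteq> 0" using False by (simp add: c_def)
    have ee: "ec (t * of_int m) = exp (c * of_real t)" for t
      by (simp add: ec_exp c_def mult_ac)
    have "(LINT t|lborel. indicator {- 1 / 2..1 / 2} t *\<^sub>R ec (t * of_int m)) = ec (1 / 2 * of_int m) / c - ec (- 1 / 2 * of_int m) / c"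
      unfolding ee
    proof (rule integral_FTC_Icc)
      show "((\<lambda>t. exp (c * of_real t) / c) has_vector_derivative exp (c * of_real t)) (at t within {- 1 / 2..1 / 2})" for t
      proof -
        have "((\<lambda>t. c * of_real t) has_vector_derivative c * of_real 1) (at t within {- 1 / 2..1 / 2})"
          by (intro has_vector_derivative_mult_right has_vector_derivative_of_real) (auto intro!: derivative_eq_intros)
        from field_vector_diff_chain_within[OF this DERIV_exp[THEN DERIV_subset[OF _ subset_UNIV]]]
        have "((\<lambda>t. exp (c * of_real t)) has_vector_derivative c * exp (c * of_real t)) (at t within {- 1 / 2..1 / 2})"
          by (simp add: o_def)
        from has_vector_derivative_mult_left[OF this, of "1 / c"] show ?thesis using c by simp
      qed
    qed (auto intro!: continuous_intros)
    moreover have "ec (1 / 2 * of_int m) = ec (- 1 / 2 * of_int m)"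
      using ec_add[of "of_int m" "- 1 / 2 * of_int m"] by (simp add: field_simps)
    ultimately show ?thesis using False by simp
  qed simp
  finally show ?thesis .
qed

lemma integral_cube_ec:
  "(LINT \<xi>|lborel. indicator open_cube \<xi> *\<^sub>R ec (\<xi> \<bullet> real_vec k)) = of_bool (k = (0 :: int ^ 'n::finite))"
proof -
  have ecs: "ec (\<Sum>i\<in>A. g i) = (\<Prod>i\<in>A. ec (g i))" for g :: "'n \<Rightarrow> real" and A
    by (induction A rule: infinite_finite_induct) (auto simp: ec_add)
  let ?f = "\<lambda>i t. of_real (indicator {- 1 / 2<..<1 / 2} t) * ec (t * of_int (k $ i))"
  have eq: "indicator open_cube \<xi> *\<^sub>R ec (\<xi> \<bullet> real_vec k) = (\<Prod>i\<in>UNIV. ?f i (\<xi> $ i))" for \<xi> :: "real ^ 'n"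
    unfolding indicator_open_cube prod.distrib scaleR_conv_of_real of_real_prod
    by (simp add: inner_vec_def real_vec_def ecs)
  have "integrable lborel (?f i)" for i
  proof (rule integrable_mult_bounded(1)[where B = 1])
    show "integrable lborel (\<lambda>t. complex_of_real (indicator {- 1 / 2<..<1 / 2 :: real} t))"
      by (intro integrable_of_real integrable_real_indicator) auto
  qed auto
  then have "(LINT \<xi>|lborel. indicator open_cube \<xi> *\<^sub>R ec (\<xi> \<bullet> real_vec k)) = (\<Prod>i\<in>UNIV. of_bool (k $ i = 0))"
    unfolding eq by (subst integral_prod_vec) (simp_all only: integral_ec_unit_interval)
  then show ?thesis by (auto simp: vec_eq_iff)
qed

subsection \<open>Uniqueness of Fourier coefficients\<close>

text \<open>Powers of this trigonometric polynomial concentrate at \<open>\<xi>0\<close> on the cube.\<close>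

definition peak :: "real ^ 'n::finite \<Rightarrow> real ^ 'n \<Rightarrow> real" where
  "peak \<xi>0 \<xi> = (\<Prod>i\<in>UNIV. (1 + cos (2 * pi * (\<xi> $ i - \<xi>0 $ i))) / 2)"

lemma peak_factor: "0 \<le> (1 + cos t) / (2::real)" "(1 + cos t) / (2::real) \<le> 1"
  by (simp_all add: add_increasing2) (use cos_ge_minus_one[of t] in linarith)

lemma peak_nonneg: "0 \<le> peak \<xi>0 \<xi>" and peak_le_1: "peak \<xi>0 \<xi> \<le> 1"
  unfolding peak_def by (auto intro!: prod_nonneg prod_le_1 peak_factor)

lemma peak_self [simp]: "peak \<xi> \<xi> = 1"
  by (simp add: peak_def)

lemma continuous_peak: "continuous_on A (peak \<xi>0)"
  unfolding peak_def by (intro continuous_intros) auto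

text \<open>A coordinate of an interior point and one of a point in the closed cube differ by less
  than 1, so each cosine equals 1 only where the coordinates agree. Admitting boundary points allows
  a compactness argument on the closed cube.\<close>

lemma peak_less_1:
  assumes \<xi>0: "\<xi>0 \<in> open_cube" and \<xi>: "\<And>i. \<bar>\<xi> $ i\<bar> \<le> 1 / 2" and ne: "\<xi> \<noteq> \<xi>0"
  shows "peak \<xi>0 \<xi> < 1"
proof -
  obtain i where i: "\<xi> $ i \<noteq> \<xi>0 $ i" using ne by (auto simp: vec_eq_iff)
  let ?c = "\<lambda>i. (1 + cos (2 * pi * (\<xi> $ i - \<xi>0 $ i))) / 2"
  have "cos (2 * pi * (\<xi> $ i - \<xi>0 $ i)) \<noteq> 1"
  proof
    assume "cos (2 * pi * (\<xi> $ i - \<xi>0 $ i)) = 1"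
    then obtain n :: int where "2 * pi * (\<xi> $ i - \<xi>0 $ i) = real_of_int n * 2 * pi" unfolding cos_one_2pi_int by blast
    then have "\<xi> $ i - \<xi>0 $ i = n" by simp
    moreover have "\<bar>\<xi> $ i - \<xi>0 $ i\<bar> < 1"
      using \<xi>[of i] \<xi>0 unfolding open_cube_def by (auto simp: abs_if split: if_splits dest!: spec[of _ i])
    ultimately have "n = 0" by linarith
    then show False using i \<open>\<xi> $ i - \<xi>0 $ i = n\<close> by simp
  qed
  then have "?c i < 1" using peak_factor(2)[of "2 * pi * (\<xi> $ i - \<xi>0 $ i)"] by (simp add: less_le)
  have "peak \<xi>0 \<xi> = ?c i * (\<Prod>j\<in>UNIV - {i}. ?c j)"
    unfolding peak_def by (rule prod.remove) auto
  also have "\<dots> \<le> ?c i * 1"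
    by (intro mult_left_mono prod_le_1 peak_factor conjI)
  finally show ?thesis using \<open>?c i < 1\<close> by simp
qed

lemma cos_eq_ec: "2 * complex_of_real (cos (2 * pi * t)) = ec t + ec (- t)"
  by (simp add: ec_def complex_eq_iff)

text \<open>Multiplication by one cosine factor combines the coefficients with indices k and k plus
  or minus a unit vector. So the property that all coefficients of D times p vanish, called
  \<open>ann\<close>, survives each factor, and induction reaches the full power.\<close>

lemma peak_power_orthogonal:
  fixes D :: "real ^ 'n::finite \<Rightarrow> complex"
  assumes D: "continuous_on UNIV D"
    and 0: "\<And>k. (LINT \<xi>|lborel. indicator open_cube \<xi> *\<^sub>R (D \<xi> * ec (\<xi> \<bullet> real_vec k))) = 0"
  shows "(LINT \<xi>|lborel. indicator open_cube \<xi> *\<^sub>R (D \<xi> * of_real (peak \<xi>0 \<xi> ^ N))) = 0"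
proof -
  define ann where "ann p \<longleftrightarrow> continuous_on UNIV p \<and> (\<forall>k. (LINT \<xi>|lborel. indicator open_cube \<xi> *\<^sub>R (D \<xi> * p \<xi> * ec (\<xi> \<bullet> real_vec k))) = 0)"
    for p :: "real ^ 'n \<Rightarrow> complex"
  have step: "ann (\<lambda>\<xi>. of_real ((1 + cos (2 * pi * (\<xi> $ i - \<xi>0 $ i))) / 2) * p \<xi>)" if p: "ann p" for p i
  proof -
    have pc: "continuous_on UNIV p" using p by (simp add: ann_def)
    have i: "integrable lborel (\<lambda>\<xi>. indicator open_cube \<xi> *\<^sub>R (D \<xi> * p \<xi> * ec (\<xi> \<bullet> real_vec k)))" for k
      by (intro cube_integrable continuous_intros D pc)
    have z: "(LINT \<xi>|lborel. indicator open_cube \<xi> *\<^sub>R (D \<xi> * p \<xi> * ec (\<xi> \<bullet> real_vec k))) = 0" for k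
      using p by (simp add: ann_def)
    have e: "indicator open_cube \<xi> *\<^sub>R (D \<xi> * (of_real ((1 + cos (2 * pi * (\<xi> $ i - \<xi>0 $ i))) / 2) * p \<xi>) * ec (\<xi> \<bullet> real_vec k)) =
      1 / 2 * (indicator open_cube \<xi> *\<^sub>R (D \<xi> * p \<xi> * ec (\<xi> \<bullet> real_vec k))) +
      (ec (- \<xi>0 $ i) / 4 * (indicator open_cube \<xi> *\<^sub>R (D \<xi> * p \<xi> * ec (\<xi> \<bullet> real_vec (k + axis i 1)))) +
      ec (\<xi>0 $ i) / 4 * (indicator open_cube \<xi> *\<^sub>R (D \<xi> * p \<xi> * ec (\<xi> \<bullet> real_vec (k - axis i 1)))))" for \<xi> k
    proof -
      have "complex_of_real ((1 + cos (2 * pi * (\<xi> $ i - \<xi>0 $ i))) / 2) = 1 / 2 + (ec (\<xi> $ i - \<xi>0 $ i) + ec (- (\<xi> $ i - \<xi>0 $ i))) / 4"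
        unfolding cos_eq_ec[symmetric] by (simp add: add_divide_distrib)
      also have "ec (\<xi> $ i - \<xi>0 $ i) = ec (\<xi> $ i) * ec (- \<xi>0 $ i)" by (simp flip: ec_add)
      also have "ec (- (\<xi> $ i - \<xi>0 $ i)) = ec (- \<xi> $ i) * ec (\<xi>0 $ i)" by (simp flip: ec_add)
      finally have c: "complex_of_real ((1 + cos (2 * pi * (\<xi> $ i - \<xi>0 $ i))) / 2) = 1 / 2 + (ec (\<xi> $ i) * ec (- \<xi>0 $ i) + ec (- \<xi> $ i) * ec (\<xi>0 $ i)) / 4" .
      have k1: "ec (\<xi> \<bullet> real_vec (k + axis i 1)) = ec (\<xi> \<bullet> real_vec k) * ec (\<xi> $ i)"
        by (simp add: inner_real_vec_add inner_real_vec_axis ec_add)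
      have k2: "ec (\<xi> \<bullet> real_vec (k - axis i 1)) = ec (\<xi> \<bullet> real_vec k) * ec (- \<xi> $ i)"
        by (simp add: inner_real_vec_diff inner_real_vec_axis ec_diff)
      show ?thesis unfolding c k1 k2 by (simp add: indicator_def algebra_simps)
    qed
    have "(LINT \<xi>|lborel. indicator open_cube \<xi> *\<^sub>R (D \<xi> * (of_real ((1 + cos (2 * pi * (\<xi> $ i - \<xi>0 $ i))) / 2) * p \<xi>) * ec (\<xi> \<bullet> real_vec k))) = 0" for k
      unfolding e
      by (subst Bochner_Integration.integral_add, (intro integrable_mult_right Bochner_Integration.integrable_add i)+,
          subst Bochner_Integration.integral_add, (intro integrable_mult_right i)+)
        (simp only: integral_mult_right_zero z mult_zero_right add_0)
    moreover have "continuous_on UNIV (\<lambda>\<xi>. complex_of_real ((1 + cos (2 * pi * (\<xi> $ i - \<xi>0 $ i))) / 2) * p \<xi>)"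
      by (intro continuous_intros pc) auto
    ultimately show ?thesis by (simp add: ann_def)
  qed
  have prod: "ann (\<lambda>\<xi>. of_real (\<Prod>i\<in>A. (1 + cos (2 * pi * (\<xi> $ i - \<xi>0 $ i))) / 2) * p \<xi>)" if p: "ann p" for p and A :: "'n set"
    using finite[of A]
  proof (induction A rule: finite_induct)
    case (insert i A)
    from step[OF insert(3), of i] show ?case by (simp only: prod.insert[OF insert(1,2)] of_real_mult mult.assoc)
  qed (use p in simp)
  have "ann (\<lambda>\<xi>. of_real (peak \<xi>0 \<xi> ^ N))"
  proof (induction N)
    case 0
    then show ?case using assms(2) by (simp add: ann_def)
  next
    case (Suc N)
    from prod[OF this, of UNIV] show ?case unfolding peak_def power_Suc of_real_mult .
  qed
  then have "(LINT \<xi>|lborel. indicator open_cube \<xi> *\<^sub>R (D \<xi> * of_real (peak \<xi>0 \<xi> ^ N) * ec (\<xi> \<bullet> real_vec 0))) = 0"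
    unfolding ann_def by blast
  moreover have "real_vec (0 :: int ^ 'n) = 0" by (simp add: real_vec_def vec_eq_iff)
  ultimately show ?thesis by simp
qed

text \<open>If D did not vanish at \<open>\<xi>0\<close>, the real part of D, rotated to be positive
  there, would be bounded below near that point. Its integral against \<open>peak ^ N\<close> is 0,
  yet the part near \<open>\<xi>0\<close> is at least a multiple of q'^N, and the rest is at most a
  multiple of q^N with q < q'.\<close>

lemma fourier_coefficients_unique:
  fixes D :: "real ^ 'n::finite \<Rightarrow> complex"
  assumes D: "continuous_on UNIV D"
    and 0: "\<And>k. (LINT \<xi>|lborel. indicator open_cube \<xi> *\<^sub>R (D \<xi> * ec (\<xi> \<bullet> real_vec k))) = 0"
    and \<xi>0: "\<xi>0 \<in> open_cube"
  shows "D \<xi>0 = 0"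
proof (rule ccontr)
  assume ne: "D \<xi>0 \<noteq> 0"
  let ?Q = "cbox (\<chi> i. - 1 / 2) (\<chi> i. 1 / 2) :: (real ^ 'n) set"
  have sub: "open_cube \<subseteq> ?Q" unfolding open_cube_eq_box by (rule box_subset_cbox)
  have Qi: "\<bar>\<xi> $ i\<bar> \<le> 1 / 2" if "\<xi> \<in> ?Q" for \<xi> i
    using that by (auto simp: mem_box_cart abs_le_iff dest!: spec[of _ i])
  define E where "E \<xi> = Re (cnj (D \<xi>0) * D \<xi>)" for \<xi>
  have cE: "continuous_on UNIV E" unfolding E_def by (intro continuous_intros D)
  define e where "e = E \<xi>0"
  have e: "e > 0" using ne by (simp add: e_def E_def complex_eq_iff sum_squares_gt_zero_iff)
  have "isCont E \<xi>0" using cE by (simp add: continuous_on_eq_continuous_at)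
  then obtain \<delta> where \<delta>: "\<delta> > 0" "\<And>\<xi>. dist \<xi> \<xi>0 < \<delta> \<Longrightarrow> dist (E \<xi>) (E \<xi>0) < e / 2"
    using e unfolding continuous_at_eps_delta by (metis half_gt_zero)
  have E2: "e / 2 \<le> E \<xi>" if "dist \<xi> \<xi>0 < \<delta>" for \<xi>
    using \<delta>(2)[OF that] unfolding e_def dist_real_def by linarith
  \<comment> \<open>Taken from the closed cube so that it is compact and \<open>peak\<close> attains
    a maximum below 1 on it.\<close>
  define K where "K = ?Q - ball \<xi>0 \<delta>"
  have "compact K" unfolding K_def by (intro compact_diff compact_cbox open_ball)
  have "\<exists>q<1. 0 \<le> q \<and> (\<forall>\<xi>\<in>K. peak \<xi>0 \<xi> \<le> q)"
  proof (cases "K = {}")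
    case False
    obtain z where z: "z \<in> K" "\<forall>\<xi>\<in>K. peak \<xi>0 \<xi> \<le> peak \<xi>0 z"
      using continuous_attains_sup[OF \<open>compact K\<close> False continuous_peak] by blast
    have "peak \<xi>0 z < 1"
    proof (rule peak_less_1[OF \<xi>0])
      show "\<bar>z $ i\<bar> \<le> 1 / 2" for i using z(1) Qi unfolding K_def by blast
      show "z \<noteq> \<xi>0" using z(1) \<delta>(1) unfolding K_def by auto
    qed
    then show ?thesis using z(2) peak_nonneg by blast
  qed (auto intro: exI[of _ 0])
  then obtain q where q: "q < 1" "0 \<le> q" "\<And>\<xi>. \<xi> \<in> K \<Longrightarrow> peak \<xi>0 \<xi> \<le> q" by blast
  \<comment> \<open>Any value strictly between q and 1 separates the growth rates near and far from
    \<open>\<xi>0\<close>.\<close>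
  define q' where "q' = (1 + q) / 2"
  have q': "q < q'" "q' < 1" "0 < q'" using q by (auto simp: q'_def)
  define V where "V = open_cube \<inter> ball \<xi>0 \<delta> \<inter> {\<xi>. q' < peak \<xi>0 \<xi>}"
  have "open V" unfolding V_def open_cube_eq_box
    by (intro open_Int open_box open_ball open_Collect_less continuous_peak continuous_on_const)
  have "\<xi>0 \<in> V" unfolding V_def using \<xi>0 \<delta>(1) q' by simp
  have [measurable]: "V \<in> sets borel" using \<open>open V\<close> by auto
  have Vfin: "emeasure lborel V < \<infinity>"
  proof -
    have "emeasure lborel V \<le> emeasure lborel ?Q" by (rule emeasure_mono) (use sub V_def in auto)
    then show ?thesis by (rule order.strict_trans1) (simp add: emeasure_lborel_cbox_eq)
  qed
  have "measure lborel V > 0"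
  proof -
    obtain r where "r > 0" "ball \<xi>0 r \<subseteq> V" using \<open>open V\<close> \<open>\<xi>0 \<in> V\<close> open_contains_ball by blast
    have "0 < measure lborel (ball \<xi>0 r)" using content_ball_pos[OF \<open>r > 0\<close>, of \<xi>0] by simp
    also have "\<dots> \<le> measure lborel V"
      using \<open>ball \<xi>0 r \<subseteq> V\<close> Vfin by (intro measure_mono_fmeasurable) (auto simp: fmeasurable_def)
    finally show ?thesis .
  qed
  obtain B where B: "\<And>\<xi>. \<xi> \<in> ?Q \<Longrightarrow> \<bar>E \<xi>\<bar> \<le> B"
  proof -
    have "bounded (E ` ?Q)" by (intro compact_imp_bounded compact_continuous_image continuous_on_subset[OF cE] compact_cbox) auto
    then show ?thesis using that unfolding bounded_iff by auto
  qed
  have B0: "B \<ge> 0" using B[of \<xi>0] \<xi>0 sub by force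
  \<comment> \<open>On V the integrand has a lower bound of order q'^N, on the rest of the ball it
    is nonnegative, and outside the ball it is at least minus the error of order q^N.\<close>
  have ineq: "e / 2 * q' ^ N * indicator V \<xi> - B * q ^ N * indicator open_cube \<xi> \<le> indicator open_cube \<xi> *\<^sub>R (E \<xi> * peak \<xi>0 \<xi> ^ N)" for N \<xi>
  proof (cases "\<xi> \<in> open_cube")
    case True
    then have Q: "\<xi> \<in> ?Q" using sub by auto
    show ?thesis
    proof (cases "\<xi> \<in> ball \<xi>0 \<delta>")
      case b: True
      then have E: "e / 2 \<le> E \<xi>" using E2 by (simp add: dist_commute)
      have "e / 2 * q' ^ N * indicator V \<xi> \<le> E \<xi> * peak \<xi>0 \<xi> ^ N"
      proof (cases "\<xi> \<in> V")
        case True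
        then have "q' ^ N \<le> peak \<xi>0 \<xi> ^ N" using q' by (intro power_mono) (auto simp: V_def)
        then have "e / 2 * q' ^ N \<le> E \<xi> * peak \<xi>0 \<xi> ^ N" using E e q' by (intro mult_mono) auto
        then show ?thesis using True by simp
      qed (use E e peak_nonneg[of \<xi>0 \<xi>] in auto)
      moreover have "0 \<le> B * q ^ N" using B0 q by simp
      ultimately show ?thesis using True by simp
    next
      case False
      then have "peak \<xi>0 \<xi> ^ N \<le> q ^ N"
        using Q q(3) by (intro power_mono peak_nonneg) (auto simp: K_def)
      then have "\<bar>E \<xi> * peak \<xi>0 \<xi> ^ N\<bar> \<le> B * q ^ N"
        unfolding abs_mult using B[OF Q] B0 peak_nonneg[of \<xi>0 \<xi>] by (intro mult_mono) auto
      moreover have "\<xi> \<notin> V" using False by (auto simp: V_def)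
      ultimately show ?thesis using True by simp
    qed
  qed (auto simp: V_def indicator_def)
  have cfin: "emeasure lborel (open_cube :: (real ^ 'n) set) < \<infinity>"
    unfolding open_cube_eq_box by (simp add: emeasure_lborel_box_eq)
  have le: "e / 2 * measure lborel V \<le> B * measure lborel (open_cube :: (real ^ 'n) set) * (q / q') ^ N" for N
  proof -
    have "integrable lborel (\<lambda>\<xi>. indicator open_cube \<xi> *\<^sub>R (D \<xi> * complex_of_real (peak \<xi>0 \<xi> ^ N)))"
      by (intro cube_integrable continuous_intros D continuous_peak)
    then have "(LINT \<xi>|lborel. cnj (D \<xi>0) * (indicator open_cube \<xi> *\<^sub>R (D \<xi> * complex_of_real (peak \<xi>0 \<xi> ^ N)))) = 0"
      unfolding integral_mult_right_zero peak_power_orthogonal[OF D 0] by simp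
    then have "0 = Re (LINT \<xi>|lborel. cnj (D \<xi>0) * (indicator open_cube \<xi> *\<^sub>R (D \<xi> * complex_of_real (peak \<xi>0 \<xi> ^ N))))" by simp
    also have "\<dots> = (LINT \<xi>|lborel. Re (cnj (D \<xi>0) * (indicator open_cube \<xi> *\<^sub>R (D \<xi> * complex_of_real (peak \<xi>0 \<xi> ^ N)))))"
      by (intro integral_Re[symmetric] integrable_mult_right cube_integrable continuous_intros D continuous_peak)
    also have "\<dots> = (LINT \<xi>|lborel. indicator open_cube \<xi> *\<^sub>R (E \<xi> * peak \<xi>0 \<xi> ^ N))"
      by (intro Bochner_Integration.integral_cong) (auto simp: E_def indicator_def left_diff_distrib algebra_simps)
    also have "\<dots> \<ge> (LINT \<xi>|lborel. e / 2 * q' ^ N * indicator V \<xi> - B * q ^ N * indicator open_cube \<xi>)"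
      using Vfin cfin
      by (intro integral_mono ineq cube_integrable continuous_intros cE continuous_peak Bochner_Integration.integrable_diff integrable_mult_right integrable_real_indicator) auto
    also have "(LINT \<xi>|lborel. e / 2 * q' ^ N * indicator V \<xi> - B * q ^ N * indicator open_cube \<xi>) = e / 2 * q' ^ N * measure lborel V - B * q ^ N * measure lborel (open_cube :: (real ^ 'n) set)"
      using Vfin cfin by (subst Bochner_Integration.integral_diff) auto
    finally show ?thesis using q' by (simp add: power_divide field_simps)
  qed
  have "(\<lambda>N. (q / q') ^ N) \<longlonglongrightarrow> 0" 
  proof (rule LIMSEQ_power_zero)
    have "0 \<le> q / q'" "q / q' < 1" using q q' by simp_all
    then show "norm (q / q') < 1" by simp
  qed
  then have "(\<lambda>N. B * measure lborel (open_cube :: (real ^ 'n) set) * (q / q') ^ N) \<longlonglongrightarrow> B * measure lborel (open_cube :: (real ^ 'n) set) * 0"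
    by (intro tendsto_mult tendsto_const)
  then have "e / 2 * measure lborel V \<le> B * measure lborel (open_cube :: (real ^ 'n) set) * 0"
    using le by (intro LIMSEQ_le_const) auto
  then show False using e \<open>measure lborel V > 0\<close> by (simp add: mult_le_0_iff)
qed

subsection \<open>Lattice sums\<close>

lemma lattice_fubini:
  fixes F :: "int ^ 'n::finite \<Rightarrow> real ^ 'n \<Rightarrow> 'b::{banach, second_countable_topology}"
  assumes m: "\<And>k. F k \<in> borel_measurable borel"
    and fin: "(\<integral>\<^sup>+k. \<integral>\<^sup>+x. ennreal (norm (F k x)) \<partial>lborel \<partial>count_space UNIV) < \<infinity>"
  shows "(LINT k|count_space UNIV. LINT x|lborel. F k x) = (LINT x|lborel. LINT k|count_space UNIV. F k x)"
proof -
  interpret pair_sigma_finite "count_space UNIV :: (int ^ 'n) measure" "lborel :: (real ^ 'n) measure"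
    by (intro pair_sigma_finite.intro sigma_finite_measure_count_space sigma_finite_lborel)
  have pm: "case_prod F \<in> borel_measurable (count_space UNIV \<Otimes>\<^sub>M lborel)"
    by (rule measurable_pair_measure_countable1) (use m in auto)
  have "(\<integral>\<^sup>+z. ennreal (norm (case_prod F z)) \<partial>(count_space UNIV \<Otimes>\<^sub>M lborel)) = (\<integral>\<^sup>+k. \<integral>\<^sup>+x. ennreal (norm (F k x)) \<partial>lborel \<partial>count_space UNIV)"
    using pm by (subst lborel.nn_integral_fst[symmetric]) (auto simp: split_beta')
  then have i: "integrable (count_space UNIV \<Otimes>\<^sub>M lborel) (case_prod F)"
    using pm fin by (auto simp: integrable_iff_bounded)
  show ?thesis using Fubini_integral[OF i] by simp
qed

lemma lattice_nn_fubini: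
  fixes F :: "int ^ 'n::finite \<Rightarrow> real ^ 'n \<Rightarrow> ennreal"
  assumes m: "\<And>k. F k \<in> borel_measurable borel"
  shows "(\<integral>\<^sup>+k. \<integral>\<^sup>+x. F k x \<partial>lborel \<partial>count_space UNIV) = (\<integral>\<^sup>+x. \<integral>\<^sup>+k. F k x \<partial>count_space UNIV \<partial>lborel)"
proof -
  interpret pair_sigma_finite "count_space UNIV :: (int ^ 'n) measure" "lborel :: (real ^ 'n) measure"
    by (intro pair_sigma_finite.intro sigma_finite_measure_count_space sigma_finite_lborel)
  have pm: "case_prod F \<in> borel_measurable (count_space UNIV \<Otimes>\<^sub>M lborel)"
    by (rule measurable_pair_measure_countable1) (use m in auto)
  show ?thesis using Fubini'[OF pm] by simp
qed

lemma lattice_nn_measurable: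
  fixes F :: "int ^ 'n::finite \<Rightarrow> real ^ 'n \<Rightarrow> ennreal"
  assumes m: "\<And>k. F k \<in> borel_measurable borel"
  shows "(\<lambda>x. \<integral>\<^sup>+k. F k x \<partial>count_space UNIV) \<in> borel_measurable borel"
proof -
  interpret sigma_finite_measure "count_space UNIV :: (int ^ 'n) measure" by (rule sigma_finite_measure_count_space)
  have "(\<lambda>(x, k). F k x) \<in> borel_measurable (borel \<Otimes>\<^sub>M count_space (UNIV :: (int ^ 'n) set))"
    using measurable_pair_measure_countable1[of "UNIV :: (int ^ 'n) set" "case_prod F" borel borel] m
    by (subst measurable_pair_swap_iff) (simp add: split_beta')
  then show ?thesis by (rule borel_measurable_nn_integral)
qed

text \<open>An integrable weight that varies by at most a constant factor on unit cubes, so that its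
  lattice sums are comparable to its integral. A product form is chosen because integrability
  reduces to one dimension and decay can be proved coordinate by coordinate.\<close>

definition wt :: "real ^ 'n::finite \<Rightarrow> real" where
  "wt x = (\<Prod>i\<in>UNIV. 1 / (1 + (x $ i)\<^sup>2))"

lemma wt_pos: "0 < wt x"
  unfolding wt_def by (intro prod_pos) (auto simp: add_pos_nonneg)

lemma wt_nonneg [simp]: "0 \<le> wt x"
  using wt_pos[of x] by simp

lemma wt_measurable [measurable]: "wt \<in> borel_measurable borel"
  unfolding wt_def by measurable

lemma integrable_wt: "integrable lborel (wt :: real ^ 'n::finite \<Rightarrow> real)"
  unfolding wt_def
  by (rule integrable_prod_vec[of "\<lambda>i t. 1 / (1 + t\<^sup>2)"]) (rule integrable_inverse_1_plus_square_UNIV)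

text \<open>A coordinate moves by at most 1/2, so 1 + (x + \<xi>)^2 is at most 1 + 2 x^2 + 1/2,
  which is below 3 (1 + x^2).\<close>

lemma wt_le_shift:
  fixes x :: "real ^ 'n::finite"
  assumes "\<xi> \<in> open_cube"
  shows "wt x \<le> 3 ^ CARD('n) * wt (x + \<xi>)"
proof -
  have "1 / (1 + (x $ i)\<^sup>2) \<le> 3 * (1 / (1 + ((x + \<xi>) $ i)\<^sup>2))" for i
  proof -
    have "\<bar>\<xi> $ i\<bar> \<le> 1 / 2" using assms unfolding open_cube_def by (auto simp: abs_if dest!: spec[of _ i])
    then have "(\<xi> $ i)\<^sup>2 \<le> (1 / 2)\<^sup>2" by (intro power2_le_iff_abs_le[THEN iffD2]) auto
    then have a1: "(\<xi> $ i)\<^sup>2 \<le> 1 / 4" by (simp add: power2_eq_square)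
    have a2: "(x $ i + \<xi> $ i)\<^sup>2 \<le> 2 * (x $ i)\<^sup>2 + 2 * (\<xi> $ i)\<^sup>2"
      using zero_le_power2[of "x $ i - \<xi> $ i"] by (simp add: power2_sum power2_diff)
    have "1 + ((x + \<xi>) $ i)\<^sup>2 \<le> 3 * (1 + (x $ i)\<^sup>2)"
      unfolding vector_add_component using a1 a2 zero_le_power2[of "x $ i"] by argo
    moreover have "0 < 1 + (x $ i)\<^sup>2" "0 < 1 + ((x + \<xi>) $ i)\<^sup>2" by (auto intro: add_pos_nonneg)
    ultimately show ?thesis by (simp add: field_simps)
  qed
  then have "wt x \<le> (\<Prod>i\<in>(UNIV :: 'n set). 3 * (1 / (1 + ((x + \<xi>) $ i)\<^sup>2)))"
    unfolding wt_def by (intro prod_mono) auto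
  also have "\<dots> = 3 ^ CARD('n) * wt (x + \<xi>)" unfolding wt_def prod.distrib by simp
  finally show ?thesis .
qed

lemma nn_integral_indicator_cube_lattice:
  fixes z :: "real ^ 'n::finite"
  shows "(\<integral>\<^sup>+k. indicator open_cube (z + real_vec k) \<partial>count_space UNIV) \<le> 1"
proof -
  have "k = l" if "z + real_vec k \<in> open_cube" "z + real_vec l \<in> open_cube" for k l :: "int ^ 'n"
  proof -
    have "k $ i = l $ i" for i
    proof -
      have "- 1 / 2 < z $ i + of_int (k $ i)" "z $ i + of_int (k $ i) < 1 / 2"
        "- 1 / 2 < z $ i + of_int (l $ i)" "z $ i + of_int (l $ i) < 1 / 2"
        using that by (auto simp: open_cube_def real_vec_def)
      then have "\<bar>real_of_int (k $ i) - real_of_int (l $ i)\<bar> < 1" by linarith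
      then show ?thesis by linarith
    qed
    then show ?thesis by (simp add: vec_eq_iff)
  qed
  then have "\<exists>k0. {k. z + real_vec k \<in> open_cube} \<subseteq> {k0}" by blast
  then obtain k0 where k0: "{k. z + real_vec k \<in> open_cube} \<subseteq> {k0 :: int ^ 'n}" ..
  have "(\<integral>\<^sup>+k. indicator open_cube (z + real_vec k) \<partial>count_space UNIV) \<le> (\<integral>\<^sup>+k. indicator {k0} k \<partial>count_space UNIV)"
    using k0 by (intro nn_integral_mono) (auto simp: indicator_def)
  also have "\<dots> = 1" by simp
  finally show ?thesis .
qed

text \<open>Replace each term by an integral over a unit cube, at the cost of the factor from
  \<open>wt_le_shift\<close>. The translated cubes are disjoint, so together these integrals are at
  most the integral over the whole space.\<close>

lemma nn_integral_lattice_wt: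
  fixes y :: "real ^ 'n::finite"
  shows "(\<integral>\<^sup>+k. ennreal (wt (y - real_vec k)) \<partial>count_space UNIV) \<le> ennreal (3 ^ CARD('n) * (LINT x|lborel. wt (x :: real ^ 'n)))"
proof -
  have c1: "(\<integral>\<^sup>+\<xi>. indicator open_cube \<xi> \<partial>(lborel :: (real ^ 'n) measure)) = 1"
  proof -
    have "real_vec (0 :: int ^ 'n) = 0" by (simp add: real_vec_def vec_eq_iff)
    then have "complex_of_real (measure lborel (open_cube :: (real ^ 'n) set)) = 1"
      using integral_cube_ec[of "0 :: int ^ 'n"] by (simp add: scaleR_conv_of_real)
    then have "measure lborel (open_cube :: (real ^ 'n) set) = 1" by (simp only: of_real_eq_1_iff)
    moreover have "emeasure lborel (open_cube :: (real ^ 'n) set) \<noteq> \<infinity>"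
      unfolding open_cube_eq_box by (simp add: emeasure_lborel_box_eq)
    ultimately show ?thesis by (simp add: emeasure_eq_ennreal_measure)
  qed
  have "(\<integral>\<^sup>+k. ennreal (wt (y - real_vec k)) \<partial>count_space UNIV) = (\<integral>\<^sup>+k. \<integral>\<^sup>+\<xi>. indicator open_cube \<xi> * ennreal (wt (y - real_vec k)) \<partial>(lborel :: (real ^ 'n) measure) \<partial>count_space UNIV)"
    using c1 by (simp add: nn_integral_multc)
  also have "\<dots> \<le> (\<integral>\<^sup>+k. \<integral>\<^sup>+\<xi>. indicator open_cube \<xi> * ennreal (3 ^ CARD('n) * wt (y - real_vec k + \<xi>)) \<partial>lborel \<partial>count_space UNIV)"
    by (intro nn_integral_mono) (auto simp: indicator_def intro!: ennreal_leI wt_le_shift)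
  also have "\<dots> = (\<integral>\<^sup>+k. \<integral>\<^sup>+x. indicator open_cube (x - y + real_vec k) * ennreal (3 ^ CARD('n) * wt x) \<partial>lborel \<partial>count_space UNIV)"
  proof (rule nn_integral_cong)
    fix k :: "int ^ 'n"
    show "(\<integral>\<^sup>+\<xi>. indicator open_cube \<xi> * ennreal (3 ^ CARD('n) * wt (y - real_vec k + \<xi>)) \<partial>lborel) =
      (\<integral>\<^sup>+x. indicator open_cube (x - y + real_vec k) * ennreal (3 ^ CARD('n) * wt x) \<partial>lborel)"
      using nn_integral_lborel_translate(1)[of "\<lambda>x. indicator open_cube (x - y + real_vec k) * ennreal (3 ^ CARD('n) * wt x)" "y - real_vec k"]
      by simp
  qed
  also have "\<dots> = (\<integral>\<^sup>+x. \<integral>\<^sup>+k. indicator open_cube (x - y + real_vec k) * ennreal (3 ^ CARD('n) * wt x) \<partial>count_space UNIV \<partial>lborel)"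
    by (rule lattice_nn_fubini) measurable
  also have "\<dots> \<le> (\<integral>\<^sup>+x. 1 * ennreal (3 ^ CARD('n) * wt (x :: real ^ 'n)) \<partial>lborel)"
  proof (rule nn_integral_mono)
    fix x
    have "(\<integral>\<^sup>+k. indicator open_cube (x - y + real_vec k) * ennreal (3 ^ CARD('n) * wt x) \<partial>count_space UNIV) =
      (\<integral>\<^sup>+k. indicator open_cube (x - y + real_vec k) \<partial>count_space UNIV) * ennreal (3 ^ CARD('n) * wt x)"
      by (rule nn_integral_multc) simp
    also have "\<dots> \<le> 1 * ennreal (3 ^ CARD('n) * wt x)"
      by (intro mult_right_mono nn_integral_indicator_cube_lattice) auto
    finally show "(\<integral>\<^sup>+k. indicator open_cube (x - y + real_vec k) * ennreal (3 ^ CARD('n) * wt x) \<partial>count_space UNIV) \<le> 1 * ennreal (3 ^ CARD('n) * wt x)" .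
  qed
  also have "\<dots> = ennreal (3 ^ CARD('n) * (LINT x|lborel. wt (x :: real ^ 'n)))"
    using integrable_wt[where 'n = 'n] by (simp, subst nn_integral_eq_integral) auto
  finally show ?thesis .
qed

lemma integrable_lattice:
  fixes u :: "real ^ 'n::finite \<Rightarrow> complex"
  assumes u: "\<And>x. norm (u x) \<le> C * wt x"
  shows "integrable (count_space UNIV) (\<lambda>k. u (y - real_vec k))"
proof (rule integrableI_bounded)
  have "0 \<le> C * wt (0 :: real ^ 'n)" using order_trans[OF norm_ge_zero u] .
  then have C: "C \<ge> 0" using wt_pos[of "0 :: real ^ 'n"] by (simp add: zero_le_mult_iff)
  have "(\<integral>\<^sup>+k. ennreal (norm (u (y - real_vec k))) \<partial>count_space UNIV) \<le> (\<integral>\<^sup>+k. ennreal C * ennreal (wt (y - real_vec k)) \<partial>count_space UNIV)"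
    unfolding ennreal_mult[OF C wt_nonneg, symmetric] by (intro nn_integral_mono ennreal_leI u)
  also have "\<dots> = ennreal C * (\<integral>\<^sup>+k. ennreal (wt (y - real_vec k)) \<partial>count_space UNIV)"
    by (rule nn_integral_cmult) simp
  also have "\<dots> \<le> ennreal C * ennreal (3 ^ CARD('n) * (LINT x|lborel. wt (x :: real ^ 'n)))"
    by (intro mult_left_mono nn_integral_lattice_wt) auto
  also have "\<dots> < \<infinity>" by (simp add: ennreal_mult_less_top)
  finally show "(\<integral>\<^sup>+k. ennreal (norm (u (y - real_vec k))) \<partial>count_space UNIV) < \<infinity>" .
qed simp

text \<open>Both sides are continuous in \<open>\<xi>\<close> and have the same Fourier coefficients
  on the cube, namely \<open>u (y + real_vec k)\<close>: on the left by orthogonality of the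
  characters, on the right by Fourier inversion, since the transform of u vanishes off the
  cube.\<close>

lemma bandlimited_poisson:
  fixes u :: "real ^ 'n::finite \<Rightarrow> complex"
  assumes u: "integrable lborel u" "continuous_on UNIV u" and ub: "\<And>x. norm (u x) \<le> C * wt x"
    and ft0: "\<And>\<xi>. \<xi> \<notin> open_cube \<Longrightarrow> ft u \<xi> = 0" and \<xi>: "\<xi> \<in> open_cube"
  shows "(LINT k|count_space UNIV. u (y - real_vec k) * ec (\<xi> \<bullet> real_vec k)) = ft u \<xi> * ec (\<xi> \<bullet> y)"
proof -
  have cft: "continuous_on UNIV (ft u)" by (rule continuous_ft[OF u(1)])
  have ind: "indicator open_cube \<xi> *\<^sub>R ft u \<xi> = ft u \<xi>" for \<xi> using ft0[of \<xi>] by (auto simp: indicator_def)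
  have ift: "integrable lborel (ft u)" using cube_integrable[OF cft] unfolding ind .
  note uk = integrable_lattice[OF ub]
  define S where "S \<xi> = (LINT k|count_space UNIV. u (y - real_vec k) * ec (\<xi> \<bullet> real_vec k))" for \<xi>
  have cS: "continuous_on UNIV S"
  proof -
    have "(\<lambda>n. S (v n)) \<longlonglongrightarrow> S \<xi>" if "v \<longlonglongrightarrow> \<xi>" for v \<xi>
      unfolding S_def
    proof (rule integral_dominated_convergence[where w = "\<lambda>k. norm (u (y - real_vec k))"])
      show "AE k in count_space UNIV. (\<lambda>n. u (y - real_vec k) * ec (v n \<bullet> real_vec k)) \<longlonglongrightarrow> u (y - real_vec k) * ec (\<xi> \<bullet> real_vec k)"
        by (intro AE_I2 tendsto_intros that)
    qed (use uk in \<open>auto simp: norm_mult\<close>)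
    then show ?thesis by (auto simp: continuous_on_sequentially o_def)
  qed
  have B: "norm (u x) \<le> \<bar>C\<bar>" for x
  proof -
    have "wt x \<le> 1" unfolding wt_def by (intro prod_le_1) (auto simp: add_pos_nonneg)
    then have "C * wt x \<le> \<bar>C\<bar> * 1" using wt_pos[of x] by (intro mult_mono) auto
    then show ?thesis using ub[of x] by simp
  qed
  have inv: "(LINT \<xi>|lborel. ft u \<xi> * ec (\<xi> \<bullet> x)) = u x" for x
    by (rule fourier_inversion[OF u(1) B _ ift]) (use u(2) in \<open>simp add: continuous_on_eq_continuous_at\<close>)
  have "S \<xi> - ft u \<xi> * ec (\<xi> \<bullet> y) = 0"
  proof (rule fourier_coefficients_unique[OF _ _ \<xi>])
    show "continuous_on UNIV (\<lambda>\<xi>. S \<xi> - ft u \<xi> * ec (\<xi> \<bullet> y))"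
      by (intro continuous_intros cS cft)
    fix k :: "int ^ 'n"
    have "(LINT \<xi>|lborel. indicator open_cube \<xi> *\<^sub>R (S \<xi> * ec (\<xi> \<bullet> real_vec k))) =
      (LINT \<xi>|lborel. LINT l|count_space UNIV. u (y - real_vec l) * (indicator open_cube \<xi> *\<^sub>R ec (\<xi> \<bullet> real_vec (l + k))))"
    proof (rule Bochner_Integration.integral_cong[OF refl])
      fix \<xi> :: "real ^ 'n"
      have "indicator open_cube \<xi> *\<^sub>R (S \<xi> * ec (\<xi> \<bullet> real_vec k)) = (LINT l|count_space UNIV. (u (y - real_vec l) * ec (\<xi> \<bullet> real_vec l)) * (indicator open_cube \<xi> *\<^sub>R ec (\<xi> \<bullet> real_vec k)))"
        unfolding S_def integral_mult_left_zero by simp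
      then show "indicator open_cube \<xi> *\<^sub>R (S \<xi> * ec (\<xi> \<bullet> real_vec k)) = (LINT l|count_space UNIV. u (y - real_vec l) * (indicator open_cube \<xi> *\<^sub>R ec (\<xi> \<bullet> real_vec (l + k))))"
        by (simp add: inner_real_vec_add ec_add mult_ac)
    qed
    also have "\<dots> = (LINT l|count_space UNIV. LINT \<xi>|lborel. u (y - real_vec l) * (indicator open_cube \<xi> *\<^sub>R ec (\<xi> \<bullet> real_vec (l + k))))"
    proof (rule lattice_fubini[symmetric])
      have "(\<integral>\<^sup>+\<xi>. ennreal (norm (u (y - real_vec l) * (indicator open_cube \<xi> *\<^sub>R ec (\<xi> \<bullet> real_vec (l + k))))) \<partial>lborel) = ennreal (norm (u (y - real_vec l))) * emeasure lborel (open_cube :: (real ^ 'n) set)" for l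
      proof -
        have "(\<integral>\<^sup>+\<xi>. ennreal (norm (u (y - real_vec l) * (indicator open_cube \<xi> *\<^sub>R ec (\<xi> \<bullet> real_vec (l + k))))) \<partial>lborel) = (\<integral>\<^sup>+\<xi>. ennreal (norm (u (y - real_vec l))) * indicator (open_cube :: (real ^ 'n) set) \<xi> \<partial>lborel)"
          by (intro nn_integral_cong) (auto simp: indicator_def norm_mult)
        then show ?thesis by (simp add: nn_integral_cmult_indicator)
      qed
      moreover have "emeasure lborel (open_cube :: (real ^ 'n) set) < \<infinity>"
        unfolding open_cube_eq_box by (simp add: emeasure_lborel_box_eq)
      ultimately show "(\<integral>\<^sup>+l. \<integral>\<^sup>+\<xi>. ennreal (norm (u (y - real_vec l) * (indicator open_cube \<xi> *\<^sub>R ec (\<xi> \<bullet> real_vec (l + k))))) \<partial>lborel \<partial>count_space UNIV) < \<infinity>"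
        using integrable_nn_finite[OF uk[of y]] by (simp add: nn_integral_multc ennreal_mult_less_top)
    qed measurable
    also have "\<dots> = (LINT l|count_space UNIV. u (y - real_vec l) * of_bool (l + k = 0))"
      unfolding integral_mult_right_zero integral_cube_ec ..
    also have "\<dots> = (LINT l|count_space UNIV. indicator {- k} l *\<^sub>R u (y - real_vec (- k)))"
      by (intro Bochner_Integration.integral_cong) (auto simp: indicator_def add_eq_0_iff2)
    also have "\<dots> = u (y - real_vec (- k))" by (simp add: measure_count_space)
    also have "real_vec (- k) = - real_vec k" by (simp add: real_vec_def vec_eq_iff)
    finally have 1: "(LINT \<xi>|lborel. indicator open_cube \<xi> *\<^sub>R (S \<xi> * ec (\<xi> \<bullet> real_vec k))) = u (y + real_vec k)" by simp
    have "(LINT \<xi>|lborel. indicator open_cube \<xi> *\<^sub>R (ft u \<xi> * ec (\<xi> \<bullet> y) * ec (\<xi> \<bullet> real_vec k))) = (LINT \<xi>|lborel. ft u \<xi> * ec (\<xi> \<bullet> (y + real_vec k)))"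
      by (rule Bochner_Integration.integral_cong) (use ft0 in \<open>auto simp: indicator_def inner_add_right ec_add\<close>)
    then have 2: "(LINT \<xi>|lborel. indicator open_cube \<xi> *\<^sub>R (ft u \<xi> * ec (\<xi> \<bullet> y) * ec (\<xi> \<bullet> real_vec k))) = u (y + real_vec k)"
      by (simp add: inv)
    have i1: "integrable lborel (\<lambda>\<xi>. indicator open_cube \<xi> *\<^sub>R (S \<xi> * ec (\<xi> \<bullet> real_vec k)))"
      by (intro cube_integrable continuous_intros cS)
    have i2: "integrable lborel (\<lambda>\<xi>. indicator open_cube \<xi> *\<^sub>R (ft u \<xi> * ec (\<xi> \<bullet> y) * ec (\<xi> \<bullet> real_vec k)))"
      by (intro cube_integrable continuous_intros cft)
    show "(LINT \<xi>|lborel. indicator open_cube \<xi> *\<^sub>R ((S \<xi> - ft u \<xi> * ec (\<xi> \<bullet> y)) * ec (\<xi> \<bullet> real_vec k))) = 0"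
      using Bochner_Integration.integral_diff[OF i1 i2] 1 2 by (simp add: left_diff_distrib scaleR_diff_right)
  qed
  then show ?thesis by (simp add: S_def)
qed

subsection \<open>Linear changes of variables\<close>

lemma matrix_inv_cancel:
  fixes b :: "real ^ 'n ^ 'n::finite"
  assumes "invertible b"
  shows "b ** matrix_inv b = mat 1" "matrix_inv b ** b = mat 1"
  using someI_ex[OF assms[unfolded invertible_def]] by (simp_all add: matrix_inv_def)

text \<open>Uniqueness of translation-invariant measures; only the existence of the factor matters
  below, so the determinant does not enter.\<close>

lemma nn_integral_linear_invertible:
  fixes b :: "real ^ 'n ^ 'n::finite" and f :: "real ^ 'n \<Rightarrow> ennreal"
  assumes b: "invertible b" and [measurable]: "f \<in> borel_measurable borel"
  shows "(\<integral>\<^sup>+x. f (b *v x) \<partial>lborel) = (\<integral>\<^sup>+x. ennreal (gauss (b *v x)) \<partial>lborel) * (\<integral>\<^sup>+x. f x \<partial>lborel)"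
proof -
  have [measurable]: "(\<lambda>x. b *v x) \<in> borel_measurable borel"
    by (intro borel_measurable_continuous_onI linear_continuous_on matrix_vector_mul_bounded_linear)
  have inv: "b *v (matrix_inv b *v y) = y" for y
    using b by (simp add: matrix_vector_mul_assoc matrix_inv_cancel)
  have "(\<integral>\<^sup>+x. f (b *v x) \<partial>lborel) = (\<integral>\<^sup>+x. \<integral>\<^sup>+y. f (b *v x) * ennreal (gauss (y + b *v x)) \<partial>lborel \<partial>lborel)"
  proof (rule nn_integral_cong)
    fix x
    have "(\<integral>\<^sup>+y. f (b *v x) * ennreal (gauss (y + b *v x)) \<partial>lborel) = f (b *v x) * (\<integral>\<^sup>+y. ennreal (gauss (y + b *v x)) \<partial>lborel)"
      by (rule nn_integral_cmult) measurable
    also have "(\<integral>\<^sup>+y. ennreal (gauss (y + b *v x)) \<partial>lborel) = 1"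
      using nn_integral_lborel_translate(2)[of "\<lambda>y::real ^ 'n. ennreal (gauss y)" "b *v x"] by (simp add: nn_integral_gauss)
    finally show "f (b *v x) = (\<integral>\<^sup>+y. f (b *v x) * ennreal (gauss (y + b *v x)) \<partial>lborel)" by simp
  qed
  also have "\<dots> = (\<integral>\<^sup>+y. \<integral>\<^sup>+x. f (b *v x) * ennreal (gauss (y + b *v x)) \<partial>lborel \<partial>lborel)"
    by (rule lborel_pair.Fubini'[symmetric]) measurable
  also have "\<dots> = (\<integral>\<^sup>+y. \<integral>\<^sup>+x. f (b *v x - y) * ennreal (gauss (b *v x)) \<partial>lborel \<partial>lborel)"
  proof (rule nn_integral_cong)
    fix y
    have "(\<integral>\<^sup>+x. f (b *v x - y) * ennreal (gauss (b *v x)) \<partial>lborel) = (\<integral>\<^sup>+x. f (b *v (x + matrix_inv b *v y) - y) * ennreal (gauss (b *v (x + matrix_inv b *v y))) \<partial>lborel)"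
      by (rule nn_integral_lborel_translate(2)[symmetric]) measurable
    also have "\<dots> = (\<integral>\<^sup>+x. f (b *v x) * ennreal (gauss (y + b *v x)) \<partial>lborel)"
      by (simp add: matrix_vector_right_distrib inv add.commute)
    finally show "(\<integral>\<^sup>+x. f (b *v x) * ennreal (gauss (y + b *v x)) \<partial>lborel) = (\<integral>\<^sup>+x. f (b *v x - y) * ennreal (gauss (b *v x)) \<partial>lborel)" by simp
  qed
  also have "\<dots> = (\<integral>\<^sup>+x. \<integral>\<^sup>+y. f (b *v x - y) * ennreal (gauss (b *v x)) \<partial>lborel \<partial>lborel)"
    by (rule lborel_pair.Fubini') measurable
  also have "\<dots> = (\<integral>\<^sup>+x. (\<integral>\<^sup>+y. f y \<partial>lborel) * ennreal (gauss (b *v x)) \<partial>lborel)"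
    by (intro nn_integral_cong, subst nn_integral_multc) (auto simp: nn_integral_lborel_translate(4))
  also have "\<dots> = (\<integral>\<^sup>+x. ennreal (gauss (b *v x)) \<partial>lborel) * (\<integral>\<^sup>+x. f x \<partial>lborel)"
    by (subst nn_integral_cmult) (auto simp: mult.commute)
  finally show ?thesis .
qed

lemma norm_le_matrix_vector_mult:
  fixes b :: "real ^ 'n ^ 'n::finite"
  assumes b: "invertible b"
  obtains K where "K \<ge> 1" "\<And>x. norm x \<le> K * norm (b *v x)"
proof -
  obtain K where K: "\<And>y. norm (matrix_inv b *v y) \<le> norm y * K"
    using bounded_linear.bounded[OF matrix_vector_mul_bounded_linear[of "matrix_inv b"]] by blast
  have "norm x \<le> max 1 K * norm (b *v x)" for x
  proof -
    have "matrix_inv b *v (b *v x) = x" using b by (simp add: matrix_vector_mul_assoc matrix_inv_cancel)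
    then have "norm x \<le> norm (b *v x) * K" using K[of "b *v x"] by simp
    also have "\<dots> \<le> norm (b *v x) * max 1 K" by (intro mult_left_mono) auto
    finally show ?thesis by (simp add: mult.commute)
  qed
  then show ?thesis using that[of "max 1 K"] by auto
qed

lemma distr_linear_invertible:
  fixes b :: "real ^ 'n ^ 'n::finite"
  assumes b: "invertible b"
  obtains C where "C \<ge> 0" "distr lborel borel (\<lambda>x. b *v x) = density lborel (\<lambda>_. ennreal C)"
proof -
  have [measurable]: "(\<lambda>x. b *v x) \<in> borel_measurable borel"
    by (intro borel_measurable_continuous_onI linear_continuous_on matrix_vector_mul_bounded_linear)
  obtain K where K: "K \<ge> 1" "\<And>x. norm x \<le> K * norm (b *v x)" using norm_le_matrix_vector_mult[OF b] by metis
  define C where "C = (LINT x|lborel. gauss (b *v x))"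
  \<comment> \<open>The scaling factor is finite because b shrinks norms by at most the factor K, so
    the Gaussian after b lies below a dilated Gaussian.\<close>
  have "integrable lborel (\<lambda>x. gauss (b *v x))"
  proof (rule Bochner_Integration.integrable_bound)
    show "integrable lborel (\<lambda>x::real ^ 'n. gauss ((1 / K) *\<^sub>R x))" using K(1) by (intro integrable_gauss_scaled) auto
    have "gauss (b *v x) \<le> gauss ((1 / K) *\<^sub>R x)" for x
    proof -
      have "norm ((1 / K) *\<^sub>R x) \<le> norm (b *v x)" using K(1) K(2)[of x] by (simp add: field_simps)
      then have "(norm ((1 / K) *\<^sub>R x))\<^sup>2 \<le> (norm (b *v x))\<^sup>2" by (rule power_mono) simp
      then show ?thesis unfolding gauss_def by simp
    qed
    then show "AE x in lborel. norm (gauss (b *v x)) \<le> norm (gauss ((1 / K) *\<^sub>R x))" by simp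
  qed measurable
  then have C: "(\<integral>\<^sup>+x. ennreal (gauss (b *v x)) \<partial>lborel) = ennreal C" "C \<ge> 0"
    unfolding C_def by (subst nn_integral_eq_integral) auto
  have "distr lborel borel (\<lambda>x. b *v x) = density lborel (\<lambda>_. ennreal C)"
  proof (rule measure_eqI)
    fix A assume "A \<in> sets (distr lborel borel (\<lambda>x. b *v x))"
    then have [measurable]: "A \<in> sets borel" by simp
    have "emeasure (distr lborel borel (\<lambda>x. b *v x)) A = (\<integral>\<^sup>+x. indicator A x \<partial>distr lborel borel (\<lambda>x. b *v x))" by simp
    also have "\<dots> = (\<integral>\<^sup>+x. indicator A (b *v x) \<partial>lborel)" by (rule nn_integral_distr) auto
    also have "\<dots> = ennreal C * emeasure lborel A"
      by (subst nn_integral_linear_invertible[OF b]) (auto simp: C)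
    also have "\<dots> = emeasure (density lborel (\<lambda>_. ennreal C)) A"
      by (subst emeasure_density_const) auto
    finally show "emeasure (distr lborel borel (\<lambda>x. b *v x)) A = emeasure (density lborel (\<lambda>_. ennreal C)) A" .
  qed simp
  then show ?thesis using that C(2) by blast
qed

subsection \<open>Smooth functions with compact support and Schwartz functions\<close>

lemma iter_partial_append: "iter_partial (is @ js) f = iter_partial is (iter_partial js f)"
  by (induction "is") simp_all

lemma smooth_iter_partial: "smooth f \<Longrightarrow> smooth (iter_partial is f)"
  unfolding smooth_def by (simp flip: iter_partial_append)

lemma smooth_differentiable: "smooth f \<Longrightarrow> f differentiable at x"
  unfolding smooth_def by (metis iter_partial.simps(1))

lemma smooth_continuous: "smooth f \<Longrightarrow> continuous_on UNIV f"
  by (simp add: continuous_on_eq_continuous_at differentiable_imp_continuous_within smooth_differentiable)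

abbreviation partial :: "'n \<Rightarrow> (real ^ 'n::finite \<Rightarrow> complex) \<Rightarrow> real ^ 'n \<Rightarrow> complex" where
  "partial i \<equiv> iter_partial [i]"

lemma has_vector_derivative_partial:
  assumes "smooth f"
  shows "((\<lambda>s. f (x + s *\<^sub>R axis i 1)) has_vector_derivative partial i f x) (at 0)"
proof -
  let ?l = "\<lambda>s::real. x + s *\<^sub>R axis i (1::real)"
  have f: "(f has_derivative frechet_derivative f (at x)) (at x)"
    using smooth_differentiable[OF assms] by (simp add: frechet_derivative_works)
  have "(?l has_derivative (\<lambda>s. s *\<^sub>R axis i 1)) (at 0)"
    by (auto intro!: derivative_eq_intros)
  moreover have "(f has_derivative frechet_derivative f (at x)) (at (?l 0))" using f by simp
  ultimately have "(f \<circ> ?l has_derivative frechet_derivative f (at x) \<circ> (\<lambda>s. s *\<^sub>R axis i 1)) (at 0)"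
    by (rule diff_chain_at)
  moreover have "frechet_derivative f (at x) \<circ> (\<lambda>s. s *\<^sub>R axis i 1) = (\<lambda>s. s *\<^sub>R partial i f x)"
    using linear_scale[OF has_derivative_linear[OF f]] by (auto simp: o_def)
  ultimately show ?thesis by (simp add: has_vector_derivative_def o_def)
qed

lemma partial_eq_0_outside:
  assumes S: "closed S" and 0: "\<And>x. x \<notin> S \<Longrightarrow> f x = 0" and x: "x \<notin> S"
  shows "partial i f x = 0"
proof -
  have "((\<lambda>_. 0) has_derivative (\<lambda>_. 0)) (at x)" by simp
  then have "(f has_derivative (\<lambda>_. 0)) (at x)"
    by (rule has_derivative_transform_within_open[where s = "- S"]) (use S 0 x in auto)
  then have "frechet_derivative f (at x) = (\<lambda>_. 0)" by (rule frechet_derivative_at[symmetric])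
  then show ?thesis by simp
qed

lemma integrable_compact_support:
  fixes f :: "real ^ 'n::finite \<Rightarrow> complex"
  assumes f: "continuous_on UNIV f" and S: "compact S" and 0: "\<And>x. x \<notin> S \<Longrightarrow> f x = 0"
  shows "integrable lborel f"
proof -
  have "integrable lborel (\<lambda>x. indicator S x *\<^sub>R f x)"
    by (rule borel_integrable_compact[OF S continuous_on_subset[OF f]]) simp
  moreover have "indicator S x *\<^sub>R f x = f x" for x using 0[of x] by (auto simp: indicator_def)
  ultimately show ?thesis by simp
qed

lemma ft_partial:
  assumes f: "smooth f" and S: "compact S" and 0: "\<And>x. x \<notin> S \<Longrightarrow> f x = 0"
  shows "ft (partial i f) \<xi> = 2 * pi * \<i> * \<xi> $ i * ft f \<xi>"
proof -
  let ?F = "\<lambda>x. f x * ec (- (\<xi> \<bullet> x))"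
  let ?F' = "\<lambda>x. partial i f x * ec (- (\<xi> \<bullet> x)) + (- 2 * pi * \<i> * \<xi> $ i) * ?F x"
  note c = smooth_continuous[OF f] and c' = smooth_continuous[OF smooth_iter_partial[of f "[i]", OF f]]
  have if': "integrable lborel f" by (rule integrable_compact_support[OF c S 0])
  have ip: "integrable lborel (partial i f)"
    by (rule integrable_compact_support[OF c' S partial_eq_0_outside[OF compact_imp_closed[OF S] 0]])
  have i: "integrable lborel ?F" "integrable lborel (\<lambda>x. partial i f x * ec (- (\<xi> \<bullet> x)))"
    by (rule integrable_mult_ec(3)[OF if'], rule integrable_mult_ec(3)[OF ip])
  have "(LINT x|lborel. ?F' x) = 0"
  proof (rule integral_partial_derivative_eq_0)
    show "integrable lborel ?F" by (rule i)
    show "integrable lborel ?F'" using i by auto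
    show "continuous_on UNIV ?F'" by (intro continuous_intros c c')
    show "((\<lambda>s. ?F (x + s *\<^sub>R axis i 1)) has_vector_derivative ?F' x) (at 0)" for x
    proof -
      have e: "((\<lambda>s. ec (- (\<xi> \<bullet> (x + s *\<^sub>R axis i 1)))) has_vector_derivative - 2 * pi * \<i> * \<xi> $ i * ec (- (\<xi> \<bullet> x))) (at 0)"
      proof -
        have "((\<lambda>s. complex_of_real (2 * pi) * \<i> * of_real (- (\<xi> \<bullet> x + s * \<xi> $ i))) has_vector_derivative
            complex_of_real (2 * pi) * \<i> * of_real (- \<xi> $ i)) (at 0)"
          by (intro has_vector_derivative_mult_right has_vector_derivative_of_real)
            (auto intro!: derivative_eq_intros)
        from field_vector_diff_chain_at[OF this DERIV_exp] show ?thesis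
          by (simp add: ec_exp o_def inner_add_right inner_axis mult_ac)
      qed
      show ?thesis
        by (rule has_vector_derivative_eq_rhs[OF has_vector_derivative_mult[OF has_vector_derivative_partial[OF f] e]])
          (simp add: algebra_simps)
    qed
  qed
  moreover have "(LINT x|lborel. ?F' x) = ft (partial i f) \<xi> + (- 2 * pi * \<i> * \<xi> $ i) * ft f \<xi>"
    unfolding ft_def using i by (subst Bochner_Integration.integral_add) auto
  ultimately show ?thesis by (simp add: add_eq_0_iff)
qed

text \<open>Induction over the set of coordinates with f varying: the new factor is paid for by f
  together with its second partial derivative in that direction, and the hypothesis for the other
  coordinates applies to both. For all coordinates this is decay at the rate
  \<open>wt\<close>.\<close>

lemma ft_smooth_compact_decay:
  assumes "smooth f" and S: "compact S" and "\<And>x. x \<notin> S \<Longrightarrow> f x = 0"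
  shows "\<exists>C. \<forall>\<xi>. norm (ft f \<xi>) * (\<Prod>i\<in>A. 1 + (\<xi> $ i)\<^sup>2) \<le> C"
  using finite[of A] assms(1,3)
proof (induction A arbitrary: f rule: finite_induct)
  case empty
  then show ?case using norm_ft_le[of f] by auto
next
  case (insert i A f)
  let ?g = "partial i (partial i f)"
  note S0 = partial_eq_0_outside[OF compact_imp_closed[OF S]]
  have g: "smooth ?g" by (intro smooth_iter_partial insert.prems)
  have g0: "?g x = 0" if "x \<notin> S" for x
    by (rule S0[OF S0 that]) (use insert.prems(2) in auto)
  obtain C1 where C1: "\<And>\<xi>. norm (ft f \<xi>) * (\<Prod>i\<in>A. 1 + (\<xi> $ i)\<^sup>2) \<le> C1"
    using insert.IH[OF insert.prems] by blast
  obtain C2 where C2: "\<And>\<xi>. norm (ft ?g \<xi>) * (\<Prod>i\<in>A. 1 + (\<xi> $ i)\<^sup>2) \<le> C2"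
    using insert.IH[OF g g0] by blast
  have "norm (ft f \<xi>) * (\<Prod>i\<in>insert i A. 1 + (\<xi> $ i)\<^sup>2) \<le> C1 + C2" for \<xi>
  proof -
    have "ft ?g \<xi> = 2 * pi * \<i> * \<xi> $ i * (2 * pi * \<i> * \<xi> $ i * ft f \<xi>)"
      using ft_partial[OF smooth_iter_partial[of f "[i]", OF insert.prems(1)] S S0[OF insert.prems(2)], of i \<xi>]
        ft_partial[OF insert.prems(1) S insert.prems(2), of i \<xi>] by simp
    then have "norm (ft ?g \<xi>) = (2 * pi)\<^sup>2 * (\<xi> $ i)\<^sup>2 * norm (ft f \<xi>)"
      by (simp add: norm_mult power2_eq_square)
    moreover have "1 * (\<xi> $ i)\<^sup>2 \<le> (2 * pi)\<^sup>2 * (\<xi> $ i)\<^sup>2"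
      using pi_ge_two by (intro mult_right_mono one_le_power) auto
    then have "(1 * (\<xi> $ i)\<^sup>2) * norm (ft f \<xi>) \<le> (2 * pi)\<^sup>2 * (\<xi> $ i)\<^sup>2 * norm (ft f \<xi>)"
      by (rule mult_right_mono) simp
    ultimately have "(1 + (\<xi> $ i)\<^sup>2) * norm (ft f \<xi>) \<le> norm (ft f \<xi>) + norm (ft ?g \<xi>)"
      by (simp add: distrib_right)
    then have "(1 + (\<xi> $ i)\<^sup>2) * norm (ft f \<xi>) * (\<Prod>i\<in>A. 1 + (\<xi> $ i)\<^sup>2) \<le> (norm (ft f \<xi>) + norm (ft ?g \<xi>)) * (\<Prod>i\<in>A. 1 + (\<xi> $ i)\<^sup>2)"
      by (rule mult_right_mono) (auto intro: prod_nonneg)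
    also have "\<dots> \<le> C1 + C2" using C1[of \<xi>] C2[of \<xi>] by (simp add: distrib_right)
    finally show ?thesis using insert.hyps by (simp add: mult_ac)
  qed
  then show ?case by blast
qed

lemma fourier_eq_ft:
  assumes "f \<in> borel_measurable borel"
  shows "fourier f \<xi> = ft f \<xi>"
proof -
  have [measurable]: "f \<in> borel_measurable lborel" using assms by simp
  have "exp (- 2 * pi * \<i> * of_real t) = ec (- t)" for t by (simp add: ec_exp)
  then have "fourier f \<xi> = (LINT x|completion lborel. f x * ec (- (\<xi> \<bullet> x)))"
    unfolding fourier_def by (simp only:)
  also have "\<dots> = ft f \<xi>" unfolding ft_def by (rule integral_completion) measurable
  finally show ?thesis .
qed

lemma inv_fourier_eq_ft:
  assumes "f \<in> borel_measurable borel"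
  shows "inv_fourier f x = ft f (- x)"
proof -
  have [measurable]: "f \<in> borel_measurable lborel" using assms by simp
  have "inv_fourier f x = (LINT \<xi>|completion lborel. f \<xi> * ec (- (- x \<bullet> \<xi>)))"
    unfolding inv_fourier_def by (simp add: ec_exp inner_commute)
  also have "\<dots> = ft f (- x)" unfolding ft_def by (rule integral_completion) measurable
  finally show ?thesis .
qed

lemma supp_eq_0: "x \<notin> supp f \<Longrightarrow> f x = 0"
  using closure_subset[of "support_on UNIV f"] by (auto simp: supp_def in_support_on)

locale cutoff_function =
  fixes \<nu> :: "real ^ 'n::finite \<Rightarrow> complex"
  assumes cutoff: "cutoff \<nu>"
begin

lemma continuous_nu: "continuous_on UNIV \<nu>"
  using cutoff smooth_continuous by (auto simp: cutoff_def)

lemma nu_measurable [measurable]: "\<nu> \<in> borel_measurable borel"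
  by (rule borel_measurable_continuous_onI[OF continuous_nu])

lemma nu_eq_0: "\<xi> \<notin> open_cube \<Longrightarrow> \<nu> \<xi> = 0"
  using cutoff supp_eq_0[of \<xi> \<nu>] by (auto simp: cutoff_def)

lemma integrable_nu: "integrable lborel \<nu>"
  using cutoff integrable_compact_support[OF continuous_nu, of "supp \<nu>"] supp_eq_0 by (auto simp: cutoff_def)

lemma nu_0: "\<nu> 0 = 1"
  using cutoff eventually_nhds_x_imp_x by (auto simp: cutoff_def)

lemma nu_bounded: "\<exists>B. \<forall>\<xi>. norm (\<nu> \<xi>) \<le> B"
proof -
  have "compact (\<nu> ` supp \<nu>)"
    using cutoff by (intro compact_continuous_image continuous_on_subset[OF continuous_nu]) (auto simp: cutoff_def)
  then obtain B where B: "\<And>\<xi>. \<xi> \<in> supp \<nu> \<Longrightarrow> norm (\<nu> \<xi>) \<le> B"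
    using compact_imp_bounded[of "\<nu> ` supp \<nu>"] by (auto simp: bounded_iff)
  have "norm (\<nu> \<xi>) \<le> max 0 B" for \<xi>
    using B[of \<xi>] supp_eq_0[of \<xi> \<nu>] by (cases "\<xi> \<in> supp \<nu>") auto
  then show ?thesis by blast
qed

lemma integrable_ft_nu: "integrable lborel (ft \<nu>)"
proof -
  obtain C where C: "\<And>\<xi>. norm (ft \<nu> \<xi>) * (\<Prod>i\<in>UNIV. 1 + (\<xi> $ i)\<^sup>2) \<le> C"
    using ft_smooth_compact_decay[of \<nu> "supp \<nu>" UNIV] cutoff supp_eq_0 by (auto simp: cutoff_def)
  show ?thesis
  proof (rule Bochner_Integration.integrable_bound[OF integrable_mult_right[OF integrable_wt, of C]])
    show "ft \<nu> \<in> borel_measurable lborel"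
      using borel_measurable_continuous_onI[OF continuous_ft[OF integrable_nu]] by simp
    have "norm (ft \<nu> \<xi>) \<le> C * wt \<xi>" for \<xi>
    proof -
      have p: "(\<Prod>i\<in>UNIV. 1 + (\<xi> $ i)\<^sup>2) > 0" by (intro prod_pos) (auto intro: add_pos_nonneg)
      have "wt \<xi> = 1 / (\<Prod>i\<in>UNIV. 1 + (\<xi> $ i)\<^sup>2)" unfolding wt_def by (simp add: prod_dividef)
      then show ?thesis using C[of \<xi>] p by (simp add: field_simps)
    qed
    then show "AE \<xi> in lborel. norm (ft \<nu> \<xi>) \<le> norm (C * wt \<xi>)"
      by (intro always_eventually allI) (metis abs_ge_self order_trans real_norm_def)
  qed
qed

lemma one_le_norm_ft_nu: "1 \<le> (LINT x|lborel. norm (ft \<nu> x))"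
proof -
  obtain B where B: "\<And>\<xi>. norm (\<nu> \<xi>) \<le> B" using nu_bounded by blast
  have "(LINT x|lborel. ft \<nu> x * ec (x \<bullet> 0)) = \<nu> 0"
    by (rule fourier_inversion[OF integrable_nu B _ integrable_ft_nu])
      (use continuous_nu in \<open>simp add: continuous_on_eq_continuous_at\<close>)
  then have "norm (LINT x|lborel. ft \<nu> x) = 1" by (simp add: nu_0)
  then show ?thesis using integral_norm_bound[of lborel "ft \<nu>"] by simp
qed

end

lemma prod_le_norm_power:
  fixes x :: "real ^ 'n::finite"
  shows "(\<Prod>i\<in>UNIV. 1 + (x $ i)\<^sup>2) \<le> (1 + norm x) ^ (2 * CARD('n))"
proof -
  have "1 + (x $ i)\<^sup>2 \<le> (1 + norm x)\<^sup>2" for i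
  proof -
    have "(x $ i)\<^sup>2 \<le> (norm x)\<^sup>2" using component_le_norm_cart[of x i] by (metis abs_le_square_iff abs_norm_cancel)
    then show ?thesis using norm_ge_zero[of x] by (simp add: power2_sum add_increasing2)
  qed
  then have "(\<Prod>i\<in>UNIV. 1 + (x $ i)\<^sup>2) \<le> (\<Prod>i\<in>(UNIV :: 'n set). (1 + norm x)\<^sup>2)"
    by (intro prod_mono) auto
  then show ?thesis by (simp add: power_mult)
qed

lemma schwartz_linear_bound:
  fixes b :: "real ^ 'n ^ 'n::finite"
  assumes \<phi>: "schwartz \<phi>" and b: "invertible b"
  shows "\<exists>C. \<forall>x. norm (\<phi> (b *v x)) \<le> C * wt x"
proof -
  \<comment> \<open>The reciprocal of \<open>wt\<close> has \<open>CARD('n)\<close> quadratic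
    factors, each at most the square of 1 + norm x.\<close>
  let ?N = "2 * CARD('n)"
  have "\<exists>C. \<forall>x. (1 + norm x) ^ ?N * norm (iter_partial [] \<phi> x) \<le> C"
    using \<phi> unfolding schwartz_def by blast
  then obtain C where C: "\<And>x. (1 + norm x) ^ ?N * norm (\<phi> x) \<le> C" by auto
  obtain K where K: "K \<ge> 1" "\<And>x. norm x \<le> K * norm (b *v x)" using norm_le_matrix_vector_mult[OF b] by metis
  have "norm (\<phi> (b *v x)) \<le> (K ^ ?N * C) * wt x" for x
  proof -
    have p: "(\<Prod>i\<in>UNIV. 1 + (x $ i)\<^sup>2) > 0" by (intro prod_pos) (auto intro: add_pos_nonneg)
    have "1 + norm x \<le> K * (1 + norm (b *v x))" using K(1) K(2)[of x] by (simp add: distrib_left)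
    then have "(1 + norm x) ^ ?N \<le> (K * (1 + norm (b *v x))) ^ ?N" by (intro power_mono) auto
    then have "(\<Prod>i\<in>UNIV. 1 + (x $ i)\<^sup>2) \<le> K ^ ?N * (1 + norm (b *v x)) ^ ?N"
      using prod_le_norm_power[of x] by (simp add: power_mult_distrib)
    then have "(\<Prod>i\<in>UNIV. 1 + (x $ i)\<^sup>2) * norm (\<phi> (b *v x)) \<le> K ^ ?N * (1 + norm (b *v x)) ^ ?N * norm (\<phi> (b *v x))"
      by (rule mult_right_mono) simp
    also have "\<dots> \<le> K ^ ?N * C" using C[of "b *v x"] K(1) by (simp add: mult.assoc mult_left_mono)
    finally have "norm (\<phi> (b *v x)) \<le> (K ^ ?N * C) / (\<Prod>i\<in>UNIV. 1 + (x $ i)\<^sup>2)"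
      using p by (simp add: field_simps)
    then show ?thesis by (simp add: wt_def prod_dividef)
  qed
  then show ?thesis by blast
qed

lemma continuous_matrix_vector_mult: "continuous_on A (\<lambda>x. (b :: real ^ 'n ^ 'm) *v x)"
  by (intro linear_continuous_on matrix_vector_mul_bounded_linear)

text \<open>The transform of \<open>\<phi>\<close> after b at \<open>\<xi>\<close> is a constant
  times that of \<open>\<phi>\<close> at \<open>\<xi> v* matrix_inv b\<close>. Since this map of
  frequencies is injective, a frequency off the cube is sent outside the support.\<close>

lemma ft_linear_eq_0:
  fixes b :: "real ^ 'n ^ 'n::finite"
  assumes \<phi>: "continuous_on UNIV \<phi>" and b: "invertible b"
    and supp: "supp (fourier \<phi>) \<subseteq> (\<lambda>\<xi>. \<xi> v* matrix_inv b) ` open_cube" and \<xi>: "\<xi> \<notin> open_cube"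
  shows "ft (\<lambda>x. \<phi> (b *v x)) \<xi> = 0"
proof -
  have [measurable]: "\<phi> \<in> borel_measurable borel" by (rule borel_measurable_continuous_onI[OF \<phi>])
  have [measurable]: "(\<lambda>x. b *v x) \<in> borel_measurable borel"
    by (intro borel_measurable_continuous_onI continuous_matrix_vector_mult)
  let ?\<eta> = "\<xi> v* matrix_inv b"
  have inj: "\<xi> = \<zeta>" if "\<xi> v* matrix_inv b = \<zeta> v* matrix_inv b" for \<zeta>
  proof -
    have "\<xi> v* matrix_inv b v* b = \<zeta> v* matrix_inv b v* b" using that by simp
    then show ?thesis using b by (simp add: vector_matrix_mul_assoc matrix_inv_cancel)
  qed
  have "?\<eta> \<notin> supp (fourier \<phi>)" using supp \<xi> inj by blast
  then have 0: "ft \<phi> ?\<eta> = 0" using supp_eq_0[of ?\<eta> "fourier \<phi>"] by (simp add: fourier_eq_ft)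
  obtain C where C: "C \<ge> 0" "distr lborel borel (\<lambda>x. b *v x) = density lborel (\<lambda>_. ennreal C)"
    using distr_linear_invertible[OF b] by metis
  have dot: "?\<eta> \<bullet> (b *v x) = \<xi> \<bullet> x" for x
    using b by (simp add: dot_lmul_matrix matrix_vector_mul_assoc matrix_inv_cancel)
  have "ft (\<lambda>x. \<phi> (b *v x)) \<xi> = (LINT x|lborel. \<phi> (b *v x) * ec (- (?\<eta> \<bullet> (b *v x))))"
    unfolding ft_def dot ..
  also have "\<dots> = (LINT z|distr lborel borel (\<lambda>x. b *v x). \<phi> z * ec (- (?\<eta> \<bullet> z)))"
    by (rule integral_distr[symmetric]) auto
  also have "\<dots> = (LINT z|lborel. C *\<^sub>R (\<phi> z * ec (- (?\<eta> \<bullet> z))))"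
    unfolding C(2) using C(1) by (intro integral_density) auto
  also have "\<dots> = C *\<^sub>R ft \<phi> ?\<eta>" unfolding ft_def by simp
  finally show ?thesis by (simp add: 0)
qed

text \<open>An essential supremum bounds the periodization only almost everywhere, while it is
  evaluated at linear images of the variable. The image of Lebesgue measure is a constant multiple
  of it, so null sets pull back to null sets.\<close>

lemma AE_linear:
  fixes b :: "real ^ 'n ^ 'n::finite"
  assumes b: "invertible b" and P: "AE x in lborel. P x"
  shows "AE x in lborel. P (y + b *v x)"
proof -
  have m[measurable]: "(\<lambda>x. b *v x) \<in> borel_measurable borel"
    by (intro borel_measurable_continuous_onI continuous_matrix_vector_mult)
  obtain C where C: "C \<ge> 0" "distr lborel borel (\<lambda>x. b *v x) = density lborel (\<lambda>_. ennreal C)"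
    using distr_linear_invertible[OF b] by metis
  obtain N where N: "{x. \<not> P x} \<subseteq> N" "N \<in> sets borel" "emeasure lborel N = 0"
    using P by (auto elim!: AE_E)
  have [measurable]: "N \<in> sets borel" by (rule N)
  have "AE x in lborel. x \<notin> N" using N(2,3) by (intro AE_not_in) (auto simp: null_sets_def)
  then have "AE x in distr lborel borel ((+) y). x \<notin> N" by (subst lborel_distr_plus)
  then have 1: "AE x in lborel. y + x \<notin> N" by (subst (asm) AE_distr_iff) auto
  then have "AE x in density lborel (\<lambda>_. ennreal C). y + x \<notin> N"
    by (subst AE_density) auto
  then have "AE x in distr lborel borel (\<lambda>x. b *v x). y + x \<notin> N" unfolding C(2) .
  then have "AE x in lborel. y + b *v x \<notin> N" by (subst (asm) AE_distr_iff) auto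
  then show ?thesis by eventually_elim (use N(1) in blast)
qed

subsection \<open>Borel representatives of Lebesgue measurable functions\<close>

text \<open>Elements of \<open>H1\<close> and their Riesz transforms are only Lebesgue measurable,
  whereas the preceding Fourier analysis works with Borel functions.\<close>

lemma lebesgue_borel_representative:
  fixes g :: "'a::euclidean_space \<Rightarrow> 'b::euclidean_space"
  assumes g: "g \<in> borel_measurable lebesgue"
  obtains g' where "g' \<in> borel_measurable borel" "AE x in lborel. g x = g' x"
proof -
  have "\<forall>c\<in>Basis. \<exists>h. h \<in> borel_measurable borel \<and> (AE x in lborel. g x \<bullet> c = h x)"
    using completion_ex_borel_measurable_real[of "\<lambda>x. g x \<bullet> c" lborel for c] g by fastforce
  then obtain h where h: "\<And>c. c \<in> Basis \<Longrightarrow> h c \<in> borel_measurable borel" "\<And>c. c \<in> Basis \<Longrightarrow> AE x in lborel. g x \<bullet> c = h c x"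
    by metis
  show ?thesis
  proof
    show "(\<lambda>x. \<Sum>c\<in>Basis. h c x *\<^sub>R c) \<in> borel_measurable borel" using h(1) by measurable
    have "AE x in lborel. \<forall>c\<in>Basis. g x \<bullet> c = h c x" using h(2) by (simp add: AE_finite_all)
    then show "AE x in lborel. g x = (\<Sum>c\<in>Basis. h c x *\<^sub>R c)"
    proof eventually_elim
      case (elim x)
      then have "(\<Sum>c\<in>Basis. h c x *\<^sub>R c) = (\<Sum>c\<in>Basis. (g x \<bullet> c) *\<^sub>R c)" by simp
      then show ?case by (simp add: euclidean_representation)
    qed
  qed
qed

text \<open>Completeness of \<open>lebesgue\<close> supplies the measurability of f from that of
  f'.\<close>

lemma
  fixes f f' :: "'a::euclidean_space \<Rightarrow> 'b::{banach, second_countable_topology}"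
  assumes f': "f' \<in> borel_measurable borel" and ae: "AE x in lborel. f x = f' x"
  shows integral_lebesgue_AE: "(LINT x|lebesgue. f x) = (LINT x|lborel. f' x)"
    and integrable_lebesgue_AE: "integrable lebesgue f \<longleftrightarrow> integrable lborel f'"
proof -
  have ae': "AE x in lebesgue. f' x = f x" using AE_completion[OF ae] by eventually_elim simp
  have m': "f' \<in> borel_measurable lebesgue" using f' by (intro measurable_completion) simp
  have m: "f \<in> borel_measurable lebesgue"
  proof (rule measurableI)
    fix A :: "'b set" assume "A \<in> sets borel"
    then have "f' -` A \<inter> space lebesgue \<in> sets lebesgue" using m' by (rule measurable_sets[rotated])
    moreover have "AE x in lebesgue. (x \<in> f' -` A \<inter> space lebesgue) \<longleftrightarrow> (x \<in> f -` A \<inter> space lebesgue)"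
      using ae' by eventually_elim auto
    ultimately show "f -` A \<inter> space lebesgue \<in> sets lebesgue"
      by (intro completion.in_sets_AE[of "f' -` A \<inter> space lebesgue" "f -` A \<inter> space lebesgue" lborel]) auto
  qed simp
  have "integral\<^sup>L lebesgue f = integral\<^sup>L lebesgue f'"
    using ae' by (intro integral_cong_AE m m') (auto simp: eq_commute)
  also have "\<dots> = integral\<^sup>L lborel f'" using f' by (intro integral_completion) simp
  finally show "(LINT x|lebesgue. f x) = (LINT x|lborel. f' x)" .
  have "integrable lebesgue f \<longleftrightarrow> integrable lebesgue f'"
    using ae' by (intro integrable_cong_AE m m') (auto simp: eq_commute)
  also have "\<dots> \<longleftrightarrow> integrable lborel f'" using f' by (intro integrable_completion) simp
  finally show "integrable lebesgue f \<longleftrightarrow> integrable lborel f'" .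
qed

lemma L1_norm_AE:
  assumes ae: "AE x in lborel. f x = f' x"
  shows "L1_norm f = (\<integral>\<^sup>+x. ennreal (norm (f' x)) \<partial>lborel)"
proof -
  have "L1_norm f = (\<integral>\<^sup>+x. ennreal (norm (f' x)) \<partial>lebesgue)"
    unfolding L1_norm_def by (rule nn_integral_cong_AE) (use AE_completion[OF ae] in eventually_elim, simp)
  then show ?thesis by (simp add: nn_integral_completion)
qed

lemma measurable_vec_componentwise:
  fixes f :: "'a \<Rightarrow> complex ^ 'n::finite"
  assumes "\<And>i. (\<lambda>x. f x $ i) \<in> borel_measurable M"
  shows "f \<in> borel_measurable M"
proof (subst borel_measurable_euclidean_space, intro ballI)
  fix c :: "complex ^ 'n" assume "c \<in> Basis"
  then obtain j d where c: "c = axis j d" by (auto simp: Basis_vec_def)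
  show "(\<lambda>x. f x \<bullet> c) \<in> borel_measurable M" unfolding c inner_axis using assms[of j] by measurable
qed

text \<open>Equality holds at every x, since for fixed x the two integrands differ only on a null
  set of y. The Gamma constant of the kernel is the mass of \<open>rad\<close> by
  \<open>integral_rad\<close>, and integrability of the truncated integrand allows taking components
  inside the integral.\<close>

lemma riesz_trunc_eq_ztrunc:
  fixes f f' :: "real ^ 'n::finite \<Rightarrow> complex"
  assumes f': "integrable lborel f'" and ae: "AE x in lborel. f x = f' x" and \<epsilon>: "\<epsilon> > 0"
  shows "riesz_trunc f x \<epsilon> $ i = of_real (LINT s|lborel. rad CARD('n) s) * ztrunc i f' x \<epsilon>"
proof -
  let ?C = "LINT s|lborel. rad CARD('n) s"
  note [measurable] = borel_measurable_integrable[OF f', unfolded measurable_lborel2]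
  have rk: "riesz_kernel y = (\<chi> i. of_real (?C * zk i y))" for y :: "real ^ 'n"
    unfolding riesz_kernel_def integral_rad by (simp add: zk_def vec_eq_iff)
  let ?g = "\<lambda>h y. indicator {y. \<epsilon> < norm y} y *\<^sub>R (h (x - y) *s riesz_kernel y)"
  have comp: "?g h y $ i = indicator {y. \<epsilon> < norm y} y *\<^sub>R (h (x - y) * of_real (?C * zk i y))" for h y i
    by (simp add: rk)
  have mg: "?g f' \<in> borel_measurable borel"
    by (rule measurable_vec_componentwise) (unfold comp, measurable)
  \<comment> \<open>The reflection y to x - y is handled as the linear map with matrix -1 followed
    by a translation.\<close>
  have ae2: "AE y in lborel. f (x - y) = f' (x - y)"
  proof -
    have "AE y in lborel. f (x + mat (- 1) *v y) = f' (x + mat (- 1) *v y)"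
    proof (rule AE_linear[OF _ ae])
      have "mat (- 1) ** (mat (- 1) :: real ^ 'n ^ 'n) = mat 1"
        by (simp add: matrix_matrix_mult_def mat_def vec_eq_iff if_distrib[of "\<lambda>x. x * _"] sum.delta' cong: if_cong)
      then show "invertible (mat (- 1) :: real ^ 'n ^ 'n)" unfolding invertible_def by blast
    qed
    moreover have "mat (- 1) *v y = - y" for y :: "real ^ 'n"
      by (simp add: matrix_vector_mult_def mat_def vec_eq_iff if_distrib[of "\<lambda>x. x * _"] sum.delta' cong: if_cong)
    ultimately show ?thesis by simp
  qed
  have eq: "riesz_trunc f x \<epsilon> = (LINT y|lborel. ?g f' y)"
    unfolding riesz_trunc_def set_lebesgue_integral_def
    by (rule integral_lebesgue_AE[OF mg]) (use ae2 in eventually_elim, simp)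
  have bound: "integrable lborel (?g f')"
  proof (rule Bochner_Integration.integrable_bound)
    show "integrable lborel (\<lambda>y. norm (f' (x - y)) * (real CARD('n) * (\<bar>?C\<bar> * (1 / \<epsilon> ^ CARD('n)))))"
      using integrable_norm[OF integrable_lborel_translate(4)[OF f', of x]] by (rule integrable_mult_left)
    show "?g f' \<in> borel_measurable lborel" using mg by simp
    have le: "norm (?g f' y) \<le> norm (f' (x - y)) * (real CARD('n) * (\<bar>?C\<bar> * (1 / \<epsilon> ^ CARD('n))))" for y
    proof (cases "\<epsilon> < norm y")
      case True
      have "norm y > 0" using True \<epsilon> by linarith
      have "norm (?g f' y $ i) \<le> norm (f' (x - y)) * (\<bar>?C\<bar> * (1 / \<epsilon> ^ CARD('n)))" for i
      proof -
        have "norm (?g f' y $ i) = norm (f' (x - y)) * (\<bar>?C\<bar> * \<bar>zk i y\<bar>)"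
          unfolding comp using True by (simp add: norm_mult abs_mult)
        also have "\<dots> \<le> norm (f' (x - y)) * (\<bar>?C\<bar> * (1 / \<epsilon> ^ CARD('n)))"
          using True \<epsilon> \<open>norm y > 0\<close>
          by (intro mult_left_mono order_trans[OF abs_zk_le] divide_left_mono power_mono mult_pos_pos zero_less_power) auto
        finally show ?thesis .
      qed
      then have "(\<Sum>i\<in>UNIV. norm (?g f' y $ i)) \<le> (\<Sum>i\<in>(UNIV :: 'n set). norm (f' (x - y)) * (\<bar>?C\<bar> * (1 / \<epsilon> ^ CARD('n))))"
        by (intro sum_mono)
      then have "(\<Sum>i\<in>UNIV. norm (?g f' y $ i)) \<le> norm (f' (x - y)) * (real CARD('n) * (\<bar>?C\<bar> * (1 / \<epsilon> ^ CARD('n))))"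
        unfolding sum_constant mult.left_commute[of "real CARD('n)"] .
      moreover have "norm (?g f' y) \<le> (\<Sum>i\<in>UNIV. norm (?g f' y $ i))"
        unfolding norm_vec_def by (rule L2_set_le_sum) simp
      ultimately show ?thesis by (rule order_trans[rotated])
    qed (use \<epsilon> in simp)
    show "AE y in lborel. norm (?g f' y) \<le> norm (norm (f' (x - y)) * (real CARD('n) * (\<bar>?C\<bar> * (1 / \<epsilon> ^ CARD('n)))))"
      unfolding real_norm_def by (intro always_eventually allI) (rule order_trans[OF le abs_ge_self])
  qed
  have "riesz_trunc f x \<epsilon> $ i = (LINT y|lborel. ?g f' y $ i)"
    unfolding eq by (rule integral_bounded_linear[OF bounded_linear_vec_nth bound, symmetric])
  also have "\<dots> = (LINT y|lborel. of_real ?C * (indicator {y. \<epsilon> < norm y} y *\<^sub>R (f' (x - y) * of_real (zk i y))))"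
    unfolding comp by (rule Bochner_Integration.integral_cong) (auto simp: indicator_def)
  finally show ?thesis unfolding ztrunc_def integral_mult_right_zero .
qed

lemma riesz_fourier_transform:
  fixes f :: "real ^ 'n::finite \<Rightarrow> complex"
  assumes f: "f \<in> H1"
  obtains f' g where "integrable lborel f'" "AE x in lborel. f x = f' x"
    "integrable lborel g" "AE x in lborel. riesz f x = g x"
    "\<And>i \<xi>. \<xi> \<noteq> 0 \<Longrightarrow> ft (\<lambda>x. g x $ i) \<xi> = - \<i> * of_real (\<xi> $ i / norm \<xi>) * ft f' \<xi>"
proof -
  let ?C = "LINT s|lborel. rad CARD('n) s"
  have C: "?C \<noteq> 0"
  proof -
    have "Gamma ((real CARD('n) + 1) / 2) > 0" by (rule Gamma_real_pos) (simp add: add_pos_nonneg)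
    then have "0 < ?C" unfolding integral_rad by (intro mult_pos_pos) auto
    then show ?thesis by simp
  qed
  have fl: "integrable lebesgue f" and lim: "AE x in lebesgue. \<exists>l. (riesz_trunc f x \<longlongrightarrow> l) (at_right 0)"
    and rl: "integrable lebesgue (riesz f)" using f by (auto simp: H1_def)
  obtain f' where f': "f' \<in> borel_measurable borel" "AE x in lborel. f x = f' x"
    using lebesgue_borel_representative[OF borel_measurable_integrable[OF fl]] .
  obtain g where g: "g \<in> borel_measurable borel" "AE x in lborel. riesz f x = g x"
    using lebesgue_borel_representative[OF borel_measurable_integrable[OF rl]] .
  have fi: "integrable lborel f'" using fl integrable_lebesgue_AE[OF f'] by simp
  have gi: "integrable lborel g" using rl integrable_lebesgue_AE[OF g] by simp
  \<comment> \<open>The total operator \<open>Lim\<close> returns the genuine limit wherever one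
    exists, which \<open>H1\<close> grants almost everywhere. Dividing by the mass of
    \<open>rad\<close> matches the unnormalised kernel in \<open>ztrunc\<close>.\<close>
  have lim': "AE x in lborel. (ztrunc i f' x \<longlongrightarrow> g x $ i / of_real ?C) (at_right 0)" for i
    using lim[unfolded AE_completion_iff] g(2)
  proof eventually_elim
    case (elim x)
    then obtain l where l: "(riesz_trunc f x \<longlongrightarrow> l) (at_right 0)" by blast
    then have "riesz f x = l" unfolding riesz_def by (intro tendsto_Lim) simp
    with l elim(2) have "((\<lambda>\<epsilon>. riesz_trunc f x \<epsilon> $ i) \<longlongrightarrow> g x $ i) (at_right 0)"
      by (auto intro: tendsto_vec_nth)
    then have "((\<lambda>\<epsilon>. of_real ?C * ztrunc i f' x \<epsilon>) \<longlongrightarrow> g x $ i) (at_right 0)"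
      by (rule Lim_transform_eventually)
        (auto simp: eventually_at_right_less riesz_trunc_eq_ztrunc[OF fi f'(2)] intro: eventually_mono[OF eventually_at_right_less])
    then have "((\<lambda>\<epsilon>. of_real ?C * ztrunc i f' x \<epsilon> / of_real ?C) \<longlongrightarrow> g x $ i / of_real ?C) (at_right 0)"
      using C by (intro tendsto_intros) auto
    then show ?case using C by simp
  qed
  have gi': "integrable lborel (\<lambda>x. g x $ i)" for i by (rule integrable_bounded_linear[OF bounded_linear_vec_nth gi])
  show ?thesis
  proof (rule that[OF fi f'(2) gi g(2)])
    fix i and \<xi> :: "real ^ 'n" assume \<xi>: "\<xi> \<noteq> 0"
    have "of_real ?C * ft (\<lambda>x. g x $ i / of_real ?C) \<xi> = - \<i> * of_real (\<xi> $ i / norm \<xi>) * ft f' \<xi>"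
      by (rule riesz_transform_multiplier[OF fi _ lim' \<xi>]) (use gi' in simp)
    moreover have "of_real ?C * ft (\<lambda>x. g x $ i / of_real ?C) \<xi> = ft (\<lambda>x. g x $ i) \<xi>"
      unfolding ft_def integral_mult_right_zero[symmetric] using C by simp
    ultimately show "ft (\<lambda>x. g x $ i) \<xi> = - \<i> * of_real (\<xi> $ i / norm \<xi>) * ft f' \<xi>" by simp
  qed
qed

subsection \<open>Sampling against a band-limited function\<close>

lemma bounded_bilinear_smult: "bounded_bilinear (\<lambda>a (v :: complex ^ 'n::finite). a *s v)"
proof
  show "\<exists>K. \<forall>a (v :: complex ^ 'n). norm (a *s v) \<le> norm a * norm v * K"
    by (rule exI[of _ 1]) (simp add: norm_vec_def norm_mult L2_set_right_distrib)
qed (simp_all add: vec_eq_iff algebra_simps)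

lemma norm_smult: "norm (a *s (v :: complex ^ 'n::finite)) = norm a * norm v"
  by (simp add: norm_vec_def norm_mult L2_set_right_distrib)

lemma measurable_smult [measurable (raw)]:
  fixes g :: "'a \<Rightarrow> complex ^ 'n::finite"
  assumes "h \<in> borel_measurable M" "g \<in> borel_measurable M"
  shows "(\<lambda>x. h x *s g x) \<in> borel_measurable M"
  by (rule borel_measurable_continuous_Pair[OF assms])
    (intro bounded_bilinear.continuous_on[OF bounded_bilinear_smult] continuous_intros)

lemma integrable_smult_bounded:
  fixes g :: "'a \<Rightarrow> complex ^ 'n::finite"
  assumes g: "integrable M g" and h: "h \<in> borel_measurable M" "\<And>x. norm (h x) \<le> B"
  shows "integrable M (\<lambda>x. h x *s g x)"
proof (rule Bochner_Integration.integrable_bound[OF integrable_mult_right[OF integrable_norm[OF g], of B]])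
  show "(\<lambda>x. h x *s g x) \<in> borel_measurable M" using g h by measurable
  show "AE x in M. norm (h x *s g x) \<le> norm (B * norm (g x))"
    unfolding norm_smult real_norm_def
    by (intro always_eventually allI order_trans[OF _ abs_ge_self] mult_right_mono h) simp
qed

lemma
  fixes f :: "'a \<Rightarrow> 'b::{banach, second_countable_topology}"
  assumes "integrable (count_space UNIV) f"
  shows infsum_eq_integral: "infsum f UNIV = (LINT k|count_space UNIV. f k)"
    and summable_norm_count_space: "(\<lambda>k. norm (f k)) summable_on UNIV"
proof -
  have f: "Infinite_Set_Sum.abs_summable_on f UNIV" using assms by (simp add: abs_summable_on_def)
  show "infsum f UNIV = (LINT k|count_space UNIV. f k)"
    using infsetsum_infsum[OF f] by (simp add: infsetsum_def)
  show "(\<lambda>k. norm (f k)) summable_on UNIV" using f abs_summable_equivalent by blast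
qed

lemma ell1_norm_le: "ell1_norm s \<le> (\<integral>\<^sup>+k. ennreal (norm (s k)) \<partial>count_space UNIV)"
proof -
  have "(\<Sum>k\<in>F. ennreal (norm (s k))) \<le> (\<integral>\<^sup>+k. ennreal (norm (s k)) \<partial>count_space UNIV)" if "finite F" for F
  proof -
    have "(\<Sum>k\<in>F. ennreal (norm (s k))) = (\<integral>\<^sup>+k. ennreal (norm (s k)) * indicator F k \<partial>count_space UNIV)"
      unfolding nn_integral_count_space_finite[OF that, symmetric] by (rule nn_integral_count_space_indicator) simp
    also have "\<dots> \<le> (\<integral>\<^sup>+k. ennreal (norm (s k)) \<partial>count_space UNIV)"
      by (intro nn_integral_mono) (auto simp: indicator_def)
    finally show ?thesis .
  qed
  then show ?thesis unfolding ell1_norm_def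
    by (subst nonneg_infsum_complete) (auto intro: SUP_least)
qed

lemma ell1I:
  fixes s :: "int ^ 'n::finite \<Rightarrow> 'b::{banach, second_countable_topology}"
  assumes "(\<integral>\<^sup>+k. ennreal (norm (s k)) \<partial>count_space UNIV) < \<infinity>"
  shows "s \<in> ell1"
  unfolding ell1_def using assms by (intro CollectI summable_norm_count_space integrableI_bounded) auto

text \<open>The multiplication formula for the Fourier transform with a linear map inserted; the map
  passes to its transpose on the frequency side.\<close>

lemma integral_ft_multiplication:
  fixes f \<Psi> :: "real ^ 'n::finite \<Rightarrow> complex"
  assumes f: "integrable lborel f" and \<Psi>: "integrable lborel \<Psi>"
  shows "(LINT x|lborel. f x * ft \<Psi> (M *v x)) = (LINT \<xi>|lborel. \<Psi> \<xi> * ft f (\<xi> v* M))"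
proof -
  note [measurable] = borel_measurable_integrable[OF f, unfolded measurable_lborel2]
    borel_measurable_integrable[OF \<Psi>, unfolded measurable_lborel2]
    borel_measurable_continuous_onI[OF continuous_matrix_vector_mult[of UNIV M]]
  let ?F = "\<lambda>x \<xi>. f x * (\<Psi> \<xi> * ec (- (\<xi> \<bullet> (M *v x))))"
  have "(\<integral>\<^sup>+x. \<integral>\<^sup>+\<xi>. ennreal (norm (?F x \<xi>)) \<partial>lborel \<partial>lborel) < \<infinity>"
    using nn_mult_finite[OF f \<Psi>] by (simp add: norm_mult ennreal_mult)
  then have "(LINT x|lborel. LINT \<xi>|lborel. ?F x \<xi>) = (LINT \<xi>|lborel. LINT x|lborel. ?F x \<xi>)"
    by (intro fubini_swap) measurable
  moreover have "(LINT \<xi>|lborel. ?F x \<xi>) = f x * ft \<Psi> (M *v x)" for x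
    unfolding ft_def integral_mult_right_zero by (simp add: inner_commute)
  moreover have "(LINT x|lborel. ?F x \<xi>) = \<Psi> \<xi> * ft f (\<xi> v* M)" for \<xi>
    unfolding ft_def integral_mult_right_zero[symmetric] dot_lmul_matrix
    by (rule Bochner_Integration.integral_cong) (simp_all add: mult_ac)
  ultimately show ?thesis by (simp only:)
qed

locale band_limited_sampling = cutoff_function \<nu> for \<nu> :: "real ^ 'n::finite \<Rightarrow> complex" +
  fixes u :: "real ^ 'n \<Rightarrow> complex" and C :: real and M :: "real ^ 'n ^ 'n"
  assumes continuous_u: "continuous_on UNIV u"
    and norm_u_le: "\<And>x. norm (u x) \<le> C * wt x"
    and ft_u_eq_0: "\<And>\<xi>. \<xi> \<notin> open_cube \<Longrightarrow> ft u \<xi> = 0"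
    and M: "invertible M"
begin

lemma u_measurable [measurable]: "u \<in> borel_measurable borel"
  by (rule borel_measurable_continuous_onI[OF continuous_u])

lemma M_measurable [measurable]: "(\<lambda>x. M *v x) \<in> borel_measurable borel"
  by (rule borel_measurable_continuous_onI[OF continuous_matrix_vector_mult])

lemma integrable_u: "integrable lborel u"
proof (rule Bochner_Integration.integrable_bound[OF integrable_mult_right[OF integrable_wt, of C]])
  show "AE x in lborel. norm (u x) \<le> norm (C * wt x)"
    unfolding real_norm_def by (intro always_eventually allI order_trans[OF norm_u_le abs_ge_self])
qed simp

text \<open>For u as in \<open>analysis_op_bound\<close> this is the periodization of the absolute
  value of \<open>\<phi>\<close> at \<open>b *v z\<close>. As an integral over counting measure it
  needs no summability.\<close>

definition period :: "real ^ 'n \<Rightarrow> ennreal" where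
  "period z = (\<integral>\<^sup>+k. ennreal (norm (u (z - real_vec k))) \<partial>count_space UNIV)"

lemma period_measurable [measurable]: "period \<in> borel_measurable borel"
  unfolding period_def by (rule lattice_nn_measurable) measurable

lemma period_bounded: "\<exists>B::real. B \<ge> 0 \<and> (\<forall>z. period z \<le> ennreal B)"
proof (intro exI conjI allI)
  let ?B = "\<bar>C\<bar> * (3 ^ CARD('n) * (LINT x|lborel. wt (x :: real ^ 'n)))"
  show "0 \<le> ?B" by (intro mult_nonneg_nonneg integral_nonneg_AE) auto
  fix z
  have "norm (u y) \<le> \<bar>C\<bar> * wt y" for y
    by (rule order_trans[OF norm_u_le mult_right_mono]) auto
  then have "period z \<le> (\<integral>\<^sup>+k. ennreal \<bar>C\<bar> * ennreal (wt (z - real_vec k)) \<partial>count_space UNIV)"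
    unfolding period_def ennreal_mult[OF abs_ge_zero wt_nonneg, symmetric] by (intro nn_integral_mono ennreal_leI)
  also have "\<dots> = ennreal \<bar>C\<bar> * (\<integral>\<^sup>+k. ennreal (wt (z - real_vec k)) \<partial>count_space UNIV)"
    by (rule nn_integral_cmult) simp
  also have "\<dots> \<le> ennreal \<bar>C\<bar> * ennreal (3 ^ CARD('n) * (LINT x|lborel. wt (x :: real ^ 'n)))"
    by (intro mult_left_mono nn_integral_lattice_wt) simp
  finally show "period z \<le> ennreal ?B" by (simp add: ennreal_mult')
qed

definition coeff :: "(real ^ 'n \<Rightarrow> complex) \<Rightarrow> int ^ 'n \<Rightarrow> complex" where
  "coeff f k = (LINT x|lborel. f x * cnj (u (M *v x - real_vec k)))"

lemma nn_integral_lattice_le: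
  assumes [measurable]: "F \<in> borel_measurable borel" and \<Lambda>: "AE z in lborel. period z \<le> \<Lambda>"
  shows "(\<integral>\<^sup>+k. \<integral>\<^sup>+x. F x * ennreal (norm (u (M *v x - real_vec k))) \<partial>lborel \<partial>count_space UNIV) \<le> \<Lambda> * (\<integral>\<^sup>+x. F x \<partial>lborel)"
proof -
  have "(\<integral>\<^sup>+k. \<integral>\<^sup>+x. F x * ennreal (norm (u (M *v x - real_vec k))) \<partial>lborel \<partial>count_space UNIV)
      = (\<integral>\<^sup>+x. \<integral>\<^sup>+k. F x * ennreal (norm (u (M *v x - real_vec k))) \<partial>count_space UNIV \<partial>lborel)"
    by (rule lattice_nn_fubini) measurable
  also have "\<dots> = (\<integral>\<^sup>+x. F x * period (M *v x) \<partial>lborel)"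
    unfolding period_def by (simp add: nn_integral_cmult)
  also have "\<dots> \<le> (\<integral>\<^sup>+x. \<Lambda> * F x \<partial>lborel)"
  proof (rule nn_integral_mono_AE)
    \<comment> \<open>The bound on \<open>period\<close> holds only almost everywhere, so it must be
      transported along the invertible matrix M.\<close>
    show "AE x in lborel. F x * period (M *v x) \<le> \<Lambda> * F x"
      using AE_linear[OF M \<Lambda>, of 0] by eventually_elim (subst mult.commute, rule mult_right_mono, simp_all)
  qed
  also have "\<dots> = \<Lambda> * (\<integral>\<^sup>+x. F x \<partial>lborel)" by (rule nn_integral_cmult) simp
  finally show ?thesis .
qed

lemma nn_integral_coeff_le:
  assumes f: "integrable lborel f" and \<Lambda>: "AE z in lborel. period z \<le> \<Lambda>"
  shows "(\<integral>\<^sup>+k. ennreal (norm (coeff f k)) \<partial>count_space UNIV) \<le> \<Lambda> * (\<integral>\<^sup>+x. ennreal (norm (f x)) \<partial>lborel)"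
proof -
  note [measurable] = borel_measurable_integrable[OF f, unfolded measurable_lborel2]
  have "ennreal (norm (coeff f k)) \<le> (\<integral>\<^sup>+x. ennreal (norm (f x)) * ennreal (norm (u (M *v x - real_vec k))) \<partial>lborel)" for k
    unfolding coeff_def by (rule order_trans[OF norm_integral_le_nn_integral]) (simp add: norm_mult ennreal_mult)
  then have "(\<integral>\<^sup>+k. ennreal (norm (coeff f k)) \<partial>count_space UNIV)
      \<le> (\<integral>\<^sup>+k. \<integral>\<^sup>+x. ennreal (norm (f x)) * ennreal (norm (u (M *v x - real_vec k))) \<partial>lborel \<partial>count_space UNIV)"
    by (intro nn_integral_mono)
  also have "\<dots> \<le> \<Lambda> * (\<integral>\<^sup>+x. ennreal (norm (f x)) \<partial>lborel)"
    by (rule nn_integral_lattice_le[OF _ \<Lambda>]) measurable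
  finally show ?thesis .
qed

lemma integrable_coeff:
  assumes f: "integrable lborel f"
  shows "integrable (count_space UNIV) (coeff f)"
proof (rule integrableI_bounded)
  obtain B :: real where B: "B \<ge> 0" "\<And>z. period z \<le> ennreal B" using period_bounded by blast
  then have "AE z in lborel. period z \<le> ennreal B" by simp
  from nn_integral_coeff_le[OF f this]
  have "(\<integral>\<^sup>+k. ennreal (norm (coeff f k)) \<partial>count_space UNIV) \<le> ennreal B * (\<integral>\<^sup>+x. ennreal (norm (f x)) \<partial>lborel)" .
  also have "\<dots> < \<infinity>" using integrable_nn_finite[OF f] by (simp add: ennreal_mult_less_top)
  finally show "(\<integral>\<^sup>+k. ennreal (norm (coeff f k)) \<partial>count_space UNIV) < \<infinity>" .
qed simp

text \<open>After interchanging the sum with the frequency integral, the sum over m is the conjugate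
  of the Poisson sum of u at y. That formula holds on the cube, and \<open>\<zeta>\<close> vanishes
  outside it.\<close>

lemma lattice_sum_eq_ft:
  assumes \<zeta>: "integrable lborel \<zeta>" and \<zeta>0: "\<And>\<xi>. \<xi> \<notin> open_cube \<Longrightarrow> \<zeta> \<xi> = 0"
  shows "(LINT m|count_space UNIV. cnj (u (y - real_vec m)) * (LINT \<xi>|lborel. ec (\<xi> \<bullet> real_vec (k - m)) * \<zeta> \<xi>))
    = ft (\<lambda>\<xi>. ec (\<xi> \<bullet> real_vec k) * \<zeta> \<xi> * cnj (ft u \<xi>)) y"
proof -
  note [measurable] = borel_measurable_integrable[OF \<zeta>, unfolded measurable_lborel2]
  let ?G = "\<lambda>m \<xi>. cnj (u (y - real_vec m)) * (ec (\<xi> \<bullet> real_vec (k - m)) * \<zeta> \<xi>)"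
  obtain B :: real where B: "B \<ge> 0" "\<And>z. period z \<le> ennreal B" using period_bounded by blast
  have "(\<integral>\<^sup>+m. \<integral>\<^sup>+\<xi>. ennreal (norm (?G m \<xi>)) \<partial>lborel \<partial>count_space UNIV) = period y * (\<integral>\<^sup>+\<xi>. ennreal (norm (\<zeta> \<xi>)) \<partial>lborel)"
    unfolding period_def by (simp add: norm_mult ennreal_mult nn_integral_cmult nn_integral_multc)
  also have "\<dots> < \<infinity>"
    using integrable_nn_finite[OF \<zeta>] le_less_trans[OF B(2)[of y] ennreal_less_top] by (simp add: ennreal_mult_less_top)
  finally have fin: "(\<integral>\<^sup>+m. \<integral>\<^sup>+\<xi>. ennreal (norm (?G m \<xi>)) \<partial>lborel \<partial>count_space UNIV) < \<infinity>" .
  have rv: "real_vec (k - m) = real_vec k - real_vec m" for m by (simp add: real_vec_def vec_eq_iff)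
  have G: "(LINT m|count_space UNIV. ?G m \<xi>) = ec (\<xi> \<bullet> real_vec k) * \<zeta> \<xi> * cnj (ft u \<xi>) * ec (- (y \<bullet> \<xi>))" for \<xi>
  proof (cases "\<xi> \<in> open_cube")
    case True
    have "?G m \<xi> = (ec (\<xi> \<bullet> real_vec k) * \<zeta> \<xi>) * cnj (u (y - real_vec m) * ec (\<xi> \<bullet> real_vec m))" for m
      unfolding rv inner_diff_right ec_diff ec_minus by (simp add: mult_ac)
    then have "(LINT m|count_space UNIV. ?G m \<xi>)
        = (ec (\<xi> \<bullet> real_vec k) * \<zeta> \<xi>) * cnj (LINT m|count_space UNIV. u (y - real_vec m) * ec (\<xi> \<bullet> real_vec m))"
      by (simp only: integral_mult_right_zero Bochner_Integration.integral_cnj)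
    moreover have "(LINT m|count_space UNIV. u (y - real_vec m) * ec (\<xi> \<bullet> real_vec m)) = ft u \<xi> * ec (\<xi> \<bullet> y)"
      by (rule bandlimited_poisson[OF integrable_u continuous_u norm_u_le ft_u_eq_0 True])
    ultimately have "(LINT m|count_space UNIV. ?G m \<xi>) = (ec (\<xi> \<bullet> real_vec k) * \<zeta> \<xi>) * cnj (ft u \<xi> * ec (\<xi> \<bullet> y))"
      by (simp only:)
    then show ?thesis by (simp only: complex_cnj_mult ec_minus inner_commute[of y] mult.assoc)
  qed (simp add: \<zeta>0)
  have "(LINT m|count_space UNIV. cnj (u (y - real_vec m)) * (LINT \<xi>|lborel. ec (\<xi> \<bullet> real_vec (k - m)) * \<zeta> \<xi>))
      = (LINT m|count_space UNIV. LINT \<xi>|lborel. ?G m \<xi>)"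
    by (simp only: integral_mult_right_zero)
  also have "\<dots> = (LINT \<xi>|lborel. LINT m|count_space UNIV. ?G m \<xi>)"
    by (rule lattice_fubini[OF _ fin]) measurable
  finally show ?thesis unfolding G ft_def .
qed

lemma integrable_symbol:
  assumes \<zeta>: "integrable lborel \<zeta>"
  shows "integrable lborel (\<lambda>\<xi>. ec (\<xi> \<bullet> real_vec k) * \<zeta> \<xi> * cnj (ft u \<xi>))"
proof (rule integrable_mult_bounded)
  show "integrable lborel (\<lambda>\<xi>. ec (\<xi> \<bullet> real_vec k) * \<zeta> \<xi>)"
    by (rule integrable_mult_bounded(2)[OF \<zeta>, of _ 1]) auto
  have "ft u \<in> borel_measurable borel" by (rule borel_measurable_continuous_onI[OF continuous_ft[OF integrable_u]])
  then show "(\<lambda>\<xi>. cnj (ft u \<xi>)) \<in> borel_measurable lborel" by simp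
  show "norm (cnj (ft u \<xi>)) \<le> (LINT x|lborel. norm (u x))" for \<xi> by (simp add: norm_ft_le)
qed

text \<open>Summing over the lattice before integrating over x reduces the claim to
  \<open>lattice_sum_eq_ft\<close> at \<open>M *v x\<close>. The multiplication formula then moves
  the transform onto f, where the symbol can act.\<close>

lemma coeff_convolution:
  assumes f: "integrable lborel f" and \<zeta>: "integrable lborel \<zeta>" and \<zeta>0: "\<And>\<xi>. \<xi> \<notin> open_cube \<Longrightarrow> \<zeta> \<xi> = 0"
  shows "(LINT m|count_space UNIV. coeff f m * (LINT \<xi>|lborel. ec (\<xi> \<bullet> real_vec (k - m)) * \<zeta> \<xi>))
    = (LINT \<xi>|lborel. ec (\<xi> \<bullet> real_vec k) * \<zeta> \<xi> * cnj (ft u \<xi>) * ft f (\<xi> v* M))"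
proof -
  note [measurable] = borel_measurable_integrable[OF f, unfolded measurable_lborel2]
  let ?z = "\<lambda>l. LINT \<xi>|lborel. ec (\<xi> \<bullet> real_vec l) * \<zeta> \<xi>"
  let ?H = "\<lambda>m x. f x * cnj (u (M *v x - real_vec m)) * ?z (k - m)"
  have z: "norm (?z l) \<le> (LINT \<xi>|lborel. norm (\<zeta> \<xi>))" for l
    by (rule order_trans[OF integral_norm_bound]) (simp add: norm_mult)
  obtain B :: real where B: "B \<ge> 0" "\<And>z. period z \<le> ennreal B" using period_bounded by blast
  let ?F = "\<lambda>x. ennreal (norm (f x) * (LINT \<xi>|lborel. norm (\<zeta> \<xi>)))"
  have "(\<integral>\<^sup>+m. \<integral>\<^sup>+x. ennreal (norm (?H m x)) \<partial>lborel \<partial>count_space UNIV)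
      \<le> (\<integral>\<^sup>+m. \<integral>\<^sup>+x. ?F x * ennreal (norm (u (M *v x - real_vec m))) \<partial>lborel \<partial>count_space UNIV)"
  proof (intro nn_integral_mono)
    fix m x
    have "norm (?H m x) \<le> (norm (f x) * (LINT \<xi>|lborel. norm (\<zeta> \<xi>))) * norm (u (M *v x - real_vec m))"
      using mult_left_mono[OF z[of "k - m"], of "norm (f x) * norm (u (M *v x - real_vec m))"] by (simp add: norm_mult mult_ac)
    then show "ennreal (norm (?H m x)) \<le> ?F x * ennreal (norm (u (M *v x - real_vec m)))"
      by (subst ennreal_mult[symmetric]) (auto intro: ennreal_leI)
  qed
  also have "\<dots> \<le> ennreal B * (\<integral>\<^sup>+x. ?F x \<partial>lborel)"
    by (rule nn_integral_lattice_le) (use B in simp_all)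
  also have "\<dots> < \<infinity>"
    using integrable_nn_finite[OF f] by (simp add: ennreal_mult nn_integral_multc ennreal_mult_less_top)
  finally have fin: "(\<integral>\<^sup>+m. \<integral>\<^sup>+x. ennreal (norm (?H m x)) \<partial>lborel \<partial>count_space UNIV) < \<infinity>" .
  have "(LINT m|count_space UNIV. coeff f m * ?z (k - m)) = (LINT m|count_space UNIV. LINT x|lborel. ?H m x)"
    unfolding coeff_def by (simp only: integral_mult_left_zero)
  also have "\<dots> = (LINT x|lborel. LINT m|count_space UNIV. ?H m x)"
    by (rule lattice_fubini[OF _ fin]) measurable
  also have "\<dots> = (LINT x|lborel. f x * ft (\<lambda>\<xi>. ec (\<xi> \<bullet> real_vec k) * \<zeta> \<xi> * cnj (ft u \<xi>)) (M *v x))"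
  proof (rule Bochner_Integration.integral_cong)
    fix x
    have "(LINT m|count_space UNIV. ?H m x) = f x * (LINT m|count_space UNIV. cnj (u (M *v x - real_vec m)) * ?z (k - m))"
      by (simp only: mult.assoc integral_mult_right_zero)
    then show "(LINT m|count_space UNIV. ?H m x) = f x * ft (\<lambda>\<xi>. ec (\<xi> \<bullet> real_vec k) * \<zeta> \<xi> * cnj (ft u \<xi>)) (M *v x)"
      by (rule trans[OF _ arg_cong[OF lattice_sum_eq_ft[OF \<zeta> \<zeta>0]]])
  qed simp
  also have "\<dots> = (LINT \<xi>|lborel. ec (\<xi> \<bullet> real_vec k) * \<zeta> \<xi> * cnj (ft u \<xi>) * ft f (\<xi> v* M))"
    by (rule integral_ft_multiplication[OF f integrable_symbol[OF \<zeta>]])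
  finally show ?thesis .
qed

definition kernel :: "int ^ 'n \<Rightarrow> real ^ 'n \<Rightarrow> complex" where
  "kernel k = ft (\<lambda>\<xi>. ec (\<xi> \<bullet> real_vec k) * \<nu> \<xi> * cnj (ft u \<xi>))"

lemma kernel_measurable [measurable]: "kernel k \<in> borel_measurable borel"
  unfolding kernel_def
  by (rule borel_measurable_continuous_onI[OF continuous_ft[OF integrable_symbol[OF integrable_nu]]])

text \<open>In space the kernel is an average of translates of the conjugate of u weighted by the
  transform of the cut-off. In this form its sum over k is controlled by \<open>period\<close>,
  which the frequency side does not reveal.\<close>

lemma kernel_eq: "kernel k y = (LINT v|lborel. cnj (u (y - v - real_vec k)) * ft \<nu> v)"
proof -
  have [measurable]: "ft \<nu> \<in> borel_measurable borel" by (rule borel_measurable_continuous_onI[OF continuous_ft[OF integrable_nu]])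
  let ?F = "\<lambda>\<xi> w. \<nu> \<xi> * ec (- ((y - real_vec k - w) \<bullet> \<xi>)) * cnj (u w)"
  have "(\<integral>\<^sup>+\<xi>. \<integral>\<^sup>+w. ennreal (norm (?F \<xi> w)) \<partial>lborel \<partial>lborel) < \<infinity>"
    using nn_mult_finite[OF integrable_nu integrable_u] by (simp add: norm_mult ennreal_mult)
  then have "(LINT \<xi>|lborel. LINT w|lborel. ?F \<xi> w) = (LINT w|lborel. LINT \<xi>|lborel. ?F \<xi> w)"
    by (intro fubini_swap) measurable
  moreover have "(LINT w|lborel. ?F \<xi> w) = ec (\<xi> \<bullet> real_vec k) * \<nu> \<xi> * cnj (ft u \<xi>) * ec (- (y \<bullet> \<xi>))" for \<xi>
  proof -
    have "?F \<xi> w = (ec (\<xi> \<bullet> real_vec k) * \<nu> \<xi> * ec (- (y \<bullet> \<xi>))) * cnj (u w * ec (- (\<xi> \<bullet> w)))" for w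
    proof -
      have "- ((y - real_vec k - w) \<bullet> \<xi>) = \<xi> \<bullet> real_vec k + (- (y \<bullet> \<xi>) + \<xi> \<bullet> w)"
        by (simp add: inner_diff_left inner_diff_right inner_commute)
      then show ?thesis by (simp only: ec_add ec_minus complex_cnj_mult complex_cnj_cnj mult_ac)
    qed
    then have "(LINT w|lborel. ?F \<xi> w) = (LINT w|lborel. (ec (\<xi> \<bullet> real_vec k) * \<nu> \<xi> * ec (- (y \<bullet> \<xi>))) * cnj (u w * ec (- (\<xi> \<bullet> w))))"
      by (simp only:)
    also have "\<dots> = (ec (\<xi> \<bullet> real_vec k) * \<nu> \<xi> * ec (- (y \<bullet> \<xi>))) * cnj (ft u \<xi>)"
      unfolding integral_mult_right_zero Bochner_Integration.integral_cnj ft_def ..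
    finally show ?thesis by (simp add: mult_ac)
  qed
  moreover have "(LINT \<xi>|lborel. ?F \<xi> w) = ft \<nu> (y - real_vec k - w) * cnj (u w)" for w
    unfolding ft_def integral_mult_left_zero ..
  ultimately have "kernel k y = (LINT w|lborel. ft \<nu> (y - real_vec k - w) * cnj (u w))"
    unfolding kernel_def ft_def[of _ y] by (simp only:)
  also have "\<dots> = (LINT v|lborel. ft \<nu> (y - real_vec k - (y - real_vec k - v)) * cnj (u (y - real_vec k - v)))"
    by (rule integral_lborel_translate(4)[symmetric, of "\<lambda>w. ft \<nu> (y - real_vec k - w) * cnj (u w)"]) measurable
  also have "\<dots> = (LINT v|lborel. cnj (u (y - v - real_vec k)) * ft \<nu> v)"
    by (rule Bochner_Integration.integral_cong) (simp_all add: algebra_simps)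
  finally show ?thesis .
qed

lemma nn_integral_lattice_kernel_le:
  assumes \<Lambda>: "AE z in lborel. period z \<le> \<Lambda>"
  shows "(\<integral>\<^sup>+k. ennreal (norm (kernel k y)) \<partial>count_space UNIV) \<le> \<Lambda> * (\<integral>\<^sup>+v. ennreal (norm (ft \<nu> v)) \<partial>lborel)"
proof -
  have [measurable]: "ft \<nu> \<in> borel_measurable borel" by (rule borel_measurable_continuous_onI[OF continuous_ft[OF integrable_nu]])
  have "ennreal (norm (kernel k y)) \<le> (\<integral>\<^sup>+v. ennreal (norm (ft \<nu> v)) * ennreal (norm (u (y - v - real_vec k))) \<partial>lborel)" for k
    unfolding kernel_eq by (rule order_trans[OF norm_integral_le_nn_integral]) (simp add: norm_mult ennreal_mult mult.commute)
  then have "(\<integral>\<^sup>+k. ennreal (norm (kernel k y)) \<partial>count_space UNIV)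
      \<le> (\<integral>\<^sup>+k. \<integral>\<^sup>+v. ennreal (norm (ft \<nu> v)) * ennreal (norm (u (y - v - real_vec k))) \<partial>lborel \<partial>count_space UNIV)"
    by (intro nn_integral_mono)
  also have "\<dots> = (\<integral>\<^sup>+v. \<integral>\<^sup>+k. ennreal (norm (ft \<nu> v)) * ennreal (norm (u (y - v - real_vec k))) \<partial>count_space UNIV \<partial>lborel)"
    by (rule lattice_nn_fubini) measurable
  also have "\<dots> = (\<integral>\<^sup>+v. ennreal (norm (ft \<nu> v)) * period (y - v) \<partial>lborel)"
    unfolding period_def by (simp add: nn_integral_cmult)
  \<comment> \<open>The substitution z = y - v places \<open>period\<close> at the integration
    variable, where its almost everywhere bound applies.\<close>
  also have "\<dots> = (\<integral>\<^sup>+z. ennreal (norm (ft \<nu> (y - z))) * period z \<partial>lborel)"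
    using nn_integral_lborel_translate(4)[of "\<lambda>v. ennreal (norm (ft \<nu> v)) * period (y - v)" y] by simp
  also have "\<dots> \<le> (\<integral>\<^sup>+z. \<Lambda> * ennreal (norm (ft \<nu> (y - z))) \<partial>lborel)"
  proof (rule nn_integral_mono_AE)
    show "AE z in lborel. ennreal (norm (ft \<nu> (y - z))) * period z \<le> \<Lambda> * ennreal (norm (ft \<nu> (y - z)))"
      using \<Lambda> by eventually_elim (subst mult.commute, rule mult_right_mono, simp_all)
  qed
  also have "\<dots> = \<Lambda> * (\<integral>\<^sup>+z. ennreal (norm (ft \<nu> (y - z))) \<partial>lborel)" by (rule nn_integral_cmult) simp
  also have "\<dots> = \<Lambda> * (\<integral>\<^sup>+v. ennreal (norm (ft \<nu> v)) \<partial>lborel)"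
    using nn_integral_lborel_translate(4)[of "\<lambda>v. ennreal (norm (ft \<nu> v))" y] by simp
  finally show ?thesis .
qed

text \<open>The symbol meets the transform of f on the cube and becomes \<open>\<kappa>\<close>
  times the transform of g, leaving the bare cut-off, which is absorbed into \<open>kernel\<close>.
  The multiplier identity is assumed away from the zero frequency, a null set for the
  integral.\<close>

lemma discrete_conv_coeff:
  fixes g :: "real ^ 'n \<Rightarrow> complex ^ 'n" and z :: "int ^ 'n \<Rightarrow> complex ^ 'n"
  assumes f: "integrable lborel f" and g: "integrable lborel g"
    and mult: "\<And>i \<xi>. \<xi> \<noteq> 0 \<Longrightarrow> \<sigma> i \<xi> * ft f (\<xi> v* M) = \<kappa> * ft (\<lambda>x. g x $ i) (\<xi> v* M)"
    and \<sigma>: "\<And>i. \<sigma> i \<in> borel_measurable borel" "\<And>i \<xi>. norm (\<sigma> i \<xi>) \<le> 1"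
    and z: "\<And>l i. z l $ i = (LINT \<xi>|lborel. ec (\<xi> \<bullet> real_vec l) * (\<sigma> i \<xi> * \<nu> \<xi>))"
  shows "discrete_conv (coeff f) z k = (LINT x|lborel. (\<kappa> * kernel k (M *v x)) *s g x)"
proof -
  have \<zeta>: "integrable lborel (\<lambda>\<xi>. \<sigma> i \<xi> * \<nu> \<xi>)" for i
    by (rule integrable_mult_bounded(2)[OF integrable_nu _ \<sigma>(2)]) (use \<sigma>(1) in simp)
  have zb: "norm (z l) \<le> (\<Sum>i\<in>UNIV. LINT \<xi>|lborel. norm (\<sigma> i \<xi> * \<nu> \<xi>))" for l
  proof -
    have "norm (z l) \<le> (\<Sum>i\<in>UNIV. norm (z l $ i))" unfolding norm_vec_def by (rule L2_set_le_sum) simp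
    also have "\<dots> \<le> (\<Sum>i\<in>UNIV. LINT \<xi>|lborel. norm (\<sigma> i \<xi> * \<nu> \<xi>))"
      unfolding z by (intro sum_mono order_trans[OF integral_norm_bound]) (simp add: norm_mult)
    finally show ?thesis .
  qed
  have "integrable (count_space UNIV) (\<lambda>m. norm (coeff f m) * (\<Sum>i\<in>UNIV. LINT \<xi>|lborel. norm (\<sigma> i \<xi> * \<nu> \<xi>)))"
    using integrable_norm[OF integrable_coeff[OF f]] by (rule integrable_mult_left)
  then have int: "integrable (count_space UNIV) (\<lambda>m. coeff f m *s z (k - m))"
    by (rule Bochner_Integration.integrable_bound)
      (auto simp: norm_smult intro!: always_eventually order_trans[OF mult_left_mono[OF zb] abs_ge_self[unfolded abs_mult]] simp flip: abs_mult)
  have "norm (kernel k y) \<le> (LINT \<xi>|lborel. norm (ec (\<xi> \<bullet> real_vec k) * \<nu> \<xi> * cnj (ft u \<xi>)))" for y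
    unfolding kernel_def by (rule norm_ft_le)
  then have int2: "integrable lborel (\<lambda>x. (\<kappa> * kernel k (M *v x)) *s g x)"
    by (intro integrable_smult_bounded[OF g, where B = "norm \<kappa> * (LINT \<xi>|lborel. norm (ec (\<xi> \<bullet> real_vec k) * \<nu> \<xi> * cnj (ft u \<xi>)))"])
      (auto simp: norm_mult intro: mult_left_mono)
  show ?thesis
  proof (rule vec_eq_iff[THEN iffD2, rule_format])
    fix i
    have gi: "integrable lborel (\<lambda>x. g x $ i)" by (rule integrable_bounded_linear[OF bounded_linear_vec_nth g])
    have "discrete_conv (coeff f) z k $ i = (LINT m|count_space UNIV. coeff f m * z (k - m) $ i)"
      unfolding discrete_conv_def infsum_eq_integral[OF int]
      by (subst integral_bounded_linear[OF bounded_linear_vec_nth int, symmetric]) simp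
    also have "\<dots> = (LINT \<xi>|lborel. ec (\<xi> \<bullet> real_vec k) * (\<sigma> i \<xi> * \<nu> \<xi>) * cnj (ft u \<xi>) * ft f (\<xi> v* M))"
      unfolding z by (rule coeff_convolution[OF f \<zeta>]) (simp add: nu_eq_0)
    also have "\<dots> = (LINT \<xi>|lborel. \<kappa> * (ec (\<xi> \<bullet> real_vec k) * \<nu> \<xi> * cnj (ft u \<xi>) * ft (\<lambda>x. g x $ i) (\<xi> v* M)))"
    proof (rule integral_cong_AE)
      have [measurable]: "(\<lambda>\<xi>. \<xi> v* M) \<in> borel_measurable borel"
        by (intro borel_measurable_continuous_onI) (simp only: transpose_matrix_vector[symmetric] continuous_matrix_vector_mult)
      have [measurable]: "ft f \<in> borel_measurable borel" "ft (\<lambda>x. g x $ i) \<in> borel_measurable borel" "ft u \<in> borel_measurable borel"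
        using f gi integrable_u by (auto intro: borel_measurable_continuous_onI continuous_ft)
      note [measurable] = \<sigma>(1)[of i]
      show "(\<lambda>\<xi>. ec (\<xi> \<bullet> real_vec k) * (\<sigma> i \<xi> * \<nu> \<xi>) * cnj (ft u \<xi>) * ft f (\<xi> v* M)) \<in> borel_measurable lborel"
        "(\<lambda>\<xi>. \<kappa> * (ec (\<xi> \<bullet> real_vec k) * \<nu> \<xi> * cnj (ft u \<xi>) * ft (\<lambda>x. g x $ i) (\<xi> v* M))) \<in> borel_measurable lborel"
        by measurable
      have "AE \<xi> in lborel. \<xi> \<noteq> (0 :: real ^ 'n)" by (rule AE_lborel_singleton)
      then show "AE \<xi> in lborel. ec (\<xi> \<bullet> real_vec k) * (\<sigma> i \<xi> * \<nu> \<xi>) * cnj (ft u \<xi>) * ft f (\<xi> v* M)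
          = \<kappa> * (ec (\<xi> \<bullet> real_vec k) * \<nu> \<xi> * cnj (ft u \<xi>) * ft (\<lambda>x. g x $ i) (\<xi> v* M))"
      proof eventually_elim
        case (elim \<xi>)
        have "ec (\<xi> \<bullet> real_vec k) * (\<sigma> i \<xi> * \<nu> \<xi>) * cnj (ft u \<xi>) * ft f (\<xi> v* M)
            = (ec (\<xi> \<bullet> real_vec k) * \<nu> \<xi> * cnj (ft u \<xi>)) * (\<sigma> i \<xi> * ft f (\<xi> v* M))" by (simp only: mult_ac)
        then show ?case unfolding mult[OF elim] by (simp only: mult_ac)
      qed
    qed
    also have "\<dots> = \<kappa> * (LINT x|lborel. g x $ i * kernel k (M *v x))"
      unfolding integral_mult_right_zero kernel_def
      by (simp only: integral_ft_multiplication[OF gi integrable_symbol[OF integrable_nu]])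
    also have "\<dots> = (LINT x|lborel. ((\<kappa> * kernel k (M *v x)) *s g x) $ i)"
      unfolding integral_mult_right_zero[symmetric] by (rule Bochner_Integration.integral_cong) (simp_all add: mult_ac)
    also have "\<dots> = (LINT x|lborel. (\<kappa> * kernel k (M *v x)) *s g x) $ i"
      by (rule integral_bounded_linear[OF bounded_linear_vec_nth int2])
    finally show "discrete_conv (coeff f) z k $ i = (LINT x|lborel. (\<kappa> * kernel k (M *v x)) *s g x) $ i" .
  qed
qed

lemma nn_integral_discrete_conv_le:
  fixes g :: "real ^ 'n \<Rightarrow> complex ^ 'n" and z :: "int ^ 'n \<Rightarrow> complex ^ 'n"
  assumes "integrable lborel f" and g: "integrable lborel g"
    and "\<And>i \<xi>. \<xi> \<noteq> 0 \<Longrightarrow> \<sigma> i \<xi> * ft f (\<xi> v* M) = \<kappa> * ft (\<lambda>x. g x $ i) (\<xi> v* M)"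
    and "\<And>i. \<sigma> i \<in> borel_measurable borel" "\<And>i \<xi>. norm (\<sigma> i \<xi>) \<le> 1"
    and "\<And>l i. z l $ i = (LINT \<xi>|lborel. ec (\<xi> \<bullet> real_vec l) * (\<sigma> i \<xi> * \<nu> \<xi>))"
    and \<kappa>: "norm \<kappa> = 1" and \<Lambda>: "AE z in lborel. period z \<le> \<Lambda>"
  shows "(\<integral>\<^sup>+k. ennreal (norm (discrete_conv (coeff f) z k)) \<partial>count_space UNIV)
    \<le> \<Lambda> * (\<integral>\<^sup>+v. ennreal (norm (ft \<nu> v)) \<partial>lborel) * (\<integral>\<^sup>+x. ennreal (norm (g x)) \<partial>lborel)"
proof -
  note [measurable] = borel_measurable_integrable[OF g, unfolded measurable_lborel2]
  let ?L = "\<Lambda> * (\<integral>\<^sup>+v. ennreal (norm (ft \<nu> v)) \<partial>lborel)"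
  have eq: "discrete_conv (coeff f) z k = (LINT x|lborel. (\<kappa> * kernel k (M *v x)) *s g x)" for k
    by (rule discrete_conv_coeff[where \<sigma> = \<sigma>, OF assms(1-6)])
  have "ennreal (norm (discrete_conv (coeff f) z k)) \<le> (\<integral>\<^sup>+x. ennreal (norm (g x)) * ennreal (norm (kernel k (M *v x))) \<partial>lborel)" for k
    unfolding eq
    by (rule order_trans[OF norm_integral_le_nn_integral]) (simp add: norm_smult norm_mult \<kappa> ennreal_mult mult.commute)
  then have "(\<integral>\<^sup>+k. ennreal (norm (discrete_conv (coeff f) z k)) \<partial>count_space UNIV)
      \<le> (\<integral>\<^sup>+k. \<integral>\<^sup>+x. ennreal (norm (g x)) * ennreal (norm (kernel k (M *v x))) \<partial>lborel \<partial>count_space UNIV)"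
    by (intro nn_integral_mono)
  also have "\<dots> = (\<integral>\<^sup>+x. \<integral>\<^sup>+k. ennreal (norm (g x)) * ennreal (norm (kernel k (M *v x))) \<partial>count_space UNIV \<partial>lborel)"
    by (rule lattice_nn_fubini) measurable
  also have "\<dots> = (\<integral>\<^sup>+x. ennreal (norm (g x)) * (\<integral>\<^sup>+k. ennreal (norm (kernel k (M *v x))) \<partial>count_space UNIV) \<partial>lborel)"
    by (simp add: nn_integral_cmult)
  also have "\<dots> \<le> (\<integral>\<^sup>+x. ennreal (norm (g x)) * ?L \<partial>lborel)"
    by (intro nn_integral_mono mult_left_mono nn_integral_lattice_kernel_le[OF \<Lambda>]) simp
  also have "\<dots> = ?L * (\<integral>\<^sup>+x. ennreal (norm (g x)) \<partial>lborel)"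
    by (subst nn_integral_multc) (simp_all add: mult.commute)
  finally show ?thesis .
qed

end

subsection \<open>The analysis operator\<close>

lemma norm_riesz_symbol_le: "norm (- \<i> * of_real ((\<eta> :: real ^ 'n::finite) $ i / norm \<eta>) :: complex) \<le> 1"
proof -
  have "norm (- \<i> * of_real (\<eta> $ i / norm \<eta>) :: complex) = \<bar>\<eta> $ i / norm \<eta>\<bar>"
    by (simp only: norm_mult norm_minus_cancel norm_ii norm_of_real mult_1)
  then show ?thesis using component_le_norm_cart[of \<eta> i] by (simp add: divide_le_eq_1)
qed

context cutoff_function
begin

lemma discrete_riesz_kernel_nth:
  "discrete_riesz_kernel b \<nu> l $ i = (LINT \<xi>|lborel. ec (\<xi> \<bullet> real_vec l) *
     (- \<i> * of_real ((\<xi> v* matrix_inv b) $ i / norm (\<xi> v* matrix_inv b)) * \<nu> \<xi>))"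
proof -
  define \<sigma> :: "'n \<Rightarrow> real ^ 'n \<Rightarrow> complex"
    where "\<sigma> i \<xi> = - \<i> * of_real ((\<xi> v* matrix_inv b) $ i / norm (\<xi> v* matrix_inv b))" for i \<xi>
  let ?H = "\<lambda>\<xi>. ec (\<xi> \<bullet> real_vec l) *s discrete_riesz_symbol b \<nu> \<xi>"
  have sym: "discrete_riesz_symbol b \<nu> \<xi> = \<nu> \<xi> *s (\<chi> i. \<sigma> i \<xi>)" for \<xi>
    by (simp add: discrete_riesz_symbol_def Let_def \<sigma>_def vec_eq_iff)
  have [measurable]: "(\<lambda>\<xi>. \<xi> v* matrix_inv b) \<in> borel_measurable borel"
    by (intro borel_measurable_continuous_onI) (simp only: transpose_matrix_vector[symmetric] continuous_matrix_vector_mult)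
  have [measurable]: "\<sigma> i \<in> borel_measurable borel" for i unfolding \<sigma>_def[abs_def] by measurable
  have [measurable]: "(\<lambda>\<xi>. \<chi> i. \<sigma> i \<xi>) \<in> borel_measurable borel" by (rule measurable_vec_componentwise) simp
  have H: "?H \<in> borel_measurable borel" unfolding sym by measurable
  have ind: "indicator open_cube \<xi> *\<^sub>R ?H \<xi> = ?H \<xi>" for \<xi>
    by (auto simp: indicator_def sym nu_eq_0)
  have "discrete_riesz_kernel b \<nu> l = (LINT \<xi>|completion lborel. indicator open_cube \<xi> *\<^sub>R ?H \<xi>)"
    unfolding discrete_riesz_kernel_def set_lebesgue_integral_def ec_exp ..
  also have "\<dots> = (LINT \<xi>|lborel. ?H \<xi>)"
    unfolding ind using H by (intro integral_completion) simp
  finally have eq: "discrete_riesz_kernel b \<nu> l = (LINT \<xi>|lborel. ?H \<xi>)" .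
  have "norm (\<sigma> i \<xi>) \<le> 1" for i \<xi>
    unfolding \<sigma>_def by (rule norm_riesz_symbol_le)
  then have "norm (\<chi> i. \<sigma> i \<xi>) \<le> (\<Sum>i\<in>(UNIV :: 'n set). 1)" for \<xi>
    unfolding norm_vec_def by (intro order_trans[OF L2_set_le_sum] sum_mono) auto
  then have "norm (?H \<xi>) \<le> norm (real CARD('n) * norm (\<nu> \<xi>))" for \<xi>
    unfolding sym norm_smult using mult_left_mono[OF _ norm_ge_zero[of "\<nu> \<xi>"], of "norm (\<chi> i. \<sigma> i \<xi>)" "real CARD('n)"]
    by (simp add: mult.commute)
  then have int: "integrable lborel ?H"
    using H by (intro Bochner_Integration.integrable_bound[OF integrable_mult_right[OF integrable_norm[OF integrable_nu], of "real CARD('n)"]])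
      (simp_all only: measurable_lborel2, intro always_eventually allI TrueI)
  have "discrete_riesz_kernel b \<nu> l $ i = (LINT \<xi>|lborel. ?H \<xi> $ i)"
    unfolding eq by (rule integral_bounded_linear[OF bounded_linear_vec_nth int, symmetric])
  then show ?thesis unfolding sym by (simp add: \<sigma>_def mult_ac)
qed

lemma L1_norm_inv_fourier_nu: "L1_norm (inv_fourier \<nu>) = (\<integral>\<^sup>+x. ennreal (norm (ft \<nu> x)) \<partial>lborel)"
proof -
  have [measurable]: "ft \<nu> \<in> borel_measurable borel" by (rule borel_measurable_continuous_onI[OF continuous_ft[OF integrable_nu]])
  have "L1_norm (inv_fourier \<nu>) = (\<integral>\<^sup>+x. ennreal (norm (ft \<nu> (- x))) \<partial>lborel)"
    by (rule L1_norm_AE) (simp add: inv_fourier_eq_ft)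
  also have "\<dots> = (\<integral>\<^sup>+x. ennreal (norm (ft \<nu> x)) \<partial>lborel)"
    by (rule nn_integral_lborel_translate(5)[of "\<lambda>x. ennreal (norm (ft \<nu> x))"]) measurable
  finally show ?thesis .
qed

lemma one_le_L1_norm_inv_fourier_nu: "1 \<le> L1_norm (inv_fourier \<nu>)"
proof -
  have "(\<integral>\<^sup>+x. ennreal (norm (ft \<nu> x)) \<partial>lborel) = ennreal (LINT x|lborel. norm (ft \<nu> x))"
    by (intro nn_integral_eq_integral integrable_norm integrable_ft_nu) simp
  then show ?thesis
    unfolding L1_norm_inv_fourier_nu using ennreal_leI[OF one_le_norm_ft_nu] by simp
qed

theorem analysis_op_bound:
  fixes b :: "real ^ 'n ^ 'n"
  assumes \<alpha>: "\<alpha> \<noteq> 0" and b: "invertible b" and \<phi>: "schwartz \<phi>"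
    and supp: "supp (fourier \<phi>) \<subseteq> (\<lambda>\<xi>. \<xi> v* matrix_inv b) ` open_cube" and f: "f \<in> H1"
  shows "analysis_op (mat \<alpha>) b \<phi> f \<in> h1 b \<nu>"
    and "h1_norm b \<nu> (analysis_op (mat \<alpha>) b \<phi> f)
      \<le> Linf_norm (periodization b (\<lambda>x. norm (\<phi> x))) * L1_norm (inv_fourier \<nu>) * H1_norm f"
proof -
  define u where "u x = of_real \<bar>det b\<bar> * \<phi> (b *v x)" for x
  define M where "M = \<alpha> *\<^sub>R matrix_inv b"
  obtain C where C: "\<And>x. norm (\<phi> (b *v x)) \<le> C * wt x" using schwartz_linear_bound[OF \<phi> b] by blast
  have c\<phi>: "continuous_on UNIV \<phi>" using \<phi> smooth_continuous by (auto simp: schwartz_def)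
  have inv: "invertible (matrix_inv b)" using matrix_inv_cancel[OF b] by (auto simp: invertible_def)
  interpret band_limited_sampling \<nu> u "\<bar>det b\<bar> * C" M
  proof unfold_locales
    show "continuous_on UNIV u" unfolding u_def[abs_def]
      by (intro continuous_intros continuous_on_compose2[OF c\<phi> continuous_matrix_vector_mult]) simp
    show "norm (u x) \<le> \<bar>det b\<bar> * C * wt x" for x
      using mult_left_mono[OF C[of x], of "\<bar>det b\<bar>"] by (simp add: u_def norm_mult)
    show "ft u \<xi> = 0" if "\<xi> \<notin> open_cube" for \<xi>
    proof -
      have "ft u \<xi> = of_real \<bar>det b\<bar> * ft (\<lambda>x. \<phi> (b *v x)) \<xi>"
        unfolding ft_def u_def integral_mult_right_zero[symmetric] by (simp only: mult.assoc)
      then show ?thesis using ft_linear_eq_0[OF c\<phi> b supp that] by simp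
    qed
    show "invertible M" unfolding M_def using \<alpha> inv by (rule scalar_invertible)
  qed
  obtain f' g where f': "integrable lborel f'" "AE x in lborel. f x = f' x"
    and g: "integrable lborel g" "AE x in lborel. riesz f x = g x"
    and riesz: "\<And>i \<xi>. \<xi> \<noteq> 0 \<Longrightarrow> ft (\<lambda>x. g x $ i) \<xi> = - \<i> * of_real (\<xi> $ i / norm \<xi>) * ft f' \<xi>"
    by (rule riesz_fourier_transform[OF f]) (rule that)
  have s: "analysis_op (mat \<alpha>) b \<phi> f = coeff f'"
  proof
    fix k
    have "b *v (M *v x - real_vec k) = mat \<alpha> *v x - b *v real_vec k" for x
    proof -
      have "b *v (M *v x) = \<alpha> *\<^sub>R x"
        using matrix_inv_cancel[OF b] unfolding M_def scaleR_matrix_vector_assoc[symmetric] matrix_vector_mult_scaleR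
        by (simp add: matrix_vector_mul_assoc)
      moreover have "mat \<alpha> *v x = \<alpha> *\<^sub>R x"
        by (simp add: matrix_vector_mult_def mat_def vec_eq_iff if_distrib[of "\<lambda>x. x * _"] sum.delta' cong: if_cong)
      ultimately show ?thesis by (simp add: matrix_vector_mult_diff_distrib)
    qed
    then have u: "u (M *v x - real_vec k) = of_real \<bar>det b\<bar> * \<phi> (mat \<alpha> *v x - b *v real_vec k)" for x
      by (simp add: u_def)
    note [measurable] = borel_measurable_integrable[OF f'(1), unfolded measurable_lborel2]
    have "analysis_op (mat \<alpha>) b \<phi> f k = (LINT x|lebesgue. f x * cnj (u (M *v x - real_vec k)))"
      unfolding analysis_op_def u integral_mult_right_zero[symmetric] by (simp add: mult_ac)
    also have "\<dots> = coeff f' k"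
      unfolding coeff_def by (rule integral_lebesgue_AE) (use f'(2) in \<open>measurable, eventually_elim, simp\<close>)
    finally show "analysis_op (mat \<alpha>) b \<phi> f k = coeff f' k" .
  qed
  let ?P = "Linf_norm (periodization b (\<lambda>x. norm (\<phi> x)))"
  let ?N = "L1_norm (inv_fourier \<nu>)"
  let ?z = "discrete_riesz_kernel b \<nu>"
  \<comment> \<open>Here the essential supremum of the periodization is read at
    \<open>b *v z\<close>, by the almost everywhere transport along b.\<close>
  have P: "AE z in lborel. period z \<le> ?P"
  proof -
    have per: "period z = ennreal (norm (periodization b (\<lambda>x. norm (\<phi> x)) (0 + b *v z)))" for z
    proof -
      have i: "integrable (count_space UNIV) (\<lambda>k. norm (u (z - real_vec k)))"
        by (intro integrable_norm integrable_lattice[OF norm_u_le])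
      have "periodization b (\<lambda>x. norm (\<phi> x)) (b *v z) = (\<Sum>\<^sub>\<infinity>k. norm (u (z - real_vec k)))"
        unfolding periodization_def infsum_scaleR_right[symmetric] u_def
        by (simp add: norm_mult matrix_vector_mult_diff_distrib)
      also have "\<dots> = (LINT k|count_space UNIV. norm (u (z - real_vec k)))" by (rule infsum_eq_integral[OF i])
      finally have e: "periodization b (\<lambda>x. norm (\<phi> x)) (b *v z) = (LINT k|count_space UNIV. norm (u (z - real_vec k)))" .
      have "0 \<le> (LINT k|count_space UNIV. norm (u (z - real_vec k)))" by (rule integral_nonneg_AE) simp
      then show ?thesis
        unfolding period_def using nn_integral_eq_integral[OF i] by (simp add: e)
    qed
    have "AE x in lborel. ennreal (norm (periodization b (\<lambda>x. norm (\<phi> x)) x)) \<le> ?P"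
      using esssup_AE[of "\<lambda>x. ennreal (norm (periodization b (\<lambda>x. norm (\<phi> x)) x))" lebesgue]
      unfolding Linf_norm_def AE_completion_iff .
    from AE_linear[OF b this, of 0] show ?thesis unfolding per .
  qed
  define \<sigma> :: "'n \<Rightarrow> real ^ 'n \<Rightarrow> complex"
    where "\<sigma> i \<xi> = - \<i> * of_real ((\<xi> v* matrix_inv b) $ i / norm (\<xi> v* matrix_inv b))" for i \<xi>
  \<comment> \<open>The normalised frequency is unchanged by positive dilations and changes sign
    under negative ones, so isotropy of the dilation reduces the comparison of the two symbols to
    this sign.\<close>
  define \<kappa> :: complex where "\<kappa> = of_real (sgn \<alpha>)"
  \<comment> \<open>Stated for an arbitrary bound since it is used twice: with a finite bound for
    membership in \<open>h1\<close>, and with the essential supremum for the norm.\<close>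
  have dc: "(\<integral>\<^sup>+k. ennreal (norm (discrete_conv (coeff f') ?z k)) \<partial>count_space UNIV) \<le> \<Lambda> * ?N * (\<integral>\<^sup>+x. ennreal (norm (g x)) \<partial>lborel)"
    if "AE z in lborel. period z \<le> \<Lambda>" for \<Lambda>
    unfolding L1_norm_inv_fourier_nu
  proof (rule nn_integral_discrete_conv_le[where \<sigma> = \<sigma> and \<kappa> = \<kappa>])
    show "\<sigma> i \<xi> * ft f' (\<xi> v* M) = \<kappa> * ft (\<lambda>x. g x $ i) (\<xi> v* M)" if "\<xi> \<noteq> 0" for i \<xi>
    proof -
      let ?\<eta> = "\<xi> v* matrix_inv b"
      have "?\<eta> v* b = \<xi>" using matrix_inv_cancel[OF b] by (simp add: vector_matrix_mul_assoc)
      then have "?\<eta> \<noteq> 0" using that by auto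
      have M: "\<xi> v* M = \<alpha> *\<^sub>R ?\<eta>" unfolding M_def by (rule vector_scaleR_matrix_ac)
      have "\<alpha> * ?\<eta> $ i / (\<bar>\<alpha>\<bar> * norm ?\<eta>) = sgn \<alpha> * (?\<eta> $ i / norm ?\<eta>)" by (simp add: sgn_if \<alpha>)
      then have "ft (\<lambda>x. g x $ i) (\<xi> v* M) = \<kappa> * (\<sigma> i \<xi> * ft f' (\<xi> v* M))"
        using riesz[of "\<xi> v* M" i] \<alpha> \<open>?\<eta> \<noteq> 0\<close> by (simp add: M \<sigma>_def \<kappa>_def)
      moreover have "\<kappa> * \<kappa> = 1" using \<alpha> by (simp add: \<kappa>_def sgn_if)
      ultimately show ?thesis by (simp add: mult.assoc[symmetric])
    qed
    have [measurable]: "(\<lambda>\<xi>. \<xi> v* matrix_inv b) \<in> borel_measurable borel"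
      by (intro borel_measurable_continuous_onI) (simp only: transpose_matrix_vector[symmetric] continuous_matrix_vector_mult)
    show "\<sigma> i \<in> borel_measurable borel" for i unfolding \<sigma>_def[abs_def] by measurable
    show "norm (\<sigma> i \<xi>) \<le> 1" for i \<xi>
      unfolding \<sigma>_def by (rule norm_riesz_symbol_le)
    show "?z l $ i = (LINT \<xi>|lborel. ec (\<xi> \<bullet> real_vec l) * (\<sigma> i \<xi> * \<nu> \<xi>))" for l i
      unfolding \<sigma>_def by (rule discrete_riesz_kernel_nth)
    show "norm \<kappa> = 1" using \<alpha> by (simp add: \<kappa>_def sgn_if)
  qed (fact f' g that)+
  \<comment> \<open>Membership in \<open>ell1\<close> needs a bound known to be finite, and the
    weight estimate for u provides one; in the norm estimate \<open>?P\<close> enters merely as an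
    extended real.\<close>
  obtain B :: real where B: "B \<ge> 0" "\<And>z. period z \<le> ennreal B" using period_bounded by blast
  then have AEB: "AE z in lborel. period z \<le> ennreal B" by simp
  have Nfin: "?N < \<infinity>" unfolding L1_norm_inv_fourier_nu by (rule integrable_nn_finite[OF integrable_ft_nu])
  have "coeff f' \<in> ell1"
    using integrable_nn_finite[OF integrable_coeff[OF f'(1)]] by (rule ell1I)
  moreover have "discrete_conv (coeff f') ?z \<in> ell1"
  proof (rule ell1I, rule le_less_trans[OF dc[OF AEB]])
    show "ennreal B * ?N * (\<integral>\<^sup>+x. ennreal (norm (g x)) \<partial>lborel) < \<infinity>"
      using Nfin integrable_nn_finite[OF g(1)] by (simp add: ennreal_mult_less_top)
  qed
  ultimately show "analysis_op (mat \<alpha>) b \<phi> f \<in> h1 b \<nu>" unfolding s h1_def by simp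
  have "ell1_norm (coeff f') \<le> ?P * (\<integral>\<^sup>+x. ennreal (norm (f' x)) \<partial>lborel)"
    by (rule order_trans[OF ell1_norm_le nn_integral_coeff_le[OF f'(1) P]])
  also have "\<dots> \<le> ?P * ?N * (\<integral>\<^sup>+x. ennreal (norm (f' x)) \<partial>lborel)"
    using mult_left_mono[OF one_le_L1_norm_inv_fourier_nu, of ?P] by (intro mult_right_mono) simp_all
  finally have "ell1_norm (coeff f') \<le> ?P * ?N * L1_norm f" unfolding L1_norm_AE[OF f'(2)] .
  moreover have "ell1_norm (discrete_conv (coeff f') ?z) \<le> ?P * ?N * L1_norm (riesz f)"
    unfolding L1_norm_AE[OF g(2)] by (rule order_trans[OF ell1_norm_le dc[OF P]])
  ultimately show "h1_norm b \<nu> (analysis_op (mat \<alpha>) b \<phi> f) \<le> ?P * ?N * H1_norm f"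
    unfolding h1_norm_def H1_norm_def s distrib_left by (rule add_mono)
qed

end

text \<open>Where the norm of f is 0, the hypothesis forces the numerator to be 0 too, and 0 / 0 is
  0 in \<open>ennreal\<close>.\<close>

lemma operator_norm_le:
  assumes "\<And>f. f \<in> X \<Longrightarrow> nY (T f) \<le> K * nX f"
  shows "operator_norm X nX nY T \<le> K"
  unfolding operator_norm_def
proof (rule SUP_least)
  fix f assume "f \<in> X"
  then have le: "nY (T f) \<le> K * nX f" by (rule assms)
  show "nY (T f) / nX f \<le> K"
  proof (cases "nX f = 0")
    case False
    then show ?thesis using le by (intro divide_le_posI_ennreal) (auto simp: mult.commute zero_less_iff_neq_zero)
  qed (use le in simp)
qed

theorem proposition21:
  fixes a :: "nat \<Rightarrow> real ^ 'n ^ 'n::finite"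
    and \<alpha> :: "nat \<Rightarrow> real"
    and b :: "real ^ 'n ^ 'n"
    and \<phi> \<nu> :: "real ^ 'n \<Rightarrow> complex"
  assumes a: "\<And>j. j \<ge> 1 \<Longrightarrow> a j = mat (\<alpha> j)"
    and nonzero: "\<And>j. j \<ge> 1 \<Longrightarrow> \<alpha> j \<noteq> 0"
    and expanding: "filterlim (\<lambda>j. \<bar>\<alpha> j\<bar>) at_top sequentially"
    and b: "invertible b"
    and \<nu>: "cutoff \<nu>"
    and \<phi>: "schwartz \<phi>"
    and supp: "supp (fourier \<phi>) \<subseteq> (\<lambda>\<xi>. \<xi> v* matrix_inv b) ` open_cube"
  shows "\<forall>j\<ge>1. analysis_op (a j) b \<phi> ` H1 \<subseteq> h1 b \<nu> \<and>
           operator_norm H1 H1_norm (h1_norm b \<nu>) (analysis_op (a j) b \<phi>)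
             \<le> Linf_norm (periodization b (\<lambda>x. norm (\<phi> x))) * L1_norm (inv_fourier \<nu>)"
proof (intro allI impI conjI)
  fix j :: nat assume j: "j \<ge> 1"
  interpret cutoff_function \<nu> by unfold_locales (rule \<nu>)
  note bound = analysis_op_bound[OF nonzero[OF j] b \<phi> supp, folded a[OF j]]
  show "analysis_op (a j) b \<phi> ` H1 \<subseteq> h1 b \<nu>" using bound(1) by blast
  show "operator_norm H1 H1_norm (h1_norm b \<nu>) (analysis_op (a j) b \<phi>)
      \<le> Linf_norm (periodization b (\<lambda>x. norm (\<phi> x))) * L1_norm (inv_fourier \<nu>)"
    by (rule operator_norm_le) (rule bound(2))
qed

end
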